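(* Let $d\ge2$ and let $h$ be the log-correlated Gaussian field on $\mathbb R^d$. For each $\beta>0$, $h_{\beta,\infty}$ is well-defined as a random function viewed modulo additive constant, and it agrees in law with $h*p_{\beta^2/2}$, modulo additive constant.
   Context: Log-correlated Gaussian field: the centered Gaussian random generalized function $h$ on $\mathbb R^d$ such that for smooth compactly supported $f$ with $\int_{\mathbb R^d}f=0$, $\int fh$ is centered Gaussian with variance $\iint f(z)f(w)\log\frac1{|z-w|}\,dz\,dw$, with additive constant fixed so that the average of $h$ over the unit sphere is zero. Kernel: $p_t$, $t>0$, is the convolution kernel of the solution operator at time $t$ of $\partial_tu+(-\Delta)^{d/2}u=0$ on $\mathbb R^d$, i.e. $\hat p_t(\zeta)=e^{-(2\pi)^dt|\zeta|^d}$, where $\hat f(\zeta)=\int e^{-2\pi ix\cdot\zeta}f(x)\,dx$. White noise fields: $W$ is a space-time white noise on $\mathbb R^d\times\mathbb R_+$, so $\int\!\!\int f\,dW$ is centered Gaussian with variance $\|f\|_{L^2}^2$ for $f\in L^2(\mathbb R^d\times\mathbb R_+)$. For $0\le\alpha\le\beta<\infty$, $h_{\alpha,\beta}(y)=\int_{\alpha^2}^{\beta^2}\int_{\mathbb R^d}p_{t/2}(x-y)\,W(dx,dt)$. The field $h_{\beta,\infty}$ is given by the same formula with time interval $(\beta^2,\infty)$, viewed modulo additive constant, i.e. through its pairings with smooth compactly supported $f$ with $\int f=0$, obtained as the limit as $R\to\infty$ of $\int f h_{\beta,R}$.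
   Formalization: With the stated normalizations the equality in law fails for every d≥2 (for d=2 the variances differ by a factor 2π); the formal claim is that √c_d·h_{β,∞}, with c_d=(2π)^d/|S^{d-1}|, agrees in law with h*p_{β²/2} modulo additive constant. *)

theory Defs
  imports "HOL-Probability.Probability"
begin

section \<open>Test functions and distributions\<close>

fun iter_deriv :: "'a::euclidean_space list \<Rightarrow> ('a \<Rightarrow> real) \<Rightarrow> 'a \<Rightarrow> real" where
  "iter_deriv [] f = f"
| "iter_deriv (v # vs) f = (\<lambda>x. frechet_derivative (iter_deriv vs f) (at x) v)"

definition smooth :: "('a::euclidean_space \<Rightarrow> real) \<Rightarrow> bool" where
  "smooth f \<longleftrightarrow> (\<forall>vs. set vs \<subseteq> Basis \<longrightarrow> (\<forall>x. iter_deriv vs f differentiable (at x)))"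

definition test_functions :: "('a::euclidean_space \<Rightarrow> real) set" where
  "test_functions = {f. smooth f \<and> compact (closure {x. f x \<noteq> 0})}"

definition test_functions0 :: "('a::euclidean_space \<Rightarrow> real) set" where
  "test_functions0 = {f \<in> test_functions. (LINT x|lborel. f x) = 0}"

text \<open>
  Only the values of \<open>T\<close> on test functions matter. Continuity is stated through the usual seminorms:
  on test functions supported in a fixed compact set, \<open>T\<close> is bounded by a multiple of the largest
  supremum norm of the partial derivatives up to some order.
\<close>

definition is_distribution :: "(('a::euclidean_space \<Rightarrow> real) \<Rightarrow> real) \<Rightarrow> bool" where
  "is_distribution T \<longleftrightarrow>
     (\<forall>f\<in>test_functions. \<forall>g\<in>test_functions. \<forall>a b. T (\<lambda>x. a * f x + b * g x) = a * T f + b * T g) \<and>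
     (\<forall>K. compact K \<longrightarrow> (\<exists>C n. \<forall>f\<in>test_functions. \<forall>B.
        {x. f x \<noteq> 0} \<subseteq> K \<longrightarrow>
        (\<forall>vs x. set vs \<subseteq> Basis \<and> length vs \<le> n \<longrightarrow> \<bar>iter_deriv vs f x\<bar> \<le> B) \<longrightarrow>
        \<bar>T f\<bar> \<le> C * B))"


section \<open>Gaussian variables and mean-square limits\<close>

text \<open>The image measure formulation includes the degenerate case of variance \<open>0\<close>.\<close>

definition centered_gaussian :: "'b measure \<Rightarrow> ('b \<Rightarrow> real) \<Rightarrow> real \<Rightarrow> bool" where
  "centered_gaussian M X v \<longleftrightarrow> X \<in> borel_measurable M \<and> 0 \<le> v \<and>
     distr M borel X = distr std_normal_distribution borel (\<lambda>x. sqrt v * x)"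

definition L2_limit :: "'b measure \<Rightarrow> (real \<Rightarrow> 'b \<Rightarrow> real) \<Rightarrow> ('b \<Rightarrow> real) \<Rightarrow> bool" where
  "L2_limit M X Y \<longleftrightarrow> (\<forall>\<^sub>F R in at_top. X R \<in> borel_measurable M) \<and> Y \<in> borel_measurable M \<and>
     ((\<lambda>R. \<integral>\<^sup>+\<omega>. ennreal ((X R \<omega> - Y \<omega>)\<^sup>2) \<partial>M) \<longlongrightarrow> 0) at_top"


section \<open>The log-correlated Gaussian field\<close>

text \<open>Normalized surface measure, as the law of the direction of a uniform point of the unit ball.\<close>

definition sphere_uniform :: "'a::euclidean_space measure" where
  "sphere_uniform = distr (uniform_measure lborel (ball 0 1)) borel sgn"

text \<open>The convolution of \<open>sphere_uniform\<close> with the approximate identity \<open>x \<mapsto> R ^ d * \<rho> (R * x)\<close>.\<close>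

definition mollified_sphere :: "('a::euclidean_space \<Rightarrow> real) \<Rightarrow> real \<Rightarrow> 'a \<Rightarrow> real" where
  "mollified_sphere \<rho> R x = (LINT \<theta>|sphere_uniform. R ^ DIM('a) * \<rho> (R *\<^sub>R (x - \<theta>)))"

text \<open>
  The surface measure is not a test function; the average of the field over the unit sphere is
  the mean-square limit of its pairings with mollifications of that measure.
\<close>

definition log_correlated_field ::
  "'b measure \<Rightarrow> ('b \<Rightarrow> ('a::euclidean_space \<Rightarrow> real) \<Rightarrow> real) \<Rightarrow> bool" where
  "log_correlated_field M h \<longleftrightarrow>
     (\<forall>\<omega>\<in>space M. is_distribution (h \<omega>)) \<and>
     (\<forall>f\<in>test_functions. \<exists>v. centered_gaussian M (\<lambda>\<omega>. h \<omega> f) v) \<and>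
     (\<forall>f\<in>test_functions0. centered_gaussian M (\<lambda>\<omega>. h \<omega> f)
        (LINT z|lborel. LINT w|lborel. f z * f w * ln (1 / norm (z - w)))) \<and>
     (\<forall>\<rho>\<in>test_functions. (LINT x|lborel. \<rho> x) = 1 \<longrightarrow>
        L2_limit M (\<lambda>R \<omega>. h \<omega> (mollified_sphere \<rho> R)) (\<lambda>_. 0))"


section \<open>The kernel\<close>

text \<open>
  The convolution kernel of the Fourier multiplier \<open>exp (- ((2 * pi) ^ d * t * norm \<zeta> ^ d))\<close>, that is,
  the inverse Fourier transform of this integrable symbol for the convention in which the forward
  transform is \<open>f \<mapsto> (\<zeta> \<mapsto> \<integral> exp (- 2 * pi * i * (x \<bullet> \<zeta>)) * f x dx)\<close>. The symbol is even,
  so the integral is real.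
\<close>

definition frac_heat_kernel :: "real \<Rightarrow> 'a::euclidean_space \<Rightarrow> real" where
  "frac_heat_kernel t x =
     Re (CLINT \<zeta>|lborel. cis (2 * pi * (x \<bullet> \<zeta>)) *
           complex_of_real (exp (- ((2 * pi) ^ DIM('a) * t * norm \<zeta> ^ DIM('a)))))"


section \<open>White noise fields\<close>

definition spacetime :: "('a::euclidean_space \<times> real) measure" where
  "spacetime = lborel \<Otimes>\<^sub>M restrict_space lborel {0..}"

definition L2_spacetime :: "('a::euclidean_space \<times> real \<Rightarrow> real) set" where
  "L2_spacetime = {F \<in> borel_measurable spacetime. integrable spacetime (\<lambda>z. (F z)\<^sup>2)}"

text \<open>
  \<open>W F\<close> is the stochastic integral of \<open>F\<close>. Almost sure linearity makes the family jointly Gaussian.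
\<close>

definition white_noise ::
  "'c measure \<Rightarrow> (('a::euclidean_space \<times> real \<Rightarrow> real) \<Rightarrow> 'c \<Rightarrow> real) \<Rightarrow> bool" where
  "white_noise N W \<longleftrightarrow>
     (\<forall>F\<in>L2_spacetime. centered_gaussian N (W F) (LINT z|spacetime. (F z)\<^sup>2)) \<and>
     (\<forall>F\<in>L2_spacetime. \<forall>G\<in>L2_spacetime. \<forall>a b.
        AE \<omega> in N. W (\<lambda>z. a * F z + b * G z) \<omega> = a * W F \<omega> + b * W G \<omega>)"

definition random_function :: "'c measure \<Rightarrow> ('c \<Rightarrow> 'a::euclidean_space \<Rightarrow> real) \<Rightarrow> bool" where
  "random_function N H \<longleftrightarrow>
     (\<forall>\<omega>\<in>space N. continuous_on UNIV (H \<omega>)) \<and> (\<forall>y. (\<lambda>\<omega>. H \<omega> y) \<in> borel_measurable N)"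

definition pairing :: "('c \<Rightarrow> 'a::euclidean_space \<Rightarrow> real) \<Rightarrow> 'c \<Rightarrow> ('a \<Rightarrow> real) \<Rightarrow> real" where
  "pairing H \<omega> f = (LINT y|lborel. f y * H \<omega> y)"

text \<open>
  \<open>H\<close> is a continuous version of the field over the time interval from \<open>\<alpha>\<^sup>2\<close> to \<open>\<beta>\<^sup>2\<close>, meaningful for
  \<open>\<alpha> > 0\<close>. For each \<open>y\<close> the stochastic integral is only determined almost surely.
\<close>

definition white_noise_field ::
  "'c measure \<Rightarrow> (('a::euclidean_space \<times> real \<Rightarrow> real) \<Rightarrow> 'c \<Rightarrow> real) \<Rightarrow> real \<Rightarrow> real \<Rightarrow>
   ('c \<Rightarrow> 'a \<Rightarrow> real) \<Rightarrow> bool" where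
  "white_noise_field N W \<alpha> \<beta> H \<longleftrightarrow> random_function N H \<and>
     (\<forall>y. AE \<omega> in N. H \<omega> y =
        W (\<lambda>(x, t). indicator {\<alpha>\<^sup>2<..<\<beta>\<^sup>2} t * frac_heat_kernel (t / 2) (x - y)) \<omega>)"

definition white_noise_field_infinity ::
  "'c measure \<Rightarrow> (('a::euclidean_space \<times> real \<Rightarrow> real) \<Rightarrow> 'c \<Rightarrow> real) \<Rightarrow> real \<Rightarrow>
   ('c \<Rightarrow> 'a \<Rightarrow> real) \<Rightarrow> bool" where
  "white_noise_field_infinity N W \<beta> H \<longleftrightarrow> random_function N H \<and>
     (\<exists>hR. (\<forall>R>\<beta>. white_noise_field N W \<beta> R (hR R)) \<and>
        (\<forall>f\<in>test_functions0. L2_limit N (\<lambda>R \<omega>. pairing (hR R) \<omega> f) (\<lambda>\<omega>. pairing H \<omega> f)))"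


section \<open>Convolution and equality in law modulo additive constant\<close>

text \<open>
  For a compactly supported kernel \<open>\<psi>\<close>, the pairing of \<open>h * \<psi>\<close> with \<open>f\<close> is \<open>h\<close> applied to
  \<open>w \<mapsto> \<integral> f y * \<psi> (y - w) dy\<close>. A kernel \<open>\<phi>\<close> without compact support is truncated by
  \<open>x \<mapsto> \<eta> (x / R)\<close>, where \<open>\<eta>\<close> is a smooth cutoff equal to \<open>1\<close> near the origin, and the
  mean-square limit as \<open>R\<close> tends to infinity is taken. \<open>Y \<omega> f\<close> is the resulting
  pairing with a test function \<open>f\<close> of integral zero.
\<close>

definition cutoffs :: "('a::euclidean_space \<Rightarrow> real) set" where
  "cutoffs = {\<eta> \<in> test_functions. \<exists>r>0. \<forall>x\<in>ball 0 r. \<eta> x = 1}"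

definition convolution_mod_const ::
  "'b measure \<Rightarrow> ('b \<Rightarrow> ('a::euclidean_space \<Rightarrow> real) \<Rightarrow> real) \<Rightarrow> ('a \<Rightarrow> real) \<Rightarrow>
   ('b \<Rightarrow> ('a \<Rightarrow> real) \<Rightarrow> real) \<Rightarrow> bool" where
  "convolution_mod_const M h \<phi> Y \<longleftrightarrow>
     (\<forall>f\<in>test_functions0. \<forall>\<eta>\<in>cutoffs.
        L2_limit M
          (\<lambda>R \<omega>. h \<omega> (\<lambda>w. LINT y|lborel. f y * (\<phi> (y - w) * \<eta> ((y - w) /\<^sub>R R))))
          (\<lambda>\<omega>. Y \<omega> f))"

text \<open>Equality of all joint laws of pairings with finitely many test functions of integral zero.\<close>

definition same_law_mod_const ::
  "'c measure \<Rightarrow> ('c \<Rightarrow> ('a::euclidean_space \<Rightarrow> real) \<Rightarrow> real) \<Rightarrow>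
   'b measure \<Rightarrow> ('b \<Rightarrow> ('a \<Rightarrow> real) \<Rightarrow> real) \<Rightarrow> bool" where
  "same_law_mod_const N X M Y \<longleftrightarrow>
     (\<forall>(n::nat) F. (\<forall>i<n. F i \<in> test_functions0) \<longrightarrow>
        distr N (\<Pi>\<^sub>M i\<in>{..<n}. borel) (\<lambda>\<omega>. \<lambda>i\<in>{..<n}. X \<omega> (F i)) =
        distr M (\<Pi>\<^sub>M i\<in>{..<n}. borel) (\<lambda>\<omega>. \<lambda>i\<in>{..<n}. Y \<omega> (F i)))"

text \<open>
  With the covariance of the log-correlated field, the kernel and the white noise normalized as
  above, the pairings of the white noise field with \<open>f\<close> have variance
  \<open>\<integral> \<bar>f^ \<zeta>\<bar>\<^sup>2 (2 pi norm \<zeta>) ^ -d exp (- (2 pi) ^ d \<beta>\<^sup>2 norm \<zeta> ^ d) d\<zeta>\<close>, whereas the Fourier transform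
  of the logarithmic kernel is \<open>norm \<zeta> ^ -d\<close> divided by the surface area \<open>d * unit_ball_vol d\<close> of the
  unit sphere. The two sides therefore agree after multiplying the white noise field by the square
  root of the following constant, which is \<open>2 * pi\<close> for \<open>d = 2\<close> and is never \<open>1\<close> for \<open>d \<ge> 2\<close>.
\<close>

definition white_noise_normalization :: "nat \<Rightarrow> real" where
  "white_noise_normalization d = (2 * pi) ^ d / (real d * unit_ball_vol (real d))"

end

theory Submission
  imports Defs
begin

text \<open>
  Both fields are compared on the Fourier side. By Plancherel in space, the white noise integral over
  a time interval \<open>I\<close>, paired with \<open>f\<close>, has variance
  \<open>\<integral>\<^sub>I \<integral> \<bar>f^ \<zeta>\<bar>\<^sup>2 exp (- (2 pi) ^ d t norm \<zeta> ^ d) d\<zeta> dt\<close>. If \<open>f\<close> has integral zero, then \<open>f^\<close>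
  vanishes at the origin and this stays finite as \<open>I\<close> increases to \<open>(\<beta>\<^sup>2, \<infinity>)\<close>. Writing the logarithm as
  a Frullani integral of Gaussians turns the covariance of the log-correlated field into
  \<open>\<integral> \<bar>f^ \<zeta>\<bar>\<^sup>2 norm \<zeta> ^ -d d\<zeta>\<close>, up to the area of the unit sphere, and convolving with the kernel
  multiplies the integrand by \<open>exp (- (2 pi) ^ d \<beta>\<^sup>2 norm \<zeta> ^ d)\<close>; integrating the first formula in time
  produces the same expression. Equality of characteristic functions of all linear combinations then
  gives equality of the joint laws.

  A continuous version of the field over the infinite interval is obtained by expanding
  \<open>exp (2 pi i (y \<bullet> \<zeta>)) - 1\<close> in powers of \<open>y\<close>. The norms of the coefficients decrease so fast that the
  resulting random power series almost surely converges everywhere, since the symbol at times at least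
  \<open>\<beta>\<^sup>2\<close> decays at least like a Gaussian, which is where \<open>d \<ge> 2\<close> is used.
\<close>

section \<open>The Fourier transform\<close>

text \<open>The white noise is linear only up to a null set for each pair of integrands, so it
  cannot be moved inside the integral that pairs the field with \<open>f\<close>, and a value of the
  field is fixed only up to a null set that depends on the point. The power series removes both
  difficulties: it involves countably many stochastic integrals, its partial sums pair with
  \<open>f\<close> as finite linear combinations, and any other continuous version with the same
  increments differs from it by a random constant. Throughout, a Gaussian variable is represented by
  its symbol: \<open>Phi\<close> sends a function \<open>a\<close> of the frequency to a space-time
  integrand, and \<open>energy\<close> is the resulting variance. Symbols that vanish to first order
  at 0 survive an infinite time horizon, although low frequencies decay only at the rate norm
  \<zeta> ^ d; this is what working modulo constants buys. On the other side, the heat kernel is not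
  a test function, and cutting it off at radius R smears its symbol by the transform of the cutoff,
  whose total mass is 1 by Fourier inversion at the origin.\<close>

definition fourier :: "('a::euclidean_space \<Rightarrow> complex) \<Rightarrow> 'a \<Rightarrow> complex" where
  "fourier m x = (LINT \<zeta>|lborel. m \<zeta> * cis (2 * pi * (x \<bullet> \<zeta>)))"

lemma measurable_cis[measurable (raw)]:
  "f \<in> borel_measurable M \<Longrightarrow> (\<lambda>x. cis (f x)) \<in> borel_measurable M"
  by (rule borel_measurable_continuous_on[of cis]) (auto intro!: continuous_intros)

lemma measurable_cnj[measurable (raw)]:
  "f \<in> borel_measurable M \<Longrightarrow> (\<lambda>x. cnj (f x)) \<in> borel_measurable M"
  by (rule borel_measurable_continuous_on[of cnj]) (auto intro!: continuous_intros)

lemma integrable_mult_bounded: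
  fixes f g :: "'x \<Rightarrow> complex"
  assumes "integrable M f" "g \<in> borel_measurable M" "\<And>x. norm (g x) \<le> B"
  shows "integrable M (\<lambda>x. f x * g x)"
proof (rule Bochner_Integration.integrable_bound)
  show "integrable M (\<lambda>x. B * norm (f x))" using assms by auto
  show "(\<lambda>x. f x * g x) \<in> borel_measurable M" using assms by measurable
  show "AE x in M. norm (f x * g x) \<le> norm (B * norm (f x))"
  proof (rule AE_I2)
    fix x show "norm (f x * g x) \<le> norm (B * norm (f x))"
      using mult_right_mono[OF order.trans[OF assms(3)[of x] abs_ge_self] norm_ge_zero[of "f x"]]
      by (simp add: norm_mult abs_mult mult.commute)
  qed
qed

lemma (in pair_sigma_finite) kernel_integrable:
  fixes f :: "'a \<Rightarrow> complex" and g :: "'b \<Rightarrow> complex"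
  assumes f: "integrable M1 f" and g: "integrable M2 g"
    and k[measurable]: "(\<lambda>(x,y). k x y) \<in> borel_measurable (M1 \<Otimes>\<^sub>M M2)"
    and B: "\<And>x y. norm (k x y) \<le> B"
  shows "integrable (M1 \<Otimes>\<^sub>M M2) (\<lambda>(x,y). f x * (g y * k x y))"
proof -
  have [measurable]: "f \<in> borel_measurable M1" "g \<in> borel_measurable M2" using f g by auto
  have "integrable (M1 \<Otimes>\<^sub>M M2) (\<lambda>(x,y). f x * g y)"
  proof (rule Fubini_integrable)
    show "integrable M1 (\<lambda>x. \<integral>y. norm ((\<lambda>(x,y). f x * g y) (x,y)) \<partial>M2)"
      using f by (simp add: norm_mult)
    show "AE x in M1. integrable M2 (\<lambda>y. (\<lambda>(x,y). f x * g y) (x,y))"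
      using g by simp
  qed measurable
  from integrable_mult_bounded[OF this k, of B] B show ?thesis
    by (simp add: case_prod_beta' mult.assoc)
qed

text \<open>The form in which Fubini is applied to Fourier integrals: the kernel is usually a
  character, of modulus 1, so absolute integrability on the product comes from the two
  single-variable factors alone.\<close>

lemma (in pair_sigma_finite) kernel_fubini:
  fixes f :: "'a \<Rightarrow> complex" and g :: "'b \<Rightarrow> complex"
  assumes f: "integrable M1 f" and g: "integrable M2 g"
    and k[measurable]: "(\<lambda>(x,y). k x y) \<in> borel_measurable (M1 \<Otimes>\<^sub>M M2)"
    and B: "\<And>x y. norm (k x y) \<le> B"
  shows "(LINT x|M1. f x * (LINT y|M2. g y * k x y)) = (LINT y|M2. g y * (LINT x|M1. f x * k x y))"
proof -
  from Fubini_integral[OF kernel_integrable[OF assms]]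
  have "(LINT y|M2. LINT x|M1. f x * (g y * k x y)) = (LINT x|M1. LINT y|M2. f x * (g y * k x y))" by simp
  also have "(LINT y|M2. LINT x|M1. f x * (g y * k x y)) = (LINT y|M2. LINT x|M1. g y * (f x * k x y))"
    by (simp add: mult.left_commute)
  finally show ?thesis by simp
qed

lemma integrable_fourier_kernel:
  "integrable lborel m \<Longrightarrow> integrable lborel (\<lambda>\<zeta>. m \<zeta> * cis (2 * pi * (x \<bullet> \<zeta>)))"
  by (rule integrable_mult_bounded[where B=1]) auto

lemma norm_fourier_le:
  "norm (fourier m x) \<le> (LINT \<zeta>|lborel. norm (m \<zeta>))"
  unfolding fourier_def by (rule order.trans[OF integral_norm_bound]) (simp add: norm_mult)

lemma continuous_fourier:
  fixes m :: "'a::euclidean_space \<Rightarrow> complex"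
  assumes "integrable lborel m" shows "continuous_on UNIV (fourier m)"
  unfolding continuous_on_sequentially
proof (safe, unfold o_def fourier_def)
  fix x :: "nat \<Rightarrow> 'a" and a assume "x \<longlonglongrightarrow> a"
  show "(\<lambda>n. LINT \<zeta>|lborel. m \<zeta> * cis (2 * pi * (x n \<bullet> \<zeta>))) \<longlonglongrightarrow> (LINT \<zeta>|lborel. m \<zeta> * cis (2 * pi * (a \<bullet> \<zeta>)))"
  proof (rule integral_dominated_convergence[where w="\<lambda>\<zeta>. norm (m \<zeta>)"])
    show "AE \<zeta> in lborel. (\<lambda>n. m \<zeta> * cis (2 * pi * (x n \<bullet> \<zeta>))) \<longlonglongrightarrow> m \<zeta> * cis (2 * pi * (a \<bullet> \<zeta>))"
      using \<open>x \<longlonglongrightarrow> a\<close> by (intro AE_I2 tendsto_intros)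
  qed (use assms in \<open>auto simp: norm_mult\<close>)
qed

lemma measurable_fourier[measurable]: "integrable lborel m \<Longrightarrow> fourier m \<in> borel_measurable borel"
  using continuous_fourier borel_measurable_continuous_onI by blast

text \<open>\<open>lborel\<close> is the image of a product of one-dimensional Lebesgue measures
  over \<open>Basis\<close>, so Fubini splits the integral. This reduces the Gaussian, and later the
  majorant in \<open>rfourier_test_integrable\<close>, to one dimension.\<close>

lemma
  fixes f :: "'a::euclidean_space \<Rightarrow> real \<Rightarrow> complex"
  assumes "\<And>b. b \<in> Basis \<Longrightarrow> integrable lborel (f b)"
  shows integrable_lborel_prod: "integrable lborel (\<lambda>x::'a. \<Prod>b\<in>Basis. f b (x \<bullet> b))"
    and integral_lborel_prod: "(LINT x|lborel. (\<Prod>b\<in>Basis. f b ((x::'a) \<bullet> b))) = (\<Prod>b\<in>Basis. (LINT s|lborel. f b s))"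
proof -
  interpret product_sigma_finite "\<lambda>_::'a. lborel :: real measure" ..
  have [measurable]: "f b \<in> borel_measurable borel" if "b \<in> Basis" for b
    using assms[OF that] by auto
  have eq: "(\<Prod>b\<in>Basis. f b ((\<Sum>b\<in>Basis. w b *\<^sub>R b) \<bullet> b)) = (\<Prod>b\<in>Basis. f b (w b))" for w
    by (intro prod.cong refl) simp
  have [measurable]: "(\<lambda>w. \<Sum>b\<in>Basis. w b *\<^sub>R (b::'a)) \<in> borel_measurable (\<Pi>\<^sub>M b\<in>Basis. (lborel::real measure))"
    by (intro borel_measurable_sum) (auto intro!: borel_measurable_scaleR)
  have m: "(\<lambda>x::'a. \<Prod>b\<in>Basis. f b (x \<bullet> b)) \<in> borel_measurable borel" by measurable
  show "integrable lborel (\<lambda>x::'a. \<Prod>b\<in>Basis. f b (x \<bullet> b))"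
    by (subst lborel_eq, subst integrable_distr_eq)
       (use m product_integrable_prod[OF finite_Basis, of f] assms in \<open>auto simp: eq\<close>)
  show "(LINT x|lborel. (\<Prod>b\<in>Basis. f b ((x::'a) \<bullet> b))) = (\<Prod>b\<in>Basis. (LINT s|lborel. f b s))"
    by (subst lborel_eq, subst integral_distr)
       (use m product_integral_prod[OF finite_Basis, of f] assms in \<open>auto simp: eq\<close>)
qed

lemma gaussian_fourier_real:
  fixes A k :: real assumes "A > 0"
  shows "integrable lborel (\<lambda>x. complex_of_real (exp (- A * x\<^sup>2)) * cis (k * x))"
    and "(LINT x|lborel. complex_of_real (exp (- A * x\<^sup>2)) * cis (k * x))
      = complex_of_real (sqrt (pi / A) * exp (- k\<^sup>2 / (4 * A)))"
proof -
  have 1: "integrable lborel (\<lambda>x. complex_of_real (exp (- x\<^sup>2 / 2)) * cis (t * x))" for t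
  proof -
    have "integrable lborel (\<lambda>x. sqrt (2 * pi) * std_normal_density x)"
      using integrable_normal_density[of 1 0] by (intro integrable_mult_right) auto
    then have "integrable lborel (\<lambda>x. complex_of_real (exp (- x\<^sup>2 / 2)))"
      by (intro integrable_of_real) (simp add: std_normal_density_def)
    then show ?thesis by (rule integrable_mult_bounded[where B=1]) auto
  qed
  have 2: "(LINT x|lborel. complex_of_real (exp (- x\<^sup>2 / 2)) * cis (t * x))
    = complex_of_real (sqrt (2 * pi) * exp (- t\<^sup>2 / 2))" for t
  proof -
    have "complex_of_real (exp (- t\<^sup>2 / 2)) = char std_normal_distribution t"
      by (simp add: char_std_normal_distribution)
    also have "\<dots> = (LINT x|lborel. std_normal_density x *\<^sub>R cis (t * x))"
      unfolding char_def by (subst integral_density) (auto simp: cis_conv_exp)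
    also have "\<dots> = (LINT x|lborel. complex_of_real (1 / sqrt (2 * pi))
      * (complex_of_real (exp (- x\<^sup>2 / 2)) * cis (t * x)))"
      by (simp add: std_normal_density_def scaleR_conv_of_real mult.assoc)
    also have "\<dots> = complex_of_real (1 / sqrt (2 * pi)) * (LINT x|lborel. complex_of_real (exp (- x\<^sup>2 / 2))
      * cis (t * x))"
      by simp
    finally show ?thesis by (simp add: field_simps)
  qed
  \<comment> \<open>With this dilation A x^2 becomes (c x)^2 / 2, so the characteristic function of
    the standard normal law can be rescaled.\<close>
  define c where "c = sqrt (2 * A)"
  have c: "c > 0" "c\<^sup>2 = 2 * A" using assms by (auto simp: c_def)
  have eq: "complex_of_real (exp (- A * x\<^sup>2)) * cis (k * x) =
     complex_of_real (exp (- (c * x)\<^sup>2 / 2)) * cis ((k / c) * (c * x))" for x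
    using c by (simp add: power_mult_distrib)
  show "integrable lborel (\<lambda>x. complex_of_real (exp (- A * x\<^sup>2)) * cis (k * x))"
    unfolding eq using lborel_integrable_real_affine[OF 1, of c 0 "k / c"] c by simp
  have "complex_of_real (sqrt (2 * pi) * exp (- (k / c)\<^sup>2 / 2))
    = \<bar>c\<bar> *\<^sub>R (LINT x|lborel. complex_of_real (exp (- (c * x)\<^sup>2 / 2)) * cis ((k / c) * (c * x)))"
    using lborel_integral_real_affine[of c "\<lambda>x. complex_of_real (exp (- x\<^sup>2 / 2)) * cis (k / c * x)" 0] c 2[of "k / c"]
      by simp
  then have "complex_of_real (sqrt (2 * pi) * exp (- (k / c)\<^sup>2 / 2))
    = c * (LINT x|lborel. complex_of_real (exp (- A * x\<^sup>2)) * cis (k * x))"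
    unfolding eq using c by (simp add: scaleR_conv_of_real)
  moreover have "(k / c)\<^sup>2 / 2 = k\<^sup>2 / (4 * A)" using c by (simp add: power_divide)
  moreover have "sqrt (2 * pi) = c * sqrt (pi / A)"
    using assms by (simp add: c_def real_sqrt_mult[symmetric])
  ultimately have "complex_of_real c * complex_of_real (sqrt (pi / A) * exp (- k\<^sup>2 / (4 * A)))
    = c * (LINT x|lborel. complex_of_real (exp (- A * x\<^sup>2)) * cis (k * x))"
    by (simp add: mult.assoc)
  then show "(LINT x|lborel. complex_of_real (exp (- A * x\<^sup>2)) * cis (k * x))
    = complex_of_real (sqrt (pi / A) * exp (- k\<^sup>2 / (4 * A)))"
    using c by simp
qed

lemma gaussian_fourier:
  fixes \<zeta> :: "'a::euclidean_space" assumes A: "A > 0"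
  shows "integrable lborel (\<lambda>x::'a. exp (- A * (norm x)\<^sup>2))"
    and "fourier (\<lambda>x. complex_of_real (exp (- A * (norm x)\<^sup>2))) \<zeta> =
      complex_of_real (sqrt (pi / A) ^ DIM('a) * exp (- pi\<^sup>2 * (norm \<zeta>)\<^sup>2 / A))"
proof -
  have eq: "complex_of_real (exp (- A * (norm x)\<^sup>2)) * cis (2 * pi * (\<zeta> \<bullet> x)) =
    (\<Prod>b\<in>Basis. complex_of_real (exp (- A * (x \<bullet> b)\<^sup>2)) * cis ((2 * pi * (\<zeta> \<bullet> b)) * (x \<bullet> b)))" for \<zeta> x :: 'a
  proof -
    have "(norm x)\<^sup>2 = (\<Sum>b\<in>Basis. (x \<bullet> b)\<^sup>2)"
      by (subst power2_norm_eq_inner, subst euclidean_inner) (simp add: power2_eq_square)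
    then have 1: "exp (- A * (norm x)\<^sup>2) = (\<Prod>b\<in>Basis. exp (- A * (x \<bullet> b)\<^sup>2))"
      by (simp add: exp_sum[symmetric] sum_distrib_left)
    have 2: "cis (2 * pi * (\<zeta> \<bullet> x)) = (\<Prod>b\<in>Basis. cis ((2 * pi * (\<zeta> \<bullet> b)) * (x \<bullet> b)))"
      by (subst euclidean_inner) (simp add: cis_conv_exp exp_sum[symmetric] sum_distrib_left mult_ac)
    show ?thesis unfolding 1 2 by (simp add: prod.distrib)
  qed
  note P = integrable_lborel_prod[OF gaussian_fourier_real(1)[OF A], where 'a='a]
    integral_lborel_prod[OF gaussian_fourier_real(1)[OF A], where 'a='a]
  have "integrable lborel (\<lambda>x::'a. complex_of_real (exp (- A * (norm x)\<^sup>2)))"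
    using P(1)[of "\<lambda>_. 0"] eq[where \<zeta>=0] by (simp only: inner_zero_left mult_zero_right mult_zero_left cis_zero
      mult_1_right)
  then show "integrable lborel (\<lambda>x::'a. exp (- A * (norm x)\<^sup>2))"
    by (simp only: complex_of_real_integrable_eq)
  have n: "(norm \<zeta>)\<^sup>2 = (\<Sum>b\<in>Basis. (\<zeta> \<bullet> b)\<^sup>2)"
      by (subst power2_norm_eq_inner, subst euclidean_inner) (simp add: power2_eq_square)
  have "fourier (\<lambda>x. complex_of_real (exp (- A * (norm x)\<^sup>2))) \<zeta>
    = (\<Prod>b\<in>(Basis::'a set). complex_of_real (sqrt (pi / A) * exp (- (2 * pi * (\<zeta> \<bullet> b))\<^sup>2 / (4 * A))))"
    unfolding fourier_def eq P(2) gaussian_fourier_real(2)[OF A] by simp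
  also have "\<dots> = complex_of_real (sqrt (pi / A) ^ DIM('a)
    * exp (\<Sum>b\<in>(Basis::'a set). (- (2 * pi * (\<zeta> \<bullet> b))\<^sup>2 / (4 * A))))"
    by (simp add: prod.distrib exp_sum)
  also have "(\<Sum>b\<in>(Basis::'a set). (- (2 * pi * (\<zeta> \<bullet> b))\<^sup>2 / (4 * A))) = - pi\<^sup>2 * (norm \<zeta>)\<^sup>2 / A"
    by (simp add: n sum_distrib_left sum_divide_distrib sum_negf power_mult_distrib)
  finally show "fourier (\<lambda>x. complex_of_real (exp (- A * (norm x)\<^sup>2))) \<zeta> =
      complex_of_real (sqrt (pi / A) ^ DIM('a) * exp (- pi\<^sup>2 * (norm \<zeta>)\<^sup>2 / A))" .
qed

section \<open>Gaussian regularization, Plancherel, and inversion at the origin\<close>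

lemma integral_lborel_scale_shift:
  fixes f :: "'a::euclidean_space \<Rightarrow> 'b::{banach, second_countable_topology}" and c :: real
  assumes c: "c \<noteq> 0" and f[measurable]: "f \<in> borel_measurable borel"
  shows "(LINT x|lborel. f x) = \<bar>c\<bar> ^ DIM('a) *\<^sub>R (LINT u|lborel. f (t + c *\<^sub>R u))"
  by (subst lborel_affine[OF c, of t]) (simp add: integral_density integral_distr)

lemma nn_integral_lborel_scale_shift:
  fixes f :: "'a::euclidean_space \<Rightarrow> ennreal" and c :: real
  assumes c: "c \<noteq> 0" and f[measurable]: "f \<in> borel_measurable borel"
  shows "(\<integral>\<^sup>+x. f x \<partial>lborel) = ennreal (\<bar>c\<bar> ^ DIM('a)) * (\<integral>\<^sup>+u. f (t + c *\<^sub>R u) \<partial>lborel)"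
  by (subst lborel_affine[OF c, of t]) (simp add: nn_integral_density nn_integral_distr nn_integral_cmult)

text \<open>The squared transform is not known to be integrable, so it is weighted by a Gaussian.
  Expanding the square and exchanging the integrals puts the transform of that Gaussian between the
  two copies of \<open>m\<close>. The limit A -> 0 gives Plancherel; the value A = pi^2 s gives the
  Gaussian layers of the logarithmic energy.\<close>

lemma fourier_gaussian_regularized:
  fixes m :: "'a::euclidean_space \<Rightarrow> complex"
  assumes m: "integrable lborel m" and A: "A > 0"
  shows "complex_of_real (LINT x|lborel. exp (- A * (norm x)\<^sup>2) * (norm (fourier m x))\<^sup>2) =
    (LINT \<zeta>|lborel. m \<zeta> * (LINT \<xi>|lborel. cnj (m \<xi>) * complex_of_real
      (sqrt (pi / A) ^ DIM('a) * exp (- pi\<^sup>2 * (norm (\<zeta> - \<xi>))\<^sup>2 / A))))"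
proof -
  let ?G = "\<lambda>x::'a. complex_of_real (exp (- A * (norm x)\<^sup>2))"
  have [measurable]: "m \<in> borel_measurable borel" "fourier m \<in> borel_measurable borel" using m by auto
  have G: "integrable lborel ?G"
    using gaussian_fourier(1)[OF A] by (simp only: complex_of_real_integrable_eq)
  have GF: "integrable lborel (\<lambda>x. ?G x * cnj (fourier m x))"
    by (rule integrable_mult_bounded[OF G, where B="LINT \<zeta>|lborel. norm (m \<zeta>)"]) (auto intro: norm_fourier_le)
  have cm: "integrable lborel (\<lambda>\<xi>. cnj (m \<xi>))" using m by simp
  have cf: "cnj (fourier m x) = (LINT \<xi>|lborel. cnj (m \<xi>) * cis (- (2 * pi * (x \<bullet> \<xi>))))" for x
    using Bochner_Integration.integral_cnj[of lborel "\<lambda>\<zeta>. m \<zeta> * cis (2 * pi * (x \<bullet> \<zeta>))"]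
      by (simp add: fourier_def cis_cnj)
  have inner: "(LINT x|lborel. (?G x * cnj (fourier m x)) * cis (2 * pi * (x \<bullet> \<zeta>))) =
    (LINT \<xi>|lborel. cnj (m \<xi>) * complex_of_real (sqrt (pi / A) ^ DIM('a) * exp (- pi\<^sup>2 * (norm (\<zeta> - \<xi>))\<^sup>2 / A)))" for \<zeta>
  proof -
    have "(LINT x|lborel. (?G x * cnj (fourier m x)) * cis (2 * pi * (x \<bullet> \<zeta>))) =
       (LINT x|lborel. (?G x * cis (2 * pi * (x \<bullet> \<zeta>))) * (LINT \<xi>|lborel. cnj (m \<xi>) * cis (- (2 * pi * (x \<bullet> \<xi>)))))"
      unfolding cf by (simp add: mult_ac)
    also have "\<dots> = (LINT \<xi>|lborel. cnj (m \<xi>) * (LINT x|lborel. (?G x * cis (2 * pi * (x \<bullet> \<zeta>)))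
      * cis (- (2 * pi * (x \<bullet> \<xi>)))))"
      using integrable_mult_bounded[OF G, of "\<lambda>x. cis (2 * pi * (x \<bullet> \<zeta>))" 1] cm
      by (intro lborel_pair.kernel_fubini[where B=1]) (simp_all only: norm_cis, measurable)
    also have "\<dots> = (LINT \<xi>|lborel. cnj (m \<xi>) * fourier ?G (\<zeta> - \<xi>))"
      unfolding fourier_def by (simp add: cis_mult mult.assoc inner_diff_left inner_diff_right right_diff_distrib
        inner_commute)
    finally show ?thesis unfolding gaussian_fourier(2)[OF A] .
  qed
  have "complex_of_real (LINT x|lborel. exp (- A * (norm x)\<^sup>2) * (norm (fourier m x))\<^sup>2) =
     (LINT x|lborel. (?G x * cnj (fourier m x)) * (LINT \<zeta>|lborel. m \<zeta> * cis (2 * pi * (x \<bullet> \<zeta>))))"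
    unfolding fourier_def[symmetric] integral_complex_of_real[symmetric]
    by (intro Bochner_Integration.integral_cong refl)
       (simp add: complex_norm_square mult_ac del: of_real_power)
  also have "\<dots> = (LINT \<zeta>|lborel. m \<zeta> * (LINT x|lborel. (?G x * cnj (fourier m x)) * cis (2 * pi * (x \<bullet> \<zeta>))))"
    by (rule lborel_pair.kernel_fubini[OF GF m, where B=1]) auto
  finally show ?thesis unfolding inner .
qed

text \<open>The substitution \<xi> = \<zeta> + sqrt A u turns the kernel into a fixed probability
  density in u and moves A into the argument of \<open>b\<close>. Continuity with dominated
  convergence then yields the limit, and total mass 1 yields the bound.\<close>

lemma gaussian_mollify:
  fixes b :: "'a::euclidean_space \<Rightarrow> complex"
  assumes b: "continuous_on UNIV b" and B: "\<And>x. norm (b x) \<le> B"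
  defines "K \<equiv> \<lambda>A \<zeta>. (LINT \<xi>|lborel. b \<xi> * complex_of_real (sqrt (pi / A) ^ DIM('a)
    * exp (- pi\<^sup>2 * (norm (\<zeta> - \<xi>))\<^sup>2 / A)))"
  shows gaussian_mollify_tendsto: "(\<lambda>n. K (1 / real (Suc n)) \<zeta>) \<longlonglongrightarrow> b \<zeta>"
    and gaussian_mollify_bound: "A > 0 \<Longrightarrow> norm (K A \<zeta>) \<le> B"
proof -
  have [measurable]: "b \<in> borel_measurable borel" using b by (rule borel_measurable_continuous_onI)
  have B0: "0 \<le> B" using B[of 0] norm_ge_zero order_trans by blast
  let ?g = "\<lambda>u::'a. sqrt pi ^ DIM('a) * exp (- pi\<^sup>2 * (norm u)\<^sup>2)"
  have pi2: "pi\<^sup>2 > 0" by simp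
  have g: "integrable lborel ?g" using gaussian_fourier(1)[OF pi2, where 'a='a] by simp
  have "complex_of_real (LINT u|lborel. ?g u)
    = complex_of_real (sqrt pi ^ DIM('a)) * fourier (\<lambda>x::'a. complex_of_real (exp (- pi\<^sup>2 * (norm x)\<^sup>2))) 0"
    unfolding fourier_def by (simp add: integral_of_real[symmetric] del: of_real_power)
  also have "\<dots> = complex_of_real ((sqrt pi * sqrt (pi / pi\<^sup>2)) ^ DIM('a))"
    unfolding gaussian_fourier(2)[OF pi2] by (simp add: power_mult_distrib)
  also have "sqrt pi * sqrt (pi / pi\<^sup>2) = 1"
    by (simp add: real_sqrt_mult[symmetric] power2_eq_square)
  finally have g1: "(LINT u|lborel. ?g u) = 1" by (simp only: power_one of_real_1 of_real_eq_1_iff)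
  have K: "K A \<zeta> = (LINT u|lborel. b (\<zeta> + sqrt A *\<^sub>R u) * complex_of_real (?g u))" if "A > 0" for A \<zeta>
  proof -
    have 1: "pi\<^sup>2 * (sqrt A * norm u)\<^sup>2 / A = pi\<^sup>2 * (norm u)\<^sup>2" for u :: 'a
      using that by (simp add: power_mult_distrib)
    have 2: "\<bar>sqrt A\<bar> ^ DIM('a) * sqrt (pi / A) ^ DIM('a) = sqrt pi ^ DIM('a)"
      using that by (simp add: power_mult_distrib[symmetric] real_sqrt_mult[symmetric])
    have "K A \<zeta> = \<bar>sqrt A\<bar> ^ DIM('a) *\<^sub>R (LINT u|lborel. b (\<zeta> + sqrt A *\<^sub>R u)
      * complex_of_real (sqrt (pi / A) ^ DIM('a) * exp (- pi\<^sup>2 * (norm (\<zeta> - (\<zeta> + sqrt A *\<^sub>R u)))\<^sup>2 / A)))"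
      unfolding K_def using that by (subst integral_lborel_scale_shift[of "sqrt A" _ \<zeta>]) auto
    also have "\<dots> = (LINT u|lborel. b (\<zeta> + sqrt A *\<^sub>R u)
      * complex_of_real ((\<bar>sqrt A\<bar> ^ DIM('a) * sqrt (pi / A) ^ DIM('a)) * exp (- pi\<^sup>2 * (norm u)\<^sup>2)))"
      unfolding integral_scaleR_right[symmetric] using 1 that
      by (intro Bochner_Integration.integral_cong refl) (simp add: scaleR_conv_of_real mult_ac)
    finally show ?thesis unfolding 2 .
  qed
  show "(\<lambda>n. K (1 / real (Suc n)) \<zeta>) \<longlonglongrightarrow> b \<zeta>"
  proof -
    have "(\<lambda>n. LINT u|lborel. b (\<zeta> + sqrt (1 / real (Suc n)) *\<^sub>R u) * complex_of_real (?g u))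
      \<longlonglongrightarrow> (LINT u|lborel. b \<zeta> * complex_of_real (?g u))"
    proof (rule integral_dominated_convergence[where w="\<lambda>u. B * ?g u"])
      have "(\<lambda>n. sqrt (1 / real (Suc n))) \<longlonglongrightarrow> sqrt 0"
        by (rule tendsto_real_sqrt[OF LIMSEQ_Suc[OF lim_1_over_n]])
      then have "(\<lambda>n. \<zeta> + sqrt (1 / real (Suc n)) *\<^sub>R u) \<longlonglongrightarrow> \<zeta> + sqrt 0 *\<^sub>R u" for u
        by (intro tendsto_add tendsto_scaleR tendsto_const)
      then have "(\<lambda>n. b (\<zeta> + sqrt (1 / real (Suc n)) *\<^sub>R u)) \<longlonglongrightarrow> b (\<zeta> + sqrt 0 *\<^sub>R u)" for u
        using b by (intro isCont_tendsto_compose[where g=b]) (auto simp: continuous_on_eq_continuous_at)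
      then show "AE u in lborel. (\<lambda>n. b (\<zeta> + sqrt (1 / real (Suc n)) *\<^sub>R u) * complex_of_real (?g u))
        \<longlonglongrightarrow> b \<zeta> * complex_of_real (?g u)"
        by (intro AE_I2 tendsto_mult tendsto_const) simp
      show "AE u in lborel. norm (b (\<zeta> + sqrt (1 / real (Suc n)) *\<^sub>R u) * complex_of_real (?g u)) \<le> B * ?g u" for n
        using B by (intro AE_I2) (auto simp: norm_mult abs_mult norm_power intro!: mult_right_mono)
      show "integrable lborel (\<lambda>u. B * ?g u)" using g by (rule integrable_mult_right)
    qed measurable
    moreover have "(LINT u|lborel. b \<zeta> * complex_of_real (?g u)) = b \<zeta>"
    proof -
      have "(LINT u|lborel. b \<zeta> * complex_of_real (?g u)) = b \<zeta> * complex_of_real (LINT u|lborel. ?g u)"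
        by (simp only: integral_mult_right_zero integral_complex_of_real)
      then show ?thesis unfolding g1 by simp
    qed
    moreover have "K (1 / real (Suc n)) \<zeta> = (LINT u|lborel. b (\<zeta> + sqrt (1 / real (Suc n)) *\<^sub>R u)
      * complex_of_real (?g u))" for n
      by (rule K) simp
    ultimately show ?thesis by (simp only:)
  qed
  show "norm (K A \<zeta>) \<le> B" if "A > 0"
  proof -
    have "norm (K A \<zeta>) \<le> (LINT u|lborel. norm (b (\<zeta> + sqrt A *\<^sub>R u) * complex_of_real (?g u)))"
      unfolding K[OF that] by (rule integral_norm_bound)
    also have "\<dots> \<le> (LINT u|lborel. B * ?g u)"
    proof (rule integral_mono_AE')
      show "integrable lborel (\<lambda>u. B * ?g u)" using g by (rule integrable_mult_right)
      show "AE u in lborel. norm (b (\<zeta> + sqrt A *\<^sub>R u) * complex_of_real (?g u)) \<le> B * ?g u"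
        using B by (intro AE_I2) (auto simp: norm_mult abs_mult norm_power intro!: mult_right_mono)
    qed (use B0 in auto)
    also have "\<dots> = B" by (subst integral_mult_right_zero, subst g1) simp
    finally show ?thesis .
  qed
qed

text \<open>As the Gaussian weight increases to 1, the transform side of
  \<open>fourier_gaussian_regularized\<close> converges monotonically and the other side by
  domination. Monotone convergence is what avoids assuming that the transform is square
  integrable.\<close>

lemma plancherel:
  fixes m :: "'a::euclidean_space \<Rightarrow> complex"
  assumes m: "integrable lborel m" "continuous_on UNIV m" and B: "\<And>x. norm (m x) \<le> B"
  shows "(\<integral>\<^sup>+x. ennreal ((norm (fourier m x))\<^sup>2) \<partial>lborel) = (\<integral>\<^sup>+\<zeta>. ennreal ((norm (m \<zeta>))\<^sup>2) \<partial>lborel)"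
proof -
  have [measurable]: "m \<in> borel_measurable borel" "fourier m \<in> borel_measurable borel" using m by auto
  define A where "A n = 1 / real (Suc n)" for n
  have A: "A n > 0" for n by (simp add: A_def)
  define K where "K A \<zeta> = (LINT \<xi>|lborel. cnj (m \<xi>)
    * complex_of_real (sqrt (pi / A) ^ DIM('a) * exp (- pi\<^sup>2 * (norm (\<zeta> - \<xi>))\<^sup>2 / A)))" for A \<zeta>
  have [measurable]: "K A \<in> borel_measurable borel" for A
    unfolding K_def by (rule lborel.borel_measurable_lebesgue_integral) measurable
  have cm: "continuous_on UNIV (\<lambda>x. cnj (m x))" "norm (cnj (m x)) \<le> B" for x
    using m(2) B by (auto intro!: continuous_intros)
  have K1: "(\<lambda>n. K (A n) \<zeta>) \<longlonglongrightarrow> cnj (m \<zeta>)" for \<zeta>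
    unfolding K_def A_def using gaussian_mollify_tendsto[OF cm] .
  have K2: "norm (K (A n) \<zeta>) \<le> B" for \<zeta> n
    unfolding K_def by (rule gaussian_mollify_bound[OF cm A])
  have sq: "norm (m x * cnj (m x)) \<le> B * norm (m x)" for x
    using mult_right_mono[OF B[of x] norm_ge_zero[of "m x"]] by (simp add: norm_mult)
  have mm: "integrable lborel (\<lambda>x. m x * cnj (m x))"
    by (rule integrable_mult_bounded[OF m(1), where B=B]) (auto simp: B)
  have lim: "(\<lambda>n. LINT \<zeta>|lborel. m \<zeta> * K (A n) \<zeta>) \<longlonglongrightarrow> (LINT \<zeta>|lborel. m \<zeta> * cnj (m \<zeta>))"
  proof (rule integral_dominated_convergence[where w="\<lambda>x. B * norm (m x)"])
    show "AE x in lborel. norm (m x * K (A n) x) \<le> B * norm (m x)" for n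
      using mult_left_mono[OF K2 norm_ge_zero] by (intro AE_I2) (simp add: norm_mult mult.commute)
    show "AE x in lborel. (\<lambda>n. m x * K (A n) x) \<longlonglongrightarrow> m x * cnj (m x)"
      by (intro AE_I2 tendsto_intros K1)
  qed (use m in auto)
  have reg: "(LINT x|lborel. exp (- A n * (norm x)\<^sup>2) * (norm (fourier m x))\<^sup>2) = Re (LINT \<zeta>|lborel. m \<zeta> * K (A n) \<zeta>)"
    for n
    unfolding K_def fourier_gaussian_regularized[OF m(1) A, symmetric] by simp
  have int: "integrable lborel (\<lambda>x. exp (- A n * (norm x)\<^sup>2) * (norm (fourier m x))\<^sup>2)" for n
  proof (rule Bochner_Integration.integrable_bound)
    let ?C = "LINT \<zeta>|lborel. norm (m \<zeta>)"
    show "integrable lborel (\<lambda>x::'a. exp (- A n * (norm x)\<^sup>2) * ?C\<^sup>2)"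
      using gaussian_fourier(1)[OF A, of n] by (intro integrable_mult_left) auto
    show "AE x in lborel. norm (exp (- A n * (norm x)\<^sup>2) * (norm (fourier m x))\<^sup>2)
      \<le> norm (exp (- A n * (norm x)\<^sup>2) * ?C\<^sup>2)"
      by (intro AE_I2) (auto simp: abs_mult intro!: power_mono norm_fourier_le)
  qed measurable
  have L1: "(\<lambda>n. \<integral>\<^sup>+x. ennreal (exp (- A n * (norm x)\<^sup>2) * (norm (fourier m x))\<^sup>2) \<partial>lborel)
    \<longlonglongrightarrow> (\<integral>\<^sup>+x. ennreal ((norm (fourier m x))\<^sup>2) \<partial>lborel)"
  proof (rule nn_integral_LIMSEQ)
    show "incseq (\<lambda>n x. ennreal (exp (- A n * (norm x)\<^sup>2) * (norm (fourier m x))\<^sup>2))"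
      by (intro incseq_SucI le_funI ennreal_leI mult_right_mono)
        (auto simp: A_def field_simps intro!: mult_right_mono)
    have "A \<longlonglongrightarrow> 0" unfolding A_def by (intro LIMSEQ_Suc[OF lim_1_over_n])
    then have "(\<lambda>n. exp (- A n * (norm x)\<^sup>2) * (norm (fourier m x))\<^sup>2) \<longlonglongrightarrow> exp (- 0 * (norm x)\<^sup>2) * (norm (fourier m x))\<^sup>2"
      for x :: 'a
      by (intro tendsto_intros)
    then show "(\<lambda>n. ennreal (exp (- A n * (norm x)\<^sup>2) * (norm (fourier m x))\<^sup>2)) \<longlonglongrightarrow> ennreal ((norm (fourier m x))\<^sup>2)"
      for x :: 'a
      by (intro tendsto_ennrealI) simp
  qed measurable
  have L2: "(\<lambda>n. \<integral>\<^sup>+x. ennreal (exp (- A n * (norm x)\<^sup>2) * (norm (fourier m x))\<^sup>2) \<partial>lborel)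
    \<longlonglongrightarrow> ennreal (Re (LINT \<zeta>|lborel. m \<zeta> * cnj (m \<zeta>)))"
    unfolding nn_integral_eq_integral[OF int AE_I2[OF mult_nonneg_nonneg[OF exp_ge_zero zero_le_power2]]] reg
    by (intro tendsto_ennrealI tendsto_Re lim)
  have "ennreal (Re (LINT \<zeta>|lborel. m \<zeta> * cnj (m \<zeta>))) = (\<integral>\<^sup>+\<zeta>. ennreal ((norm (m \<zeta>))\<^sup>2) \<partial>lborel)"
  proof -
    have "Re (LINT \<zeta>|lborel. m \<zeta> * cnj (m \<zeta>)) = (LINT \<zeta>|lborel. (norm (m \<zeta>))\<^sup>2)"
      by (subst integral_Re[OF mm, symmetric]) (simp add: complex_mult_cnj cmod_power2)
    moreover have "integrable lborel (\<lambda>\<zeta>. (norm (m \<zeta>))\<^sup>2)"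
      using integrable_norm[OF mm] by (simp add: norm_mult power2_eq_square)
    ultimately show ?thesis by (simp add: nn_integral_eq_integral)
  qed
  with LIMSEQ_unique[OF L1 L2] show ?thesis by simp
qed

text \<open>A Gaussian weight on the transform becomes, after Fubini, a Gaussian average of
  \<open>f\<close> around 0. The identity is wanted only at the origin: it computes the total mass
  of the transform of a cutoff.\<close>

lemma fourier_inversion_at_0:
  fixes f :: "'a::euclidean_space \<Rightarrow> complex"
  assumes f: "integrable lborel f" "continuous_on UNIV f" and B: "\<And>x. norm (f x) \<le> B"
    and F: "integrable lborel (fourier f)"
  shows "(LINT \<zeta>|lborel. fourier f \<zeta>) = f 0"
proof -
  have [measurable]: "f \<in> borel_measurable borel" "fourier f \<in> borel_measurable borel" using f by auto
  define A where "A n = 1 / real (Suc n)" for n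
  have A: "A n > 0" for n by (simp add: A_def)
  let ?G = "\<lambda>n (x::'a). complex_of_real (exp (- A n * (norm x)\<^sup>2))"
  have G: "integrable lborel (?G n)" for n
    using gaussian_fourier(1)[OF A] by (simp only: complex_of_real_integrable_eq)
  have eq: "(LINT \<zeta>|lborel. ?G n \<zeta> * fourier f \<zeta>)
    = (LINT x|lborel. f x * complex_of_real (sqrt (pi / A n) ^ DIM('a) * exp (- pi\<^sup>2 * (norm (0 - x))\<^sup>2 / A n)))" for n
  proof -
    have "(LINT \<zeta>|lborel. ?G n \<zeta> * fourier f \<zeta>)
      = (LINT x|lborel. f x * (LINT \<zeta>|lborel. ?G n \<zeta> * cis (2 * pi * (\<zeta> \<bullet> x))))"
      unfolding fourier_def by (rule lborel_pair.kernel_fubini[OF G f(1), where B=1]) auto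
    also have "\<dots> = (LINT x|lborel. f x * fourier (?G n) x)"
      by (simp add: fourier_def inner_commute)
    finally show ?thesis unfolding gaussian_fourier(2)[OF A] by simp
  qed
  have L1: "(\<lambda>n. LINT \<zeta>|lborel. ?G n \<zeta> * fourier f \<zeta>) \<longlonglongrightarrow> f 0"
    unfolding eq unfolding A_def by (rule gaussian_mollify_tendsto[OF f(2) B])
  have L2: "(\<lambda>n. LINT \<zeta>|lborel. ?G n \<zeta> * fourier f \<zeta>) \<longlonglongrightarrow> (LINT \<zeta>|lborel. fourier f \<zeta>)"
  proof (rule integral_dominated_convergence[where w="\<lambda>\<zeta>. norm (fourier f \<zeta>)"])
    have "A \<longlonglongrightarrow> 0" unfolding A_def by (intro LIMSEQ_Suc[OF lim_1_over_n])
    then have "(\<lambda>n. ?G n x * fourier f x) \<longlonglongrightarrow> complex_of_real (exp (- 0 * (norm x)\<^sup>2)) * fourier f x" for x :: 'a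
      by (intro tendsto_intros)
    then show "AE x in lborel. (\<lambda>n. ?G n x * fourier f x) \<longlonglongrightarrow> fourier f x"
      by simp
    show "AE x in lborel. norm (?G n x * fourier f x) \<le> norm (fourier f x)" for n
      unfolding norm_mult using A[of n] by (intro AE_I2 mult_left_le_one_le) auto
  qed (use F in auto)
  show ?thesis by (rule LIMSEQ_unique[OF L2 L1])
qed

section \<open>Test functions and their convolutions\<close>

abbreviation partial :: "'a::euclidean_space \<Rightarrow> ('a \<Rightarrow> real) \<Rightarrow> 'a \<Rightarrow> real" where
  "partial b f \<equiv> \<lambda>x. frechet_derivative f (at x) b"

lemma partial_eqI: "(f has_derivative f') (at x) \<Longrightarrow> partial b f x = f' b"
  by (metis frechet_derivative_at)

text \<open>A coinductive criterion that hides iterated derivatives. It is applied to linear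
  combinations, to correlations with a fixed kernel, and to an algebra that contains the bump
  functions.\<close>

lemma smooth_class:
  assumes "f \<in> S"
    and "\<And>f x. f \<in> S \<Longrightarrow> f differentiable (at x)"
    and "\<And>f b. f \<in> S \<Longrightarrow> b \<in> Basis \<Longrightarrow> partial b f \<in> S"
  shows "smooth f"
proof -
  have "iter_deriv vs f \<in> S" if "set vs \<subseteq> Basis" for vs
    using that by (induction vs) (auto intro: assms)
  then show ?thesis unfolding smooth_def using assms(2) by blast
qed

lemma smooth_differentiable: "smooth f \<Longrightarrow> f differentiable (at x)"
  unfolding smooth_def by (metis empty_set empty_subsetI iter_deriv.simps(1))

lemma smooth_has_derivative: "smooth f \<Longrightarrow> (f has_derivative frechet_derivative f (at x)) (at x)"
  using smooth_differentiable frechet_derivative_works by blast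

lemma smooth_continuous: "smooth f \<Longrightarrow> continuous_on S f"
  by (intro continuous_at_imp_continuous_on ballI differentiable_imp_continuous_within smooth_differentiable)

lemma smooth_partial:
  assumes "smooth f" "b \<in> Basis" shows "smooth (partial b f)"
proof -
  \<comment> \<open>The last entry of a list is differentiated first, so one extra initial
    derivative is an entry appended at the end.\<close>
  have "iter_deriv vs (partial b f) = iter_deriv (vs @ [b]) f" for vs
    by (induction vs) auto
  with assms show ?thesis unfolding smooth_def by (metis Un_subset_iff bot.extremum insert_subset list.set set_append)
qed

lemma partial_lincomb:
  assumes "smooth f" "smooth g"
  shows "((\<lambda>x. a * f x + c * g x) has_derivative (\<lambda>v. a * frechet_derivative f (at x) v + c
    * frechet_derivative g (at x) v)) (at x)"
  using smooth_has_derivative[OF assms(1), of x] smooth_has_derivative[OF assms(2), of x]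
  by (intro has_derivative_add has_derivative_mult_right) auto

lemma smooth_lincomb:
  fixes f g :: "'a::euclidean_space \<Rightarrow> real"
  assumes "smooth f" "smooth g" shows "smooth (\<lambda>x. a * f x + c * g x)"
proof (rule smooth_class[where S="{h. \<exists>f g. smooth f \<and> smooth g \<and> h = (\<lambda>x. a * f x + c * g x)}"])
  fix h :: "'a \<Rightarrow> real" and x assume "h \<in> {h. \<exists>f g. smooth f \<and> smooth g \<and> h = (\<lambda>x. a * f x + c * g x)}"
  then obtain f g where h: "smooth f" "smooth g" "h = (\<lambda>x. a * f x + c * g x)" by blast
  show "h differentiable (at x)"
    using partial_lincomb[OF h(1,2)] unfolding h(3) differentiable_def by blast
  fix b :: 'a assume b: "b \<in> Basis"
  have "partial b h = (\<lambda>x. a * partial b f x + c * partial b g x)"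
    unfolding h(3) by (intro ext partial_eqI partial_lincomb h)
  then show "partial b h \<in> {h. \<exists>f g. smooth f \<and> smooth g \<and> h = (\<lambda>x. a * f x + c * g x)}"
    using smooth_partial[OF h(1) b] smooth_partial[OF h(2) b] by blast
qed (use assms in blast)

lemma test_functions_iff:
  "f \<in> test_functions \<longleftrightarrow> smooth f \<and> (\<exists>r. \<forall>x. norm x > r \<longrightarrow> f x = 0)"
proof -
  have "compact (closure {x. f x \<noteq> 0}) \<longleftrightarrow> (\<exists>r. \<forall>x. norm x > r \<longrightarrow> f x = 0)"
    unfolding compact_closure bounded_iff by (metis (mono_tags, lifting) linorder_not_le mem_Collect_eq)
  then show ?thesis by (simp add: test_functions_def)
qed

lemma test_smooth: "f \<in> test_functions \<Longrightarrow> smooth f"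
  by (simp add: test_functions_iff)

lemma test_continuous: "f \<in> test_functions \<Longrightarrow> continuous_on S f"
  by (simp add: test_smooth smooth_continuous)

lemma test_measurable[measurable_dest]: "f \<in> test_functions \<Longrightarrow> f \<in> borel_measurable borel"
  by (simp add: borel_measurable_continuous_onI test_continuous)

lemma test_support:
  assumes "f \<in> test_functions" obtains r where "r > 0" "\<And>x. norm x > r \<Longrightarrow> f x = 0"
proof -
  from assms obtain r where "\<forall>x. norm x > r \<longrightarrow> f x = 0" by (auto simp: test_functions_iff)
  then show ?thesis by (intro that[of "max 1 r"]) auto
qed

lemma test_lincomb:
  assumes "f \<in> test_functions" "g \<in> test_functions"
  shows "(\<lambda>x. a * f x + c * g x) \<in> test_functions"
proof -
  obtain r where "\<And>x. norm x > r \<Longrightarrow> f x = 0" using test_support[OF assms(1)] by metis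
  moreover obtain s where "\<And>x. norm x > s \<Longrightarrow> g x = 0" using test_support[OF assms(2)] by metis
  ultimately have "\<forall>x. norm x > max r s \<longrightarrow> a * f x + c * g x = 0" by auto
  then show ?thesis using assms smooth_lincomb test_functions_iff by blast
qed

lemma test_partial:
  assumes f: "f \<in> test_functions" and b: "b \<in> Basis"
  shows "partial b f \<in> test_functions"
proof -
  obtain r where r: "\<And>x. norm x > r \<Longrightarrow> f x = 0" using test_support[OF f] by metis
  have "partial b f x = 0" if "norm x > r" for x
  proof (rule partial_eqI[where f'="\<lambda>_. 0"])
    show "(f has_derivative (\<lambda>_. 0)) (at x)"
      by (rule has_derivative_transform_within_open[OF has_derivative_const,
        where s="- cball 0 r"]) (use that r in auto)
  qed
  then show ?thesis using smooth_partial[OF test_smooth[OF f] b] test_functions_iff by blast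
qed

lemma integrable_compact_support:
  fixes f :: "'a::euclidean_space \<Rightarrow> 'b::{banach, second_countable_topology}"
  assumes "continuous_on UNIV f" "\<And>x. norm x > r \<Longrightarrow> f x = 0"
  shows "integrable lborel f"
proof -
  have "integrable lborel (\<lambda>x. indicator (cball 0 r) x *\<^sub>R f x)"
    by (rule borel_integrable_compact) (auto intro: continuous_on_subset[OF assms(1)])
  also have "(\<lambda>x. indicator (cball 0 r) x *\<^sub>R f x) = f"
    using assms(2) by (auto simp: indicator_def fun_eq_iff)
  finally show ?thesis .
qed

lemma bounded_compact_support:
  fixes f :: "'a::euclidean_space \<Rightarrow> 'b::real_normed_vector"
  assumes "continuous_on UNIV f" "\<And>x. norm x > r \<Longrightarrow> f x = 0"
  obtains B where "B > 0" "\<And>x. norm (f x) \<le> B"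
proof -
  have "compact (f ` cball 0 r)" by (rule compact_continuous_image) (auto intro: continuous_on_subset[OF assms(1)])
  then have "bounded (f ` cball 0 r)" by (rule compact_imp_bounded)
  then obtain B where "B > 0" "\<And>y. y \<in> f ` cball 0 r \<Longrightarrow> norm y \<le> B"
    unfolding bounded_pos by metis
  note B = this
  have "norm (f x) \<le> B" for x
  proof (cases "norm x > r")
    case True
    then show ?thesis using assms(2) B(1) by simp
  next
    case False
    then have "f x \<in> f ` cball 0 r" by simp
    then show ?thesis by (rule B(2))
  qed
  then show ?thesis by (rule that[OF B(1)])
qed

lemma test_integrable:
  assumes "f \<in> test_functions" shows "integrable lborel f"
proof -
  obtain r where "\<And>x. norm x > r \<Longrightarrow> f x = 0" using test_support[OF assms] by metis
  then show ?thesis by (rule integrable_compact_support[OF test_continuous[OF assms]])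
qed

lemma test_bounded:
  assumes "f \<in> test_functions" obtains B where "B > 0" "\<And>x. \<bar>f x\<bar> \<le> B"
proof -
  obtain r where "\<And>x. norm x > r \<Longrightarrow> f x = 0" using test_support[OF assms] by metis
  then show ?thesis
    by (rule bounded_compact_support[OF test_continuous[OF assms]]) (use that in auto)
qed

abbreviation rfourier :: "('a::euclidean_space \<Rightarrow> real) \<Rightarrow> 'a \<Rightarrow> complex" where
  "rfourier f \<equiv> fourier (\<lambda>x. complex_of_real (f x))"

lemma test_integrable_complex: "f \<in> test_functions \<Longrightarrow> integrable lborel (\<lambda>x. complex_of_real (f x))"
  using test_integrable by (simp only: complex_of_real_integrable_eq)

lemma rfourier_lincomb:
  assumes "integrable lborel f" "integrable lborel g"
  shows "rfourier (\<lambda>x. a * f x + c * g x) \<zeta> = a * rfourier f \<zeta> + c * rfourier g \<zeta>"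
proof -
  have "integrable lborel (\<lambda>x. complex_of_real (f x) * cis (2 * pi * (\<zeta> \<bullet> x)))"
    "integrable lborel (\<lambda>x. complex_of_real (g x) * cis (2 * pi * (\<zeta> \<bullet> x)))"
    by (intro integrable_fourier_kernel; simp only: complex_of_real_integrable_eq assms)+
  then show ?thesis unfolding fourier_def by (simp add: distrib_right mult.assoc)
qed

lemma directional_DERIV:
  assumes "smooth f"
  shows "((\<lambda>s. f (x + s *\<^sub>R b)) has_real_derivative partial b f (x + s *\<^sub>R b)) (at s)"
proof -
  let ?f' = "frechet_derivative f (at (x + s *\<^sub>R b))"
  have f': "(f has_derivative ?f') (at (x + s *\<^sub>R b))" by (rule smooth_has_derivative[OF assms])
  have "((\<lambda>s. f (x + s *\<^sub>R b)) has_derivative (\<lambda>h. ?f' (0 + h *\<^sub>R b))) (at s)"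
    by (rule has_derivative_compose[where g=f and f="\<lambda>s. x + s *\<^sub>R b", OF _ f']) (auto intro!: derivative_eq_intros)
  moreover have "(\<lambda>h. ?f' (0 + h *\<^sub>R b)) = times (?f' b)"
    using linear_frechet_derivative[OF smooth_differentiable[OF assms]] by (auto simp: linear_cmul)
  ultimately show ?thesis by (simp add: has_field_derivative_def)
qed

text \<open>Translating \<open>f\<close> multiplies its transform by a character; the identity is
  the derivative of this relation along \<open>b\<close>. The sign is negative because
  \<open>fourier\<close> carries a positive exponent.\<close>

lemma rfourier_partial:
  fixes f :: "'a::euclidean_space \<Rightarrow> real"
  assumes f: "f \<in> test_functions" and b: "b \<in> Basis"
  shows "rfourier (partial b f) \<zeta> = - \<i> * complex_of_real (2 * pi * (\<zeta> \<bullet> b)) * rfourier f \<zeta>"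
proof -
  define h where "h n = 1 / real (Suc n)" for n
  have h: "h n > 0" "h n \<le> 1" for n by (auto simp: h_def)
  have hlim: "filterlim h (at 0) sequentially"
  proof -
    have "h \<longlonglongrightarrow> 0" unfolding h_def by (rule LIMSEQ_Suc[OF lim_1_over_n])
    moreover have "h n \<noteq> 0" for n using h(1)[of n] by simp
    ultimately show ?thesis unfolding filterlim_at by simp
  qed
  have [measurable]: "f \<in> borel_measurable borel" "partial b f \<in> borel_measurable borel"
    using f test_partial[OF f b] by measurable
  let ?c = "\<lambda>x. cis (2 * pi * (\<zeta> \<bullet> x))"
  have fi: "integrable lborel (\<lambda>x. complex_of_real (f x) * ?c x)"
    by (rule integrable_fourier_kernel[OF test_integrable_complex[OF f]])
  define D where "D n x = (f (x + h n *\<^sub>R b) - f x) / h n" for n and x :: 'a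
  obtain r where r: "r > 0" "\<And>x. norm x > r \<Longrightarrow> f x = 0" using test_support[OF f] by metis
  obtain L where L: "L > 0" "\<And>x. \<bar>partial b f x\<bar> \<le> L" using test_bounded[OF test_partial[OF f b]] by metis
  \<comment> \<open>As \<open>h n\<close> is at most 1, the quotients vanish outside the ball of
    radius r + 1; inside it the mean value theorem bounds them by the supremum of the
    derivative.\<close>
  have Dbound: "\<bar>D n x\<bar> \<le> L * indicator (cball 0 (r + 1)) x" for n x
  proof (cases "norm x > r + 1")
    case True
    have "norm x \<le> norm (x + h n *\<^sub>R b) + norm (h n *\<^sub>R b)"
      by (metis add_diff_cancel_right' norm_triangle_ineq4)
    moreover have "norm (h n *\<^sub>R b) \<le> 1" using h[of n] b by simp
    ultimately have "norm (x + h n *\<^sub>R b) > r" using True by simp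
    then show ?thesis using r True by (simp add: D_def)
  next
    case False
    have "\<exists>z. 0 < z \<and> z < h n \<and> f (x + h n *\<^sub>R b) - f (x + 0 *\<^sub>R b) = (h n - 0) * partial b f (x + z *\<^sub>R b)"
      by (rule MVT2[where f="\<lambda>s. f (x + s *\<^sub>R b)"]) (auto simp: h intro: directional_DERIV[OF test_smooth[OF f]])
    then obtain z where "f (x + h n *\<^sub>R b) - f x = h n * partial b f (x + z *\<^sub>R b)" by auto
    then have "D n x = partial b f (x + z *\<^sub>R b)" using h(1)[of n] by (simp add: D_def)
    then show ?thesis using L False by simp
  qed
  have Dlim: "(\<lambda>n. D n x) \<longlonglongrightarrow> partial b f x" for x
  proof -
    have "((\<lambda>h. (f (x + (0 + h) *\<^sub>R b) - f (x + 0 *\<^sub>R b)) / h) \<longlongrightarrow> partial b f (x + 0 *\<^sub>R b)) (at 0)"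
      using directional_DERIV[OF test_smooth[OF f], of x b 0] unfolding DERIV_def .
    from filterlim_compose[OF this hlim] show ?thesis by (simp add: D_def)
  qed
  have L1: "(\<lambda>n. LINT x|lborel. complex_of_real (D n x) * ?c x) \<longlonglongrightarrow> rfourier (partial b f) \<zeta>"
    unfolding fourier_def
  proof (rule integral_dominated_convergence[where w="\<lambda>x. L * indicator (cball 0 (r + 1)) x"])
    show "integrable lborel (\<lambda>x. L * indicator (cball 0 (r + 1)) (x::'a))"
      using emeasure_bounded_finite[OF bounded_cball, of "0::'a" "r + 1"]
      by (intro integrable_mult_right integrable_real_indicator) auto
    show "AE x in lborel. norm (complex_of_real (D n x) * ?c x) \<le> L * indicator (cball 0 (r + 1)) x" for n
      using Dbound by (intro AE_I2) (simp add: norm_mult)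
    show "AE x in lborel. (\<lambda>n. complex_of_real (D n x) * ?c x) \<longlonglongrightarrow> complex_of_real (partial b f x) * ?c x"
      by (intro AE_I2 tendsto_mult tendsto_of_real Dlim tendsto_const)
  qed (auto simp: D_def)
  have eq: "(LINT x|lborel. complex_of_real (D n x) * ?c x) =
    ((cis ((- 2 * pi * (\<zeta> \<bullet> b)) * h n) - 1) / h n) * rfourier f \<zeta>" for n
  proof -
    have sh: "(LINT x|lborel. complex_of_real (f (x + h n *\<^sub>R b)) * ?c x)
      = cis ((- 2 * pi * (\<zeta> \<bullet> b)) * h n) * rfourier f \<zeta>"
    proof -
      have "(LINT x|lborel. complex_of_real (f x) * ?c (x - h n *\<^sub>R b))
        = (LINT x|lborel. complex_of_real (f (h n *\<^sub>R b + 1 *\<^sub>R x)) * ?c ((h n *\<^sub>R b + 1 *\<^sub>R x) - h n *\<^sub>R b))"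
        by (subst integral_lborel_scale_shift[of 1 _ "h n *\<^sub>R b"]) auto
      then have "(LINT x|lborel. complex_of_real (f (x + h n *\<^sub>R b)) * ?c x)
        = (LINT x|lborel. complex_of_real (f x) * ?c (x - h n *\<^sub>R b))"
        by (simp add: add.commute)
      also have "\<dots> = (LINT x|lborel. cis ((- 2 * pi * (\<zeta> \<bullet> b)) * h n) * (complex_of_real (f x) * ?c x))"
        by (intro Bochner_Integration.integral_cong refl) (simp add: cis_mult inner_diff_right algebra_simps)
      finally show ?thesis by (simp add: fourier_def)
    qed
    have i2: "integrable lborel (\<lambda>x. complex_of_real (f (x + h n *\<^sub>R b)) * ?c x)"
    proof (rule integrable_compact_support)
      show "continuous_on UNIV (\<lambda>x. complex_of_real (f (x + h n *\<^sub>R b)) * ?c x)"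
        by (intro continuous_intros continuous_on_compose2[OF test_continuous[OF f, of UNIV]]) auto
      fix x :: 'a assume "norm x > r + h n"
      moreover have "norm x \<le> norm (x + h n *\<^sub>R b) + norm (h n *\<^sub>R b)"
        by (metis add_diff_cancel_right' norm_triangle_ineq4)
      ultimately have "norm (x + h n *\<^sub>R b) > r" using b h[of n] by simp
      then show "complex_of_real (f (x + h n *\<^sub>R b)) * ?c x = 0" using r by simp
    qed
    have "(LINT x|lborel. complex_of_real (D n x) * ?c x)
      = (LINT x|lborel. (1 / complex_of_real (h n)) * (complex_of_real (f (x + h n *\<^sub>R b)) * ?c x - complex_of_real
      (f x) * ?c x))"
      by (intro Bochner_Integration.integral_cong refl) (simp add: D_def field_simps)
    also have "\<dots> = (1 / complex_of_real (h n)) * (cis ((- 2 * pi * (\<zeta> \<bullet> b)) * h n) * rfourier f \<zeta> - rfourier f \<zeta>)"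
      using i2 fi sh by (simp add: fourier_def)
    finally show ?thesis by (simp add: field_simps)
  qed
  have L2: "(\<lambda>n. ((cis ((- 2 * pi * (\<zeta> \<bullet> b)) * h n) - 1) / h n) * rfourier f \<zeta>)
    \<longlonglongrightarrow> (- \<i> * complex_of_real (2 * pi * (\<zeta> \<bullet> b))) * rfourier f \<zeta>"
  proof (intro tendsto_mult tendsto_const)
    let ?k = "- 2 * pi * (\<zeta> \<bullet> b)"
    have "((\<lambda>s. exp (\<i> * complex_of_real ?k * s)) has_field_derivative (\<i> * complex_of_real ?k)) (at 0)"
      by (auto intro!: derivative_eq_intros)
    then have "((\<lambda>s. (exp (\<i> * complex_of_real ?k * (0 + s)) - exp (\<i> * complex_of_real ?k * 0)) / s)
      \<longlongrightarrow> \<i> * complex_of_real ?k) (at 0)"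
      unfolding DERIV_def .
    moreover have "filterlim (\<lambda>n. complex_of_real (h n)) (at 0) sequentially"
      using hlim unfolding filterlim_at by (auto intro: tendsto_of_real[where 'a=complex and a=0, simplified])
    ultimately have "(\<lambda>n. (exp (\<i> * complex_of_real ?k * (0 + complex_of_real (h n)))
      - exp (\<i> * complex_of_real ?k * 0)) / complex_of_real (h n)) \<longlonglongrightarrow> \<i> * complex_of_real ?k"
      by (rule filterlim_compose)
    then show "(\<lambda>n. (cis (?k * h n) - 1) / complex_of_real (h n)) \<longlonglongrightarrow> - \<i> * complex_of_real (2 * pi * (\<zeta> \<bullet> b))"
      by (simp add: cis_conv_exp mult.assoc)
  qed
  show ?thesis by (rule LIMSEQ_unique[OF L1[unfolded eq] L2])
qed

text \<open>Applying 1 minus the second derivative in every coordinate gives a test function whose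
  transform is that of \<open>f\<close> times the product of the factors 1 + (2 pi (\<zeta>
  \<bullet> b))^2. That transform is bounded, and the reciprocal of the product is integrable
  coordinate by coordinate.\<close>

lemma rfourier_test_integrable:
  fixes f :: "'a::euclidean_space \<Rightarrow> real"
  assumes f: "f \<in> test_functions" shows "integrable lborel (rfourier f)"
proof -
  have "\<exists>g\<in>test_functions. \<forall>\<zeta>. complex_of_real (\<Prod>b\<in>S. 1 + (2 * pi * (\<zeta> \<bullet> b))\<^sup>2) * rfourier f \<zeta> = rfourier g \<zeta>"
    if "finite S" "S \<subseteq> Basis" for S
    using that
  proof (induction S rule: finite_induct)
    case empty
    then show ?case using f by auto
  next
    case (insert b S)
    then obtain g where g: "g \<in> test_functions" "\<And>\<zeta>. complex_of_real (\<Prod>b\<in>S. 1 + (2 * pi * (\<zeta> \<bullet> b))\<^sup>2) * rfourier f \<zeta>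
      = rfourier g \<zeta>" by auto
    have b: "b \<in> Basis" using insert by auto
    define g2 where "g2 = partial b (partial b g)"
    have g2: "g2 \<in> test_functions" unfolding g2_def by (intro test_partial g b)
    have "rfourier g2 \<zeta> = - complex_of_real ((2 * pi * (\<zeta> \<bullet> b))\<^sup>2) * rfourier g \<zeta>" for \<zeta>
      unfolding g2_def rfourier_partial[OF test_partial[OF g(1) b] b] rfourier_partial[OF g(1) b]
      by (simp add: power2_eq_square)
    then have "rfourier (\<lambda>x. 1 * g x + (-1) * g2 x) \<zeta> = complex_of_real (1 + (2 * pi * (\<zeta> \<bullet> b))\<^sup>2) * rfourier g \<zeta>"
      for \<zeta>
      by (subst rfourier_lincomb) (auto intro!: test_integrable g g2 simp: distrib_right)
    moreover have "(\<lambda>x. 1 * g x + (-1) * g2 x) \<in> test_functions" by (rule test_lincomb[OF g(1) g2])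
    ultimately show ?case using insert(1,2) g(2)
      by (intro bexI[of _ "\<lambda>x. 1 * g x + (-1) * g2 x"]) (auto simp: mult.assoc)
  qed
  from this[OF finite_Basis subset_refl] obtain g where g: "g \<in> test_functions"
    "\<And>\<zeta>. complex_of_real (\<Prod>b\<in>Basis. 1 + (2 * pi * (\<zeta> \<bullet> b))\<^sup>2) * rfourier f \<zeta> = rfourier g \<zeta>" by auto
  let ?k = "\<lambda>\<zeta>::'a. \<Prod>b\<in>Basis. complex_of_real (inverse (1 + (2 * pi * (\<zeta> \<bullet> b))\<^sup>2))"
  have pos: "(\<Prod>b\<in>Basis. 1 + (2 * pi * (\<zeta> \<bullet> b))\<^sup>2) > 0" for \<zeta> :: 'a
    by (intro prod_pos ballI add_pos_nonneg) auto
  have "integrable lborel (\<lambda>s::real. inverse (1 + s\<^sup>2))"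
    using integrable_inverse_1_plus_square by (simp add: set_integrable_def)
  from lborel_integrable_real_affine[OF this, of "2 * pi" 0]
  have "integrable lborel (\<lambda>s::real. complex_of_real (inverse (1 + (2 * pi * s)\<^sup>2)))"
    by (simp only: complex_of_real_integrable_eq) simp
  then have k: "integrable lborel ?k"
    by (rule integrable_lborel_prod)
  have "integrable lborel (\<lambda>\<zeta>. ?k \<zeta> * rfourier g \<zeta>)"
    by (rule integrable_mult_bounded[OF k _ norm_fourier_le])
       (use measurable_fourier[OF test_integrable_complex[OF g(1)]] in simp)
  moreover have "?k \<zeta> * rfourier g \<zeta> = rfourier f \<zeta>" for \<zeta>
  proof -
    have "?k \<zeta> = complex_of_real (inverse (\<Prod>b\<in>Basis. 1 + (2 * pi * (\<zeta> \<bullet> b))\<^sup>2))"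
      by (simp only: of_real_prod[symmetric] prod_inversef[unfolded o_def])
    then have "?k \<zeta> * rfourier g \<zeta> = complex_of_real (inverse (\<Prod>b\<in>Basis. 1 + (2 * pi * (\<zeta> \<bullet> b))\<^sup>2)
      * (\<Prod>b\<in>Basis. 1 + (2 * pi * (\<zeta> \<bullet> b))\<^sup>2)) * rfourier f \<zeta>"
      unfolding g(2)[symmetric] by (simp only: of_real_mult mult.assoc)
    moreover have "inverse (\<Prod>b\<in>Basis. 1 + (2 * pi * (\<zeta> \<bullet> b))\<^sup>2) * (\<Prod>b\<in>Basis. 1 + (2 * pi * (\<zeta> \<bullet> b))\<^sup>2) = 1"
      by (rule left_inverse) (use pos[of \<zeta>] in \<open>rule less_imp_neq[symmetric]\<close>)
    ultimately show ?thesis by simp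
  qed
  ultimately show ?thesis by simp
qed


section \<open>Correlation of a test function with a compactly supported kernel\<close>

lemma frechet_derivative_eq_sum_partial:
  fixes f :: "'a::euclidean_space \<Rightarrow> real"
  assumes "smooth f"
  shows "frechet_derivative f (at x) v = (\<Sum>b\<in>Basis. (v \<bullet> b) * partial b f x)"
proof -
  have l: "linear (frechet_derivative f (at x))"
    using linear_frechet_derivative[OF smooth_differentiable[OF assms]] .
  have "frechet_derivative f (at x) v = frechet_derivative f (at x) (\<Sum>b\<in>Basis. (v \<bullet> b) *\<^sub>R b)"
    by (simp add: euclidean_representation)
  also have "\<dots> = (\<Sum>b\<in>Basis. (v \<bullet> b) * partial b f x)"
    by (subst linear_sum[OF l]) (simp add: linear_cmul[OF l])
  finally show ?thesis .
qed

text \<open>The expression is a correlation because the pairing of h * \<psi> with \<open>f\<close>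
  is \<open>h\<close> applied to the map that sends w to the integral of f (w + u) \<psi> u over u.
  All derivatives fall on \<open>f\<close>, so \<psi> need only be continuous.\<close>

lemma convolution_has_derivative:
  fixes f \<psi> :: "'a::euclidean_space \<Rightarrow> real"
  assumes f: "f \<in> test_functions" and \<psi>: "continuous_on UNIV \<psi>" and r: "\<And>x. norm x > r \<Longrightarrow> \<psi> x = 0"
  shows "\<exists>D. ((\<lambda>w. LINT u|lborel. f (w + u) * \<psi> u) has_derivative D) (at w) \<and>
    (\<forall>b\<in>Basis. D b = (LINT u|lborel. partial b f (w + u) * \<psi> u))"
proof -
  obtain c d where cd: "cball (0::'a) r \<subseteq> cbox c d"
    using bounded_subset_cbox_symmetric[OF bounded_cball, of 0 r] by metis
  have eq: "(LINT u|lborel. g (w + u) * \<psi> u) = integral (cbox c d) (\<lambda>u. g (w + u) * \<psi> u)"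
    if g: "continuous_on UNIV g" for g :: "'a \<Rightarrow> real" and w
  proof -
    have cont: "continuous_on UNIV (\<lambda>u. g (w + u) * \<psi> u)"
      by (intro continuous_intros continuous_on_compose2[OF g] \<psi>) auto
    have "integrable lborel (\<lambda>u. g (w + u) * \<psi> u)"
      by (rule integrable_compact_support[OF cont, of r]) (simp add: r)
    then have "(LINT u|lborel. g (w + u) * \<psi> u) = integral UNIV (\<lambda>u. g (w + u) * \<psi> u)"
      by (rule integral_lborel[symmetric])
    also have "\<dots> = integral (cbox c d) (\<lambda>u. g (w + u) * \<psi> u)"
    proof (rule integral_spike_set)
      have e: "{x \<in> UNIV - cbox c d. g (w + x) * \<psi> x \<noteq> 0} = {}"
        using cd r by (force simp: subset_iff not_le)
      show "negligible {x \<in> UNIV - cbox c d. g (w + x) * \<psi> x \<noteq> 0}" unfolding e by (rule negligible_empty)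
      show "negligible {x \<in> cbox c d - UNIV. g (w + x) * \<psi> x \<noteq> 0}" by simp
    qed
    finally show ?thesis .
  qed
  \<comment> \<open>The Leibniz rule on a box wants a jointly continuous derivative with values in
    bounded linear maps; written in coordinates, joint continuity reduces to that of the partial
    derivatives.\<close>
  define fx where "fx = (\<lambda>w u. \<Sum>b\<in>Basis. (partial b f (w + u) * \<psi> u) *\<^sub>R blinfun_inner_left b)"
  have fx: "blinfun_apply (fx w u) v = frechet_derivative f (at (w + u)) v * \<psi> u" for w u v
    by (subst frechet_derivative_eq_sum_partial[OF test_smooth[OF f]])
       (simp add: fx_def blinfun.sum_left blinfun.scaleR_left sum_distrib_left mult_ac)
  have contp: "continuous_on UNIV (partial b f)" if "b \<in> Basis" for b
    by (rule test_continuous[OF test_partial[OF f that]])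
  have contfx: "continuous_on (UNIV \<times> cbox c d) (\<lambda>(w, u). fx w u)"
    unfolding fx_def case_prod_beta'
    by (intro continuous_intros continuous_on_compose2[OF contp] continuous_on_compose2[OF \<psi>]) auto
  have D: "((\<lambda>w. integral (cbox c d) (\<lambda>u. f (w + u) * \<psi> u)) has_derivative blinfun_apply (integral (cbox c d) (fx w)))
    (at w within UNIV)"
  proof (rule leibniz_rule[OF _ _ contfx])
    fix w u
    have "(f has_derivative frechet_derivative f (at (w + u))) (at (w + u))"
      by (rule smooth_has_derivative[OF test_smooth[OF f]])
    then have "((\<lambda>w. f (w + u)) has_derivative (\<lambda>h. frechet_derivative f (at (w + u)) h)) (at w)"
      by (rule has_derivative_compose[where f="\<lambda>w. w + u", rotated]) (auto intro!: derivative_eq_intros)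
    then have "((\<lambda>w. f (w + u) * \<psi> u) has_derivative (\<lambda>h. frechet_derivative f (at (w + u)) h * \<psi> u)) (at w)"
      by (rule has_derivative_mult_left)
    then show "((\<lambda>w. f (w + u) * \<psi> u) has_derivative blinfun_apply (fx w u)) (at w within UNIV)"
      by (simp add: fx[abs_def])
  next
    fix w show "(\<lambda>u. f (w + u) * \<psi> u) integrable_on cbox c d"
      by (intro integrable_continuous continuous_intros continuous_on_compose2[OF test_continuous[OF f, of UNIV]]
        continuous_on_subset[OF \<psi>]) auto
  qed auto
  have Db: "blinfun_apply (integral (cbox c d) (fx w)) b = (LINT u|lborel. partial b f (w + u) * \<psi> u)"
    if b: "b \<in> Basis" for b
  proof -
    have "fx w integrable_on cbox c d"
    proof (rule integrable_continuous)
      show "continuous_on (cbox c d) (fx w)"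
      proof -
        have "continuous_on (cbox c d) (\<lambda>u. (\<lambda>(w, u). fx w u) (w, u))"
          by (rule continuous_on_compose2[OF contfx]) (auto intro!: continuous_intros)
        then show ?thesis by simp
      qed
    qed
    from integral_linear[OF this, of "\<lambda>L. blinfun_apply L b"]
    have "blinfun_apply (integral (cbox c d) (fx w)) b = integral (cbox c d) (\<lambda>u. partial b f (w + u) * \<psi> u)"
      by (simp add: o_def fx bounded_linear_intros)
    then show ?thesis unfolding eq[OF contp[OF b]] .
  qed
  show ?thesis
    using D Db unfolding eq[OF test_continuous[OF f, of UNIV]] by auto
qed

text \<open>The correlations with a fixed \<psi> form a class closed under partial derivatives,
  since each derivative passes to \<open>f\<close>; this is the setting of
  \<open>smooth_class\<close>.\<close>

lemma convolution_test:
  fixes f \<psi> :: "'a::euclidean_space \<Rightarrow> real"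
  assumes f: "f \<in> test_functions" and \<psi>: "continuous_on UNIV \<psi>" and r: "\<And>x. norm x > r \<Longrightarrow> \<psi> x = 0"
  shows "(\<lambda>w. LINT u|lborel. f (w + u) * \<psi> u) \<in> test_functions"
proof -
  let ?C = "\<lambda>f w. LINT u|lborel. f (w + u) * \<psi> u"
  have "smooth (?C f)"
  proof (rule smooth_class[where S="?C ` test_functions"])
    fix g x assume "g \<in> ?C ` test_functions"
    then obtain f where f: "f \<in> test_functions" "g = ?C f" by auto
    show "g differentiable (at x)"
      unfolding f(2) differentiable_def using convolution_has_derivative[OF f(1) \<psi> r, of r x] by auto
    fix b :: 'a assume b: "b \<in> Basis"
    have "partial b g = ?C (partial b f)"
    proof
      fix x
      obtain D where D: "(?C f has_derivative D) (at x)" "\<forall>b\<in>Basis. D b = ?C (partial b f) x"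
        using convolution_has_derivative[OF f(1) \<psi> r, of r x] by auto
      then show "partial b g x = ?C (partial b f) x"
        using partial_eqI[OF D(1)] b unfolding f(2) by auto
    qed
    then show "partial b g \<in> ?C ` test_functions" by (rule image_eqI[OF _ test_partial[OF f(1) b]])
  qed (use f in auto)
  moreover obtain s where s: "\<And>x. norm x > s \<Longrightarrow> f x = 0" using test_support[OF f] by metis
  have "?C f w = 0" if "norm w > s + r" for w
  proof -
    have "f (w + u) * \<psi> u = 0" for u
    proof (cases "norm u > r")
      case False
      have "norm w \<le> norm (w + u) + norm u" by (metis add_diff_cancel_right' norm_triangle_ineq4)
      then show ?thesis using s[of "w + u"] False that by simp
    qed (simp add: r)
    then have "(\<lambda>u. f (w + u) * \<psi> u) = (\<lambda>_. 0)" by (rule ext)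
    then show ?thesis by simp
  qed
  ultimately show ?thesis unfolding test_functions_iff by blast
qed

section \<open>Flat functions and smooth bumps\<close>

lemma power_over_fact_le_exp:
  fixes x :: real assumes "x \<ge> 0" shows "x ^ n / fact n \<le> exp x"
proof -
  have "(\<lambda>n. x ^ n / fact n) sums exp x"
    using exp_converges[of x] by (simp add: divide_inverse mult.commute)
  then have "summable (\<lambda>n. x ^ n / fact n)" "(\<Sum>n. x ^ n / fact n) = exp x"
    by (auto simp: sums_iff)
  with sum_le_suminf[of "\<lambda>n. x ^ n / fact n" "{n}"] assms show ?thesis by simp
qed

text \<open>The classical smooth function exp (- 1 / s) is the case k = 0. The negative powers of s
  are included so that derivatives stay in the span of the family.\<close>

definition flat :: "nat \<Rightarrow> real \<Rightarrow> real" where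
  "flat k s = (if s > 0 then exp (- 1 / s) / s ^ k else 0)"

text \<open>One term of the exponential series at 1 / s beats the power of s in the denominator with
  two powers to spare. The quadratic bound makes the derivative at 0 exist and vanish in
  \<open>flat_DERIV\<close>.\<close>

lemma flat_le: "0 \<le> flat k s" "flat k s \<le> fact (k + 2) * s\<^sup>2"
proof -
  show "flat k s \<le> fact (k + 2) * s\<^sup>2"
  proof (cases "s > 0")
    case True
    have "(1 / s) ^ (k + 2) / fact (k + 2) \<le> exp (1 / s)"
      by (rule power_over_fact_le_exp) (use True in simp)
    then have "exp (- 1 / s) * ((1 / s) ^ (k + 2) / fact (k + 2)) \<le> exp (- 1 / s) * exp (1 / s)"
      by (intro mult_left_mono) auto
    also have "\<dots> = 1" by (simp add: exp_minus)
    finally have "exp (- 1 / s) * ((1 / s) ^ (k + 2) / fact (k + 2)) * (fact (k + 2) * s\<^sup>2) \<le> 1 * (fact (k + 2) * s\<^sup>2)"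
      by (rule mult_right_mono) auto
    moreover have "exp (- 1 / s) * ((1 / s) ^ (k + 2) / fact (k + 2)) * (fact (k + 2) * s\<^sup>2) = flat k s"
      using True by (simp add: flat_def power_divide power_add power2_eq_square del: fact_Suc)
    ultimately show ?thesis by simp
  qed (simp add: flat_def)
qed (simp add: flat_def)

lemma flat_DERIV: "(flat k has_real_derivative (flat (k + 2) s - k * flat (k + 1) s)) (at s)"
proof -
  consider "s > 0" | "s < 0" | "s = 0" by linarith
  then show ?thesis
  proof cases
    case 1
    have "((\<lambda>s. exp (- 1 / s) / s ^ k) has_real_derivative (flat (k + 2) s - k * flat (k + 1) s)) (at s)"
      using 1 by (auto intro!: derivative_eq_intros simp: flat_def field_simps power2_eq_square power_add
        power_Suc[symmetric] simp del: power_Suc)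
         (cases k; simp add: field_simps)
    then show ?thesis
      by (rule has_field_derivative_transform_within_open[where S="{0<..}"]) (use 1 in \<open>auto simp: flat_def\<close>)
  next
    case 2
    have "((\<lambda>s. 0) has_real_derivative (flat (k + 2) s - k * flat (k + 1) s)) (at s)"
      using 2 by (simp add: flat_def)
    then show ?thesis
      by (rule has_field_derivative_transform_within_open[where S="{..<0}"]) (use 2 in \<open>auto simp: flat_def\<close>)
  next
    case 3
    have "((\<lambda>h. (flat k (0 + h) - flat k 0) / h) \<longlongrightarrow> 0) (at 0)"
    proof (rule Lim_null_comparison)
      show "\<forall>\<^sub>F h in at 0. norm ((flat k (0 + h) - flat k 0) / h) \<le> fact (k + 2) * \<bar>h\<bar>"
        unfolding eventually_at_filter
      proof (intro always_eventually allI impI)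
        fix h :: real assume "h \<noteq> 0"
        have "\<bar>flat k h\<bar> / \<bar>h\<bar> \<le> (fact (k + 2) * h\<^sup>2) / \<bar>h\<bar>"
          using flat_le[of k h] by (intro divide_right_mono) auto
        also have "\<dots> = fact (k + 2) * \<bar>h\<bar>"
          using \<open>h \<noteq> 0\<close> by (simp add: power2_eq_square abs_if)
        finally show "norm ((flat k (0 + h) - flat k 0) / h) \<le> fact (k + 2) * \<bar>h\<bar>"
          by (simp add: flat_def)
      qed
      show "((\<lambda>h::real. fact (k + 2) * \<bar>h\<bar>) \<longlongrightarrow> 0) (at 0)"
        by (auto intro!: tendsto_eq_intros)
    qed
    then show ?thesis using 3 by (simp add: DERIV_def flat_def)
  qed
qed

lemma flat_pos: "flat k s > 0 \<longleftrightarrow> s > 0"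
  by (simp add: flat_def)

text \<open>The smooth step g (2 - u) / (g (2 - u) + g (u - 1)) for g = \<open>flat 0\<close>,
  evaluated at u = n^2 |x - y|^2: it is 1 up to u = 1 and 0 from u = 2 on. So \<open>n\<close> is an
  inverse radius, and the squared norm avoids a singularity at the centre.\<close>

definition bump :: "real \<Rightarrow> 'a::euclidean_space \<Rightarrow> 'a \<Rightarrow> real" where
  "bump n y x = flat 0 (2 - n\<^sup>2 * (norm (x - y))\<^sup>2) *
     inverse (flat 0 (2 - n\<^sup>2 * (norm (x - y))\<^sup>2) + flat 0 (n\<^sup>2 * (norm (x - y))\<^sup>2 - 1))"

text \<open>Built to satisfy \<open>smooth_class\<close>: differentiating a flat factor raises its
  index and produces a coordinate of x, and the reciprocal satisfies (1 / q)' = - q' / q^2, so it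
  reproduces itself. Coordinates and constants are generators for this reason.\<close>

inductive_set bump_class :: "real \<Rightarrow> 'a::euclidean_space \<Rightarrow> ('a \<Rightarrow> real) set" for n :: real and y :: 'a where
  const: "(\<lambda>_. c) \<in> bump_class n y"
| coord: "(\<lambda>x. x \<bullet> b) \<in> bump_class n y"
| inner: "(\<lambda>x. flat k (2 - n\<^sup>2 * (norm (x - y))\<^sup>2)) \<in> bump_class n y"
| outer: "(\<lambda>x. flat k (n\<^sup>2 * (norm (x - y))\<^sup>2 - 1)) \<in> bump_class n y"
| inv: "(\<lambda>x. inverse (flat 0 (2 - n\<^sup>2 * (norm (x - y))\<^sup>2) + flat 0 (n\<^sup>2 * (norm (x - y))\<^sup>2 - 1))) \<in> bump_class n y"
| add: "f \<in> bump_class n y \<Longrightarrow> g \<in> bump_class n y \<Longrightarrow> (\<lambda>x. f x + g x) \<in> bump_class n y"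
| mult: "f \<in> bump_class n y \<Longrightarrow> g \<in> bump_class n y \<Longrightarrow> (\<lambda>x. f x * g x) \<in> bump_class n y"

lemma bump_denominator_pos: "flat 0 (2 - s) + flat 0 (s - 1) > 0"
proof -
  have "2 - s > 0 \<or> s - 1 > 0" by linarith
  then show ?thesis using flat_pos[of 0 "2 - s"] flat_pos[of 0 "s - 1"] flat_le(1)[of 0 "2 - s"] flat_le(1)[of 0 "s
    - 1"]
    by linarith
qed

lemma bump_class_derivative:
  fixes y :: "'a::euclidean_space"
  assumes "f \<in> bump_class n y"
  shows "\<exists>D. (\<forall>x. (f has_derivative D x) (at x)) \<and> (\<forall>b\<in>Basis. (\<lambda>x. D x b) \<in> bump_class n y)"
proof -
  let ?u = "\<lambda>x. n\<^sup>2 * (norm (x - y))\<^sup>2"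
  have du: "(?u has_derivative (\<lambda>v. 2 * n\<^sup>2 * ((x - y) \<bullet> v))) (at x)" for x
    unfolding power2_norm_eq_inner by (auto intro!: derivative_eq_intros simp: inner_commute)
  have ub: "(\<lambda>x. 2 * n\<^sup>2 * ((x - y) \<bullet> b)) \<in> bump_class n y" for b
  proof -
    have "(\<lambda>x. (2 * n\<^sup>2) * (x \<bullet> b + - (y \<bullet> b))) \<in> bump_class n y" by (intro bump_class.intros)
    then show ?thesis by (simp add: inner_diff_left)
  qed
  have dflat: "(\<lambda>x. flat (k + 2) (v x) + (- real k) * flat (k + 1) (v x)) \<in> bump_class n y"
    if "v = (\<lambda>x. 2 - ?u x) \<or> v = (\<lambda>x. ?u x - 1)" for k v
    using that by (elim disjE) (simp_all only:, (intro bump_class.intros)+)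
  have chain: "((\<lambda>x. flat k (v x)) has_derivative (\<lambda>h. (flat (k + 2) (v x) + (- real k) * flat (k + 1) (v x)) * v' h))
    (at x)"
    if "(v has_derivative v') (at x)" for v v' k and x :: 'a
    using has_derivative_compose[OF that, of "flat k", OF flat_DERIV[unfolded has_field_derivative_def]] by simp
  have din: "((\<lambda>x. 2 - ?u x) has_derivative (\<lambda>v. (-1) * (2 * n\<^sup>2 * ((x - y) \<bullet> v)))) (at x)" for x
    using has_derivative_diff[OF has_derivative_const[of 2] du] by simp
  have dout: "((\<lambda>x. ?u x - 1) has_derivative (\<lambda>v. 2 * n\<^sup>2 * ((x - y) \<bullet> v))) (at x)" for x
    using has_derivative_diff[OF du has_derivative_const[of 1]] by simp
  note C = bump_class.intros
  show ?thesis using assms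
  proof induction
    case (const c)
    show ?case by (intro exI[of _ "\<lambda>_ _. 0"]) (auto intro: bump_class.const)
  next
    case (coord b)
    show ?case by (intro exI[of _ "\<lambda>_ v. v \<bullet> b"]) (auto intro!: bump_class.const derivative_eq_intros)
  next
    case (inner k)
    show ?case
      by (intro exI[of _ "\<lambda>x h. (flat (k + 2) (2 - ?u x) + (- real k) * flat (k + 1) (2 - ?u x))
        * ((-1) * (2 * n\<^sup>2 * ((x - y) \<bullet> h)))"] conjI allI ballI chain din C(7) C(1) dflat ub) simp
  next
    case (outer k)
    show ?case
      by (intro exI[of _ "\<lambda>x h. (flat (k + 2) (?u x - 1) + (- real k) * flat (k + 1) (?u x - 1))
        * (2 * n\<^sup>2 * ((x - y) \<bullet> h))"] conjI allI ballI chain dout C(7) C(1) dflat ub) simp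
  next
    case inv
    let ?q = "\<lambda>x. flat 0 (2 - ?u x) + flat 0 (?u x - 1)"
    let ?q' = "\<lambda>x h. (flat (0 + 2) (2 - ?u x) + (- real 0) * flat (0 + 1) (2 - ?u x))
      * ((-1) * (2 * n\<^sup>2 * ((x - y) \<bullet> h))) +
       (flat (0 + 2) (?u x - 1) + (- real 0) * flat (0 + 1) (?u x - 1)) * (2 * n\<^sup>2 * ((x - y) \<bullet> h))"
    have "(?q has_derivative ?q' x) (at x)" for x by (intro has_derivative_add chain din dout)
    moreover have "?q x \<noteq> 0" for x using bump_denominator_pos[of "?u x"] by simp
    ultimately have "((\<lambda>x. inverse (?q x)) has_derivative (\<lambda>h. - (inverse (?q x) * ?q' x h * inverse (?q x)))) (at x)"
      for x
      by (intro Deriv.has_derivative_inverse)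
    then have "((\<lambda>x. inverse (?q x)) has_derivative (\<lambda>h. (-1) * (inverse (?q x) * ?q' x h * inverse (?q x)))) (at x)"
      for x
      by simp
    moreover have "(\<lambda>x. (-1) * (inverse (?q x) * ?q' x b * inverse (?q x))) \<in> bump_class n y" for b
      by (intro C(7) C(6) C(1) C(5) dflat ub) simp_all
    ultimately show ?case by (intro exI[of _ "\<lambda>x h. (-1) * (inverse (?q x) * ?q' x h * inverse (?q x))"]) blast
  next
    case (add f g)
    then obtain D E where "\<forall>x. (f has_derivative D x) (at x)" "\<forall>b\<in>Basis. (\<lambda>x. D x b) \<in> bump_class n y"
      "\<forall>x. (g has_derivative E x) (at x)" "\<forall>b\<in>Basis. (\<lambda>x. E x b) \<in> bump_class n y" by blast
    then show ?case by (intro exI[of _ "\<lambda>x h. D x h + E x h"] conjI allI ballI has_derivative_add C(6)) auto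
  next
    case (mult f g)
    then obtain D E where "\<forall>x. (f has_derivative D x) (at x)" "\<forall>b\<in>Basis. (\<lambda>x. D x b) \<in> bump_class n y"
      "\<forall>x. (g has_derivative E x) (at x)" "\<forall>b\<in>Basis. (\<lambda>x. E x b) \<in> bump_class n y" by blast
    with mult.hyps show ?case by (intro exI[of _ "\<lambda>x h. f x * E x h + D x h
      * g x"] conjI allI ballI has_derivative_mult C(6) C(7)) auto
  qed
qed

lemma bump_class_smooth: "f \<in> bump_class n y \<Longrightarrow> smooth f"
proof (rule smooth_class[where S="bump_class n y"])
  fix f x assume "f \<in> bump_class n y"
  then obtain D where D: "\<forall>x. (f has_derivative D x) (at x)" "\<forall>b\<in>Basis. (\<lambda>x. D x b) \<in> bump_class n y"
    using bump_class_derivative by blast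
  then show "f differentiable (at x)" unfolding differentiable_def by blast
  fix b :: 'a assume "b \<in> Basis"
  moreover have "partial b f = (\<lambda>x. D x b)" using D(1) partial_eqI by blast
  ultimately show "partial b f \<in> bump_class n y" using D(2) by simp
qed

lemma bump_test:
  assumes "n > 0" shows "bump n y \<in> test_functions"
proof -
  have "smooth (bump n y)"
    unfolding bump_def[abs_def] by (intro bump_class_smooth[where n=n and y=y] bump_class.intros)
  \<comment> \<open>The radius 2 / n is a convenient enlargement of sqrt 2 / n.\<close>
  moreover have "bump n y x = 0" if "norm x > norm y + 2 / n" for x
  proof -
    have "norm x \<le> norm (x - y) + norm y" by (metis diff_add_cancel norm_triangle_ineq)
    with that have "norm (x - y) > 2 / n" by simp
    then have "n * norm (x - y) > 2" using assms by (simp add: field_simps)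
    then have "(n * norm (x - y))\<^sup>2 > 2\<^sup>2" by (intro power_strict_mono) auto
    then have "\<not> 2 - n\<^sup>2 * (norm (x - y))\<^sup>2 > 0" by (simp add: power_mult_distrib)
    then show ?thesis by (simp add: bump_def flat_def)
  qed
  ultimately show ?thesis unfolding test_functions_iff by blast
qed

lemma bump_nonneg: "bump n y x \<ge> 0"
  unfolding bump_def using flat_le(1) by (intro mult_nonneg_nonneg) (auto intro: add_nonneg_nonneg)

lemma bump_eq_1: "n * norm (x - y) \<le> 1 \<Longrightarrow> n > 0 \<Longrightarrow> bump n y x = 1"
proof -
  assume "n * norm (x - y) \<le> 1" "n > 0"
  then have "(n * norm (x - y))\<^sup>2 \<le> 1\<^sup>2" by (intro power_mono) auto
  then have u: "n\<^sup>2 * (norm (x - y))\<^sup>2 \<le> 1" by (simp add: power_mult_distrib)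
  then have "flat 0 (n\<^sup>2 * (norm (x - y))\<^sup>2 - 1) = 0" by (simp add: flat_def)
  moreover have "flat 0 (2 - n\<^sup>2 * (norm (x - y))\<^sup>2) > 0" using u by (simp add: flat_pos)
  ultimately show ?thesis by (simp add: bump_def)
qed

lemma bump_scale: "n > 0 \<Longrightarrow> bump n y (y + (1 / n) *\<^sub>R u) = bump 1 0 u"
  by (simp add: bump_def power_divide)

lemma bump_cutoff: "bump 1 0 \<in> cutoffs"
proof -
  have "bump 1 0 x = 1" if "x \<in> ball 0 1" for x :: 'a
    using bump_eq_1[of 1 x 0] that by simp
  then show ?thesis
    unfolding cutoffs_def using bump_test[of 1 0] by (auto intro!: exI[of _ 1])
qed

section \<open>The spectral form of the logarithmic energy\<close>

text \<open>The antiderivative exp (- u / s) / u, continued by 0 to s \<le> 0 as a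
  \<open>flat\<close> function, is differentiable at 0 as well, so the fundamental theorem of
  calculus applies on the closed half-line.\<close>

lemma nn_integral_exp_inverse:
  fixes u :: real assumes u: "u > 0"
  shows "(\<integral>\<^sup>+s. ennreal (indicator {0<..} s * (exp (- u / s) / s\<^sup>2)) \<partial>lborel) = ennreal (1 / u)"
proof -
  have "(\<integral>\<^sup>+s. ennreal (flat 2 (s / u) / u\<^sup>2) * indicator {0..} s \<partial>lborel) = ennreal (1 / u - flat 0 (0 / u) / u)"
  proof (rule nn_integral_FTC_atLeast)
    have "flat 2 = (\<lambda>s. indicator {0<..} s * (exp (- 1 / s) / s\<^sup>2))"
      by (auto simp: flat_def fun_eq_iff)
    then have [measurable]: "flat 2 \<in> borel_measurable borel" by simp
    show "(\<lambda>s. flat 2 (s / u) / u\<^sup>2) \<in> borel_measurable borel" by measurable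
    show "((\<lambda>s. flat 0 (s / u) / u) has_real_derivative flat 2 (s / u) / u\<^sup>2) (at s)" if "0 \<le> s" for s
      using u by (auto intro!: derivative_eq_intros DERIV_chain2[OF flat_DERIV[of 0]] simp: power2_eq_square
        numeral_2_eq_2)
    show "0 \<le> flat 2 (s / u) / u\<^sup>2" for s using flat_le(1) by simp
    have "((\<lambda>s. exp (- u / s) / u) \<longlongrightarrow> exp 0 / u) at_top"
      by (intro tendsto_intros tendsto_divide_0[OF tendsto_const] filterlim_at_top_imp_at_infinity filterlim_ident)
        (use u in auto)
    then have lim: "((\<lambda>s. exp (- u / s) / u) \<longlongrightarrow> 1 / u) at_top" by simp
    have ev: "\<forall>\<^sub>F s in at_top. flat 0 (s / u) / u = exp (- u / s) / u"
      using eventually_gt_at_top[of 0] by eventually_elim (use u in \<open>simp add: flat_def field_simps\<close>)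
    show "((\<lambda>s. flat 0 (s / u) / u) \<longlongrightarrow> 1 / u) at_top"
      by (rule iffD2[OF tendsto_cong[OF ev] lim])
  qed
  also have "(\<lambda>s. ennreal (flat 2 (s / u) / u\<^sup>2) * indicator {0..} s)
    = (\<lambda>s. ennreal (indicator {0<..} s * (exp (- u / s) / s\<^sup>2)))"
    using u by (auto simp: flat_def fun_eq_iff indicator_def field_simps power2_eq_square)
  finally show ?thesis by (simp add: flat_def)
qed

text \<open>The difference of exponentials divided by s is the integral of exp (- u / s) / s^2 over
  u between a and b; integrating in s first leaves 1 / u. Replacing s by 1 / s gives the usual
  Frullani integral.\<close>

lemma nn_integral_frullani:
  fixes a b :: real assumes a: "0 < a" "a \<le> b"
  shows "(\<integral>\<^sup>+s. ennreal (indicator {0<..} s * ((exp (- a / s) - exp (- b / s)) / s)) \<partial>lborel) = ennreal (ln (b / a))"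
proof -
  have "(\<integral>\<^sup>+s. ennreal (indicator {0<..} s * ((exp (- a / s) - exp (- b / s)) / s)) \<partial>lborel) =
    (\<integral>\<^sup>+s. \<integral>\<^sup>+u. ennreal (indicator {0<..} s * (exp (- u / s) / s\<^sup>2)) * indicator {a..b} u \<partial>lborel \<partial>lborel)"
  proof (intro nn_integral_cong)
    fix s :: real
    show "ennreal (indicator {0<..} s * ((exp (- a / s) - exp (- b / s)) / s))
      = (\<integral>\<^sup>+u. ennreal (indicator {0<..} s * (exp (- u / s) / s\<^sup>2)) * indicator {a..b} u \<partial>lborel)"
    proof (cases "s > 0")
      case True
      have "(\<integral>\<^sup>+u. ennreal (exp (- u / s) / s\<^sup>2) * indicator {a..b} u \<partial>lborel)
        = ennreal ((- exp (- b / s) / s) - (- exp (- a / s) / s))"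
        using a True
        by (intro nn_integral_FTC_Icc) (auto intro!: derivative_eq_intros simp: power2_eq_square)
      then show ?thesis using True by (simp add: diff_divide_distrib)
    qed simp
  qed
  also have "\<dots> = (\<integral>\<^sup>+u. \<integral>\<^sup>+s. ennreal (indicator {0<..} s * (exp (- u / s) / s\<^sup>2)) * indicator {a..b} u \<partial>lborel \<partial>lborel)"
    by (rule lborel_pair.Fubini') measurable
  also have "\<dots> = (\<integral>\<^sup>+u. ennreal (1 / u) * indicator {a..b} u \<partial>lborel)"
  proof (intro nn_integral_cong)
    fix u :: real
    show "(\<integral>\<^sup>+s. ennreal (indicator {0<..} s * (exp (- u / s) / s\<^sup>2)) * indicator {a..b} u \<partial>lborel)
      = ennreal (1 / u) * indicator {a..b} u"
      using a nn_integral_exp_inverse[of u] by (auto simp: indicator_def)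
  qed
  also have "\<dots> = ennreal (ln b - ln a)"
    using a by (intro nn_integral_FTC_Icc) (auto intro!: derivative_eq_intros simp: divide_inverse)
  finally show ?thesis using a by (simp add: ln_div)
qed

text \<open>Frullani at the values r^2 and 1, hence the factor 2. For fixed r the integrand has one
  sign, decided by r \<le> 1, so its absolute integral is explicit too; that is the bound which
  justifies Fubini in \<open>log_energy\<close>.\<close>

lemma frullani_log:
  fixes r :: real assumes r: "r > 0"
  defines "K \<equiv> \<lambda>s. indicator {0<..} s * ((exp (- r\<^sup>2 / s) - exp (- 1 / s)) / s)"
  shows "integrable lborel K" "(LINT s|lborel. K s) = 2 * ln (1 / r)"
    "(LINT s|lborel. \<bar>K s\<bar>) = 2 * \<bar>ln r\<bar>"
proof -
  have m: "K \<in> borel_measurable lborel" unfolding K_def by simp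
  have "integrable lborel K \<and> (LINT s|lborel. K s) = 2 * ln (1 / r) \<and> (LINT s|lborel. \<bar>K s\<bar>) = 2 * \<bar>ln r\<bar>"
  proof (cases "r \<le> 1")
    case True
    have pos: "K s \<ge> 0" for s
      unfolding K_def using power_mono[OF True, of 2] r
        by (auto simp: indicator_def intro!: divide_right_mono divide_nonneg_pos)
    have "(\<integral>\<^sup>+s. ennreal (K s) \<partial>lborel) = ennreal (ln (1 / r\<^sup>2))"
      unfolding K_def using nn_integral_frullani[of "r\<^sup>2" 1] r power_mono[OF True, of 2] by simp
    moreover have "ln (1 / r\<^sup>2) = 2 * ln (1 / r)" using r by (simp add: ln_div ln_realpow)
    moreover have "2 * ln (1 / r) = 2 * \<bar>ln r\<bar>" using r True by (simp add: ln_div)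
    ultimately have n: "(\<integral>\<^sup>+s. ennreal (K s) \<partial>lborel) = ennreal (2 * \<bar>ln r\<bar>)" and e: "2 * ln (1 / r) = 2 * \<bar>ln r\<bar>"
      by simp_all
    have "has_bochner_integral lborel K (2 * \<bar>ln r\<bar>)"
      by (rule has_bochner_integral_nn_integral[OF m _ _ n]) (use pos in auto)
    then show ?thesis using pos e by (auto simp: has_bochner_integral_iff abs_of_nonneg[OF pos])
  next
    case False
    have pos: "- K s \<ge> 0" for s
      unfolding K_def using power_mono[of 1 r 2] False by (auto simp: indicator_def field_simps)
    have eq: "- K s = indicator {0<..} s * ((exp (- 1 / s) - exp (- r\<^sup>2 / s)) / s)" for s
      unfolding K_def by (simp add: indicator_def field_simps)
    have "(\<integral>\<^sup>+s. ennreal (- K s) \<partial>lborel) = ennreal (ln (r\<^sup>2 / 1))"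
      unfolding eq using False power_mono[of 1 r 2] by (intro nn_integral_frullani) auto
    moreover have "ln (r\<^sup>2 / 1) = 2 * \<bar>ln r\<bar>" using r False by (simp add: ln_realpow)
    ultimately have n: "(\<integral>\<^sup>+s. ennreal (- K s) \<partial>lborel) = ennreal (2 * \<bar>ln r\<bar>)" by simp
    have "has_bochner_integral lborel (\<lambda>s. - K s) (2 * \<bar>ln r\<bar>)"
      by (rule has_bochner_integral_nn_integral[OF _ _ _ n]) (use pos m in auto)
    moreover have "\<bar>K s\<bar> = - K s" for s using pos[of s] by simp
    ultimately show ?thesis using r False by (simp add: has_bochner_integral_iff ln_div)
  qed
  then show "integrable lborel K" "(LINT s|lborel. K s) = 2 * ln (1 / r)"
    "(LINT s|lborel. \<bar>K s\<bar>) = 2 * \<bar>ln r\<bar>" by auto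
qed

lemma log_locally_integrable:
  "(\<integral>\<^sup>+u. ennreal (\<bar>ln (norm u)\<bar> * indicator (cball (0::'a::euclidean_space) \<rho>) u) \<partial>lborel) < \<infinity>"
proof -
  have fin: "emeasure lborel (cball (0::'a) r) < \<infinity>" for r
    by (rule emeasure_bounded_finite[OF bounded_cball])
  \<comment> \<open>Inside the unit ball |ln |u|| is the integral of 1 / \<tau> over \<tau> from |u|
    to 1. Tonelli then replaces the ball indicator by a volume of order \<tau>^d, which cancels the
    factor 1 / \<tau>.\<close>
  define T where "T u = (\<integral>\<^sup>+\<tau>. ennreal (1 / \<tau>) * indicator {0<..1} \<tau> * indicator (cball 0 \<tau>) u \<partial>lborel)" for u :: 'a
  have bound: "ennreal (\<bar>ln (norm u)\<bar> * indicator (cball 0 \<rho>) u) \<le> T u + ennreal \<rho> * indicator (cball 0 \<rho>) u"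
    for u :: 'a
  proof (cases "0 < norm u \<and> norm u \<le> 1")
    case True
    have "(\<integral>\<^sup>+\<tau>. ennreal (1 / \<tau>) * indicator {norm u..1} \<tau> \<partial>lborel) = ennreal (ln 1 - ln (norm u))"
      using True by (intro nn_integral_FTC_Icc)
        (auto intro!: derivative_eq_intros less_imp_le simp: divide_inverse intro: less_le_trans[of 0 "norm u"])
    moreover have "T u = (\<integral>\<^sup>+\<tau>. ennreal (1 / \<tau>) * indicator {norm u..1} \<tau> \<partial>lborel)"
    proof -
      have "0 < \<tau>" if "norm u \<le> \<tau>" for \<tau> using that True by linarith
      then show ?thesis
        unfolding T_def by (intro nn_integral_cong) (auto simp: indicator_def)
    qed
    ultimately have "T u = ennreal \<bar>ln (norm u)\<bar>" using True by simp
    then show ?thesis by (auto simp: indicator_def intro: order.trans[OF _ add_increasing2])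
  next
    case False
    then consider "u = 0" | "norm u > 1" by auto
    then show ?thesis
    proof cases
      case 2
      have "ln (norm u) \<le> norm u" using 2 by (intro order.trans[OF ln_le_minus_one]) auto
      then have "\<bar>ln (norm u)\<bar> * indicator (cball 0 \<rho>) u \<le> \<rho> * indicator (cball 0 \<rho>) u"
        using 2 by (auto simp: indicator_def)
      then have "ennreal (\<bar>ln (norm u)\<bar> * indicator (cball 0 \<rho>) u) \<le> ennreal (\<rho> * indicator (cball 0 \<rho>) u)"
        by (rule ennreal_leI)
      also have "\<dots> = ennreal \<rho> * indicator (cball 0 \<rho>) u" by (auto simp: indicator_def)
      finally show ?thesis by (rule add_increasing[OF zero_le])
    qed simp
  qed
  have "(\<integral>\<^sup>+u. ennreal (\<bar>ln (norm u)\<bar> * indicator (cball (0::'a) \<rho>) u) \<partial>lborel)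
    \<le> (\<integral>\<^sup>+u. T u + ennreal \<rho> * indicator (cball 0 \<rho>) u \<partial>lborel)"
    by (intro nn_integral_mono bound)
  also have "\<dots> = (\<integral>\<^sup>+u. T u \<partial>lborel) + ennreal \<rho> * emeasure lborel (cball (0::'a) \<rho>)"
  proof (subst nn_integral_add)
    show "T \<in> borel_measurable lborel" unfolding T_def mem_cball_0 indicator_def by measurable
    show "(\<lambda>u::'a. ennreal \<rho> * indicator (cball 0 \<rho>) u) \<in> borel_measurable lborel"
      by (intro borel_measurable_times_ennreal borel_measurable_const borel_measurable_indicator) auto
  qed (simp add: nn_integral_cmult_indicator)
  also have "(\<integral>\<^sup>+u. T u \<partial>lborel) = (\<integral>\<^sup>+\<tau>. \<integral>\<^sup>+u. ennreal (1 / \<tau>) * indicator {0<..1} \<tau>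
    * indicator (cball (0::'a) \<tau>) u \<partial>lborel \<partial>lborel)"
    unfolding T_def by (rule lborel_pair.Fubini') (unfold mem_cball_0 indicator_def, measurable)
  also have "\<dots> \<le> (\<integral>\<^sup>+\<tau>. ennreal (unit_ball_vol (real DIM('a))) * indicator {0..1} \<tau> \<partial>(lborel::real measure))"
  proof (intro nn_integral_mono)
    fix \<tau> :: real
    show "(\<integral>\<^sup>+u. ennreal (1 / \<tau>) * indicator {0<..1} \<tau> * indicator (cball (0::'a) \<tau>) u \<partial>lborel)
      \<le> ennreal (unit_ball_vol (real DIM('a))) * indicator {0..1} \<tau>"
    proof (cases "0 < \<tau> \<and> \<tau> \<le> 1")
      case True
      have "1 / \<tau> * (unit_ball_vol (real DIM('a)) * \<tau> ^ DIM('a)) = unit_ball_vol (real DIM('a)) * \<tau> ^ (DIM('a) - 1)"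
        using True power_Suc[of \<tau> "DIM('a) - 1"] DIM_positive[where 'a='a] by (simp add: field_simps)
      also have "\<dots> \<le> unit_ball_vol (real DIM('a)) * 1"
        using True by (intro mult_left_mono power_le_one) auto
      finally have "ennreal (1 / \<tau> * (unit_ball_vol (real DIM('a)) * \<tau> ^ DIM('a)))
        \<le> ennreal (unit_ball_vol (real DIM('a)))"
        by (intro ennreal_leI) simp
      then show ?thesis using True
        by (simp add: nn_integral_cmult_indicator emeasure_cball ennreal_mult[symmetric])
    qed (auto simp: indicator_def)
  qed
  also have "\<dots> = ennreal (unit_ball_vol (real DIM('a)))" by (simp add: nn_integral_cmult)
  finally have "(\<integral>\<^sup>+u. ennreal (\<bar>ln (norm u)\<bar> * indicator (cball (0::'a) \<rho>) u) \<partial>lborel)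
    \<le> ennreal (unit_ball_vol (real DIM('a))) + ennreal \<rho> * emeasure lborel (cball (0::'a) \<rho>)"
    by (simp add: add_right_mono)
  also have "\<dots> < \<infinity>" using fin[of \<rho>] by (simp add: ennreal_mult_less_top)
  finally show ?thesis .
qed

text \<open>A Gamma integral in the scale variable, with \<open>n\<close> standing for norm \<zeta>.
  It produces Gamma (d / 2) / (pi^(d/2) n^d), and 2 pi^(d/2) / Gamma (d / 2) is the area of the unit
  sphere, written here as d times the volume of the unit ball.\<close>

lemma nn_integral_gamma_scale:
  fixes n :: real assumes n: "n > 0" and d: "d > 0"
  shows "(\<integral>\<^sup>+s. ennreal (indicator {0<..} s * (sqrt (pi * s) ^ d / s * exp (- (pi\<^sup>2 * s) * n\<^sup>2))) \<partial>lborel) =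
    ennreal (2 / (real d * unit_ball_vol (real d)) / n ^ d)"
proof -
  let ?c = "pi\<^sup>2 * n\<^sup>2"
  have c: "?c > 0" using n by simp
  have "ennreal (Gamma (d / 2)) = (\<integral>\<^sup>+t. ennreal (indicator {0..} t * t powr (d / 2 - 1) / exp t) \<partial>lborel)"
    using d by (intro Gamma_conv_nn_integral_real) auto
  also have "\<dots> = ennreal ?c * (\<integral>\<^sup>+s. ennreal (indicator {0..} (?c * s) * (?c * s) powr (d / 2 - 1) / exp (?c * s))
    \<partial>lborel)"
    using c by (subst nn_integral_real_affine[where c="?c" and t=0]) auto
  also have "\<dots> = (\<integral>\<^sup>+s. ennreal (?c powr (d / 2) / pi powr (d / 2))
    * ennreal (indicator {0<..} s * (sqrt (pi * s) ^ d / s * exp (- (pi\<^sup>2 * s) * n\<^sup>2))) \<partial>lborel)"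
  proof (subst nn_integral_cmult[symmetric], simp, intro nn_integral_cong)
    fix s :: real
    consider "s > 0" | "s = 0" | "s < 0" by linarith
    then show "ennreal ?c * ennreal (indicator {0..} (?c * s) * (?c * s) powr (d / 2 - 1) / exp (?c * s)) =
      ennreal (?c powr (d / 2) / pi powr (d / 2)) * ennreal
        (indicator {0<..} s * (sqrt (pi * s) ^ d / s * exp (- (pi\<^sup>2 * s) * n\<^sup>2)))"
    proof cases
      case 1
      have "sqrt (pi * s) ^ d = (pi * s) powr (d / 2)"
        using 1 by (simp add: powr_half_sqrt[symmetric] powr_realpow[symmetric] powr_powr)
      then have a: "sqrt (pi * s) ^ d / s = pi powr (d / 2) * s powr (d / 2 - 1)"
        using 1 by (simp add: powr_mult powr_diff)
      have b: "?c * (?c * s) powr (d / 2 - 1) = ?c powr (d / 2) * s powr (d / 2 - 1)"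
        using 1 c by (simp add: powr_mult[of ?c s] powr_diff[of ?c])
      have "?c * ((?c * s) powr (d / 2 - 1) / exp (?c * s))
        = ?c powr (d / 2) / pi powr (d / 2) * (sqrt (pi * s) ^ d / s * exp (- (pi\<^sup>2 * s) * n\<^sup>2))"
      proof -
        have e: "exp (- (pi\<^sup>2 * s) * n\<^sup>2) = 1 / exp (?c * s)" by (simp add: exp_minus divide_inverse mult_ac)
        have "?c * ((?c * s) powr (d / 2 - 1) / exp (?c * s)) = ?c powr (d / 2) * s powr (d / 2 - 1) / exp (?c * s)"
          using b by (simp only: times_divide_eq_right)
        also have "\<dots> = ?c powr (d / 2) / pi powr (d / 2)
          * (pi powr (d / 2) * s powr (d / 2 - 1) * (1 / exp (?c * s)))"
          by simp
        finally show ?thesis unfolding a e .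
      qed
      then show ?thesis using 1 c by (simp add: ennreal_mult[symmetric] zero_le_mult_iff)
    next
      case 3
      then have "\<not> ?c * s \<ge> 0" using c by (simp add: mult_less_0_iff not_le)
      then show ?thesis using 3 by (simp add: indicator_def)
    qed simp
  qed
  also have "\<dots> = ennreal (?c powr (d / 2) / pi powr (d / 2))
    * (\<integral>\<^sup>+s. ennreal (indicator {0<..} s * (sqrt (pi * s) ^ d / s * exp (- (pi\<^sup>2 * s) * n\<^sup>2))) \<partial>lborel)"
    by (intro nn_integral_cmult) measurable
  finally have *: "ennreal (Gamma (d / 2)) = ennreal (?c powr (d / 2) / pi powr (d / 2))
    * (\<integral>\<^sup>+s. ennreal (indicator {0<..} s * (sqrt (pi * s) ^ d / s * exp (- (pi\<^sup>2 * s) * n\<^sup>2))) \<partial>lborel)" .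
  have cp: "?c powr (d / 2) / pi powr (d / 2) = pi powr (d / 2) * n ^ d"
  proof -
    have "?c powr (d / 2) = (pi * n) powr d"
    proof -
      have "?c = (pi * n) powr 2" using n by (simp add: power_mult_distrib)
      then show ?thesis by (simp only: powr_powr) simp
    qed
    also have "\<dots> = pi powr (d / 2) * pi powr (d / 2) * n ^ d"
      using n by (simp add: powr_mult powr_realpow powr_add[symmetric])
    finally show ?thesis by simp
  qed
  have G: "Gamma (real d / 2) > 0" using d by simp
  have "real d / 2 \<notin> \<int>\<^sub>\<le>\<^sub>0" using d nonpos_Ints_nonpos[of "real d / 2"] by auto
  note Gp = Gamma_plus1[OF this]
  have "2 / (real d * unit_ball_vol (real d)) / n ^ d = Gamma (d / 2) / (pi powr (d / 2) * n ^ d)"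
    using d n G Gp by (simp add: unit_ball_vol_def field_simps)
  moreover have "ennreal (Gamma (d / 2)) / ennreal (pi powr (d / 2) * n ^ d)
    = (\<integral>\<^sup>+s. ennreal (indicator {0<..} s * (sqrt (pi * s) ^ d / s * exp (- (pi\<^sup>2 * s) * n\<^sup>2))) \<partial>lborel)"
    unfolding * cp using n by (subst mult.commute, intro ennreal_mult_divide_eq) auto
  ultimately show ?thesis using n G by (simp add: divide_ennreal)
qed


lemma fourier_gaussian_integrable:
  fixes m :: "'a::euclidean_space \<Rightarrow> complex"
  assumes m: "integrable lborel m" and A: "A > 0"
  shows "integrable lborel (\<lambda>x. exp (- A * (norm x)\<^sup>2) * (norm (fourier m x))\<^sup>2)"
proof (rule Bochner_Integration.integrable_bound)
  have [measurable]: "fourier m \<in> borel_measurable borel" using m by auto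
  let ?C = "LINT \<zeta>|lborel. norm (m \<zeta>)"
  show "integrable lborel (\<lambda>x::'a. exp (- A * (norm x)\<^sup>2) * ?C\<^sup>2)"
    using gaussian_fourier(1)[OF A] by (intro integrable_mult_left) auto
  show "AE x in lborel. norm (exp (- A * (norm x)\<^sup>2) * (norm (fourier m x))\<^sup>2) \<le> norm (exp (- A * (norm x)\<^sup>2) * ?C\<^sup>2)"
    by (intro AE_I2) (auto simp: abs_mult intro!: power_mono norm_fourier_le)
  show "(\<lambda>x. exp (- A * (norm x)\<^sup>2) * (norm (fourier m x))\<^sup>2) \<in> borel_measurable lborel" by measurable
qed

text \<open>The logarithmic kernel is evaluated only off the diagonal, where
  \<open>frullani_log\<close> applies.\<close>

lemma AE_pair_ne: "AE p in lborel. fst p \<noteq> (snd p :: 'a::euclidean_space)"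
proof -
  have "AE p in lborel \<Otimes>\<^sub>M lborel. fst p \<noteq> (snd p :: 'a)"
  proof (rule lborel_pair.AE_pair_measure)
    have "open {p. fst p \<noteq> (snd p :: 'a)}" by (rule open_Collect_neq) (auto intro: continuous_intros)
    then have "{p. fst p \<noteq> (snd p :: 'a)} \<in> sets lborel" unfolding sets_lborel by (rule borel_open)
    then show "{p \<in> space (lborel \<Otimes>\<^sub>M lborel). fst p \<noteq> (snd p :: 'a)} \<in> sets (lborel \<Otimes>\<^sub>M lborel)"
      by (simp only: lborel_prod space_lborel space_borel UNIV_I simp_thms)
    show "AE x in lborel. AE y in lborel. fst (x, y) \<noteq> (snd (x, y) :: 'a)"
      using AE_lborel_singleton by (auto simp: eq_commute)
  qed
  then show ?thesis unfolding lborel_prod .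
qed

text \<open>The substitution u = z - w isolates the singularity: differences of points of the
  support lie in a ball of radius 2 r, where the logarithm is integrable, and the remaining integral
  in z runs over a bounded set.\<close>

lemma log_kernel_integrable:
  fixes f :: "'a::euclidean_space \<Rightarrow> real"
  assumes f: "f \<in> test_functions"
  shows "integrable lborel (\<lambda>p. f (fst p) * f (snd p) * \<bar>ln (norm (fst p - snd p))\<bar>)"
proof (rule integrableI_bounded)
  have [measurable]: "f \<in> borel_measurable borel" using f by measurable
  show "(\<lambda>p. f (fst p) * f (snd p) * \<bar>ln (norm (fst p - snd p))\<bar>) \<in> borel_measurable lborel"
    by (simp add: lborel_prod[symmetric])
  obtain r where r: "\<And>x. norm x > r \<Longrightarrow> f x = 0" using test_support[OF f] by metis
  obtain B where B: "B > 0" "\<And>x. \<bar>f x\<bar> \<le> B" using test_bounded[OF f] by metis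
  let ?L = "\<lambda>u::'a. ennreal (\<bar>ln (norm u)\<bar> * indicator (cball 0 (2 * r)) u)"
  have "(\<integral>\<^sup>+p. ennreal (norm (f (fst p) * f (snd p) * \<bar>ln (norm (fst p - snd p))\<bar>)) \<partial>lborel) =
     (\<integral>\<^sup>+z. \<integral>\<^sup>+w. ennreal (norm (f z * f w * \<bar>ln (norm (z - w))\<bar>)) \<partial>lborel \<partial>lborel)"
    by (subst lborel_prod[symmetric], subst lborel.nn_integral_fst[symmetric]) auto
  also have "\<dots> \<le> (\<integral>\<^sup>+z. \<integral>\<^sup>+w. ennreal (B\<^sup>2) * indicator (cball 0 r) z * ?L (z - w) \<partial>lborel \<partial>lborel)"
  proof (intro nn_integral_mono)
    fix z w :: 'a
    show "ennreal (norm (f z * f w * \<bar>ln (norm (z - w))\<bar>)) \<le> ennreal (B\<^sup>2) * indicator (cball 0 r) z * ?L (z - w)"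
    proof (cases "norm z > r \<or> norm w > r")
      case True then show ?thesis using r by auto
    next
      case False
      then have "norm (z - w) \<le> 2 * r" using norm_triangle_ineq4[of z w] by linarith
      moreover have "\<bar>f z * f w\<bar> * \<bar>ln (norm (z - w))\<bar> \<le> B\<^sup>2 * \<bar>ln (norm (z - w))\<bar>"
        unfolding abs_mult power2_eq_square using B by (intro mult_right_mono mult_mono) auto
      ultimately show ?thesis using False by (simp add: abs_mult ennreal_mult[symmetric] ennreal_leI)
    qed
  qed
  also have "\<dots> = (\<integral>\<^sup>+z. ennreal (B\<^sup>2) * (\<integral>\<^sup>+u. ?L u \<partial>lborel) * indicator (cball (0::'a) r) z \<partial>lborel)"
  proof (intro nn_integral_cong)
    fix z :: 'a
    have Lm: "?L \<in> borel_measurable borel"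
      by (intro measurable_compose[OF _ measurable_ennreal] borel_measurable_times borel_measurable_indicator) auto
    have Lm': "(\<lambda>w. ?L (z - w)) \<in> borel_measurable borel" by (rule measurable_compose[OF _ Lm]) simp
    have "(\<integral>\<^sup>+w. ?L (z - w) \<partial>lborel) = (\<integral>\<^sup>+u. ?L u \<partial>lborel)"
      by (subst nn_integral_lborel_scale_shift[OF _ Lm', where c="-1" and t=z]) auto
    then show "(\<integral>\<^sup>+w. ennreal (B\<^sup>2) * indicator (cball 0 r) z * ?L (z - w) \<partial>lborel)
      = ennreal (B\<^sup>2) * (\<integral>\<^sup>+u. ?L u \<partial>lborel) * indicator (cball (0::'a) r) z"
      using Lm' by (subst nn_integral_cmult) (simp_all add: mult_ac)
  qed
  also have "\<dots> = ennreal (B\<^sup>2) * (\<integral>\<^sup>+u. ?L u \<partial>lborel) * emeasure lborel (cball (0::'a) r)"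
    by (rule nn_integral_cmult_indicator) auto
  also have "\<dots> < \<infinity>"
    using log_locally_integrable[of "2 * r", where 'a='a] emeasure_bounded_finite[OF bounded_cball, of "0::'a" r]
    by (simp add: ennreal_mult_less_top)
  finally show "(\<integral>\<^sup>+p. ennreal (norm (f (fst p) * f (snd p) * \<bar>ln (norm (fst p - snd p))\<bar>)) \<partial>lborel) < \<infinity>" .
qed

lemma test_functions0_iff: "f \<in> test_functions0 \<longleftrightarrow> f \<in> test_functions \<and> (LINT x|lborel. f x) = 0"
  by (simp add: test_functions0_def)

text \<open>The term exp (- 1 / s) makes the scale integral converge and drops out of the double
  integral because \<open>f\<close> has integral zero. At a fixed scale s there remains a
  Gaussian-weighted integral of the squared transform, which is nonnegative. This sign gives V \<ge>
  0 and allows the final exchange by Tonelli, although the logarithm itself changes sign.\<close>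

theorem log_energy:
  fixes f :: "'a::euclidean_space \<Rightarrow> real"
  assumes f0: "f \<in> test_functions0"
  defines "V \<equiv> (LINT z|lborel. LINT w|lborel. f z * f w * ln (1 / norm (z - w)))"
  shows "V \<ge> 0" "(\<integral>\<^sup>+\<zeta>. ennreal ((norm (rfourier f \<zeta>))\<^sup>2 / norm \<zeta> ^ DIM('a)) \<partial>lborel)
    = ennreal (real DIM('a) * unit_ball_vol (real DIM('a)) * V)"
proof -
  have f: "f \<in> test_functions" and fz: "(LINT x|lborel. f x) = 0" using f0 by (auto simp: test_functions0_iff)
  have fi: "integrable lborel f" and fc: "integrable lborel (\<lambda>x. complex_of_real (f x))"
    using test_integrable[OF f] test_integrable_complex[OF f] .
  have [measurable]: "f \<in> borel_measurable borel" using f by measurable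
  have [measurable]: "rfourier f \<in> borel_measurable borel" using measurable_fourier[OF fc] .
  define K where "K r s = indicator {0<..} s * ((exp (- r\<^sup>2 / s) - exp (- 1 / s)) / s)" for r s :: real
  have [measurable]: "(\<lambda>x. K (a x) (b x)) \<in> borel_measurable M" if "a \<in> borel_measurable M" "b \<in> borel_measurable M"
    for a b and M :: "'x measure"
    unfolding K_def using that by measurable
  define G where "G p = f (fst p) * f (snd p)" for p :: "'a \<times> 'a"
  have Gm[measurable]: "G \<in> borel_measurable (borel \<Otimes>\<^sub>M borel)" unfolding G_def by measurable
  obtain r where r: "r > 0" "\<And>x. norm x > r \<Longrightarrow> f x = 0" using test_support[OF f] by metis
  have Gi: "integrable lborel G"
  proof (rule integrable_compact_support[where r="r + r"])
    show "continuous_on UNIV G" unfolding G_def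
      by (intro continuous_intros continuous_on_compose2[OF test_continuous[OF f, of UNIV]]) auto
    fix p :: "'a \<times> 'a" assume "norm p > r + r"
    then have "norm (fst p) > r \<or> norm (snd p) > r" using norm_Pair_le[of "fst p" "snd p"] by (simp, linarith)
    then show "G p = 0" using r by (auto simp: G_def)
  qed
  have iterated: "(LINT p|lborel. G p * k (fst p - snd p)) = (LINT z|lborel. LINT w|lborel. f z * f w * k (z - w))"
    if "integrable lborel (\<lambda>p. G p * k (fst p - snd p))" for k
    using lborel_pair.integral_fst'[of "\<lambda>p. G p * k (fst p - snd p)"] that by (simp add: lborel_prod G_def)
  have bnd: "integrable lborel (\<lambda>p. G p * k p)" if "k \<in> borel_measurable (borel \<Otimes>\<^sub>M borel)" "\<And>p. \<bar>k p\<bar> \<le> 1" for k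
  proof (rule Bochner_Integration.integrable_bound[OF Gi])
    show "(\<lambda>p. G p * k p) \<in> borel_measurable lborel" using that(1) by (simp add: lborel_prod[symmetric])
    show "AE p in lborel. norm (G p * k p) \<le> norm (G p)"
      using that(2) by (intro AE_I2) (auto simp: abs_mult intro!: mult_left_le)
  qed
  have G0: "(LINT p|lborel. G p) = 0"
    using iterated[of "\<lambda>_. 1"] Gi fz by simp
  define h where "h p s = G p * K (norm (fst p - snd p)) s" for p s
  have hm[measurable]: "(\<lambda>(p, s). h p s) \<in> borel_measurable (lborel \<Otimes>\<^sub>M lborel)"
  proof -
    have "(\<lambda>(p, s). h p s) \<in> borel_measurable ((borel \<Otimes>\<^sub>M borel) \<Otimes>\<^sub>M borel)" unfolding h_def by measurable
    moreover have "sets ((borel :: 'a measure) \<Otimes>\<^sub>M (borel :: 'a measure)) = sets (lborel :: ('a \<times> 'a) measure)"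
      unfolding sets_lborel borel_prod ..
    ultimately show ?thesis by (simp cong: measurable_cong_sets sets_pair_measure_cong)
  qed
  have hs: "(LINT s|lborel. norm (h p s)) = \<bar>G p\<bar> * (2 * \<bar>ln (norm (fst p - snd p))\<bar>)"
    "integrable lborel (h p)" "(LINT s|lborel. h p s) = G p * (2 * ln (1 / norm (fst p - snd p)))"
    if "fst p \<noteq> snd p" for p
    using frullani_log[of "norm (fst p - snd p)", folded K_def] that unfolding h_def by (auto simp: abs_mult)
  \<comment> \<open>The inner absolute integral is known exactly from \<open>frullani_log\<close>,
    so integrability on the product reduces to that of the logarithmic kernel.\<close>
  have hint: "integrable (lborel \<Otimes>\<^sub>M lborel) (\<lambda>(p, s). h p s)"
  proof (rule lborel_pair.Fubini_integrable)
    have "integrable lborel (\<lambda>p. 2 * norm (G p * \<bar>ln (norm (fst p - snd p))\<bar>))"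
      unfolding G_def by (intro integrable_mult_right integrable_norm log_kernel_integrable f)
    then show "integrable lborel (\<lambda>p. LINT s|lborel. norm (case (p, s) of (p, s) \<Rightarrow> h p s))"
    proof (rule integrable_cong_AE_imp)
      show "AE p in lborel. 2 * norm (G p * \<bar>ln (norm (fst p - snd p))\<bar>)
        = (LINT s|lborel. norm (case (p, s) of (p, s) \<Rightarrow> h p s))"
        using AE_pair_ne by eventually_elim (simp add: hs(1)[unfolded real_norm_def] abs_mult)
      show "(\<lambda>p. LINT s|lborel. norm (case (p, s) of (p, s) \<Rightarrow> h p s)) \<in> borel_measurable lborel" by measurable
    qed
    show "AE p in lborel. integrable lborel (\<lambda>s. case (p, s) of (p, s) \<Rightarrow> h p s)"
      using AE_pair_ne by eventually_elim (simp add: hs(2))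
  qed (rule hm)
  define E where "E s = (LINT \<zeta>|lborel. exp (- (pi\<^sup>2 * s) * (norm \<zeta>)\<^sup>2) * (norm (rfourier f \<zeta>))\<^sup>2)" for s
  have H: "(LINT p|lborel. h p s) = indicator {0<..} s * (sqrt (pi * s) ^ DIM('a) / s * E s)" for s
  proof (cases "s > 0")
    case True
    let ?e = "\<lambda>u::'a. exp (- (norm u)\<^sup>2 / s)"
    have e1: "integrable lborel (\<lambda>p. G p * ?e (fst p - snd p))"
      by (rule bnd) (use True in auto)
    have "(LINT p|lborel. h p s) = (LINT p|lborel. (1 / s) * (G p * ?e (fst p - snd p) - exp (- 1 / s) * G p))"
      by (intro Bochner_Integration.integral_cong refl) (use True in \<open>simp add: h_def K_def field_simps\<close>)
    also have "\<dots> = (1 / s) * (LINT p|lborel. G p * ?e (fst p - snd p))"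
      using e1 Gi G0 by simp
    also have "(LINT p|lborel. G p * ?e (fst p - snd p)) = (LINT z|lborel. LINT w|lborel. f z * f w * ?e (z - w))"
      by (rule iterated[OF e1])
    also have "\<dots> = sqrt (pi * s) ^ DIM('a) * E s"
    proof -
      \<comment> \<open>For A = pi^2 s the transformed Gaussian in
        \<open>fourier_gaussian_regularized\<close> is exp (- |z - w|^2 / s), up to a
        constant.\<close>
      have A: "pi\<^sup>2 * s > 0" using True by simp
      have q: "sqrt (pi / (pi\<^sup>2 * s)) * sqrt (pi * s) = 1"
        using True by (simp add: real_sqrt_mult[symmetric] power2_eq_square)
      have "complex_of_real (E s) = (LINT \<zeta>|lborel. complex_of_real (f \<zeta>)
        * (LINT \<xi>|lborel. complex_of_real (f \<xi>) * complex_of_real (sqrt (pi / (pi\<^sup>2 * s)) ^ DIM('a) * ?e (\<zeta> - \<xi>))))"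
        unfolding E_def fourier_gaussian_regularized[OF fc A] using True by simp
      also have "\<dots> = complex_of_real (LINT \<zeta>|lborel. f \<zeta>
        * (LINT \<xi>|lborel. f \<xi> * (sqrt (pi / (pi\<^sup>2 * s)) ^ DIM('a) * ?e (\<zeta> - \<xi>))))"
        by (simp only: of_real_mult[symmetric] integral_complex_of_real)
      finally have "E s = (LINT \<zeta>|lborel. f \<zeta>
        * (LINT \<xi>|lborel. f \<xi> * (sqrt (pi / (pi\<^sup>2 * s)) ^ DIM('a) * ?e (\<zeta> - \<xi>))))"
        by (simp only: of_real_eq_iff)
      also have "\<dots> = (LINT \<zeta>|lborel. sqrt (pi / (pi\<^sup>2 * s)) ^ DIM('a) * (LINT \<xi>|lborel. f \<zeta> * f \<xi> * ?e (\<zeta> - \<xi>)))"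
        by (simp only: integral_mult_right_zero[symmetric] mult_ac)
      also have "\<dots> = sqrt (pi / (pi\<^sup>2 * s)) ^ DIM('a) * (LINT \<zeta>|lborel. LINT \<xi>|lborel. f \<zeta> * f \<xi> * ?e (\<zeta> - \<xi>))"
        by (rule integral_mult_right_zero)
      finally have "sqrt (pi * s) ^ DIM('a) * E s = (sqrt (pi / (pi\<^sup>2 * s)) * sqrt (pi * s)) ^ DIM('a)
        * (LINT \<zeta>|lborel. LINT \<xi>|lborel. f \<zeta> * f \<xi> * ?e (\<zeta> - \<xi>))"
        by (simp only: power_mult_distrib mult_ac)
      then show ?thesis unfolding q by simp
    qed
    finally show ?thesis using True by simp
  qed (simp add: h_def K_def)
  have E0: "E s \<ge> 0" for s unfolding E_def by (rule integral_nonneg_AE) simp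
  have H0: "(LINT p|lborel. h p s) \<ge> 0" for s unfolding H using E0 by (auto simp: indicator_def)
  have "integrable (lborel \<Otimes>\<^sub>M lborel) (\<lambda>(s, p). h p s)"
    using lborel_pair.integrable_product_swap[OF hint] by simp
  from lborel_pair.integrable_fst'[OF this] have Hi: "integrable lborel (\<lambda>s. LINT p|lborel. h p s)" by simp
  \<comment> \<open>The factor 2 is that of \<open>frullani_log\<close>.\<close>
  have V: "2 * V = (LINT s|lborel. LINT p|lborel. h p s)"
  proof -
    have Gl: "integrable lborel (\<lambda>p. G p * ln (1 / norm (fst p - snd p)))"
    proof (rule Bochner_Integration.integrable_bound[OF log_kernel_integrable[OF f]])
      show "(\<lambda>p. G p * ln (1 / norm (fst p - snd p))) \<in> borel_measurable lborel" by (simp add: lborel_prod[symmetric])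
      show "AE p in lborel. norm (G p * ln (1 / norm (fst p - snd p)))
        \<le> norm (f (fst p) * f (snd p) * \<bar>ln (norm (fst p - snd p))\<bar>)"
      proof (rule AE_I2)
        fix p :: "'a \<times> 'a"
        have "\<bar>ln (1 / norm (fst p - snd p))\<bar> = \<bar>ln (norm (fst p - snd p))\<bar>"
          by (cases "fst p = snd p") (auto simp: ln_div)
        then show "norm (G p * ln (1 / norm (fst p - snd p)))
          \<le> norm (f (fst p) * f (snd p) * \<bar>ln (norm (fst p - snd p))\<bar>)"
          by (simp add: G_def abs_mult)
      qed
    qed
    have "2 * V = (LINT p|lborel. G p * (2 * ln (1 / norm (fst p - snd p))))"
      unfolding V_def iterated[OF Gl, symmetric] integral_mult_right_zero[symmetric]
      by (intro Bochner_Integration.integral_cong refl) simp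
    also have "\<dots> = (LINT p|lborel. LINT s|lborel. h p s)"
    proof (rule integral_cong_AE)
      show "(\<lambda>p. G p * (2 * ln (1 / norm (fst p - snd p)))) \<in> borel_measurable lborel"
        by (simp add: lborel_prod[symmetric])
      show "AE p in lborel. G p * (2 * ln (1 / norm (fst p - snd p))) = (LINT s|lborel. h p s)"
        using AE_pair_ne by eventually_elim (simp add: hs(3))
    qed measurable
    also have "\<dots> = (LINT s|lborel. LINT p|lborel. h p s)"
      by (rule lborel_pair.Fubini_integral[OF hint, symmetric])
    finally show ?thesis .
  qed
  have V0: "2 * V \<ge> 0" unfolding V by (rule integral_nonneg_AE) (use H0 in auto)
  then show "V \<ge> 0" by simp
  let ?g = "\<lambda>s. indicator {0<..} s * (sqrt (pi * s) ^ DIM('a) / s)"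
  have "ennreal (2 * V) = (\<integral>\<^sup>+s. ennreal (LINT p|lborel. h p s) \<partial>lborel)"
    unfolding V by (rule nn_integral_eq_integral[symmetric, OF Hi]) (use H0 in auto)
  also have "\<dots> = (\<integral>\<^sup>+s. \<integral>\<^sup>+\<zeta>. ennreal ((norm (rfourier f \<zeta>))\<^sup>2)
    * ennreal (indicator {0<..} s * (sqrt (pi * s) ^ DIM('a) / s * exp (- (pi\<^sup>2 * s) * (norm \<zeta>)\<^sup>2))) \<partial>lborel \<partial>lborel)"
  proof (intro nn_integral_cong)
    fix s :: real
    show "ennreal (LINT p|lborel. h p s) = (\<integral>\<^sup>+\<zeta>. ennreal ((norm (rfourier f \<zeta>))\<^sup>2)
      * ennreal (indicator {0<..} s * (sqrt (pi * s) ^ DIM('a) / s * exp (- (pi\<^sup>2 * s) * (norm \<zeta>)\<^sup>2))) \<partial>lborel)"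
    proof (cases "s > 0")
      case True
      then have A: "pi\<^sup>2 * s > 0" by simp
      have "ennreal (E s) = (\<integral>\<^sup>+\<zeta>. ennreal (exp (- (pi\<^sup>2 * s) * (norm \<zeta>)\<^sup>2) * (norm (rfourier f \<zeta>))\<^sup>2) \<partial>lborel)"
        unfolding E_def by (rule nn_integral_eq_integral[symmetric, OF fourier_gaussian_integrable[OF fc A]]) auto
      moreover have "ennreal (LINT p|lborel. h p s) = ennreal (sqrt (pi * s) ^ DIM('a) / s) * ennreal (E s)"
        unfolding H using True E0 by (subst ennreal_mult[symmetric]) auto
      ultimately have "ennreal (LINT p|lborel. h p s)
        = ennreal (sqrt (pi * s) ^ DIM('a) / s) *
        (\<integral>\<^sup>+\<zeta>. ennreal (exp (- (pi\<^sup>2 * s) * (norm \<zeta>)\<^sup>2) * (norm (rfourier f \<zeta>))\<^sup>2) \<partial>lborel)"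
        by (simp only:)
      also have "\<dots> = (\<integral>\<^sup>+\<zeta>. ennreal (sqrt (pi * s) ^ DIM('a) / s)
        * ennreal (exp (- (pi\<^sup>2 * s) * (norm \<zeta>)\<^sup>2) * (norm (rfourier f \<zeta>))\<^sup>2) \<partial>lborel)"
        by (rule nn_integral_cmult[symmetric]) measurable
      finally show ?thesis using True by (simp add: ennreal_mult[symmetric] mult_ac)
    qed (simp add: H)
  qed
  also have "\<dots> = (\<integral>\<^sup>+\<zeta>. \<integral>\<^sup>+s. ennreal ((norm (rfourier f \<zeta>))\<^sup>2)
    * ennreal (indicator {0<..} s * (sqrt (pi * s) ^ DIM('a) / s * exp (- (pi\<^sup>2 * s) * (norm \<zeta>)\<^sup>2))) \<partial>lborel \<partial>lborel)"
    by (rule lborel_pair.Fubini') measurable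
  also have "\<dots> = (\<integral>\<^sup>+\<zeta>. ennreal (2 / (real DIM('a) * unit_ball_vol (real DIM('a))))
    * ennreal ((norm (rfourier f \<zeta>))\<^sup>2 / norm \<zeta> ^ DIM('a)) \<partial>lborel)"
  proof (rule nn_integral_cong_AE)
    show "AE \<zeta> in lborel. (\<integral>\<^sup>+s. ennreal ((norm (rfourier f \<zeta>))\<^sup>2)
      * ennreal (indicator {0<..} s * (sqrt (pi * s) ^ DIM('a) / s * exp (- (pi\<^sup>2 * s) * (norm \<zeta>)\<^sup>2))) \<partial>lborel) =
       ennreal (2 / (real DIM('a) * unit_ball_vol (real DIM('a)))) * ennreal
         ((norm (rfourier f \<zeta>))\<^sup>2 / norm \<zeta> ^ DIM('a))"
      using AE_lborel_singleton[of "0::'a"]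
    proof eventually_elim
      fix \<zeta> :: 'a assume "\<zeta> \<noteq> 0"
      then show "(\<integral>\<^sup>+s. ennreal ((norm (rfourier f \<zeta>))\<^sup>2)
        * ennreal (indicator {0<..} s * (sqrt (pi * s) ^ DIM('a) / s * exp (- (pi\<^sup>2 * s) * (norm \<zeta>)\<^sup>2))) \<partial>lborel) =
       ennreal (2 / (real DIM('a) * unit_ball_vol (real DIM('a)))) * ennreal
         ((norm (rfourier f \<zeta>))\<^sup>2 / norm \<zeta> ^ DIM('a))"
        by (subst nn_integral_cmult, measurable, subst nn_integral_gamma_scale)
           (auto simp: ennreal_mult[symmetric] mult_ac)
    qed
  qed
  also have "\<dots> = ennreal (2 / (real DIM('a) * unit_ball_vol (real DIM('a))))
    * (\<integral>\<^sup>+\<zeta>. ennreal ((norm (rfourier f \<zeta>))\<^sup>2 / norm \<zeta> ^ DIM('a)) \<partial>lborel)"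
    by (rule nn_integral_cmult) measurable
  finally have eq: "ennreal (2 * V) = ennreal (2 / (real DIM('a) * unit_ball_vol (real DIM('a))))
    * (\<integral>\<^sup>+\<zeta>. ennreal ((norm (rfourier f \<zeta>))\<^sup>2 / norm \<zeta> ^ DIM('a)) \<partial>lborel)" .
  let ?\<sigma> = "real DIM('a) * unit_ball_vol (real DIM('a))"
  have \<sigma>: "?\<sigma> > 0" by simp
  have "ennreal (?\<sigma> * V) = ennreal (?\<sigma> / 2) * ennreal (2 * V)"
    using V0 \<sigma> by (subst ennreal_mult[symmetric]) auto
  also have "\<dots> = ennreal (?\<sigma> / 2 * (2 / ?\<sigma>)) * (\<integral>\<^sup>+\<zeta>. ennreal ((norm (rfourier f \<zeta>))\<^sup>2 / norm \<zeta> ^ DIM('a)) \<partial>lborel)"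
    unfolding eq using \<sigma> by (subst ennreal_mult) (auto simp: mult.assoc)
  also have "?\<sigma> / 2 * (2 / ?\<sigma>) = 1" using less_imp_neq[OF \<sigma>] by (simp only: times_divide_times_eq) simp
  finally show "(\<integral>\<^sup>+\<zeta>. ennreal ((norm (rfourier f \<zeta>))\<^sup>2 / norm \<zeta> ^ DIM('a)) \<partial>lborel) = ennreal (?\<sigma> * V)" by simp
qed

section \<open>The heat symbol and the energy of space-time profiles\<close>

definition heat_symbol :: "real \<Rightarrow> 'a::euclidean_space \<Rightarrow> real" where
  "heat_symbol t \<zeta> = exp (- ((2 * pi) ^ DIM('a) * t * norm \<zeta> ^ DIM('a)))"

lemma heat_symbol_pos: "heat_symbol t \<zeta> > 0" by (simp add: heat_symbol_def)

lemma heat_symbol_add: "heat_symbol (s + t) \<zeta> = heat_symbol s \<zeta> * heat_symbol t \<zeta>"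
  by (simp add: heat_symbol_def exp_add[symmetric] algebra_simps)

lemma heat_symbol_antimono: "s \<le> t \<Longrightarrow> heat_symbol t \<zeta> \<le> heat_symbol s \<zeta>"
  by (simp add: heat_symbol_def mult_left_mono mult_right_mono)

lemma heat_symbol_le_1: "t \<ge> 0 \<Longrightarrow> heat_symbol t \<zeta> \<le> 1"
  by (simp add: heat_symbol_def)

lemma heat_symbol_even: "heat_symbol t (- \<zeta>) = heat_symbol t \<zeta>" by (simp add: heat_symbol_def)

lemma continuous_heat_symbol[continuous_intros]: "continuous_on S (heat_symbol t)"
  unfolding heat_symbol_def by (intro continuous_intros)

lemma measurable_heat_symbol[measurable (raw)]:
  fixes g :: "'x \<Rightarrow> 'a::euclidean_space"
  assumes [measurable]: "f \<in> borel_measurable M" "g \<in> borel_measurable M"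
  shows "(\<lambda>x. heat_symbol (f x) (g x)) \<in> borel_measurable M"
  unfolding heat_symbol_def by measurable

text \<open>With its positive exponent, \<open>fourier\<close> is the inverse transform in the
  convention of the kernel. For real test functions only the modulus of the transform enters the
  variances, and the sign of the exponent does not affect their integrals.\<close>

lemma heat_kernel_fourier:
  "frac_heat_kernel t x = Re (fourier (\<lambda>\<zeta>. complex_of_real (heat_symbol t \<zeta>)) x)"
  by (simp add: frac_heat_kernel_def fourier_def heat_symbol_def mult.commute)

text \<open>In dimension at least 2, norm \<zeta> ^ d \<ge> norm \<zeta> ^ 2 - 1, so the symbol
  decays at least like a Gaussian. Completing the square spends half of the Gaussian exponent on the
  factor exp (C * norm \<zeta>).\<close>

lemma exp_heat_symbol_bound:
  assumes d: "DIM('a::euclidean_space) \<ge> 2" and t: "t > 0"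
  shows "\<exists>D A. D > 0 \<and> A > 0 \<and> (\<forall>\<zeta>::'a. exp (C * norm \<zeta>) * heat_symbol t \<zeta> \<le> D * exp (- A * (norm \<zeta>)\<^sup>2))"
proof -
  define k where "k = (2 * pi) ^ DIM('a) * t"
  have k: "k > 0" using t by (simp add: k_def)
  have "exp (C * norm \<zeta>) * heat_symbol t \<zeta> \<le> exp (k + C\<^sup>2 / (2 * k)) * exp (- (k / 2) * (norm \<zeta>)\<^sup>2)" for \<zeta> :: 'a
  proof -
    have "(norm \<zeta>)\<^sup>2 \<le> norm \<zeta> ^ DIM('a) + 1"
    proof (cases "norm \<zeta> \<le> 1")
      case True
      then have "(norm \<zeta>)\<^sup>2 \<le> 1" by (simp add: power_le_one)
      then show ?thesis using zero_le_power[OF norm_ge_zero[of \<zeta>], of "DIM('a)"] by linarith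
    next
      case False
      then have "(norm \<zeta>)\<^sup>2 \<le> norm \<zeta> ^ DIM('a)" using d by (intro power_increasing) auto
      then show ?thesis by simp
    qed
    then have "k * (norm \<zeta>)\<^sup>2 \<le> k * (norm \<zeta> ^ DIM('a) + 1)" using k by (intro mult_left_mono) auto
    moreover have "C * norm \<zeta> \<le> k / 2 * (norm \<zeta>)\<^sup>2 + C\<^sup>2 / (2 * k)"
    proof -
      have "0 \<le> (k * norm \<zeta> - C)\<^sup>2 / (2 * k)" using k by simp
      also have "\<dots> = k / 2 * (norm \<zeta>)\<^sup>2 + C\<^sup>2 / (2 * k) - C * norm \<zeta>"
        using k by (simp add: power2_eq_square field_simps)
      finally show ?thesis by simp
    qed
    ultimately have "C * norm \<zeta> - k * norm \<zeta> ^ DIM('a) \<le> (k + C\<^sup>2 / (2 * k)) + - (k / 2) * (norm \<zeta>)\<^sup>2"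
      by (simp add: algebra_simps)
    then have "exp (C * norm \<zeta> - k * norm \<zeta> ^ DIM('a)) \<le> exp ((k + C\<^sup>2 / (2 * k)) + - (k / 2) * (norm \<zeta>)\<^sup>2)"
      by simp
    moreover have "exp (C * norm \<zeta>) * heat_symbol t \<zeta> = exp (C * norm \<zeta> - k * norm \<zeta> ^ DIM('a))"
      by (simp add: heat_symbol_def k_def mult_exp_exp)
    ultimately show ?thesis by (simp only: mult_exp_exp)
  qed
  then show ?thesis using k by (intro exI[of _ "exp (k + C\<^sup>2 / (2 * k))"] exI[of _ "k / 2"]) auto
qed

text \<open>The hermitian symmetry makes the associated space-time profile real. Exponential growth
  is absorbed by the heat symbol at any positive time. Characters, which represent point values of
  the field, belong to this class.\<close>

definition adm :: "('a::euclidean_space \<Rightarrow> complex) \<Rightarrow> bool" where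
  "adm a \<longleftrightarrow> continuous_on UNIV a \<and> (\<forall>\<zeta>. a (- \<zeta>) = cnj (a \<zeta>)) \<and> (\<exists>C. \<forall>\<zeta>. norm (a \<zeta>) \<le> C * exp (C * norm \<zeta>))"

text \<open>The factor norm \<zeta> expresses first-order vanishing at the origin, shared by
  increments of characters and by transforms of test functions of integral zero. It controls the low
  frequencies over infinite time intervals. A single C serves as factor and as rate, which costs
  nothing since it may be enlarged.\<close>

definition adm0 :: "('a::euclidean_space \<Rightarrow> complex) \<Rightarrow> bool" where
  "adm0 a \<longleftrightarrow> continuous_on UNIV a \<and> (\<forall>\<zeta>. a (- \<zeta>) = cnj (a \<zeta>)) \<and> (\<exists>C. \<forall>\<zeta>. norm (a \<zeta>) \<le> C * (norm \<zeta> * exp (C * norm \<zeta>)))"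

lemma exp_bound_pos:
  fixes a :: "'a::real_normed_vector \<Rightarrow> complex"
  assumes "\<exists>C. \<forall>\<zeta>. norm (a \<zeta>) \<le> C * (g \<zeta> * exp (C * norm \<zeta>))" "\<And>\<zeta>. g \<zeta> \<ge> 0"
  obtains C where "C > 0" "\<And>\<zeta>. norm (a \<zeta>) \<le> C * (g \<zeta> * exp (C * norm \<zeta>))"
proof -
  obtain C where C: "\<And>\<zeta>. norm (a \<zeta>) \<le> C * (g \<zeta> * exp (C * norm \<zeta>))" using assms(1) by blast
  have "norm (a \<zeta>) \<le> max C 1 * (g \<zeta> * exp (max C 1 * norm \<zeta>))" for \<zeta>
    by (rule order.trans[OF C]) (auto intro!: mult_mono mult_nonneg_nonneg assms(2) mult_right_mono)
  then show ?thesis by (intro that[of "max C 1"]) auto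
qed

lemma admE:
  assumes "adm a"
  obtains C where "C > 0" "\<And>\<zeta>. norm (a \<zeta>) \<le> C * exp (C * norm \<zeta>)"
  using exp_bound_pos[of a "\<lambda>_. 1"] assms unfolding adm_def by auto

lemma adm0E:
  assumes "adm0 a"
  obtains C where "C > 0" "\<And>\<zeta>. norm (a \<zeta>) \<le> C * (norm \<zeta> * exp (C * norm \<zeta>))"
  using exp_bound_pos[of a norm] assms unfolding adm0_def by auto

lemma norm_le_exp: "norm x \<le> exp (norm x)"
  using exp_ge_add_one_self[of "norm x"] by linarith

lemma adm0_adm:
  assumes "adm0 a" shows "adm a"
proof -
  obtain C where C: "C > 0" "\<And>\<zeta>. norm (a \<zeta>) \<le> C * (norm \<zeta> * exp (C * norm \<zeta>))" using adm0E[OF assms] by metis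
  have "norm (a \<zeta>) \<le> (C + 1) * exp ((C + 1) * norm \<zeta>)" for \<zeta>
  proof -
    have "C * (norm \<zeta> * exp (C * norm \<zeta>)) \<le> (C + 1) * (exp (norm \<zeta>) * exp (C * norm \<zeta>))"
      using C(1) norm_le_exp by (intro mult_mono) auto
    with C(2)[of \<zeta>] show ?thesis by (simp add: exp_add[symmetric] algebra_simps)
  qed
  then show ?thesis using assms unfolding adm_def adm0_def by blast
qed

lemma adm_measurable[measurable_dest]: "adm a \<Longrightarrow> a \<in> borel_measurable borel"
  unfolding adm_def by (auto intro: borel_measurable_continuous_onI)

lemma exp_bound_lincomb:
  fixes a b :: "'a::real_normed_vector \<Rightarrow> complex"
  assumes "\<exists>C. \<forall>\<zeta>. norm (a \<zeta>) \<le> C * (g \<zeta> * exp (C * norm \<zeta>))"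
    "\<exists>C. \<forall>\<zeta>. norm (b \<zeta>) \<le> C * (g \<zeta> * exp (C * norm \<zeta>))" "\<And>\<zeta>. g \<zeta> \<ge> 0"
  shows "\<exists>C. \<forall>\<zeta>. norm (complex_of_real r * a \<zeta> + complex_of_real s * b \<zeta>) \<le> C * (g \<zeta> * exp (C * norm \<zeta>))"
proof -
  obtain C where C: "C > 0" "\<And>\<zeta>. norm (a \<zeta>) \<le> C * (g \<zeta> * exp (C * norm \<zeta>))" using exp_bound_pos[OF assms(1,3)]
    by metis
  obtain D where D: "D > 0" "\<And>\<zeta>. norm (b \<zeta>) \<le> D * (g \<zeta> * exp (D * norm \<zeta>))" using exp_bound_pos[OF assms(2,3)]
    by metis
  define E where "E = \<bar>r\<bar> * C + \<bar>s\<bar> * D + C + D"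
  have E: "C \<le> E" "D \<le> E" "\<bar>r\<bar> * C + \<bar>s\<bar> * D \<le> E" "E > 0" using C(1) D(1)
    by (auto simp: E_def add_pos_nonneg add_nonneg_pos)
  have "norm (complex_of_real r * a \<zeta> + complex_of_real s * b \<zeta>) \<le> E * (g \<zeta> * exp (E * norm \<zeta>))" for \<zeta>
  proof -
    have g: "g \<zeta> * exp (C * norm \<zeta>) \<le> g \<zeta> * exp (E * norm \<zeta>)" "g \<zeta> * exp (D * norm \<zeta>) \<le> g \<zeta> * exp (E * norm \<zeta>)"
      using E assms(3) by (auto intro!: mult_left_mono mult_right_mono)
    have ab: "norm (a \<zeta>) \<le> C * (g \<zeta> * exp (E * norm \<zeta>))" "norm (b \<zeta>) \<le> D * (g \<zeta> * exp (E * norm \<zeta>))"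
      using order.trans[OF C(2) mult_left_mono[OF g(1)]] order.trans[OF D(2) mult_left_mono[OF g(2)]] C(1) D(1)
        by auto
    have "norm (complex_of_real r * a \<zeta> + complex_of_real s * b \<zeta>) \<le> \<bar>r\<bar> * norm (a \<zeta>) + \<bar>s\<bar> * norm (b \<zeta>)"
      by (rule order.trans[OF norm_triangle_ineq]) (simp add: norm_mult)
    also have "\<dots> \<le> \<bar>r\<bar> * (C * (g \<zeta> * exp (E * norm \<zeta>))) + \<bar>s\<bar> * (D * (g \<zeta> * exp (E * norm \<zeta>)))"
      by (intro add_mono mult_left_mono ab abs_ge_zero)
    also have "\<dots> = (\<bar>r\<bar> * C + \<bar>s\<bar> * D) * (g \<zeta> * exp (E * norm \<zeta>))" by (simp add: algebra_simps)
    also have "\<dots> \<le> E * (g \<zeta> * exp (E * norm \<zeta>))" using E assms(3) by (intro mult_right_mono) auto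
    finally show ?thesis .
  qed
  then show ?thesis by blast
qed

lemma adm0_lincomb:
  assumes "adm0 a" "adm0 b"
  shows "adm0 (\<lambda>\<zeta>. complex_of_real r * a \<zeta> + complex_of_real s * b \<zeta>)"
  using assms exp_bound_lincomb[of a norm b r s] unfolding adm0_def
  by (auto intro!: continuous_intros)

lemma adm_heat_symbol:
  fixes a :: "'a::euclidean_space \<Rightarrow> complex"
  assumes d: "DIM('a) \<ge> 2" and a: "adm a" and t: "t > 0"
  shows adm_heat_symbol_integrable: "integrable lborel (\<lambda>\<zeta>. a \<zeta> * complex_of_real (heat_symbol t \<zeta>))"
    and adm_heat_symbol_bounded: "\<exists>B. \<forall>\<zeta>. norm (a \<zeta> * complex_of_real (heat_symbol t \<zeta>)) \<le> B"
proof -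
  obtain C where C: "C > 0" "\<And>\<zeta>. norm (a \<zeta>) \<le> C * exp (C * norm \<zeta>)" using admE[OF a] by metis
  obtain D A where DA: "D > 0" "A > 0" "\<And>\<zeta>::'a. exp (C * norm \<zeta>) * heat_symbol t \<zeta> \<le> D * exp (- A * (norm \<zeta>)\<^sup>2)"
    using exp_heat_symbol_bound[OF d t, of C] by metis
  have [measurable]: "a \<in> borel_measurable borel" using a by measurable
  have bd: "norm (a \<zeta> * complex_of_real (heat_symbol t \<zeta>)) \<le> C * (D * exp (- A * (norm \<zeta>)\<^sup>2))" for \<zeta>
  proof -
    have "norm (a \<zeta> * complex_of_real (heat_symbol t \<zeta>)) \<le> C * exp (C * norm \<zeta>) * heat_symbol t \<zeta>"
      using C(2)[of \<zeta>] heat_symbol_pos[of t \<zeta>] by (simp add: norm_mult mult_right_mono)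
    also have "\<dots> \<le> C * (D * exp (- A * (norm \<zeta>)\<^sup>2))" using DA(3)[of \<zeta>] C(1) by (simp add: mult.assoc)
    finally show ?thesis .
  qed
  show "integrable lborel (\<lambda>\<zeta>. a \<zeta> * complex_of_real (heat_symbol t \<zeta>))"
  proof (rule Bochner_Integration.integrable_bound)
    show "integrable lborel (\<lambda>\<zeta>::'a. C * (D * exp (- A * (norm \<zeta>)\<^sup>2)))"
      by (intro integrable_mult_right gaussian_fourier(1) DA(2))
    show "AE \<zeta> in lborel. norm (a \<zeta> * complex_of_real (heat_symbol t \<zeta>)) \<le> norm (C * (D * exp (- A * (norm \<zeta>)\<^sup>2)))"
      by (intro AE_I2 order.trans[OF bd]) (simp only: real_norm_def abs_ge_self)
  qed measurable
  show "\<exists>B. \<forall>\<zeta>. norm (a \<zeta> * complex_of_real (heat_symbol t \<zeta>)) \<le> B"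
  proof (intro exI allI)
    fix \<zeta> :: 'a
    have "C * (D * exp (- A * (norm \<zeta>)\<^sup>2)) \<le> C * (D * 1)"
      using C(1) DA by (intro mult_left_mono) auto
    with bd[of \<zeta>] show "norm (a \<zeta> * complex_of_real (heat_symbol t \<zeta>)) \<le> C * (D * 1)" by linarith
  qed
qed

text \<open>Reflecting the variable of integration conjugates the integral.\<close>

lemma fourier_hermitian_real:
  assumes [measurable]: "m \<in> borel_measurable borel" and h: "\<And>\<zeta>. m (- \<zeta>) = cnj (m \<zeta>)"
  shows "Im (fourier m x) = 0"
proof -
  have "fourier m x = (LINT \<zeta>|lborel. m (- \<zeta>) * cis (2 * pi * (x \<bullet> (- \<zeta>))))"
    unfolding fourier_def by (subst integral_lborel_scale_shift[where c="-1" and t=0]) auto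
  also have "\<dots> = (LINT \<zeta>|lborel. cnj (m \<zeta> * cis (2 * pi * (x \<bullet> \<zeta>))))"
    by (simp add: h cis_cnj)
  also have "\<dots> = cnj (fourier m x)"
    unfolding fourier_def by (rule Bochner_Integration.integral_cnj)
  finally have "Im (fourier m x) = Im (cnj (fourier m x))" by (rule arg_cong)
  then show ?thesis by simp
qed

lemma fourier_reflect:
  assumes [measurable]: "m \<in> borel_measurable borel"
  shows "fourier (\<lambda>\<zeta>. m (- \<zeta>)) x = fourier m (- x)"
  unfolding fourier_def
  by (subst (2) integral_lborel_scale_shift[where c="-1" and t=0]) auto

text \<open>The integrand whose white noise integral realizes the symbol \<open>a\<close>. Time t /
  2 makes the square of the symbol equal to \<open>heat_symbol t\<close>, and the reflected point -
  x turns the character of y into the kernel centred at y, see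
  \<open>Phi_heat_kernel\<close>.\<close>

definition Phi :: "real set \<Rightarrow> ('a::euclidean_space \<Rightarrow> complex) \<Rightarrow> 'a \<times> real \<Rightarrow> real" where
  "Phi I a = (\<lambda>(x, t). indicator I t * Re (fourier (\<lambda>\<zeta>. a \<zeta> * complex_of_real (heat_symbol (t / 2) \<zeta>)) (- x)))"

text \<open>The variance of the white noise integral of \<open>Phi I a\<close>, by
  \<open>Phi_norm\<close>. Values in \<open>ennreal\<close> leave room for divergence, which occurs
  for a character over a half-line of times.\<close>

definition energy :: "real set \<Rightarrow> ('a::euclidean_space \<Rightarrow> complex) \<Rightarrow> ennreal" where
  "energy I a = (\<integral>\<^sup>+t. (\<integral>\<^sup>+\<zeta>. ennreal ((norm (a \<zeta>))\<^sup>2 * heat_symbol t \<zeta>) \<partial>lborel) * indicator I t \<partial>lborel)"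

lemma Phi_heat_kernel:
  "Phi I (\<lambda>\<zeta>. cis (2 * pi * (y \<bullet> \<zeta>))) = (\<lambda>(x, t). indicator I t * frac_heat_kernel (t / 2) (x - y))"
proof -
  have "fourier (\<lambda>\<zeta>. cis (2 * pi * (y \<bullet> \<zeta>)) * complex_of_real (heat_symbol t \<zeta>)) (- x)
    = fourier (\<lambda>\<zeta>. complex_of_real (heat_symbol t \<zeta>)) (x - y)" for x t
  proof -
    have "fourier (\<lambda>\<zeta>. cis (2 * pi * (y \<bullet> \<zeta>)) * complex_of_real (heat_symbol t \<zeta>)) (- x)
      = fourier (\<lambda>\<zeta>. complex_of_real (heat_symbol t \<zeta>)) (- (x - y))"
    proof -
      have "cis (2 * pi * (- (x - y) \<bullet> \<zeta>)) = cis (2 * pi * (y \<bullet> \<zeta>)) * cis (2 * pi * (- x \<bullet> \<zeta>))" for \<zeta>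
        by (simp add: cis_mult inner_diff_left algebra_simps)
      then show ?thesis unfolding fourier_def
        by (intro Bochner_Integration.integral_cong refl) (simp only: mult_ac)
    qed
    also have "\<dots> = fourier (\<lambda>\<zeta>. complex_of_real (heat_symbol t (- \<zeta>))) (x - y)"
      by (subst fourier_reflect) auto
    finally show ?thesis by (simp add: heat_symbol_even)
  qed
  then show ?thesis by (simp add: Phi_def heat_kernel_fourier)
qed

lemma Phi_lincomb:
  fixes a b :: "'a::euclidean_space \<Rightarrow> complex"
  assumes d: "DIM('a) \<ge> 2" and a: "adm a" and b: "adm b" and I: "I \<subseteq> {0<..}"
  shows "Phi I (\<lambda>\<zeta>. complex_of_real r * a \<zeta> + complex_of_real s * b \<zeta>) = (\<lambda>z. r * Phi I a z + s * Phi I b z)"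
proof
  fix z :: "'a \<times> real"
  obtain x t where z: "z = (x, t)" by force
  show "Phi I (\<lambda>\<zeta>. complex_of_real r * a \<zeta> + complex_of_real s * b \<zeta>) z = r * Phi I a z + s * Phi I b z"
  proof (cases "t \<in> I")
    case True
    then have t: "t / 2 > 0" using I by auto
    note i = integrable_fourier_kernel[OF adm_heat_symbol_integrable[OF d a t], of "- x"]
      integrable_fourier_kernel[OF adm_heat_symbol_integrable[OF d b t], of "- x"]
    have "fourier (\<lambda>\<zeta>. (complex_of_real r * a \<zeta> + complex_of_real s * b \<zeta>) * complex_of_real (heat_symbol (t / 2) \<zeta>))
      (- x) =
       (LINT \<zeta>|lborel. complex_of_real r * (a \<zeta> * complex_of_real (heat_symbol (t / 2) \<zeta>) * cis (2 * pi * (- x \<bullet> \<zeta>)))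
         + complex_of_real s * (b \<zeta> * complex_of_real (heat_symbol (t / 2) \<zeta>) * cis (2 * pi * (- x \<bullet> \<zeta>))))"
      unfolding fourier_def by (intro Bochner_Integration.integral_cong refl) (simp add: algebra_simps)
    also have "\<dots> = complex_of_real r * fourier (\<lambda>\<zeta>. a \<zeta> * complex_of_real (heat_symbol (t / 2) \<zeta>)) (- x)
      + complex_of_real s * fourier (\<lambda>\<zeta>. b \<zeta> * complex_of_real (heat_symbol (t / 2) \<zeta>)) (- x)"
      unfolding fourier_def by (subst Bochner_Integration.integral_add) (use i in auto)
    finally show ?thesis by (simp add: Phi_def z True)
  qed (simp add: Phi_def z)
qed

text \<open>\<open>spacetime\<close> restricts time to the half-line; the identity transfers
  measurability from the full product space.\<close>

lemma measurable_spacetime_id: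
  "(\<lambda>z. z) \<in> measurable (spacetime :: ('a::euclidean_space \<times> real) measure) (borel \<Otimes>\<^sub>M borel)"
proof -
  let ?S = "spacetime :: ('a \<times> real) measure"
  have "snd \<in> measurable ?S (restrict_space lborel {0..})" unfolding spacetime_def by (rule measurable_snd)
  then have "snd \<in> measurable ?S borel" unfolding measurable_restrict_space2_iff by simp
  moreover have "fst \<in> measurable ?S borel" unfolding spacetime_def by simp
  ultimately have "(\<lambda>z. (fst z, snd z)) \<in> measurable ?S (borel \<Otimes>\<^sub>M borel)" by (intro measurable_Pair)
  then show ?thesis by simp
qed

lemma Phi_measurable:
  assumes [measurable]: "a \<in> borel_measurable borel" "I \<in> sets borel"
  shows "Phi I a \<in> borel_measurable (borel \<Otimes>\<^sub>M borel)" "Phi I a \<in> borel_measurable spacetime"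
proof -
  have "(\<lambda>(x, t). fourier (\<lambda>\<zeta>. a \<zeta> * complex_of_real (heat_symbol (t / 2) \<zeta>)) (- x))
    \<in> borel_measurable (borel \<Otimes>\<^sub>M borel)"
    unfolding fourier_def case_prod_beta' by (rule lborel.borel_measurable_lebesgue_integral) measurable
  then show 1: "Phi I a \<in> borel_measurable (borel \<Otimes>\<^sub>M borel)"
    unfolding Phi_def case_prod_beta' by measurable
  show "Phi I a \<in> borel_measurable spacetime"
    using measurable_compose[OF measurable_spacetime_id 1] by simp
qed

lemma Phi_norm:
  fixes a :: "'a::euclidean_space \<Rightarrow> complex"
  assumes d: "DIM('a) \<ge> 2" and a: "adm a" and I[measurable]: "I \<in> sets borel" and I0: "I \<subseteq> {0<..}"
  shows "(\<integral>\<^sup>+z. ennreal ((Phi I a z)\<^sup>2) \<partial>spacetime) = energy I a"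
proof -
  have [measurable]: "a \<in> borel_measurable borel" using a by measurable
  interpret R: sigma_finite_measure "restrict_space lborel {0::real..}"
    by (rule sigma_finite_measure_restrict_space) (auto intro: lborel.sigma_finite_measure_axioms)
  interpret P: pair_sigma_finite "lborel :: 'a measure" "restrict_space lborel {0::real..}" ..
  have m: "(\<lambda>z. ennreal ((Phi I a z)\<^sup>2)) \<in> borel_measurable spacetime"
    using Phi_measurable(2)[OF _ I, of a] by measurable
  have "(\<integral>\<^sup>+z. ennreal ((Phi I a z)\<^sup>2) \<partial>spacetime)
    = (\<integral>\<^sup>+t. \<integral>\<^sup>+x. ennreal ((Phi I a (x, t))\<^sup>2) \<partial>lborel \<partial>restrict_space lborel {0..})"
    unfolding spacetime_def using m by (subst P.nn_integral_snd[symmetric]) (auto simp: spacetime_def)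
  also have "\<dots> = (\<integral>\<^sup>+t. (\<integral>\<^sup>+x. ennreal ((Phi I a (x, t))\<^sup>2) \<partial>lborel) * indicator {0..} t \<partial>lborel)"
    by (rule nn_integral_restrict_space) simp
  also have "\<dots> = energy I a"
    unfolding energy_def
  proof (intro nn_integral_cong)
    fix t :: real
    show "(\<integral>\<^sup>+x. ennreal ((Phi I a (x, t))\<^sup>2) \<partial>lborel) * indicator {0..} t
      = (\<integral>\<^sup>+\<zeta>. ennreal ((norm (a \<zeta>))\<^sup>2 * heat_symbol t \<zeta>) \<partial>lborel) * indicator I t"
    proof (cases "t \<in> I")
      case True
      then have t: "t / 2 > 0" using I0 by auto
      let ?m = "\<lambda>\<zeta>. a \<zeta> * complex_of_real (heat_symbol (t / 2) \<zeta>)"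
      have mi: "integrable lborel ?m" by (rule adm_heat_symbol_integrable[OF d a t])
      have [measurable]: "fourier ?m \<in> borel_measurable borel" using mi by measurable
      obtain B where B: "\<And>\<zeta>. norm (?m \<zeta>) \<le> B" using adm_heat_symbol_bounded[OF d a t] by blast
      have cont: "continuous_on UNIV ?m" using a unfolding adm_def by (intro continuous_intros) auto
      have Im0: "Im (fourier ?m x) = 0" for x
        by (rule fourier_hermitian_real) (use a in \<open>auto simp: adm_def heat_symbol_even\<close>)
      have "(\<integral>\<^sup>+x. ennreal ((Phi I a (x, t))\<^sup>2) \<partial>lborel) = (\<integral>\<^sup>+x. ennreal ((norm (fourier ?m (- x)))\<^sup>2) \<partial>lborel)"
        using True by (simp add: Phi_def cmod_power2 Im0)
      also have "\<dots> = (\<integral>\<^sup>+x. ennreal ((norm (fourier ?m x))\<^sup>2) \<partial>lborel)"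
        by (subst (2) nn_integral_lborel_scale_shift[where c="-1" and t=0]) auto
      also have "\<dots> = (\<integral>\<^sup>+\<zeta>. ennreal ((norm (?m \<zeta>))\<^sup>2) \<partial>lborel)"
        by (rule plancherel[OF mi cont B])
      also have "\<dots> = (\<integral>\<^sup>+\<zeta>. ennreal ((norm (a \<zeta>))\<^sup>2 * heat_symbol t \<zeta>) \<partial>lborel)"
      proof (intro nn_integral_cong arg_cong[where f=ennreal])
        fix \<zeta> :: 'a
        have "heat_symbol t \<zeta> = (heat_symbol (t / 2) \<zeta>)\<^sup>2" using heat_symbol_add[of "t / 2" "t / 2" \<zeta>]
          by (simp add: power2_eq_square)
        then show "(norm (?m \<zeta>))\<^sup>2 = (norm (a \<zeta>))\<^sup>2 * heat_symbol t \<zeta>" by (simp add: norm_mult power_mult_distrib)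
      qed
      finally show ?thesis using True I0 by auto
    qed (simp add: Phi_def)
  qed
  finally show ?thesis .
qed

lemma energy_mono:
  fixes a b :: "'a::euclidean_space \<Rightarrow> complex"
  assumes "I \<subseteq> J" "\<And>\<zeta>. (norm (a \<zeta>))\<^sup>2 \<le> c * (norm (b \<zeta>))\<^sup>2" "c \<ge> 0"
    and [measurable]: "b \<in> borel_measurable borel" "J \<in> sets borel"
  shows "energy I a \<le> ennreal c * energy J b"
proof -
  have "energy I a \<le> (\<integral>\<^sup>+t. ennreal c * ((\<integral>\<^sup>+\<zeta>. ennreal ((norm (b \<zeta>))\<^sup>2 * heat_symbol t \<zeta>) \<partial>lborel) * indicator J t)
    \<partial>lborel)"
    unfolding energy_def
  proof (intro nn_integral_mono)
    fix t
    have "(\<integral>\<^sup>+\<zeta>. ennreal ((norm (a \<zeta>))\<^sup>2 * heat_symbol t \<zeta>) \<partial>lborel)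
      \<le> (\<integral>\<^sup>+\<zeta>. ennreal c * ennreal ((norm (b \<zeta>))\<^sup>2 * heat_symbol t \<zeta>) \<partial>lborel)"
    proof (intro nn_integral_mono)
      fix \<zeta> :: 'a
      have "(norm (a \<zeta>))\<^sup>2 * heat_symbol t \<zeta> \<le> c * (norm (b \<zeta>))\<^sup>2 * heat_symbol t \<zeta>"
        using assms(2) heat_symbol_pos[of t \<zeta>] by (intro mult_right_mono) auto
      then show "ennreal ((norm (a \<zeta>))\<^sup>2 * heat_symbol t \<zeta>) \<le> ennreal c * ennreal ((norm (b \<zeta>))\<^sup>2 * heat_symbol t \<zeta>)"
        using assms(3) heat_symbol_pos[of t \<zeta>] by (simp add: ennreal_mult[symmetric] mult.assoc ennreal_leI)
    qed
    also have "\<dots> = ennreal c * (\<integral>\<^sup>+\<zeta>. ennreal ((norm (b \<zeta>))\<^sup>2 * heat_symbol t \<zeta>) \<partial>lborel)"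
      by (rule nn_integral_cmult) measurable
    finally show "(\<integral>\<^sup>+\<zeta>. ennreal ((norm (a \<zeta>))\<^sup>2 * heat_symbol t \<zeta>) \<partial>lborel) * indicator I t
      \<le> ennreal c * ((\<integral>\<^sup>+\<zeta>. ennreal ((norm (b \<zeta>))\<^sup>2 * heat_symbol t \<zeta>) \<partial>lborel) * indicator J t)"
      using assms(1) by (auto simp: indicator_def)
  qed
  also have "\<dots> = ennreal c * energy J b"
    unfolding energy_def by (rule nn_integral_cmult) measurable
  finally show ?thesis .
qed


lemma nn_integral_heat_symbol_1_finite:
  assumes d: "DIM('a::euclidean_space) \<ge> 2"
  shows "(\<integral>\<^sup>+\<zeta>. ennreal ((norm \<zeta>)\<^sup>2 * heat_symbol 1 (\<zeta>::'a)) \<partial>lborel) < \<infinity>"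
proof -
  obtain D A where DA: "D > 0" "A > 0" "\<And>\<zeta>::'a. exp (2 * norm \<zeta>) * heat_symbol 1 \<zeta> \<le> D * exp (- A * (norm \<zeta>)\<^sup>2)"
    using exp_heat_symbol_bound[OF d zero_less_one, of 2] by metis
  have "(norm \<zeta>)\<^sup>2 * heat_symbol 1 \<zeta> \<le> D * exp (- A * (norm \<zeta>)\<^sup>2)" for \<zeta> :: 'a
  proof -
    have "(norm \<zeta>)\<^sup>2 \<le> (exp (norm \<zeta>))\<^sup>2" by (intro power_mono norm_le_exp) auto
    also have "\<dots> = exp (2 * norm \<zeta>)" by (simp add: exp_double)
    finally have "(norm \<zeta>)\<^sup>2 * heat_symbol 1 \<zeta> \<le> exp (2 * norm \<zeta>) * heat_symbol 1 \<zeta>"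
      using heat_symbol_pos[of 1 \<zeta>] by (intro mult_right_mono) auto
    with DA(3)[of \<zeta>] show ?thesis by linarith
  qed
  then have "(\<integral>\<^sup>+\<zeta>. ennreal ((norm \<zeta>)\<^sup>2 * heat_symbol 1 (\<zeta>::'a)) \<partial>lborel)
    \<le> (\<integral>\<^sup>+\<zeta>. ennreal (D * exp (- A * (norm (\<zeta>::'a))\<^sup>2)) \<partial>lborel)"
    by (intro nn_integral_mono ennreal_leI)
  also have "\<dots> = ennreal (LINT \<zeta>|lborel. D * exp (- A * (norm (\<zeta>::'a))\<^sup>2))"
    using DA by (intro nn_integral_eq_integral integrable_mult_right gaussian_fourier(1)) auto
  also have "\<dots> < \<infinity>" by simp
  finally show ?thesis .
qed

text \<open>Dilating by c = t powr (- 1 / d) turns \<open>heat_symbol t\<close> into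
  \<open>heat_symbol 1\<close>. The Jacobian contributes c^d = 1 / t and the weight contributes c^2;
  this extra decay makes the result integrable at large times.\<close>

lemma nn_integral_heat_symbol_scale:
  fixes t :: real
  assumes t: "t > 0"
  shows "(\<integral>\<^sup>+\<zeta>. ennreal ((norm \<zeta>)\<^sup>2 * heat_symbol t (\<zeta>::'a::euclidean_space)) \<partial>lborel) =
    ennreal (t powr (- 1 - 2 / DIM('a))) * (\<integral>\<^sup>+\<zeta>. ennreal ((norm \<zeta>)\<^sup>2 * heat_symbol 1 (\<zeta>::'a)) \<partial>lborel)"
proof -
  define c where "c = t powr (- 1 / DIM('a))"
  have c: "c > 0" using t by (simp add: c_def)
  have cd: "c ^ DIM('a) = 1 / t"
    using t c by (simp add: c_def powr_realpow[symmetric] powr_powr powr_neg_one)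
  have c2: "c\<^sup>2 = t powr (- 2 / DIM('a))"
    using t by (simp add: c_def powr_powr flip: powr_numeral)
  have e: "(norm (0 + c *\<^sub>R u))\<^sup>2 * heat_symbol t (0 + c *\<^sub>R u) = c\<^sup>2 * ((norm u)\<^sup>2 * heat_symbol 1 u)" for u :: 'a
    using t c by (simp add: heat_symbol_def power_mult_distrib cd)
  have "(\<integral>\<^sup>+\<zeta>. ennreal ((norm \<zeta>)\<^sup>2 * heat_symbol t (\<zeta>::'a)) \<partial>lborel)
    = ennreal (\<bar>c\<bar> ^ DIM('a)) * (\<integral>\<^sup>+u. ennreal (c\<^sup>2 * ((norm u)\<^sup>2 * heat_symbol 1 (u::'a))) \<partial>lborel)"
  proof -
    have m: "(\<lambda>\<zeta>::'a. ennreal ((norm \<zeta>)\<^sup>2 * heat_symbol t \<zeta>)) \<in> borel_measurable borel" by measurable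
    show ?thesis
      using nn_integral_lborel_scale_shift[OF less_imp_neq[OF c, symmetric] m, of 0] by (simp only: e)
  qed
  also have "(\<integral>\<^sup>+u. ennreal (c\<^sup>2 * ((norm u)\<^sup>2 * heat_symbol 1 (u::'a))) \<partial>lborel)
    = ennreal (c\<^sup>2) * (\<integral>\<^sup>+u. ennreal ((norm u)\<^sup>2 * heat_symbol 1 (u::'a)) \<partial>lborel)"
    by (subst nn_integral_cmult[symmetric]) (auto simp: ennreal_mult')
  also have "ennreal (\<bar>c\<bar> ^ DIM('a)) * (ennreal (c\<^sup>2) * (\<integral>\<^sup>+u. ennreal ((norm u)\<^sup>2 * heat_symbol 1 (u::'a)) \<partial>lborel))
    = ennreal (c ^ DIM('a) * c\<^sup>2) * (\<integral>\<^sup>+u. ennreal ((norm u)\<^sup>2 * heat_symbol 1 (u::'a)) \<partial>lborel)"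
    using c by (simp add: ennreal_mult' mult.assoc)
  also have "c ^ DIM('a) * c\<^sup>2 = t powr (- 1 - 2 / DIM('a))"
    unfolding cd c2 using t by (simp add: powr_diff powr_minus_divide)
  finally show ?thesis .
qed

text \<open>For t \<ge> T0 part of the symbol, \<open>heat_symbol (T0 / 2)\<close>, absorbs the
  exponential growth of \<open>a\<close>, while \<open>heat_symbol (t / 2)\<close> integrates the
  remaining norm \<zeta> squared. By scaling this has order t^(-1-2/d), and its integral from T on
  has order T^(-2/d).\<close>

lemma energy_tail:
  fixes a :: "'a::euclidean_space \<Rightarrow> complex"
  assumes d: "DIM('a) \<ge> 2" and a: "adm0 a" and T0: "T0 > 0"
  shows "\<exists>D. \<forall>T\<ge>T0. energy {T..} a \<le> ennreal (D * T powr (- 2 / DIM('a)))"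
proof -
  obtain C where C: "C > 0" "\<And>\<zeta>. norm (a \<zeta>) \<le> C * (norm \<zeta> * exp (C * norm \<zeta>))" using adm0E[OF a] by metis
  \<comment> \<open>The rate is 2 C because the bound on \<open>a\<close> gets squared.\<close>
  obtain D A where DA: "D > 0" "A > 0" "\<And>\<zeta>::'a. exp (2 * C * norm \<zeta>) * heat_symbol (T0 / 2) \<zeta>
    \<le> D * exp (- A * (norm \<zeta>)\<^sup>2)"
    using exp_heat_symbol_bound[OF d, of "T0 / 2" "2 * C"] T0 by auto
  define J where "J = enn2real (\<integral>\<^sup>+\<zeta>. ennreal ((norm \<zeta>)\<^sup>2 * heat_symbol 1 (\<zeta>::'a)) \<partial>lborel)"
  have J: "(\<integral>\<^sup>+\<zeta>. ennreal ((norm \<zeta>)\<^sup>2 * heat_symbol 1 (\<zeta>::'a)) \<partial>lborel) = ennreal J" "J \<ge> 0"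
    using nn_integral_heat_symbol_1_finite[OF d] by (auto simp: J_def)
  let ?e = "- 1 - 2 / real DIM('a)"
  \<comment> \<open>The power of 1 / 2 comes from evaluating the scaling law at t / 2.\<close>
  define E where "E = C\<^sup>2 * D * J * (1 / 2) powr ?e"
  have E: "E \<ge> 0" using DA J by (simp add: E_def)
  have pt: "(\<integral>\<^sup>+\<zeta>. ennreal ((norm (a \<zeta>))\<^sup>2 * heat_symbol t \<zeta>) \<partial>lborel) \<le> ennreal (E * t powr ?e)" if t: "t \<ge> T0" for t
  proof -
    have "(norm (a \<zeta>))\<^sup>2 * heat_symbol t \<zeta> \<le> C\<^sup>2 * D * ((norm \<zeta>)\<^sup>2 * heat_symbol (t / 2) \<zeta>)" for \<zeta>
    proof -
      have "(norm (a \<zeta>))\<^sup>2 \<le> (C * (norm \<zeta> * exp (C * norm \<zeta>)))\<^sup>2" by (intro power_mono C) auto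
      also have "\<dots> = C\<^sup>2 * (norm \<zeta>)\<^sup>2 * exp (2 * C * norm \<zeta>)"
        by (simp add: power_mult_distrib exp_double[symmetric] mult_ac)
      finally have 1: "(norm (a \<zeta>))\<^sup>2 * heat_symbol t \<zeta> \<le> C\<^sup>2 * (norm \<zeta>)\<^sup>2 * exp (2 * C * norm \<zeta>) * heat_symbol t \<zeta>"
        using heat_symbol_pos[of t \<zeta>] by (intro mult_right_mono) auto
      have "heat_symbol t \<zeta> \<le> heat_symbol (T0 / 2) \<zeta> * heat_symbol (t / 2) \<zeta>"
        unfolding heat_symbol_add[symmetric] using t by (intro heat_symbol_antimono) (simp add: field_simps)
      then have "exp (2 * C * norm \<zeta>) * heat_symbol t \<zeta>
        \<le> exp (2 * C * norm \<zeta>) * (heat_symbol (T0 / 2) \<zeta> * heat_symbol (t / 2) \<zeta>)"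
        by (intro mult_left_mono) auto
      also have "\<dots> \<le> D * exp (- A * (norm \<zeta>)\<^sup>2) * heat_symbol (t / 2) \<zeta>"
        unfolding mult.assoc[symmetric] using DA(3)[of \<zeta>] heat_symbol_pos[of "t / 2" \<zeta>]
          by (intro mult_right_mono) auto
      also have "\<dots> \<le> D * 1 * heat_symbol (t / 2) \<zeta>"
        using DA heat_symbol_pos[of "t / 2" \<zeta>] by (intro mult_right_mono mult_left_mono) auto
      finally have "C\<^sup>2 * (norm \<zeta>)\<^sup>2 * (exp (2 * C * norm \<zeta>) * heat_symbol t \<zeta>)
        \<le> C\<^sup>2 * (norm \<zeta>)\<^sup>2 * (D * 1 * heat_symbol (t / 2) \<zeta>)"
        by (intro mult_left_mono) auto
      with 1 show ?thesis by (simp add: mult_ac)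
    qed
    then have "(\<integral>\<^sup>+\<zeta>. ennreal ((norm (a \<zeta>))\<^sup>2 * heat_symbol t \<zeta>) \<partial>lborel)
      \<le> (\<integral>\<^sup>+\<zeta>. ennreal (C\<^sup>2 * D) * ennreal ((norm \<zeta>)\<^sup>2 * heat_symbol (t / 2) (\<zeta>::'a)) \<partial>lborel)"
      using DA(1) by (intro nn_integral_mono) (simp add: ennreal_mult'[symmetric] ennreal_leI)
    also have "\<dots> = ennreal (C\<^sup>2 * D) * (ennreal ((t / 2) powr ?e) * ennreal J)"
      using t T0 by (subst nn_integral_cmult) (auto simp: nn_integral_heat_symbol_scale J)
    also have "\<dots> = ennreal (C\<^sup>2 * D * ((t / 2) powr ?e * J))"
      using DA J by (simp add: ennreal_mult)
    also have "(t / 2) powr ?e = (1 / 2) powr ?e * t powr ?e" using t T0 by (subst powr_mult[symmetric]) auto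
    finally show ?thesis by (simp add: E_def mult_ac)
  qed
  have "energy {T..} a \<le> ennreal (E * (DIM('a) / 2) * T powr (- 2 / DIM('a)))" if T: "T \<ge> T0" for T
  proof -
    have T': "T > 0" using T T0 by simp
    have "energy {T..} a \<le> (\<integral>\<^sup>+t. ennreal (E * t powr ?e) * indicator {T..} t \<partial>lborel)"
      unfolding energy_def using pt T by (intro nn_integral_mono) (auto simp: indicator_def)
    also have "\<dots> = ennreal (0 - (- (E * (DIM('a) / 2) * T powr (- 2 / DIM('a)))))"
    proof (rule nn_integral_FTC_atLeast)
      let ?F = "\<lambda>t. - (E * (real DIM('a) / 2) * t powr (- 2 / DIM('a)))"
      show "DERIV ?F t :> E * t powr ?e" if "T \<le> t" for t
      proof -
        have "DERIV ?F t :> - (E * (real DIM('a) / 2) * ((- 2 / real DIM('a)) * t powr (- 2 / real DIM('a) - 1)))"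
          using that T' by (intro DERIV_minus DERIV_cmult has_real_derivative_powr) auto
        moreover have "- (E * (real DIM('a) / 2) * ((- 2 / real DIM('a)) * t powr (- 2 / real DIM('a) - 1)))
          = E * t powr ?e"
        proof -
          have e: "- 2 / real DIM('a) - 1 = ?e" by simp
          show ?thesis unfolding e by simp
        qed
        ultimately show ?thesis by (rule DERIV_cong)
      qed
      show "(?F \<longlongrightarrow> 0) at_top"
        using tendsto_mult_right_zero[OF tendsto_neg_powr[OF _ filterlim_ident], of "- 2 / DIM('a)" "E
          * (real DIM('a) / 2)"]
          tendsto_minus[of _ 0] by fastforce
    qed (use E in auto)
    finally show ?thesis by simp
  qed
  then show ?thesis by blast
qed

lemma energy_finite:
  fixes a :: "'a::euclidean_space \<Rightarrow> complex"
  assumes d: "DIM('a) \<ge> 2" and a: "adm0 a" and T0: "T0 > 0" and I: "I \<subseteq> {T0..}"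
  shows "energy I a < \<infinity>"
proof -
  have [measurable]: "a \<in> borel_measurable borel" using adm0_adm[OF a] by measurable
  obtain D where "energy {T0..} a \<le> ennreal D" using energy_tail[OF d a T0] by blast
  moreover have "energy I a \<le> ennreal 1 * energy {T0..} a" by (rule energy_mono[OF I]) auto
  ultimately have "energy I a \<le> ennreal D" by simp
  then show ?thesis by (rule order.strict_trans1) simp
qed

text \<open>A character does not vanish at the origin, so its energy is controlled through the
  length of a bounded time interval instead of through \<open>energy_tail\<close>.\<close>

lemma energy_finite_bounded:
  fixes a :: "'a::euclidean_space \<Rightarrow> complex"
  assumes d: "DIM('a) \<ge> 2" and a: "adm a" and T0: "T0 > 0" and I: "I \<subseteq> {T0..T1}"
  shows "energy I a < \<infinity>"
proof -
  have [measurable]: "a \<in> borel_measurable borel" using a by measurable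
  have i: "integrable lborel (\<lambda>\<zeta>. a \<zeta> * complex_of_real (heat_symbol (T0 / 2) \<zeta>))"
    and b: "\<exists>B. \<forall>\<zeta>. norm (a \<zeta> * complex_of_real (heat_symbol (T0 / 2) \<zeta>)) \<le> B"
    using adm_heat_symbol_integrable[OF d a, of "T0 / 2"] adm_heat_symbol_bounded[OF d a, of "T0 / 2"] T0 by auto
  obtain B where B: "\<And>\<zeta>. norm (a \<zeta> * complex_of_real (heat_symbol (T0 / 2) \<zeta>)) \<le> B" using b by blast
  let ?J = "\<integral>\<^sup>+\<zeta>. ennreal ((norm (a \<zeta>))\<^sup>2 * heat_symbol T0 \<zeta>) \<partial>lborel"
  have "?J \<le> (\<integral>\<^sup>+\<zeta>. ennreal (B * norm (a \<zeta> * complex_of_real (heat_symbol (T0 / 2) \<zeta>))) \<partial>lborel)"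
  proof (intro nn_integral_mono ennreal_leI)
    fix \<zeta> :: 'a
    have "(norm (a \<zeta>))\<^sup>2 * heat_symbol T0 \<zeta> = norm (a \<zeta> * complex_of_real (heat_symbol (T0 / 2) \<zeta>))
      * norm (a \<zeta> * complex_of_real (heat_symbol (T0 / 2) \<zeta>))"
      using heat_symbol_add[of "T0 / 2" "T0 / 2" \<zeta>] heat_symbol_pos[of "T0 / 2" \<zeta>]
        by (simp add: norm_mult power2_eq_square)
    also have "\<dots> \<le> B * norm (a \<zeta> * complex_of_real (heat_symbol (T0 / 2) \<zeta>))" by (intro mult_right_mono B) auto
    finally show "(norm (a \<zeta>))\<^sup>2 * heat_symbol T0 \<zeta> \<le> B * norm (a \<zeta> * complex_of_real (heat_symbol (T0 / 2) \<zeta>))" .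
  qed
  also have "\<dots> = ennreal (LINT \<zeta>|lborel. B * norm (a \<zeta> * complex_of_real (heat_symbol (T0 / 2) \<zeta>)))"
    using order.trans[OF norm_ge_zero B] by (intro nn_integral_eq_integral integrable_mult_right integrable_norm i)
      auto
  finally have J: "?J < \<infinity>" by (rule order.strict_trans1) simp
  have "energy I a \<le> (\<integral>\<^sup>+t. ?J * indicator {T0..T1} t \<partial>lborel)"
    unfolding energy_def
  proof (intro nn_integral_mono)
    fix t
    have "(\<integral>\<^sup>+\<zeta>. ennreal ((norm (a \<zeta>))\<^sup>2 * heat_symbol t \<zeta>) \<partial>lborel) \<le> ?J" if "t \<ge> T0"
      using that by (intro nn_integral_mono ennreal_leI mult_left_mono heat_symbol_antimono) auto
    then show "(\<integral>\<^sup>+\<zeta>. ennreal ((norm (a \<zeta>))\<^sup>2 * heat_symbol t \<zeta>) \<partial>lborel) * indicator I t \<le> ?J * indicator {T0..T1} t"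
      using I by (auto simp: indicator_def)
  qed
  also have "\<dots> = ?J * emeasure lborel {T0..T1}" by (rule nn_integral_cmult_indicator) auto
  also have "\<dots> < \<infinity>" using J by (simp add: ennreal_mult_less_top emeasure_lborel_Icc_eq)
  finally show ?thesis .
qed

text \<open>Each frequency is integrated against exp (- k t) with k = (2 pi)^d norm \<zeta>^d; the
  resulting 1 / k is the source of the power (2 pi)^d in
  \<open>white_noise_normalization\<close>.\<close>

lemma energy_Ioi:
  fixes a :: "'a::euclidean_space \<Rightarrow> complex"
  assumes [measurable]: "a \<in> borel_measurable borel"
  shows "energy {T<..} a = (\<integral>\<^sup>+\<zeta>. ennreal ((norm (a \<zeta>))\<^sup>2 * heat_symbol T \<zeta> / ((2 * pi) ^ DIM('a) * norm \<zeta> ^ DIM('a)))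
    \<partial>lborel)"
proof -
  have "energy {T<..} a = (\<integral>\<^sup>+t. \<integral>\<^sup>+\<zeta>. ennreal ((norm (a \<zeta>))\<^sup>2 * heat_symbol t \<zeta>) * indicator {T<..} t \<partial>lborel \<partial>lborel)"
    unfolding energy_def by (intro nn_integral_cong, subst nn_integral_multc) auto
  also have "\<dots> = (\<integral>\<^sup>+\<zeta>. \<integral>\<^sup>+t. ennreal ((norm (a \<zeta>))\<^sup>2 * heat_symbol t \<zeta>) * indicator {T<..} t \<partial>lborel \<partial>lborel)"
    by (rule lborel_pair.Fubini') measurable
  also have "\<dots> = (\<integral>\<^sup>+\<zeta>. ennreal ((norm (a \<zeta>))\<^sup>2 * heat_symbol T \<zeta> / ((2 * pi) ^ DIM('a) * norm \<zeta> ^ DIM('a))) \<partial>lborel)"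
  proof (rule nn_integral_cong_AE)
    have "(\<integral>\<^sup>+t. ennreal ((norm (a \<zeta>))\<^sup>2 * heat_symbol t \<zeta>) * indicator {T<..} t \<partial>lborel)
      = ennreal ((norm (a \<zeta>))\<^sup>2 * heat_symbol T \<zeta> / ((2 * pi) ^ DIM('a) * norm \<zeta> ^ DIM('a)))" if "\<zeta> \<noteq> 0" for \<zeta>
    proof -
      define k where "k = (2 * pi) ^ DIM('a) * norm \<zeta> ^ DIM('a)"
      have k: "k > 0" using that by (simp add: k_def)
      have s: "heat_symbol t \<zeta> = exp (- k * t)" for t by (simp add: heat_symbol_def k_def mult_ac)
      have "(\<integral>\<^sup>+t. ennreal ((norm (a \<zeta>))\<^sup>2 * heat_symbol t \<zeta>) * indicator {T<..} t \<partial>lborel)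
        = (\<integral>\<^sup>+t. ennreal ((norm (a \<zeta>))\<^sup>2 * heat_symbol t \<zeta>) * indicator {T..} t \<partial>lborel)"
        by (rule nn_integral_cong_AE) (use AE_lborel_singleton[of T] in \<open>eventually_elim, auto simp: indicator_def\<close>)
      also have "\<dots> = ennreal (0 - (- (norm (a \<zeta>))\<^sup>2 * exp (- k * T) / k))"
        unfolding s
      proof (rule nn_integral_FTC_atLeast)
        show "DERIV (\<lambda>t. - (norm (a \<zeta>))\<^sup>2 * exp (- k * t) / k) t :> (norm (a \<zeta>))\<^sup>2 * exp (- k * t)" for t
          using k by (auto intro!: derivative_eq_intros)
        have "LIM t at_top. - k * t :> at_bot"
          using k by (intro filterlim_tendsto_neg_mult_at_bot[OF tendsto_const _ filterlim_ident]) auto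
        then have "((\<lambda>t. exp (- k * t)) \<longlongrightarrow> 0) at_top" by (rule filterlim_compose[OF exp_at_bot])
        then have "((\<lambda>t. - (norm (a \<zeta>))\<^sup>2 * exp (- k * t) / k) \<longlongrightarrow> - (norm (a \<zeta>))\<^sup>2 * 0 / k) at_top"
          using k by (intro tendsto_divide tendsto_mult tendsto_const) auto
        then show "((\<lambda>t. - (norm (a \<zeta>))\<^sup>2 * exp (- k * t) / k) \<longlongrightarrow> 0) at_top" by simp
      qed auto
      finally show ?thesis unfolding k_def[symmetric] s by simp
    qed
    then show "AE \<zeta> in lborel. (\<integral>\<^sup>+t. ennreal ((norm (a \<zeta>))\<^sup>2 * heat_symbol t \<zeta>) * indicator {T<..} t \<partial>lborel)
      = ennreal ((norm (a \<zeta>))\<^sup>2 * heat_symbol T \<zeta> / ((2 * pi) ^ DIM('a) * norm \<zeta> ^ DIM('a)))"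
      by (intro AE_mp[OF AE_lborel_singleton[of "0::'a"] AE_I2]) auto
  qed
  finally show ?thesis .
qed

text \<open>The central binomial coefficient is at most 4^n. This lets the square of the n-th term
  of an exponential series be compared with the term of index 2 n.\<close>

lemma factorial_square_bound: "fact (2 * n) \<le> (4 ^ n * (fact n)\<^sup>2 :: real)"
proof -
  have "real (2 * n choose n) \<le> 2 ^ (2 * n)" using binomial_le_pow2[of "2 * n" n]
    by (metis of_nat_le_iff of_nat_numeral of_nat_power)
  moreover have "real (2 * n choose n) = fact (2 * n) / (fact n * fact n)"
    using binomial_fact[of n "2 * n", where 'a=real] by (simp add: mult_2)
  then have "fact (2 * n) = (fact n)\<^sup>2 * real (2 * n choose n)" by (simp add: power2_eq_square)
  ultimately have "fact (2 * n) \<le> (fact n)\<^sup>2 * (2 ^ (2 * n) :: real)"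
    by (simp only:) (intro mult_left_mono, auto)
  moreover have "(4::real) ^ n = 2 ^ (2 * n)" by (simp add: power_mult)
  ultimately show ?thesis by (simp only: mult.commute)
qed

text \<open>The square of (R x)^n / n! is at most 4^(-n) times (4 R x)^(2 n) / (2 n)!, a term of the
  series of exp (4 R x). Hence one finite energy bounds all degrees at once, with a geometric
  factor. This supplies both the convergence of the random series and its remainder
  estimates.\<close>

lemma energy_taylor_bound:
  fixes T0 :: real
  assumes d: "DIM('a::euclidean_space) \<ge> 2" and T0: "T0 > 0" and R: "R \<ge> 0"
  shows "\<exists>B\<ge>0. \<forall>I n (a :: 'a \<Rightarrow> complex). I \<subseteq> {T0..} \<longrightarrow> n \<ge> 1 \<longrightarrow> (\<forall>\<zeta>. norm (a \<zeta>) \<le> (R * norm \<zeta>) ^ n / fact n) \<longrightarrow>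
     energy I a \<le> ennreal (B * (1 / 4) ^ n)"
proof -
  \<comment> \<open>Its square is (4 R norm \<zeta>)^2 exp (4 R norm \<zeta>). The quadratic factor,
    split off from the term of index 2 n, keeps the majorant in \<open>adm0\<close>; this is
    possible as n \<ge> 1.\<close>
  define b where "b \<zeta> = complex_of_real (4 * R * norm \<zeta> * exp (2 * R * norm \<zeta>))" for \<zeta> :: 'a
  have "norm (b \<zeta>) \<le> (4 * R) * (norm \<zeta> * exp ((4 * R) * norm \<zeta>))" for \<zeta>
    unfolding b_def using R by (auto simp: norm_mult intro!: mult_left_mono mult_right_mono)
  then have b: "adm0 b" unfolding adm0_def by (auto simp: b_def intro!: continuous_intros)
  have [measurable]: "b \<in> borel_measurable borel" using adm0_adm[OF b] by measurable
  define B where "B = enn2real (energy {T0..} b)"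
  have B: "energy {T0..} b = ennreal B" using energy_finite[OF d b T0 subset_refl] by (simp add: B_def)
  have "energy I a \<le> ennreal (B * (1 / 4) ^ n)" if I: "I \<subseteq> {T0..}" and n: "n \<ge> 1"
    and a: "\<And>\<zeta>. norm (a \<zeta>) \<le> (R * norm \<zeta>) ^ n / fact n"
    for I n and a :: "'a \<Rightarrow> complex"
  proof -
    have "energy I a \<le> ennreal ((1 / 4) ^ n) * energy {T0..} b"
    proof (rule energy_mono[OF I])
      fix \<zeta> :: 'a
      let ?x = "4 * R * norm \<zeta>"
      have x: "?x \<ge> 0" using R by simp
      have "?x ^ (2 * n) / fact (2 * n) \<le> ?x ^ (2 * n) / fact (2 * n - 2)"
        using x by (intro divide_left_mono fact_mono) auto
      also have "\<dots> = ?x\<^sup>2 * (?x ^ (2 * n - 2) / fact (2 * n - 2))"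
      proof -
        have "2 + (2 * n - 2) = 2 * n" using n by simp
        then have "?x ^ (2 * n) = ?x\<^sup>2 * ?x ^ (2 * n - 2)" using power_add[of ?x 2 "2 * n - 2"] by (simp only:)
        then show ?thesis by (simp only: times_divide_eq_right)
      qed
      also have "\<dots> \<le> ?x\<^sup>2 * exp ?x" by (intro mult_left_mono power_over_fact_le_exp x) auto
      also have "\<dots> = (norm (b \<zeta>))\<^sup>2"
        using R by (simp add: b_def norm_mult power_mult_distrib exp_double[symmetric])
      finally have 1: "?x ^ (2 * n) / fact (2 * n) \<le> (norm (b \<zeta>))\<^sup>2" .
      have "(norm (a \<zeta>))\<^sup>2 \<le> ((R * norm \<zeta>) ^ n / fact n)\<^sup>2" by (intro power_mono a) auto
      also have "\<dots> = (R * norm \<zeta>) ^ (2 * n) / (fact n)\<^sup>2"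
        by (simp add: power_divide power_mult[symmetric] mult.commute)
      also have "\<dots> = 4 ^ n * (R * norm \<zeta>) ^ (2 * n) / (4 ^ n * (fact n)\<^sup>2)" by simp
      also have "\<dots> \<le> 4 ^ n * (R * norm \<zeta>) ^ (2 * n) / fact (2 * n)"
        using R by (intro divide_left_mono factorial_square_bound) auto
      also have "\<dots> = (1 / 4) ^ n * (?x ^ (2 * n) / fact (2 * n))"
      proof -
        have "(4::real) ^ (2 * n) = 4 ^ n * 4 ^ n" by (simp add: power_add mult_2)
        then show ?thesis by (simp add: power_mult_distrib power_divide)
      qed
      also have "\<dots> \<le> (1 / 4) ^ n * (norm (b \<zeta>))\<^sup>2" by (intro mult_left_mono 1) auto
      finally show "(norm (a \<zeta>))\<^sup>2 \<le> (1 / 4) ^ n * (norm (b \<zeta>))\<^sup>2" .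
    qed auto
    also have "\<dots> = ennreal (B * (1 / 4) ^ n)" unfolding B
      by (subst ennreal_mult[symmetric]) (auto simp: B_def mult.commute)
    finally show ?thesis .
  qed
  moreover have "B \<ge> 0" by (simp add: B_def)
  ultimately show ?thesis by (intro exI[of _ B]) blast
qed

section \<open>Gaussian variables and mean-square limits\<close>

lemma centered_gaussian_char:
  assumes g: "centered_gaussian N X v"
  shows "(LINT \<omega>|N. cis (s * X \<omega>)) = complex_of_real (exp (- (s\<^sup>2 * v / 2)))"
proof -
  have [measurable]: "X \<in> borel_measurable N" and v: "v \<ge> 0"
    and d: "distr N borel X = distr std_normal_distribution borel (\<lambda>x. sqrt v * x)"
    using g by (auto simp: centered_gaussian_def)
  have "(LINT \<omega>|N. cis (s * X \<omega>)) = (LINT x|distr N borel X. cis (s * x))"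
    by (subst integral_distr) auto
  also have "\<dots> = (LINT x|std_normal_distribution. cis ((s * sqrt v) * x))"
    unfolding d by (subst integral_distr) (auto simp: mult.assoc)
  also have "\<dots> = char std_normal_distribution (s * sqrt v)"
    by (simp add: char_def cis_conv_exp)
  also have "\<dots> = complex_of_real (exp (- (s\<^sup>2 * v / 2)))"
    using v by (simp add: char_std_normal_distribution power_mult_distrib)
  finally show ?thesis .
qed

lemma centered_gaussian_second_moment:
  assumes g: "centered_gaussian N X v"
  shows "(\<integral>\<^sup>+\<omega>. ennreal ((X \<omega>)\<^sup>2) \<partial>N) = ennreal v"
proof -
  have [measurable]: "X \<in> borel_measurable N" and v: "v \<ge> 0"
    and d: "distr N borel X = distr std_normal_distribution borel (\<lambda>x. sqrt v * x)"
    using g by (auto simp: centered_gaussian_def)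
  have "(\<integral>\<^sup>+\<omega>. ennreal ((X \<omega>)\<^sup>2) \<partial>N) = (\<integral>\<^sup>+x. ennreal (x\<^sup>2) \<partial>distr N borel X)"
    by (subst nn_integral_distr) auto
  also have "\<dots> = (\<integral>\<^sup>+x. ennreal (v * x\<^sup>2) \<partial>std_normal_distribution)"
    unfolding d using v by (subst nn_integral_distr) (auto simp: power_mult_distrib)
  also have "\<dots> = ennreal (LINT x|std_normal_distribution. v * x\<^sup>2)"
    using integrable_std_normal_distribution_moment[of 2] v
    by (intro nn_integral_eq_integral integrable_mult_right) auto
  also have "(LINT x|std_normal_distribution. v * x\<^sup>2) = v"
    using std_normal_distribution_even_moments(1)[of 1] by simp
  finally show ?thesis .
qed

lemma nn_integral_square_add:
  fixes X Y :: "'x \<Rightarrow> real"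
  assumes [measurable]: "X \<in> borel_measurable N" "Y \<in> borel_measurable N"
  shows "(\<integral>\<^sup>+\<omega>. ennreal ((X \<omega> + Y \<omega>)\<^sup>2) \<partial>N) \<le> 2 * (\<integral>\<^sup>+\<omega>. ennreal ((X \<omega>)\<^sup>2) \<partial>N) + 2 * (\<integral>\<^sup>+\<omega>. ennreal ((Y \<omega>)\<^sup>2) \<partial>N)"
proof -
  have "(\<integral>\<^sup>+\<omega>. ennreal ((X \<omega> + Y \<omega>)\<^sup>2) \<partial>N) \<le> (\<integral>\<^sup>+\<omega>. 2 * ennreal ((X \<omega>)\<^sup>2) + 2 * ennreal ((Y \<omega>)\<^sup>2) \<partial>N)"
  proof (intro nn_integral_mono)
    fix \<omega>
    have "(X \<omega> + Y \<omega>)\<^sup>2 + (X \<omega> - Y \<omega>)\<^sup>2 = 2 * (X \<omega>)\<^sup>2 + 2 * (Y \<omega>)\<^sup>2" by (simp add: power2_eq_square algebra_simps)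
    then have "(X \<omega> + Y \<omega>)\<^sup>2 \<le> 2 * (X \<omega>)\<^sup>2 + 2 * (Y \<omega>)\<^sup>2" using zero_le_power2[of "X \<omega> - Y \<omega>"] by linarith
    then have "ennreal ((X \<omega> + Y \<omega>)\<^sup>2) \<le> ennreal (2 * (X \<omega>)\<^sup>2 + 2 * (Y \<omega>)\<^sup>2)" by (rule ennreal_leI)
    also have "\<dots> = 2 * ennreal ((X \<omega>)\<^sup>2) + 2 * ennreal ((Y \<omega>)\<^sup>2)" by (simp add: ennreal_plus ennreal_mult)
    finally show "ennreal ((X \<omega> + Y \<omega>)\<^sup>2) \<le> 2 * ennreal ((X \<omega>)\<^sup>2) + 2 * ennreal ((Y \<omega>)\<^sup>2)" .
  qed
  also have "\<dots> = 2 * (\<integral>\<^sup>+\<omega>. ennreal ((X \<omega>)\<^sup>2) \<partial>N) + 2 * (\<integral>\<^sup>+\<omega>. ennreal ((Y \<omega>)\<^sup>2) \<partial>N)"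
    by (simp add: nn_integral_add nn_integral_cmult)
  finally show ?thesis .
qed

lemma nn_integral_square_diff_triangle:
  fixes X Y Z :: "'x \<Rightarrow> real"
  assumes [measurable]: "X \<in> borel_measurable N" "Y \<in> borel_measurable N" "Z \<in> borel_measurable N"
  shows "(\<integral>\<^sup>+\<omega>. ennreal ((X \<omega> - Z \<omega>)\<^sup>2) \<partial>N) \<le> 2 * (\<integral>\<^sup>+\<omega>. ennreal ((X \<omega> - Y \<omega>)\<^sup>2) \<partial>N) + 2
    * (\<integral>\<^sup>+\<omega>. ennreal ((Y \<omega> - Z \<omega>)\<^sup>2) \<partial>N)"
  using nn_integral_square_add[of "\<lambda>\<omega>. X \<omega> - Y \<omega>" N "\<lambda>\<omega>. Y \<omega> - Z \<omega>"] by simp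

lemma nn_integral_square_commute: "(\<integral>\<^sup>+\<omega>. ennreal ((X \<omega> - Y \<omega>)\<^sup>2) \<partial>N) = (\<integral>\<^sup>+\<omega>. ennreal ((Y \<omega> - X \<omega>)\<^sup>2) \<partial>N)"
  for X Y :: "'x \<Rightarrow> real"
  by (simp add: power2_commute)

lemma AE_eq_of_square_zero:
  fixes X Y :: "'x \<Rightarrow> real"
  assumes [measurable]: "X \<in> borel_measurable N" "Y \<in> borel_measurable N"
    and z: "(\<integral>\<^sup>+\<omega>. ennreal ((X \<omega> - Y \<omega>)\<^sup>2) \<partial>N) = 0"
  shows "AE \<omega> in N. X \<omega> = Y \<omega>"
  using z by (subst (asm) nn_integral_0_iff_AE) (auto simp: ennreal_eq_0_iff)

lemma ennreal_tendsto_0_lincomb: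
  fixes f g :: "'x \<Rightarrow> ennreal"
  assumes "(f \<longlongrightarrow> 0) F" "(g \<longlongrightarrow> 0) F"
  shows "((\<lambda>x. 2 * f x + 2 * g x) \<longlongrightarrow> 0) F"
proof -
  have "((\<lambda>x. 2 * f x + 2 * g x) \<longlongrightarrow> 2 * 0 + 2 * 0) F"
    by (intro tendsto_add ennreal_tendsto_cmult assms) auto
  then show ?thesis by simp
qed

lemma tendsto_0_le_ennreal:
  fixes f g :: "'x \<Rightarrow> ennreal"
  assumes "(g \<longlongrightarrow> 0) F" "\<forall>\<^sub>F x in F. f x \<le> g x"
  shows "(f \<longlongrightarrow> 0) F"
  by (rule tendsto_sandwich[OF _ assms(2) tendsto_const assms(1)]) auto

lemma L2_limit_unique:
  assumes X: "L2_limit N X Y" "L2_limit N X Z"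
  shows "AE \<omega> in N. Y \<omega> = Z \<omega>"
proof -
  have [measurable]: "Y \<in> borel_measurable N" "Z \<in> borel_measurable N" using X by (auto simp: L2_limit_def)
  have "((\<lambda>R::real. \<integral>\<^sup>+\<omega>. ennreal ((Y \<omega> - Z \<omega>)\<^sup>2) \<partial>N) \<longlongrightarrow> 0) at_top"
  proof (rule tendsto_0_le_ennreal)
    show "((\<lambda>R. 2 * (\<integral>\<^sup>+\<omega>. ennreal ((X R \<omega> - Y \<omega>)\<^sup>2) \<partial>N) + 2 * (\<integral>\<^sup>+\<omega>. ennreal ((X R \<omega> - Z \<omega>)\<^sup>2) \<partial>N)) \<longlongrightarrow> 0) at_top"
      using X by (intro ennreal_tendsto_0_lincomb) (auto simp: L2_limit_def)
    have "\<forall>\<^sub>F R in at_top. X R \<in> borel_measurable N" using X by (simp add: L2_limit_def)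
    then show "\<forall>\<^sub>F R in at_top. (\<integral>\<^sup>+\<omega>. ennreal ((Y \<omega> - Z \<omega>)\<^sup>2) \<partial>N) \<le> 2 * (\<integral>\<^sup>+\<omega>. ennreal ((X R \<omega> - Y \<omega>)\<^sup>2) \<partial>N) + 2
      * (\<integral>\<^sup>+\<omega>. ennreal ((X R \<omega> - Z \<omega>)\<^sup>2) \<partial>N)"
    proof eventually_elim
      case (elim R)
      then show ?case
        using nn_integral_square_diff_triangle[of Y N "X R" Z] nn_integral_square_commute[where X=Y and Y="X R"
          and N=N] by simp
    qed
  qed
  then have "(\<integral>\<^sup>+\<omega>. ennreal ((Y \<omega> - Z \<omega>)\<^sup>2) \<partial>N) = 0"
    by (simp add: tendsto_const_iff)
  then show ?thesis by (intro AE_eq_of_square_zero) auto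
qed

lemma L2_limit_cong_AE:
  assumes X: "L2_limit N X Y"
    and e: "\<forall>\<^sub>F R in at_top. X' R \<in> borel_measurable N \<and> (AE \<omega> in N. X' R \<omega> = X R \<omega>)"
  shows "L2_limit N X' Y"
proof -
  have "((\<lambda>R. \<integral>\<^sup>+\<omega>. ennreal ((X R \<omega> - Y \<omega>)\<^sup>2) \<partial>N) \<longlongrightarrow> 0) at_top" using X by (simp add: L2_limit_def)
  moreover have "\<forall>\<^sub>F R in at_top. (\<integral>\<^sup>+\<omega>. ennreal ((X R \<omega> - Y \<omega>)\<^sup>2) \<partial>N) = (\<integral>\<^sup>+\<omega>. ennreal ((X' R \<omega> - Y \<omega>)\<^sup>2) \<partial>N)"
    using e by eventually_elim (auto intro!: nn_integral_cong_AE)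
  ultimately have "((\<lambda>R. \<integral>\<^sup>+\<omega>. ennreal ((X' R \<omega> - Y \<omega>)\<^sup>2) \<partial>N) \<longlongrightarrow> 0) at_top"
    using tendsto_cong by force
  moreover have "\<forall>\<^sub>F R in at_top. X' R \<in> borel_measurable N" using e by eventually_elim simp
  ultimately show ?thesis using X by (simp add: L2_limit_def)
qed

text \<open>Fatou's lemma bounds the mean square of Y - Z by a lower limit that vanishes.\<close>

lemma AE_limit_eq_L2_limit:
  fixes X :: "nat \<Rightarrow> 'x \<Rightarrow> real"
  assumes [measurable]: "\<And>n. X n \<in> borel_measurable N" "Y \<in> borel_measurable N" "Z \<in> borel_measurable N"
    and Y: "AE \<omega> in N. (\<lambda>n. X n \<omega>) \<longlonglongrightarrow> Y \<omega>"
    and Z: "(\<lambda>n. \<integral>\<^sup>+\<omega>. ennreal ((X n \<omega> - Z \<omega>)\<^sup>2) \<partial>N) \<longlonglongrightarrow> 0"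
  shows "AE \<omega> in N. Y \<omega> = Z \<omega>"
proof -
  have "(\<integral>\<^sup>+\<omega>. ennreal ((Y \<omega> - Z \<omega>)\<^sup>2) \<partial>N) = (\<integral>\<^sup>+\<omega>. liminf (\<lambda>n. ennreal ((X n \<omega> - Z \<omega>)\<^sup>2)) \<partial>N)"
  proof (rule nn_integral_cong_AE)
    show "AE \<omega> in N. ennreal ((Y \<omega> - Z \<omega>)\<^sup>2) = liminf (\<lambda>n. ennreal ((X n \<omega> - Z \<omega>)\<^sup>2))"
      using Y
    proof eventually_elim
      case (elim \<omega>)
      then have "(\<lambda>n. ennreal ((X n \<omega> - Z \<omega>)\<^sup>2)) \<longlonglongrightarrow> ennreal ((Y \<omega> - Z \<omega>)\<^sup>2)"
        by (intro tendsto_ennrealI tendsto_intros)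
      then show ?case by (intro lim_imp_Liminf[symmetric]) auto
    qed
  qed
  also have "\<dots> \<le> liminf (\<lambda>n. \<integral>\<^sup>+\<omega>. ennreal ((X n \<omega> - Z \<omega>)\<^sup>2) \<partial>N)"
    by (rule nn_integral_liminf) measurable
  also have "\<dots> = 0" by (rule lim_imp_Liminf[OF _ Z]) simp
  finally show ?thesis by (intro AE_eq_of_square_zero) auto
qed

text \<open>Integrating |X| \<le> X^2 / (2 c) + c / 2 over a probability space gives the
  Cauchy-Schwarz bound; c = 0 is separate because of the division.\<close>

lemma (in prob_space) nn_integral_abs_le_sqrt:
  fixes X :: "'a \<Rightarrow> real"
  assumes [measurable]: "X \<in> borel_measurable M" and b: "(\<integral>\<^sup>+\<omega>. ennreal ((X \<omega>)\<^sup>2) \<partial>M) \<le> ennreal (c\<^sup>2)" and c: "c \<ge> 0"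
  shows "(\<integral>\<^sup>+\<omega>. ennreal \<bar>X \<omega>\<bar> \<partial>M) \<le> ennreal c"
proof (cases "c = 0")
  case True
  then have "AE \<omega> in M. X \<omega> = 0" using b AE_eq_of_square_zero[of X M "\<lambda>_. 0"] by simp
  then have "(\<integral>\<^sup>+\<omega>. ennreal \<bar>X \<omega>\<bar> \<partial>M) = (\<integral>\<^sup>+\<omega>. 0 \<partial>M)" by (intro nn_integral_cong_AE) auto
  then show ?thesis by simp
next
  case False
  then have c: "c > 0" using c by simp
  have "(\<integral>\<^sup>+\<omega>. ennreal \<bar>X \<omega>\<bar> \<partial>M) \<le> (\<integral>\<^sup>+\<omega>. ennreal (1 / (2 * c)) * ennreal ((X \<omega>)\<^sup>2) + ennreal (c / 2) \<partial>M)"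
  proof (intro nn_integral_mono)
    fix \<omega>
    have "0 \<le> (\<bar>X \<omega>\<bar> - c)\<^sup>2 / (2 * c)" using c by simp
    also have "\<dots> = 1 / (2 * c) * (X \<omega>)\<^sup>2 + c / 2 - \<bar>X \<omega>\<bar>" using c
      by (simp add: power2_diff field_simps power2_eq_square)
    finally have "ennreal \<bar>X \<omega>\<bar> \<le> ennreal (1 / (2 * c) * (X \<omega>)\<^sup>2 + c / 2)" by (intro ennreal_leI) simp
    also have "\<dots> = ennreal (1 / (2 * c)) * ennreal ((X \<omega>)\<^sup>2) + ennreal (c / 2)"
      using c by (simp add: ennreal_plus ennreal_mult[symmetric])
    finally show "ennreal \<bar>X \<omega>\<bar> \<le> ennreal (1 / (2 * c)) * ennreal ((X \<omega>)\<^sup>2) + ennreal (c / 2)" .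
  qed
  also have "\<dots> = ennreal (1 / (2 * c)) * (\<integral>\<^sup>+\<omega>. ennreal ((X \<omega>)\<^sup>2) \<partial>M) + ennreal (c / 2)"
    by (subst nn_integral_add) (auto simp: nn_integral_cmult emeasure_space_1)
  also have "\<dots> \<le> ennreal (1 / (2 * c)) * ennreal (c\<^sup>2) + ennreal (c / 2)"
    using b by (intro add_mono mult_left_mono) auto
  also have "\<dots> = ennreal c" using c by (simp add: ennreal_mult[symmetric] ennreal_plus[symmetric] power2_eq_square
    field_simps del: ennreal_plus)
  finally show ?thesis .
qed

text \<open>Along a sufficiently sparse sequence the increments are absolutely summable in mean, so
  the sequence converges almost surely; Fatou then transfers the modulus \<open>e\<close> to every
  R, not only to the sequence.\<close>

lemma (in prob_space) L2_limit_complete: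
  fixes X :: "real \<Rightarrow> 'a \<Rightarrow> real" and e :: "real \<Rightarrow> real"
  assumes m: "\<And>R. R > 0 \<Longrightarrow> X R \<in> borel_measurable M"
    and c: "\<And>R S. R > 0 \<Longrightarrow> S > 0 \<Longrightarrow> (\<integral>\<^sup>+\<omega>. ennreal ((X R \<omega> - X S \<omega>)\<^sup>2) \<partial>M) \<le> ennreal (e R + e S)"
    and e: "(e \<longlongrightarrow> 0) at_top" "\<And>R. e R \<ge> 0"
  shows "\<exists>Y. L2_limit M X Y"
proof -
  have "\<exists>R>0. \<forall>S\<ge>R. e S < (1 / 4) ^ n / 2" for n :: nat
  proof -
    have "\<forall>\<^sub>F S in at_top. e S < (1 / 4) ^ n / 2" using e(1) by (rule order_tendstoD) simp
    then obtain R0 where "\<And>S. S \<ge> R0 \<Longrightarrow> e S < (1 / 4) ^ n / 2" by (auto simp: eventually_at_top_linorder)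
    then show ?thesis by (intro exI[of _ "max R0 1"]) auto
  qed
  then obtain r0 where r0: "\<And>n. r0 n > 0" "\<And>n S. S \<ge> r0 n \<Longrightarrow> e S < (1 / 4) ^ n / 2" by metis
  \<comment> \<open>The sum makes the sequence monotone and at least \<open>r0 n\<close>; the
    summand n forces it to infinity.\<close>
  define r where "r n = (\<Sum>k\<le>n. r0 k) + real n" for n
  have r0r: "r0 n \<le> r n" for n
    unfolding r_def using member_le_sum[of n "{..n}" r0] r0(1) by (simp add: less_imp_le add_increasing2)
  have rpos: "r n > 0" for n using r0r[of n] r0(1)[of n] by linarith
  have rn: "real n \<le> r n" for n unfolding r_def using r0(1) by (simp add: sum_nonneg less_imp_le)
  have er: "e (r n) < (1 / 4) ^ n / 2" for n by (rule r0(2)[OF r0r])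
  have rmono: "r n \<le> r (Suc n)" for n unfolding r_def using r0(1)[of "Suc n"] by simp
  have [measurable]: "X (r n) \<in> borel_measurable M" for n by (rule m[OF rpos])
  have erS: "e (r (Suc n)) < (1 / 4) ^ n / 2" for n
    by (rule r0(2)) (use r0r[of n] rmono[of n] in linarith)
  have step: "(\<integral>\<^sup>+\<omega>. ennreal \<bar>X (r (Suc n)) \<omega> - X (r n) \<omega>\<bar> \<partial>M) \<le> ennreal ((1 / 2) ^ n)" for n
  proof (rule nn_integral_abs_le_sqrt)
    have "(\<integral>\<^sup>+\<omega>. ennreal ((X (r (Suc n)) \<omega> - X (r n) \<omega>)\<^sup>2) \<partial>M) \<le> ennreal (e (r (Suc n)) + e (r n))"
      by (rule c[OF rpos rpos])
    also have "\<dots> \<le> ennreal ((1 / 4) ^ n)" using er[of n] erS[of n] by (intro ennreal_leI) linarith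
    also have "(1 / 4 :: real) ^ n = ((1 / 2) ^ n)\<^sup>2" by (simp add: power2_eq_square power_mult_distrib[symmetric])
    finally show "(\<integral>\<^sup>+\<omega>. ennreal ((X (r (Suc n)) \<omega> - X (r n) \<omega>)\<^sup>2) \<partial>M) \<le> ennreal (((1 / 2) ^ n)\<^sup>2)" .
  qed auto
  have "(\<integral>\<^sup>+\<omega>. (\<Sum>n. ennreal \<bar>X (r (Suc n)) \<omega> - X (r n) \<omega>\<bar>) \<partial>M) = (\<Sum>n. \<integral>\<^sup>+\<omega>. ennreal \<bar>X (r (Suc n)) \<omega> - X (r n) \<omega>\<bar> \<partial>M)"
    by (rule nn_integral_suminf) measurable
  also have "\<dots> \<le> (\<Sum>n. ennreal ((1 / 2) ^ n))" by (intro suminf_le step) auto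
  also have "\<dots> = ennreal (\<Sum>n. (1 / 2) ^ n)" by (rule suminf_ennreal2) (auto intro: summable_geometric)
  finally have "(\<integral>\<^sup>+\<omega>. (\<Sum>n. ennreal \<bar>X (r (Suc n)) \<omega> - X (r n) \<omega>\<bar>) \<partial>M) \<noteq> \<infinity>" by (auto simp: top_unique)
  then have "AE \<omega> in M. (\<Sum>n. ennreal \<bar>X (r (Suc n)) \<omega> - X (r n) \<omega>\<bar>) \<noteq> \<infinity>"
    by (intro nn_integral_PInf_AE) auto
  then have conv: "AE \<omega> in M. convergent (\<lambda>n. X (r n) \<omega>)"
  proof eventually_elim
    case (elim \<omega>)
    then have "summable (\<lambda>n. \<bar>X (r (Suc n)) \<omega> - X (r n) \<omega>\<bar>)"
      by (intro summable_suminf_not_top) auto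
    then have "summable (\<lambda>n. X (r (Suc n)) \<omega> - X (r n) \<omega>)" by (rule summable_rabs_cancel)
    then show ?case unfolding summable_iff_convergent sum_lessThan_telescope[of "\<lambda>n. X (r n) \<omega>"]
      by (simp add: convergent_diff_const_right_iff)
  qed
  define Y where "Y \<omega> = lim (\<lambda>n. X (r n) \<omega>)" for \<omega>
  have [measurable]: "Y \<in> borel_measurable M" unfolding Y_def by measurable
  have Ylim: "AE \<omega> in M. (\<lambda>n. X (r n) \<omega>) \<longlonglongrightarrow> Y \<omega>"
    using conv by eventually_elim (simp add: Y_def convergent_LIMSEQ_iff)
  have er0: "(\<lambda>n. e (r n)) \<longlonglongrightarrow> 0"
  proof (rule filterlim_compose[OF e(1)])
    show "filterlim r at_top sequentially"
      by (rule filterlim_at_top_mono[OF filterlim_real_sequentially]) (use rn in auto)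
  qed
  have bd: "(\<integral>\<^sup>+\<omega>. ennreal ((X R \<omega> - Y \<omega>)\<^sup>2) \<partial>M) \<le> ennreal (e R)" if R: "R > 0" for R
  proof -
    have [measurable]: "X R \<in> borel_measurable M" by (rule m[OF R])
    have "(\<integral>\<^sup>+\<omega>. ennreal ((X R \<omega> - Y \<omega>)\<^sup>2) \<partial>M) = (\<integral>\<^sup>+\<omega>. liminf (\<lambda>n. ennreal ((X R \<omega> - X (r n) \<omega>)\<^sup>2)) \<partial>M)"
    proof (rule nn_integral_cong_AE)
      show "AE \<omega> in M. ennreal ((X R \<omega> - Y \<omega>)\<^sup>2) = liminf (\<lambda>n. ennreal ((X R \<omega> - X (r n) \<omega>)\<^sup>2))"
        using Ylim
      proof eventually_elim
        case (elim \<omega>)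
        then have "(\<lambda>n. ennreal ((X R \<omega> - X (r n) \<omega>)\<^sup>2)) \<longlonglongrightarrow> ennreal ((X R \<omega> - Y \<omega>)\<^sup>2)"
          by (intro tendsto_ennrealI tendsto_intros)
        then show ?case by (intro lim_imp_Liminf[symmetric]) auto
      qed
    qed
    also have "\<dots> \<le> liminf (\<lambda>n. \<integral>\<^sup>+\<omega>. ennreal ((X R \<omega> - X (r n) \<omega>)\<^sup>2) \<partial>M)"
      by (rule nn_integral_liminf) measurable
    also have "\<dots> \<le> liminf (\<lambda>n. ennreal (e R + e (r n)))"
      by (intro Liminf_mono always_eventually allI c R rpos)
    also have "\<dots> = ennreal (e R + 0)"
      by (intro lim_imp_Liminf tendsto_ennrealI tendsto_add tendsto_const er0) auto
    finally show ?thesis by simp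
  qed
  have "L2_limit M X Y"
    unfolding L2_limit_def
  proof (intro conjI)
    show "\<forall>\<^sub>F R in at_top. X R \<in> borel_measurable M"
      using eventually_gt_at_top[of 0] by eventually_elim (rule m)
    have "((\<lambda>R. ennreal (e R)) \<longlongrightarrow> ennreal 0) at_top" by (rule tendsto_ennrealI[OF e(1)])
    then have el: "((\<lambda>R. ennreal (e R)) \<longlongrightarrow> 0) at_top" by simp
    have "\<forall>\<^sub>F R in at_top. (\<integral>\<^sup>+\<omega>. ennreal ((X R \<omega> - Y \<omega>)\<^sup>2) \<partial>M) \<le> ennreal (e R)"
      using eventually_gt_at_top[of 0] by eventually_elim (rule bd)
    then show "((\<lambda>R. \<integral>\<^sup>+\<omega>. ennreal ((X R \<omega> - Y \<omega>)\<^sup>2) \<partial>M) \<longlongrightarrow> 0) at_top"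
      by (rule tendsto_0_le_ennreal[OF el])
  qed measurable
  then show ?thesis by blast
qed

text \<open>The map s \<mapsto> cis s is 1-Lipschitz, so a small mean-square distance forces the two
  expectations together.\<close>

lemma (in prob_space) L2_limit_char:
  assumes X: "L2_limit M X Y" and c: "((\<lambda>R. LINT \<omega>|M. cis (X R \<omega>)) \<longlongrightarrow> c) at_top"
  shows "(LINT \<omega>|M. cis (Y \<omega>)) = c"
proof -
  have [measurable]: "Y \<in> borel_measurable M" using X by (auto simp: L2_limit_def)
  have lim: "((\<lambda>R. \<integral>\<^sup>+\<omega>. ennreal ((X R \<omega> - Y \<omega>)\<^sup>2) \<partial>M) \<longlongrightarrow> 0) at_top" using X by (simp add: L2_limit_def)
  have "((\<lambda>R. (LINT \<omega>|M. cis (X R \<omega>)) - (LINT \<omega>|M. cis (Y \<omega>))) \<longlongrightarrow> 0) at_top"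
  proof (rule tendstoI)
    fix \<epsilon> :: real assume \<epsilon>: "\<epsilon> > 0"
    have "\<forall>\<^sub>F R in at_top. (\<integral>\<^sup>+\<omega>. ennreal ((X R \<omega> - Y \<omega>)\<^sup>2) \<partial>M) < ennreal ((\<epsilon> / 2)\<^sup>2)"
      using lim by (rule order_tendstoD) (use \<epsilon> in auto)
    moreover have "\<forall>\<^sub>F R in at_top. X R \<in> borel_measurable M" using X by (simp add: L2_limit_def)
    ultimately show "\<forall>\<^sub>F R in at_top. dist ((LINT \<omega>|M. cis (X R \<omega>)) - (LINT \<omega>|M. cis (Y \<omega>))) 0 < \<epsilon>"
    proof eventually_elim
      case (elim R)
      have [measurable]: "X R \<in> borel_measurable M" by (rule elim)
      have i: "integrable M (\<lambda>\<omega>. cis (X R \<omega>))" "integrable M (\<lambda>\<omega>. cis (Y \<omega>))"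
        by (intro integrable_const_bound[where B=1]; simp)+
      have "norm ((LINT \<omega>|M. cis (X R \<omega>)) - (LINT \<omega>|M. cis (Y \<omega>))) = norm (LINT \<omega>|M. cis (X R \<omega>) - cis (Y \<omega>))"
        using i by simp
      also have "\<dots> \<le> enn2real (\<integral>\<^sup>+\<omega>. ennreal (norm (cis (X R \<omega>) - cis (Y \<omega>))) \<partial>M)"
      proof -
        have "norm (LINT \<omega>|M. cis (X R \<omega>) - cis (Y \<omega>)) \<le> (LINT \<omega>|M. norm (cis (X R \<omega>) - cis (Y \<omega>)))"
          by (rule integral_norm_bound)
        also have "\<dots> = enn2real (\<integral>\<^sup>+\<omega>. ennreal (norm (cis (X R \<omega>) - cis (Y \<omega>))) \<partial>M)"
          by (rule integral_eq_nn_integral) auto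
        finally show ?thesis .
      qed
      also have "\<dots> \<le> enn2real (ennreal (\<epsilon> / 2))"
      proof (rule enn2real_mono)
        have "(\<integral>\<^sup>+\<omega>. ennreal (norm (cis (X R \<omega>) - cis (Y \<omega>))) \<partial>M) \<le> (\<integral>\<^sup>+\<omega>. ennreal \<bar>X R \<omega> - Y \<omega>\<bar> \<partial>M)"
        proof (intro nn_integral_mono ennreal_leI)
          fix \<omega>
          have "cis (X R \<omega>) - cis (Y \<omega>) = cis (Y \<omega>) * (cis (X R \<omega> - Y \<omega>) - 1)" by (simp add: algebra_simps cis_mult)
          then have "norm (cis (X R \<omega>) - cis (Y \<omega>)) = norm (cis (X R \<omega> - Y \<omega>) - 1)" by (simp add: norm_mult)
          also have "\<dots> \<le> \<bar>X R \<omega> - Y \<omega>\<bar>" using iexp_approx1[of "X R \<omega> - Y \<omega>" 0] by (simp add: cis_conv_exp)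
          finally show "norm (cis (X R \<omega>) - cis (Y \<omega>)) \<le> \<bar>X R \<omega> - Y \<omega>\<bar>" .
        qed
        also have "\<dots> \<le> ennreal (\<epsilon> / 2)"
          using elim(1) \<epsilon> by (intro nn_integral_abs_le_sqrt) (auto intro: less_imp_le)
        finally show "(\<integral>\<^sup>+\<omega>. ennreal (norm (cis (X R \<omega>) - cis (Y \<omega>))) \<partial>M) \<le> ennreal (\<epsilon> / 2)" .
      qed simp
      also have "\<dots> < \<epsilon>" using \<epsilon> by simp
      finally show ?case by (simp add: dist_norm)
    qed
  qed
  then have "((\<lambda>R. LINT \<omega>|M. cis (X R \<omega>)) \<longlongrightarrow> (LINT \<omega>|M. cis (Y \<omega>))) at_top"
    by (rule LIM_zero_cancel)
  from tendsto_unique[OF _ this c] show ?thesis by simp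
qed


section \<open>Joint laws from characteristic functions\<close>

lemma weighted_char_unique_continuous:
  fixes b :: "real \<Rightarrow> complex"
  assumes N: "prob_space N" and M: "prob_space M"
    and [measurable]: "X \<in> borel_measurable N" "U \<in> borel_measurable N" "Y \<in> borel_measurable M" "V
      \<in> borel_measurable M"
    and U1: "\<And>\<omega>. norm (U \<omega>) \<le> 1" and V1: "\<And>\<omega>. norm (V \<omega>) \<le> 1"
    and eq: "\<And>s. (LINT \<omega>|N. U \<omega> * cis (s * X \<omega>)) = (LINT \<omega>|M. V \<omega> * cis (s * Y \<omega>))"
    and b: "continuous_on UNIV b" "\<And>x. norm x > r \<Longrightarrow> b x = 0"
  shows "(LINT \<omega>|N. U \<omega> * b (X \<omega>)) = (LINT \<omega>|M. V \<omega> * b (Y \<omega>))"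
proof -
  obtain B where B: "\<And>x. norm (b x) \<le> B" using bounded_compact_support[OF b] by metis
  have bi: "integrable lborel b" by (rule integrable_compact_support[OF b])
  have [measurable]: "b \<in> borel_measurable borel" using b(1) by (rule borel_measurable_continuous_onI)
  define A where "A n = 1 / real (Suc n)" for n
  have A: "A n > 0" for n by (simp add: A_def)
  define K where "K n x = (LINT \<xi>|lborel. b \<xi>
    * complex_of_real (sqrt (pi / A n) ^ DIM(real) * exp (- pi\<^sup>2 * (norm (x - \<xi>))\<^sup>2 / A n)))" for n x
  have Klim: "(\<lambda>n. K n x) \<longlonglongrightarrow> b x" for x
    unfolding K_def A_def by (rule gaussian_mollify_tendsto[OF b(1) B])
  have Kb: "norm (K n x) \<le> B" for n x
    unfolding K_def by (rule gaussian_mollify_bound[OF b(1) B A])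
  have [measurable]: "K n \<in> borel_measurable borel" for n
    unfolding K_def by (rule lborel.borel_measurable_lebesgue_integral) measurable
  let ?G = "\<lambda>n (x::real). complex_of_real (exp (- A n * (norm x)\<^sup>2))"
  have G: "integrable lborel (?G n)" for n
    using gaussian_fourier(1)[OF A] by (simp only: complex_of_real_integrable_eq)
  \<comment> \<open>The mollification of \<open>b\<close> is a superposition of characters with the
    integrable density \<open>q n\<close>, so the hypothesis on characters passes to it by Fubini,
    and then to \<open>b\<close> in the limit.\<close>
  define q where "q n \<zeta> = ?G n \<zeta> * fourier b (- \<zeta>)" for n \<zeta>
  have qi: "integrable lborel (q n)" for n
    unfolding q_def by (rule integrable_mult_bounded[OF G, where B="LINT \<zeta>|lborel. norm (b \<zeta>)"])
      (use measurable_fourier[OF bi] in \<open>auto intro: norm_fourier_le\<close>)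
  have Kq: "K n x = (LINT \<zeta>|lborel. q n \<zeta> * cis (2 * pi * \<zeta> * x))" for n x
  proof -
    have "(LINT \<zeta>|lborel. q n \<zeta> * cis (2 * pi * \<zeta> * x))
      = (LINT \<zeta>|lborel. (?G n \<zeta> * cis (2 * pi * \<zeta> * x)) * (LINT \<xi>|lborel. b \<xi> * cis (2 * pi * (- \<zeta> \<bullet> \<xi>))))"
      by (simp add: q_def fourier_def mult_ac)
    also have "\<dots> = (LINT \<xi>|lborel. b \<xi> * (LINT \<zeta>|lborel. (?G n \<zeta> * cis (2 * pi * \<zeta> * x)) * cis (2 * pi * (- \<zeta> \<bullet> \<xi>))))"
    proof (rule lborel_pair.kernel_fubini[OF _ bi, where B=1])
      show "integrable lborel (\<lambda>\<zeta>. ?G n \<zeta> * cis (2 * pi * \<zeta> * x))"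
        by (rule integrable_mult_bounded[OF G, where B=1]) auto
    qed auto
    also have "\<dots> = (LINT \<xi>|lborel. b \<xi> * fourier (?G n) (x - \<xi>))"
    proof -
      have "cis (2 * pi * \<zeta> * x) * cis (2 * pi * (- \<zeta> \<bullet> \<xi>)) = cis (2 * pi * ((x - \<xi>) \<bullet> \<zeta>))" for \<zeta> \<xi>
        by (simp add: cis_mult algebra_simps)
      then show ?thesis unfolding fourier_def by (simp only: mult.assoc)
    qed
    also have "\<dots> = K n x" unfolding K_def gaussian_fourier(2)[OF A] ..
    finally show ?thesis by simp
  qed
  have fub: "(LINT \<omega>|P. Z \<omega> * K n (T \<omega>)) = (LINT \<zeta>|lborel. q n \<zeta> * (LINT \<omega>|P. Z \<omega> * cis (2 * pi * \<zeta> * T \<omega>)))"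
    if P: "prob_space P" and [measurable]: "Z \<in> borel_measurable P" "T \<in> borel_measurable P"
      and Z1: "\<And>\<omega>. norm (Z \<omega>) \<le> 1" for P :: "'z measure" and Z T n
  proof -
    interpret P: prob_space P by fact
    interpret PP: pair_sigma_finite P "lborel :: real measure" ..
    have Zi: "integrable P Z" by (rule P.integrable_const_bound[where B=1]) (use Z1 in auto)
    show ?thesis unfolding Kq by (rule PP.kernel_fubini[OF Zi qi, where B=1]) auto
  qed
  have lim: "(\<lambda>n. LINT \<omega>|P. Z \<omega> * K n (T \<omega>)) \<longlonglongrightarrow> (LINT \<omega>|P. Z \<omega> * b (T \<omega>))"
    if P: "prob_space P" and [measurable]: "Z \<in> borel_measurable P" "T \<in> borel_measurable P"
      and Z1: "\<And>\<omega>. norm (Z \<omega>) \<le> 1" for P :: "'z measure" and Z T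
  proof (rule integral_dominated_convergence[where w="\<lambda>_. B"])
    interpret P: prob_space P by fact
    show "integrable P (\<lambda>_. B)" by simp
    show "AE \<omega> in P. (\<lambda>n. Z \<omega> * K n (T \<omega>)) \<longlonglongrightarrow> Z \<omega> * b (T \<omega>)" by (intro AE_I2 tendsto_mult tendsto_const Klim)
    show "AE \<omega> in P. norm (Z \<omega> * K n (T \<omega>)) \<le> B" for n
    proof (rule AE_I2)
      fix \<omega>
      have "norm (Z \<omega>) * norm (K n (T \<omega>)) \<le> 1 * B" by (intro mult_mono Z1 Kb) auto
      then show "norm (Z \<omega> * K n (T \<omega>)) \<le> B" by (simp add: norm_mult)
    qed
  qed measurable
  have L1: "(\<lambda>n. LINT \<omega>|N. U \<omega> * K n (X \<omega>)) \<longlonglongrightarrow> (LINT \<omega>|N. U \<omega> * b (X \<omega>))" by (rule lim[OF N]) (use U1 in auto)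
  have L2: "(\<lambda>n. LINT \<omega>|M. V \<omega> * K n (Y \<omega>)) \<longlonglongrightarrow> (LINT \<omega>|M. V \<omega> * b (Y \<omega>))" by (rule lim[OF M]) (use V1 in auto)
  have "(LINT \<omega>|N. U \<omega> * K n (X \<omega>)) = (LINT \<omega>|M. V \<omega> * K n (Y \<omega>))" for n
    by (subst fub[OF N], measurable, rule U1, subst fub[OF M], measurable, rule V1, simp only: eq)
  with L1 L2 show ?thesis using LIMSEQ_unique by force
qed

text \<open>The complex weights make an induction over coordinates possible: they carry the factors
  of all other coordinates. Open intervals are reached by trapezoidal functions and form a
  generating family stable under intersection; the case s = 0 of the hypothesis settles
  complements.\<close>

lemma weighted_char_unique:
  fixes X :: "'x \<Rightarrow> real" and Y :: "'y \<Rightarrow> real"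
  assumes N: "prob_space N" and M: "prob_space M"
    and [measurable]: "X \<in> borel_measurable N" "U \<in> borel_measurable N" "Y \<in> borel_measurable M" "V
      \<in> borel_measurable M"
    and U1: "\<And>\<omega>. norm (U \<omega>) \<le> 1" and V1: "\<And>\<omega>. norm (V \<omega>) \<le> 1"
    and eq: "\<And>s. (LINT \<omega>|N. U \<omega> * cis (s * X \<omega>)) = (LINT \<omega>|M. V \<omega> * cis (s * Y \<omega>))"
    and S: "S \<in> sets borel"
  shows "(LINT \<omega>|N. U \<omega> * complex_of_real (indicator S (X \<omega>)))
    = (LINT \<omega>|M. V \<omega> * complex_of_real (indicator S (Y \<omega>)))"
proof -
  interpret N: prob_space N by fact
  interpret M: prob_space M by fact
  have Ui: "integrable N (\<lambda>\<omega>. U \<omega> * complex_of_real (g (X \<omega>)))" if [measurable]: "g \<in> borel_measurable borel"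
    and "\<And>x. \<bar>g x\<bar> \<le> 1" for g :: "real \<Rightarrow> real"
  proof (rule N.integrable_const_bound[where B=1])
    show "AE \<omega> in N. norm (U \<omega> * complex_of_real (g (X \<omega>))) \<le> 1"
      using mult_mono[OF U1 that(2)] by (intro AE_I2) (auto simp: norm_mult)
  qed measurable
  have Vi: "integrable M (\<lambda>\<omega>. V \<omega> * complex_of_real (g (Y \<omega>)))" if [measurable]: "g \<in> borel_measurable borel"
    and "\<And>x. \<bar>g x\<bar> \<le> 1" for g :: "real \<Rightarrow> real"
  proof (rule M.integrable_const_bound[where B=1])
    show "AE \<omega> in M. norm (V \<omega> * complex_of_real (g (Y \<omega>))) \<le> 1"
      using mult_mono[OF V1 that(2)] by (intro AE_I2) (auto simp: norm_mult)
  qed measurable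
  have interval: "(LINT \<omega>|N. U \<omega> * complex_of_real (indicator {c<..<d} (X \<omega>)))
    = (LINT \<omega>|M. V \<omega> * complex_of_real (indicator {c<..<d} (Y \<omega>)))" for c d
  proof -
    define g where "g n x = min 1 (real n * max 0 (min (x - c) (d - x)))" for n :: nat and x
    have gc: "continuous_on UNIV (g n)" for n unfolding g_def by (intro continuous_intros)
    have [measurable]: "g n \<in> borel_measurable borel" for n using gc by (rule borel_measurable_continuous_onI)
    have g1: "\<bar>g n x\<bar> \<le> 1" for n x unfolding g_def by auto
    have glim: "(\<lambda>n. g n x) \<longlonglongrightarrow> indicator {c<..<d} x" for x
    proof (cases "x \<in> {c<..<d}")
      case True
      define e where "e = min (x - c) (d - x)"
      have e: "e > 0" using True by (simp add: e_def)
      obtain n0 where n0: "real n0 * e > 1" using ex_less_of_nat_mult[OF e] by blast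
      have "\<forall>\<^sub>F n in sequentially. g n x = 1"
        using eventually_ge_at_top[of n0]
      proof eventually_elim
        case (elim n)
        then have "real n0 * e \<le> real n * e" using e by (intro mult_right_mono) auto
        then have "real n * e > 1" using n0 by linarith
        then have "real n * max 0 e > 1" using e by (simp add: max_absorb2)
        then show ?case by (simp add: g_def e_def[symmetric])
      qed
      then show ?thesis using True by (simp add: tendsto_eventually)
    next
      case False
      then have "min (x - c) (d - x) \<le> 0" by auto
      then have "g n x = 0" for n by (simp add: g_def max_absorb1)
      then show ?thesis using False by simp
    qed
    have eqn: "(LINT \<omega>|N. U \<omega> * complex_of_real (g n (X \<omega>))) = (LINT \<omega>|M. V \<omega> * complex_of_real (g n (Y \<omega>)))" for n
    proof (rule weighted_char_unique_continuous[OF N M _ _ _ _ U1 V1 eq, where r="\<bar>c\<bar> + \<bar>d\<bar>"])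
      show "continuous_on UNIV (\<lambda>x. complex_of_real (g n x))" using gc by (intro continuous_intros) auto
      fix x :: real assume "norm x > \<bar>c\<bar> + \<bar>d\<bar>"
      then have "min (x - c) (d - x) \<le> 0" by (auto simp: abs_if split: if_splits)
      then show "complex_of_real (g n x) = 0" by (simp add: g_def max_absorb1)
    qed measurable
    have L1: "(\<lambda>n. LINT \<omega>|N. U \<omega> * complex_of_real (g n (X \<omega>)))
      \<longlonglongrightarrow> (LINT \<omega>|N. U \<omega> * complex_of_real (indicator {c<..<d} (X \<omega>)))"
    proof (rule integral_dominated_convergence[where w="\<lambda>_. 1"])
      show "AE \<omega> in N. (\<lambda>n. U \<omega> * complex_of_real (g n (X \<omega>))) \<longlonglongrightarrow> U \<omega> * complex_of_real (indicator {c<..<d} (X \<omega>))"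
        by (intro AE_I2 tendsto_mult tendsto_const tendsto_of_real glim)
      show "AE \<omega> in N. norm (U \<omega> * complex_of_real (g n (X \<omega>))) \<le> 1" for n
        using mult_mono[OF U1 g1] by (intro AE_I2) (auto simp: norm_mult)
    qed auto
    have L2: "(\<lambda>n. LINT \<omega>|M. V \<omega> * complex_of_real (g n (Y \<omega>)))
      \<longlonglongrightarrow> (LINT \<omega>|M. V \<omega> * complex_of_real (indicator {c<..<d} (Y \<omega>)))"
    proof (rule integral_dominated_convergence[where w="\<lambda>_. 1"])
      show "AE \<omega> in M. (\<lambda>n. V \<omega> * complex_of_real (g n (Y \<omega>))) \<longlonglongrightarrow> V \<omega> * complex_of_real (indicator {c<..<d} (Y \<omega>))"
        by (intro AE_I2 tendsto_mult tendsto_const tendsto_of_real glim)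
      show "AE \<omega> in M. norm (V \<omega> * complex_of_real (g n (Y \<omega>))) \<le> 1" for n
        using mult_mono[OF V1 g1] by (intro AE_I2) (auto simp: norm_mult)
    qed auto
    show ?thesis by (rule LIMSEQ_unique[OF L1[unfolded eqn] L2])
  qed
  have borel_Ioo: "borel = sigma UNIV (range (\<lambda>(c, d). {c<..<d::real}))"
    using borel_eq_box[where 'a=real] by simp
  have int_stable: "Int_stable (range (\<lambda>(c, d). {c<..<d::real}))"
  proof (rule Int_stableI_image)
    fix i j :: "real \<times> real"
    show "\<exists>k\<in>UNIV. (case i of (c, d) \<Rightarrow> {c<..<d}) \<inter> (case j of (c, d) \<Rightarrow> {c<..<d}) = (case k of (c, d) \<Rightarrow> {c<..<d})"
      by (intro bexI[of _ "(max (fst i) (fst j), min (snd i) (snd j))"]) (auto simp: split_beta)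
  qed
  have S': "S \<in> sigma_sets UNIV (range (\<lambda>(c, d). {c<..<d}))"
    using S by (subst (asm) borel_Ioo) simp
  show ?thesis
    using int_stable _ S'
  proof (rule sigma_sets_induct_disjoint)
    fix A :: "real set" assume "A \<in> range (\<lambda>(c, d). {c<..<d})"
    then show "(LINT \<omega>|N. U \<omega> * complex_of_real (indicator A (X \<omega>)))
      = (LINT \<omega>|M. V \<omega> * complex_of_real (indicator A (Y \<omega>)))"
      using interval by auto
  next
    show "(LINT \<omega>|N. U \<omega> * complex_of_real (indicator {} (X \<omega>)))
      = (LINT \<omega>|M. V \<omega> * complex_of_real (indicator {} (Y \<omega>)))" by simp
  next
    fix A :: "real set" assume "A \<in> sigma_sets UNIV (range (\<lambda>(c, d). {c<..<d}))"
    then have [measurable]: "A \<in> sets borel" by (subst borel_Ioo) simp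
    assume IH: "(LINT \<omega>|N. U \<omega> * complex_of_real (indicator A (X \<omega>)))
      = (LINT \<omega>|M. V \<omega> * complex_of_real (indicator A (Y \<omega>)))"
    have ind: "complex_of_real (indicator (UNIV - A) x) = complex_of_real 1 - complex_of_real (indicator A x)"
      for x :: real by (simp add: indicator_def)
    have "(LINT \<omega>|N. U \<omega> * complex_of_real (indicator (UNIV - A) (X \<omega>)))
      = (LINT \<omega>|N. U \<omega> * complex_of_real 1) - (LINT \<omega>|N. U \<omega> * complex_of_real (indicator A (X \<omega>)))"
      unfolding ind right_diff_distrib by (intro Bochner_Integration.integral_diff Ui) (auto simp: indicator_def)
    also have "\<dots> = (LINT \<omega>|M. V \<omega> * complex_of_real 1) - (LINT \<omega>|M. V \<omega> * complex_of_real (indicator A (Y \<omega>)))"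
      using IH eq[of 0] by simp
    also have "\<dots> = (LINT \<omega>|M. V \<omega> * complex_of_real (indicator (UNIV - A) (Y \<omega>)))"
      unfolding ind right_diff_distrib by (intro Bochner_Integration.integral_diff[symmetric] Vi)
        (auto simp: indicator_def)
    finally show "(LINT \<omega>|N. U \<omega> * complex_of_real (indicator (UNIV - A) (X \<omega>)))
      = (LINT \<omega>|M. V \<omega> * complex_of_real (indicator (UNIV - A) (Y \<omega>)))" .
  next
    fix A :: "nat \<Rightarrow> real set"
    assume disj: "disjoint_family A" and "range A \<subseteq> sigma_sets UNIV (range (\<lambda>(c, d). {c<..<d}))"
      and IH: "\<And>i. (LINT \<omega>|N. U \<omega> * complex_of_real (indicator (A i) (X \<omega>)))
        = (LINT \<omega>|M. V \<omega> * complex_of_real (indicator (A i) (Y \<omega>)))"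
    then have Am[measurable]: "A i \<in> sets borel" for i by (subst borel_Ioo) auto
    define h :: "nat \<Rightarrow> real \<Rightarrow> real" where "h n x = (\<Sum>i<n. indicator (A i) x)" for n x
    have hind: "h n x = indicator (\<Union>i<n. A i) x" for n x
      unfolding h_def using disj by (subst indicator_UN_disjoint) (auto simp: disjoint_family_on_def)
    have AU: "(\<Union>i. A i) \<in> sets borel" by (rule sets.countable_UN) (use Am in auto)
    have [measurable]: "(indicator (\<Union>i. A i) :: real \<Rightarrow> real) \<in> borel_measurable borel"
      by (rule borel_measurable_indicator[OF AU])
    have hlim: "(\<lambda>n. h n x) \<longlonglongrightarrow> indicator (\<Union>i. A i) x" for x
      unfolding hind by (rule LIMSEQ_indicator_UN)
    have h1: "\<bar>h n x\<bar> \<le> 1" for n x unfolding hind by (simp add: indicator_def)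
    have [measurable]: "h n \<in> borel_measurable borel" for n unfolding h_def by measurable
    have eqn: "(LINT \<omega>|N. U \<omega> * complex_of_real (h n (X \<omega>))) = (LINT \<omega>|M. V \<omega> * complex_of_real (h n (Y \<omega>)))" for n
    proof -
      have "(LINT \<omega>|N. U \<omega> * complex_of_real (h n (X \<omega>)))
        = (\<Sum>i<n. LINT \<omega>|N. U \<omega> * complex_of_real (indicator (A i) (X \<omega>)))"
        unfolding h_def of_real_sum sum_distrib_left
        by (rule Bochner_Integration.integral_sum, rule Ui) (auto simp: indicator_def)
      also have "\<dots> = (\<Sum>i<n. LINT \<omega>|M. V \<omega> * complex_of_real (indicator (A i) (Y \<omega>)))" by (simp only: IH)
      also have "\<dots> = (LINT \<omega>|M. V \<omega> * complex_of_real (h n (Y \<omega>)))"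
        unfolding h_def of_real_sum sum_distrib_left
        by (rule Bochner_Integration.integral_sum[symmetric], rule Vi) (auto simp: indicator_def)
      finally show ?thesis .
    qed
    have L1: "(\<lambda>n. LINT \<omega>|N. U \<omega> * complex_of_real (h n (X \<omega>)))
      \<longlonglongrightarrow> (LINT \<omega>|N. U \<omega> * complex_of_real (indicator (\<Union>i. A i) (X \<omega>)))"
    proof (rule integral_dominated_convergence[where w="\<lambda>_. 1"])
      show "AE \<omega> in N. (\<lambda>n. U \<omega> * complex_of_real (h n (X \<omega>))) \<longlonglongrightarrow> U \<omega> * complex_of_real (indicator (\<Union>i. A i) (X \<omega>))"
        by (intro AE_I2 tendsto_mult tendsto_const tendsto_of_real hlim)
      show "AE \<omega> in N. norm (U \<omega> * complex_of_real (h n (X \<omega>))) \<le> 1" for n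
        using mult_mono[OF U1 h1] by (intro AE_I2) (auto simp: norm_mult)
    qed (simp, measurable)
    have L2: "(\<lambda>n. LINT \<omega>|M. V \<omega> * complex_of_real (h n (Y \<omega>)))
      \<longlonglongrightarrow> (LINT \<omega>|M. V \<omega> * complex_of_real (indicator (\<Union>i. A i) (Y \<omega>)))"
    proof (rule integral_dominated_convergence[where w="\<lambda>_. 1"])
      show "AE \<omega> in M. (\<lambda>n. V \<omega> * complex_of_real (h n (Y \<omega>))) \<longlonglongrightarrow> V \<omega> * complex_of_real (indicator (\<Union>i. A i) (Y \<omega>))"
        by (intro AE_I2 tendsto_mult tendsto_const tendsto_of_real hlim)
      show "AE \<omega> in M. norm (V \<omega> * complex_of_real (h n (Y \<omega>))) \<le> 1" for n
        using mult_mono[OF V1 h1] by (intro AE_I2) (auto simp: norm_mult)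
    qed (simp, measurable)
    show "(LINT \<omega>|N. U \<omega> * complex_of_real (indicator (\<Union>i. A i) (X \<omega>)))
      = (LINT \<omega>|M. V \<omega> * complex_of_real (indicator (\<Union>i. A i) (Y \<omega>)))"
      by (rule LIMSEQ_unique[OF L1[unfolded eqn] L2])
  qed simp
qed

text \<open>Characters are exchanged for indicators one coordinate at a time. The intermediate
  identity \<open>mixed\<close> has indicators on the coordinates in S and characters on the others;
  once S is everything, it compares the laws on rectangles.\<close>

lemma joint_law_eqI:
  fixes X :: "nat \<Rightarrow> 'x \<Rightarrow> real" and Y :: "nat \<Rightarrow> 'y \<Rightarrow> real"
  assumes N: "prob_space N" and M: "prob_space M"
    and X: "\<And>i. i < n \<Longrightarrow> X i \<in> borel_measurable N" and Y: "\<And>i. i < n \<Longrightarrow> Y i \<in> borel_measurable M"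
    and eq: "\<And>a. (LINT \<omega>|N. cis (\<Sum>i<n. a i * X i \<omega>)) = (LINT \<omega>|M. cis (\<Sum>i<n. a i * Y i \<omega>))"
  shows "distr N (\<Pi>\<^sub>M i\<in>{..<n}. borel) (\<lambda>\<omega>. \<lambda>i\<in>{..<n}. X i \<omega>) = distr M (\<Pi>\<^sub>M i\<in>{..<n}. borel) (\<lambda>\<omega>. \<lambda>i\<in>{..<n}. Y i \<omega>)"
proof -
  interpret N: prob_space N by fact
  interpret M: prob_space M by fact
  have mixed: "(LINT \<omega>|N. (\<Prod>i\<in>S. complex_of_real (indicator (A i) (X i \<omega>))) * cis (\<Sum>i\<in>{..<n} - S. a i * X i \<omega>)) =
     (LINT \<omega>|M. (\<Prod>i\<in>S. complex_of_real (indicator (A i) (Y i \<omega>))) * cis (\<Sum>i\<in>{..<n} - S. a i * Y i \<omega>))"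
    if "finite S" "S \<subseteq> {..<n}" and A: "\<And>i. A i \<in> sets borel" for S A a
    using that(1,2)
  proof (induction S arbitrary: a rule: finite_induct)
    case empty
    then show ?case using eq by simp
  next
    case (insert j S)
    then have j: "j < n" and Sn: "S \<subseteq> {..<n}" by auto
    let ?U = "\<lambda>Z \<omega>. (\<Prod>i\<in>S. complex_of_real (indicator (A i) (Z i \<omega>))) * cis (\<Sum>i\<in>{..<n} - insert j S. a i * Z i \<omega>)"
    have U1: "norm (?U Z \<omega>) \<le> 1" for Z :: "nat \<Rightarrow> 'z \<Rightarrow> real" and \<omega>
      unfolding norm_mult norm_cis mult_1_right prod_norm[symmetric] by (intro prod_le_1) (auto simp: indicator_def)
    \<comment> \<open>The new character in coordinate j is absorbed by giving the coefficient
      \<open>a j\<close> the value s, which is why the induction keeps \<open>a\<close>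
      arbitrary.\<close>
    have split: "?U Z \<omega> * cis (s * Z j \<omega>) = (\<Prod>i\<in>S. complex_of_real (indicator (A i) (Z i \<omega>)))
      * cis (\<Sum>i\<in>{..<n} - S. (a(j := s)) i * Z i \<omega>)" for Z :: "nat \<Rightarrow> 'z \<Rightarrow> real" and \<omega> s
    proof -
      have e: "{..<n} - S = insert j ({..<n} - insert j S)" using insert.hyps j by auto
      have "(\<Sum>i\<in>{..<n} - S. (a(j := s)) i * Z i \<omega>)
        = (a(j := s)) j * Z j \<omega> + (\<Sum>i\<in>{..<n} - insert j S. (a(j := s)) i * Z i \<omega>)"
        by (subst e, subst sum.insert) auto
      also have "(a(j := s)) j = s" by simp
      also have "(\<Sum>i\<in>{..<n} - insert j S. (a(j := s)) i * Z i \<omega>) = (\<Sum>i\<in>{..<n} - insert j S. a i * Z i \<omega>)"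
        by (intro sum.cong) auto
      finally show ?thesis by (simp add: cis_mult mult.assoc add.commute)
    qed
    have Xm[measurable]: "X i \<in> borel_measurable N" if "i \<in> S \<or> i \<in> {..<n} - insert j S \<or> i = j" for i
      using X Sn j that by auto
    have Ym[measurable]: "Y i \<in> borel_measurable M" if "i \<in> S \<or> i \<in> {..<n} - insert j S \<or> i = j" for i
      using Y Sn j that by auto
    note [measurable] = A
    have UX: "?U X \<in> borel_measurable N" by (intro borel_measurable_times borel_measurable_prod measurable_cis
      borel_measurable_sum borel_measurable_of_real borel_measurable_const)
      (auto intro!: Xm measurable_compose[OF Xm borel_measurable_indicator] A)
    have UY: "?U Y \<in> borel_measurable M" by (intro borel_measurable_times borel_measurable_prod measurable_cis
      borel_measurable_sum borel_measurable_of_real borel_measurable_const)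
      (auto intro!: Ym measurable_compose[OF Ym borel_measurable_indicator] A)
    have "(LINT \<omega>|N. ?U X \<omega> * complex_of_real (indicator (A j) (X j \<omega>)))
      = (LINT \<omega>|M. ?U Y \<omega> * complex_of_real (indicator (A j) (Y j \<omega>)))"
    proof (rule weighted_char_unique[where U="?U X" and V="?U Y" and X="X j" and Y="Y j" and S="A j", OF N M])
      show "(LINT \<omega>|N. ?U X \<omega> * cis (s * X j \<omega>)) = (LINT \<omega>|M. ?U Y \<omega> * cis (s * Y j \<omega>))" for s
        unfolding split by (rule insert.IH[OF Sn])
    qed (use UX UY Xm Ym A U1 in auto)
    then show ?case using insert.hyps by (simp add: mult_ac)
  qed
  have Xm: "(\<lambda>\<omega>. \<lambda>i\<in>{..<n}. X i \<omega>) \<in> measurable N (\<Pi>\<^sub>M i\<in>{..<n}. borel)" by (rule measurable_restrict) (use X in auto)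
  have Ym: "(\<lambda>\<omega>. \<lambda>i\<in>{..<n}. Y i \<omega>) \<in> measurable M (\<Pi>\<^sub>M i\<in>{..<n}. borel)" by (rule measurable_restrict) (use Y in auto)
  have em: "ennreal (Re (LINT \<omega>|P. (\<Prod>i\<in>{..<n}. complex_of_real (indicator (A i) (Z i \<omega>)))))
    = emeasure (distr P (\<Pi>\<^sub>M i\<in>{..<n}. borel) (\<lambda>\<omega>. \<lambda>i\<in>{..<n}. Z i \<omega>)) (Pi\<^sub>E {..<n} A)"
    if P: "prob_space P" and Zm: "(\<lambda>\<omega>. \<lambda>i\<in>{..<n}. Z i \<omega>) \<in> measurable P (\<Pi>\<^sub>M i\<in>{..<n}. borel)"
      and A: "\<And>i. i < n \<Longrightarrow> A i \<in> sets borel"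
    for P :: "'z measure" and Z A
  proof -
    interpret P: prob_space P by fact
    let ?E = "(\<lambda>\<omega>. \<lambda>i\<in>{..<n}. Z i \<omega>) -` (Pi\<^sub>E {..<n} A) \<inter> space P"
    have PiA: "Pi\<^sub>E {..<n} A \<in> sets (\<Pi>\<^sub>M i\<in>{..<n}. borel)" by (rule sets_PiM_I_finite) (use A in auto)
    have E: "?E \<in> sets P" by (rule measurable_sets[OF Zm PiA])
    have "(\<Prod>i\<in>{..<n}. complex_of_real (indicator (A i) (Z i \<omega>))) = complex_of_real (indicator ?E \<omega>)" if "\<omega> \<in> space P"
      for \<omega>
    proof (cases "\<forall>i<n. Z i \<omega> \<in> A i")
      case True
      then show ?thesis using that by (auto simp: indicator_def PiE_iff)
    next
      case False
      then obtain i where "i < n" "Z i \<omega> \<notin> A i" by blast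
      then have "(\<Prod>i\<in>{..<n}. complex_of_real (indicator (A i) (Z i \<omega>))) = 0"
        by (intro prod_zero bexI[of _ i]) (auto simp: indicator_def)
      moreover have "\<omega> \<notin> ?E" using False by (auto simp: PiE_iff)
      ultimately show ?thesis by simp
    qed
    then have "(LINT \<omega>|P. (\<Prod>i\<in>{..<n}. complex_of_real (indicator (A i) (Z i \<omega>))))
      = (LINT \<omega>|P. complex_of_real (indicator ?E \<omega>))"
      by (intro Bochner_Integration.integral_cong) auto
    also have "\<dots> = complex_of_real (measure P ?E)" using E by simp
    finally show ?thesis using Zm PiA E by (simp add: emeasure_distr P.emeasure_eq_measure)
  qed
  show ?thesis
  proof (rule measure_eqI_PiM_finite[where I="{..<n}" and M="\<lambda>_. borel" and A="\<lambda>_. Pi\<^sub>E {..<n} (\<lambda>_. UNIV)"])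
    fix A :: "nat \<Rightarrow> real set" assume A: "\<And>i. i \<in> {..<n} \<Longrightarrow> A i \<in> sets borel"
    \<comment> \<open>\<open>mixed\<close> asks for measurable sets at every index, so the indices
      from n on receive the empty set.\<close>
    define A' where "A' i = (if i < n then A i else {})" for i
    have A': "A' i \<in> sets borel" for i using A by (simp add: A'_def)
    have PA: "Pi\<^sub>E {..<n} A = Pi\<^sub>E {..<n} A'" by (intro PiE_cong) (simp add: A'_def)
    have "(LINT \<omega>|N. (\<Prod>i\<in>{..<n}. complex_of_real (indicator (A' i) (X i \<omega>))))
      = (LINT \<omega>|M. (\<Prod>i\<in>{..<n}. complex_of_real (indicator (A' i) (Y i \<omega>))))"
      using mixed[of "{..<n}" A' "\<lambda>_. 0"] A' by simp
    then show "emeasure (distr N (\<Pi>\<^sub>M i\<in>{..<n}. borel) (\<lambda>\<omega>. \<lambda>i\<in>{..<n}. X i \<omega>)) (Pi\<^sub>E {..<n} A)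
      = emeasure (distr M (\<Pi>\<^sub>M i\<in>{..<n}. borel) (\<lambda>\<omega>. \<lambda>i\<in>{..<n}. Y i \<omega>)) (Pi\<^sub>E {..<n} A)"
      unfolding PA using em[OF N Xm, of A'] em[OF M Ym, of A'] A' by simp
  next
    show "range (\<lambda>_::nat. Pi\<^sub>E {..<n} (\<lambda>_. UNIV)) \<subseteq> prod_algebra {..<n} (\<lambda>_. borel :: real measure)"
      by (auto intro!: prod_algebraI_finite)
    show "(\<Union>i::nat. Pi\<^sub>E {..<n} (\<lambda>_. UNIV)) = space (\<Pi>\<^sub>M i\<in>{..<n}. (borel :: real measure))" by (simp add: space_PiM)
    interpret D: prob_space "distr N (\<Pi>\<^sub>M i\<in>{..<n}. borel) (\<lambda>\<omega>. \<lambda>i\<in>{..<n}. X i \<omega>)" by (rule N.prob_space_distr[OF Xm])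
    show "emeasure (distr N (\<Pi>\<^sub>M i\<in>{..<n}. borel) (\<lambda>\<omega>. \<lambda>i\<in>{..<n}. X i \<omega>)) (Pi\<^sub>E {..<n} (\<lambda>_. UNIV)) \<noteq> \<infinity>" for i :: nat
      by simp
  qed auto
qed

section \<open>Continuous versions of white noise integrals\<close>

lemma Phi_L2:
  fixes a :: "'a::euclidean_space \<Rightarrow> complex"
  assumes d: "DIM('a) \<ge> 2" and a: "adm a" and I: "I \<in> sets borel" "I \<subseteq> {0<..}" and fin: "energy I a < \<infinity>"
  shows "Phi I a \<in> L2_spacetime" "(LINT z|spacetime. (Phi I a z)\<^sup>2) = enn2real (energy I a)"
proof -
  have [measurable]: "Phi I a \<in> borel_measurable spacetime" by (rule Phi_measurable(2)[OF adm_measurable[OF a] I(1)])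
  have "integrable spacetime (\<lambda>z. (Phi I a z)\<^sup>2)"
    by (rule integrableI_nonneg) (use fin in \<open>auto simp: Phi_norm[OF d a I]\<close>)
  then show "Phi I a \<in> L2_spacetime" by (simp add: L2_spacetime_def)
  show "(LINT z|spacetime. (Phi I a z)\<^sup>2) = enn2real (energy I a)"
    by (subst integral_eq_nn_integral) (auto simp: Phi_norm[OF d a I])
qed

section \<open>Taylor expansion of the characters\<close>

definition monom_at :: "'a::euclidean_space list \<Rightarrow> 'a \<Rightarrow> real" where
  "monom_at vs y = (\<Prod>v\<leftarrow>vs. y \<bullet> v)"

text \<open>Monomials are indexed by words of basis vectors, not by multi-indices. Repeating the
  same monomial expands (y \<bullet> \<zeta>)^n with all coefficients equal to 1, at the price of
  d^n words, which \<open>energy_taylor_bound\<close> affords.\<close>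

definition basis_lists :: "nat \<Rightarrow> 'a::euclidean_space list set" where
  "basis_lists n = {vs. set vs \<subseteq> Basis \<and> length vs = n}"

lemma finite_basis_lists[simp]: "finite (basis_lists n)"
  unfolding basis_lists_def by (rule finite_lists_length_eq) simp

lemma card_basis_lists: "card (basis_lists n :: 'a::euclidean_space list set) = DIM('a) ^ n"
  unfolding basis_lists_def by (rule card_lists_length_eq) simp

lemma sum_monom_at:
  fixes y \<zeta> :: "'a::euclidean_space"
  shows "(\<Sum>vs\<in>basis_lists n. monom_at vs y * monom_at vs \<zeta>) = (y \<bullet> \<zeta>) ^ n"
proof (induction n)
  case 0
  have "basis_lists 0 = {[] :: 'a list}" by (auto simp: basis_lists_def)
  then show ?case by (simp add: monom_at_def)
next
  case (Suc n)
  have eq: "basis_lists (Suc n) = (\<lambda>(b, vs). b # vs) ` ((Basis :: 'a set) \<times> basis_lists n)"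
    by (auto simp: basis_lists_def length_Suc_conv image_iff)
  have inj: "inj_on (\<lambda>(b, vs). b # vs) ((Basis :: 'a set) \<times> basis_lists n)" by (auto simp: inj_on_def)
  have "(\<Sum>vs\<in>basis_lists (Suc n). monom_at vs y * monom_at vs \<zeta>)
    = (\<Sum>p\<in>(Basis :: 'a set) \<times> basis_lists n. ((y \<bullet> fst p) * (\<zeta> \<bullet> fst p)) * (monom_at (snd p) y * monom_at (snd p) \<zeta>))"
    unfolding eq by (subst sum.reindex[OF inj]) (auto simp: monom_at_def intro!: sum.cong)
  also have "\<dots> = (\<Sum>b\<in>Basis. (y \<bullet> b) * (\<zeta> \<bullet> b)) * (\<Sum>vs\<in>basis_lists n. monom_at vs y * monom_at vs \<zeta>)"
    unfolding sum_product sum.cartesian_product by (simp add: case_prod_beta')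
  also have "\<dots> = (y \<bullet> \<zeta>) ^ Suc n"
    unfolding Suc by (simp add: euclidean_inner[of y \<zeta>])
  finally show ?case .
qed

lemma monom_at_bound:
  assumes "set vs \<subseteq> Basis" shows "\<bar>monom_at vs y\<bar> \<le> norm y ^ length vs"
  using assms
proof (induction vs)
  case (Cons v vs)
  then have "\<bar>y \<bullet> v\<bar> * \<bar>monom_at vs y\<bar> \<le> norm y * norm y ^ length vs"
    by (intro mult_mono) (auto simp: Basis_le_norm)
  then show ?case by (simp add: monom_at_def abs_mult)
qed (simp add: monom_at_def)

lemma continuous_monom_at[continuous_intros]: "continuous_on S (monom_at vs)"
proof (induction vs)
  case (Cons v vs)
  then show ?case unfolding monom_at_def by (auto intro!: continuous_intros)
qed (simp add: monom_at_def)

lemma monom_at_minus: "monom_at vs (- y) = (-1) ^ length vs * monom_at vs y"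
  by (induction vs) (auto simp: monom_at_def)

text \<open>The coefficient of \<open>monom_at vs y\<close> in the expansion of exp (2 pi i (y
  \<bullet> \<zeta>)) over words.\<close>

definition taylor_coeff :: "'a::euclidean_space list \<Rightarrow> 'a \<Rightarrow> complex" where
  "taylor_coeff vs \<zeta> = (2 * pi * \<i>) ^ length vs / fact (length vs) * complex_of_real (monom_at vs \<zeta>)"

text \<open>One factor R * norm \<zeta> is taken out before the rest is bounded by the exponential;
  this keeps the zero at the origin.\<close>

lemma taylor_bound_adm0:
  fixes a :: "'a::euclidean_space \<Rightarrow> complex"
  assumes "\<And>\<zeta>. norm (a \<zeta>) \<le> (R * norm \<zeta>) ^ n / fact n" "n \<ge> 1" "R \<ge> 0"
  shows "\<exists>C. \<forall>\<zeta>. norm (a \<zeta>) \<le> C * (norm \<zeta> * exp (C * norm \<zeta>))"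
proof (intro exI allI)
  fix \<zeta> :: 'a
  have x: "R * norm \<zeta> \<ge> 0" using assms by simp
  have "(R * norm \<zeta>) ^ n / fact n \<le> (R * norm \<zeta>) ^ n / fact (n - 1)"
    using x by (intro divide_left_mono fact_mono) auto
  also have "\<dots> = (R * norm \<zeta>) * ((R * norm \<zeta>) ^ (n - 1) / fact (n - 1))"
    using assms(2) by (cases n) auto
  also have "\<dots> \<le> (R * norm \<zeta>) * exp (R * norm \<zeta>)"
    by (intro mult_left_mono power_over_fact_le_exp x)
  finally show "norm (a \<zeta>) \<le> R * (norm \<zeta> * exp (R * norm \<zeta>))"
    using assms(1)[of \<zeta>] by (simp add: mult.assoc)
qed

lemma taylor_coeff_bound:
  assumes "set vs \<subseteq> Basis"
  shows "norm (taylor_coeff vs \<zeta>) \<le> (2 * pi * norm \<zeta>) ^ length vs / fact (length vs)"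
proof -
  have "norm (taylor_coeff vs \<zeta>) = (2 * pi) ^ length vs / fact (length vs) * \<bar>monom_at vs \<zeta>\<bar>"
    by (simp add: taylor_coeff_def norm_mult norm_divide norm_power)
  also have "\<dots> \<le> (2 * pi) ^ length vs / fact (length vs) * norm \<zeta> ^ length vs"
    by (intro mult_left_mono monom_at_bound assms) auto
  finally show ?thesis by (simp add: power_mult_distrib)
qed

lemma taylor_coeff_adm0:
  assumes "set vs \<subseteq> Basis" "length vs \<ge> 1" shows "adm0 (taylor_coeff vs)"
proof -
  have "taylor_coeff vs (- \<zeta>) = cnj (taylor_coeff vs \<zeta>)" for \<zeta>
    by (simp add: taylor_coeff_def monom_at_minus power_mult_distrib[symmetric])
  moreover have "continuous_on UNIV (taylor_coeff vs)"
    unfolding taylor_coeff_def by (intro continuous_intros) auto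
  moreover have "\<exists>C. \<forall>\<zeta>. norm (taylor_coeff vs \<zeta>) \<le> C * (norm \<zeta> * exp (C * norm \<zeta>))"
    using taylor_bound_adm0[OF taylor_coeff_bound[OF assms(1)] assms(2)] by simp
  ultimately show ?thesis by (simp add: adm0_def)
qed

text \<open>The symbol of the increment of the field from 0 to y. Subtracting 1 fixes the additive
  constant in such a way that the symbol vanishes at the origin and has finite energy over infinite
  intervals.\<close>

definition incr :: "'a::euclidean_space \<Rightarrow> 'a \<Rightarrow> complex" where
  "incr y \<zeta> = cis (2 * pi * (y \<bullet> \<zeta>)) - 1"

lemma cis_adm: "adm (\<lambda>\<zeta>. cis (2 * pi * (y \<bullet> \<zeta>)))"
  unfolding adm_def by (auto intro!: continuous_intros exI[of _ 1] simp: cis_cnj)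

lemma norm_cis_minus_1: "norm (cis x - 1) \<le> \<bar>x\<bar>"
  using iexp_approx1[of x 0] by (simp add: cis_conv_exp)

lemma incr_adm0: "adm0 (incr y)"
proof -
  have "norm (incr y \<zeta>) \<le> (2 * pi * norm y * norm \<zeta>) ^ 1 / fact 1" for \<zeta>
  proof -
    have "norm (incr y \<zeta>) \<le> 2 * pi * \<bar>y \<bullet> \<zeta>\<bar>" unfolding incr_def using norm_cis_minus_1[of "2 * pi * (y \<bullet> \<zeta>)"]
      by (simp add: abs_mult)
    also have "\<dots> \<le> 2 * pi * (norm y * norm \<zeta>)" by (intro mult_left_mono Cauchy_Schwarz_ineq2) auto
    finally show ?thesis by (simp add: mult.assoc)
  qed
  from taylor_bound_adm0[OF this] have "\<exists>C. \<forall>\<zeta>. norm (incr y \<zeta>) \<le> C * (norm \<zeta> * exp (C * norm \<zeta>))" by simp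
  then show ?thesis unfolding adm0_def incr_def by (auto intro!: continuous_intros simp: cis_cnj)
qed

text \<open>Words of lengths 1 to n; the empty word is left out because \<open>incr\<close> has no
  constant term.\<close>

definition taylor_lists :: "nat \<Rightarrow> 'a::euclidean_space list set" where
  "taylor_lists n = (\<Union>k<n. basis_lists (Suc k))"

lemma finite_taylor_lists[simp]: "finite (taylor_lists n)" by (simp add: taylor_lists_def)

lemma taylor_listsD: "vs \<in> taylor_lists n \<Longrightarrow> set vs \<subseteq> Basis" "vs \<in> taylor_lists n \<Longrightarrow> length vs \<ge> 1"
  by (auto simp: taylor_lists_def basis_lists_def)

lemma sum_taylor_lists: "(\<Sum>vs\<in>taylor_lists n. g vs) = (\<Sum>k<n. \<Sum>vs\<in>basis_lists (Suc k). g vs)"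
  unfolding taylor_lists_def by (rule sum.UNION_disjoint) (simp, simp, auto simp: basis_lists_def)

lemma taylor_sum_eq:
  "(\<Sum>vs\<in>taylor_lists n. complex_of_real (monom_at vs y) * taylor_coeff vs \<zeta>)
    = (\<Sum>k<n. (\<i> * complex_of_real (2 * pi * (y \<bullet> \<zeta>))) ^ Suc k / fact (Suc k))"
proof -
  have "(\<Sum>vs\<in>basis_lists k. complex_of_real (monom_at vs y) * taylor_coeff vs \<zeta>)
    = (\<i> * complex_of_real (2 * pi * (y \<bullet> \<zeta>))) ^ k / fact k" for k
  proof -
    have "(\<Sum>vs\<in>basis_lists k. complex_of_real (monom_at vs y) * taylor_coeff vs \<zeta>)
      = (\<Sum>vs\<in>basis_lists k. (2 * pi * \<i>) ^ k / fact k * complex_of_real (monom_at vs y * monom_at vs \<zeta>))"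
      by (intro sum.cong refl) (auto simp: taylor_coeff_def basis_lists_def)
    also have "\<dots> = (2 * pi * \<i>) ^ k / fact k * complex_of_real ((y \<bullet> \<zeta>) ^ k)"
      unfolding sum_distrib_left[symmetric] of_real_sum[symmetric] sum_monom_at ..
    finally show ?thesis by (simp add: power_mult_distrib mult_ac)
  qed
  then show ?thesis unfolding sum_taylor_lists by simp
qed

lemma taylor_remainder:
  "norm (incr y \<zeta> - (\<Sum>vs\<in>taylor_lists n. complex_of_real (monom_at vs y) * taylor_coeff vs \<zeta>))
    \<le> (2 * pi * norm y * norm \<zeta>) ^ Suc n / fact (Suc n)"
proof -
  let ?x = "2 * pi * (y \<bullet> \<zeta>)"
  have "incr y \<zeta> - (\<Sum>vs\<in>taylor_lists n. complex_of_real (monom_at vs y) * taylor_coeff vs \<zeta>)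
    = iexp ?x - (\<Sum>k\<le>n. (\<i> * ?x) ^ k / fact k)"
    unfolding taylor_sum_eq sum.atMost_shift incr_def by (simp add: cis_conv_exp del: of_real_mult)
  then have "norm (incr y \<zeta> - (\<Sum>vs\<in>taylor_lists n. complex_of_real (monom_at vs y) * taylor_coeff vs \<zeta>))
    \<le> \<bar>?x\<bar> ^ Suc n / fact (Suc n)"
    using iexp_approx1[of ?x n] by simp
  also have "\<dots> \<le> (2 * pi * norm y * norm \<zeta>) ^ Suc n / fact (Suc n)"
  proof (intro divide_right_mono power_mono)
    show "\<bar>?x\<bar> \<le> 2 * pi * norm y * norm \<zeta>"
      using Cauchy_Schwarz_ineq2[of y \<zeta>] by (simp add: abs_mult mult.assoc)
  qed auto
  finally show ?thesis .
qed

text \<open>Integral zero allows 1 to be subtracted from the character under the integral, and on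
  the bounded support |cis s - 1| \<le> |s| produces the factor norm \<zeta>.\<close>

lemma rfourier_adm0:
  assumes f0: "f \<in> test_functions0" shows "adm0 (rfourier f)"
proof -
  have f: "f \<in> test_functions" and fz: "(LINT x|lborel. f x) = 0" using f0 by (auto simp: test_functions0_iff)
  have fc: "integrable lborel (\<lambda>x. complex_of_real (f x))" by (rule test_integrable_complex[OF f])
  obtain r where r: "r > 0" "\<And>x. norm x > r \<Longrightarrow> f x = 0" using test_support[OF f] by metis
  have "rfourier f (- \<zeta>) = cnj (rfourier f \<zeta>)" for \<zeta>
  proof -
    have "rfourier f (- \<zeta>) = (LINT x|lborel. cnj (complex_of_real (f x) * cis (2 * pi * (\<zeta> \<bullet> x))))"
      unfolding fourier_def by (simp add: cis_cnj)
    also have "\<dots> = cnj (rfourier f \<zeta>)" unfolding fourier_def by (rule Bochner_Integration.integral_cnj)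
    finally show ?thesis .
  qed
  moreover have "continuous_on UNIV (rfourier f)" by (rule continuous_fourier[OF fc])
  moreover have "\<exists>C. \<forall>\<zeta>. norm (rfourier f \<zeta>) \<le> C * (norm \<zeta> * exp (C * norm \<zeta>))"
  proof -
    define c where "c = (LINT x|lborel. \<bar>f x\<bar>)"
    have c: "c \<ge> 0" unfolding c_def by simp
    have "norm (rfourier f \<zeta>) \<le> (2 * pi * r * c * norm \<zeta>) ^ 1 / fact 1" for \<zeta>
    proof -
      have 0: "(LINT x|lborel. complex_of_real (f x)) = 0" using fz by (simp only: integral_complex_of_real) simp
      have "rfourier f \<zeta> = rfourier f \<zeta> - (LINT x|lborel. complex_of_real (f x))" using 0 by simp
      also have "\<dots> = (LINT x|lborel. complex_of_real (f x) * cis (2 * pi * (\<zeta> \<bullet> x)) - complex_of_real (f x))"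
        unfolding fourier_def by (rule Bochner_Integration.integral_diff[symmetric, OF
          integrable_fourier_kernel[OF fc] fc])
      finally have "norm (rfourier f \<zeta>) \<le> (LINT x|lborel. norm (complex_of_real (f x) * cis (2 * pi * (\<zeta> \<bullet> x))
        - complex_of_real (f x)))"
        using integral_norm_bound by metis
      also have "\<dots> \<le> (LINT x|lborel. 2 * pi * r * norm \<zeta> * \<bar>f x\<bar>)"
      proof (rule integral_mono)
        show "integrable lborel (\<lambda>x. norm (complex_of_real (f x) * cis (2 * pi * (\<zeta> \<bullet> x)) - complex_of_real (f x)))"
          by (intro integrable_norm Bochner_Integration.integrable_diff integrable_fourier_kernel fc)
        show "integrable lborel (\<lambda>x. 2 * pi * r * norm \<zeta> * \<bar>f x\<bar>)"
          using test_integrable[OF f] by (intro integrable_mult_right integrable_abs)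
        fix x
        have "norm (complex_of_real (f x) * cis (2 * pi * (\<zeta> \<bullet> x)) - complex_of_real (f x))
          = \<bar>f x\<bar> * norm (cis (2 * pi * (\<zeta> \<bullet> x)) - 1)"
        proof -
          have "complex_of_real (f x) * cis (2 * pi * (\<zeta> \<bullet> x)) - complex_of_real (f x)
            = complex_of_real (f x) * (cis (2 * pi * (\<zeta> \<bullet> x)) - 1)" by (simp add: algebra_simps)
          then show ?thesis by (simp add: norm_mult)
        qed
        also have "\<dots> \<le> \<bar>f x\<bar> * (2 * pi * r * norm \<zeta>)"
        proof (cases "norm x > r")
          case False
          have "norm (cis (2 * pi * (\<zeta> \<bullet> x)) - 1) \<le> 2 * pi * \<bar>\<zeta> \<bullet> x\<bar>" using norm_cis_minus_1[of "2 * pi * (\<zeta> \<bullet> x)"]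
            by (simp add: abs_mult)
          also have "\<dots> \<le> 2 * pi * (norm \<zeta> * norm x)" by (intro mult_left_mono Cauchy_Schwarz_ineq2) auto
          also have "\<dots> \<le> 2 * pi * (norm \<zeta> * r)" using False by (intro mult_left_mono) auto
          finally show ?thesis by (intro mult_left_mono) (auto simp: mult_ac)
        qed (simp add: r)
        finally show "norm (complex_of_real (f x) * cis (2 * pi * (\<zeta> \<bullet> x)) - complex_of_real (f x))
          \<le> 2 * pi * r * norm \<zeta> * \<bar>f x\<bar>" by (simp add: mult_ac)
      qed
      also have "\<dots> = 2 * pi * r * norm \<zeta> * c" unfolding c_def by (rule integral_mult_right_zero)
      finally show ?thesis by (simp add: mult_ac)
    qed
    from taylor_bound_adm0[OF this] c r show ?thesis by simp
  qed
  ultimately show ?thesis by (simp add: adm0_def)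
qed

text \<open>The null set in the hypothesis depends on y; a countable dense set gives a common one,
  and continuity extends the equality.\<close>

lemma AE_all_continuous:
  fixes g h :: "'x \<Rightarrow> 'a::euclidean_space \<Rightarrow> real"
  assumes g: "\<And>\<omega>. \<omega> \<in> space N \<Longrightarrow> continuous_on UNIV (g \<omega>)" and h: "\<And>\<omega>. \<omega> \<in> space N \<Longrightarrow> continuous_on UNIV (h \<omega>)"
    and e: "\<And>y. AE \<omega> in N. g \<omega> y = h \<omega> y"
  shows "AE \<omega> in N. \<forall>y. g \<omega> y = h \<omega> y"
proof -
  obtain D :: "'a set" where D: "countable D" "\<And>X. open X \<Longrightarrow> X \<noteq> {} \<Longrightarrow> \<exists>d\<in>D. d \<in> X"
    using countable_dense_setE by metis
  have "AE \<omega> in N. \<forall>y\<in>D. g \<omega> y = h \<omega> y" using e by (simp add: AE_ball_countable[OF D(1)])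
  then show ?thesis
    using AE_space
  proof eventually_elim
    case (elim \<omega>)
    have "open {y. g \<omega> y \<noteq> h \<omega> y}" by (rule open_Collect_neq) (use g h elim in auto)
    then have "{y. g \<omega> y \<noteq> h \<omega> y} = {}" using D(2)[of "{y. g \<omega> y \<noteq> h \<omega> y}"] elim(1) by auto
    then show ?case by auto
  qed
qed


section \<open>The random power series over a time interval\<close>

locale noise = prob_space N for N :: "'c measure" +
  fixes W :: "('a::euclidean_space \<times> real \<Rightarrow> real) \<Rightarrow> 'c \<Rightarrow> real"
  assumes white_noise: "white_noise N W" and dim: "DIM('a) \<ge> 2"
begin

lemma W_gaussian: "F \<in> L2_spacetime \<Longrightarrow> centered_gaussian N (W F) (LINT z|spacetime. (F z)\<^sup>2)"
  using white_noise by (simp add: white_noise_def)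

lemma W_measurable: "F \<in> L2_spacetime \<Longrightarrow> W F \<in> borel_measurable N"
  using W_gaussian by (simp add: centered_gaussian_def)

lemma W_linear: "F \<in> L2_spacetime \<Longrightarrow> G \<in> L2_spacetime \<Longrightarrow> AE \<omega> in N. W (\<lambda>z. a * F z + b * G z) \<omega> = a * W F \<omega> + b * W G \<omega>"
  using white_noise by (simp add: white_noise_def)

end

text \<open>\<open>T0\<close> keeps the interval away from time 0, where the symbol provides no
  decay at high frequencies.\<close>

locale noise_interval = noise N W for N :: "'c measure" and W :: "('a::euclidean_space \<times> real \<Rightarrow> real) \<Rightarrow> 'c \<Rightarrow> real" +
  fixes I :: "real set" and T0 :: real
  assumes I: "I \<in> sets borel" "I \<subseteq> {T0..}" and T0: "T0 > 0"
begin

abbreviation Z :: "('a \<Rightarrow> complex) \<Rightarrow> 'c \<Rightarrow> real" where "Z a \<equiv> W (Phi I a)"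

lemma I0: "I \<subseteq> {0<..}" using I T0 by auto

lemma energy_lt_top: "adm0 a \<Longrightarrow> energy I a < \<infinity>" for a :: "'a \<Rightarrow> complex"
  by (rule energy_finite[OF dim _ T0 I(2)])

lemma Z_L2: "adm0 a \<Longrightarrow> Phi I a \<in> L2_spacetime" for a :: "'a \<Rightarrow> complex"
  by (rule Phi_L2(1)[OF dim adm0_adm I(1) I0 energy_lt_top])

lemma Z_gaussian: "adm0 a \<Longrightarrow> centered_gaussian N (Z a) (enn2real (energy I a))"
  using W_gaussian[OF Z_L2] Phi_L2(2)[OF dim adm0_adm I(1) I0 energy_lt_top] by simp

lemma Z_measurable: "adm0 a \<Longrightarrow> Z a \<in> borel_measurable N"
  by (rule W_measurable[OF Z_L2])

lemma Z_second_moment: "adm0 a \<Longrightarrow> (\<integral>\<^sup>+\<omega>. ennreal ((Z a \<omega>)\<^sup>2) \<partial>N) = energy I a"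
  using centered_gaussian_second_moment[OF Z_gaussian] energy_lt_top[of a] by simp

lemma Z_lincomb:
  assumes "adm0 a" "adm0 b"
  shows "AE \<omega> in N. Z (\<lambda>\<zeta>. complex_of_real r * a \<zeta> + complex_of_real s * b \<zeta>) \<omega> = r * Z a \<omega> + s * Z b \<omega>"
  unfolding Phi_lincomb[OF dim adm0_adm[OF assms(1)] adm0_adm[OF assms(2)] I0]
  by (rule W_linear) (use assms in \<open>auto intro: Z_L2\<close>)

lemma Z_distance:
  assumes a: "adm0 a" and b: "adm0 b"
  shows "(\<integral>\<^sup>+\<omega>. ennreal ((Z a \<omega> - Z b \<omega>)\<^sup>2) \<partial>N) = energy I (\<lambda>\<zeta>. a \<zeta> - b \<zeta>)"
proof -
  have eq: "(\<lambda>\<zeta>. complex_of_real 1 * a \<zeta> + complex_of_real (-1) * b \<zeta>) = (\<lambda>\<zeta>. a \<zeta> - b \<zeta>)" by simp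
  have e: "AE \<omega> in N. Z (\<lambda>\<zeta>. a \<zeta> - b \<zeta>) \<omega> = 1 * Z a \<omega> + (-1) * Z b \<omega>"
    using Z_lincomb[OF a b, of 1 "-1"] unfolding eq .
  have "(\<integral>\<^sup>+\<omega>. ennreal ((Z a \<omega> - Z b \<omega>)\<^sup>2) \<partial>N) = (\<integral>\<^sup>+\<omega>. ennreal ((Z (\<lambda>\<zeta>. a \<zeta> - b \<zeta>) \<omega>)\<^sup>2) \<partial>N)"
    by (rule nn_integral_cong_AE) (use e in \<open>eventually_elim, simp\<close>)
  also have "\<dots> = energy I (\<lambda>\<zeta>. a \<zeta> - b \<zeta>)"
    using adm0_lincomb[OF a b, of 1 "-1"] unfolding eq by (rule Z_second_moment)
  finally show ?thesis .
qed

lemma adm0_zero: "adm0 (\<lambda>_. 0)"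
  by (auto simp: adm0_def intro!: exI[of _ 0])

text \<open>Linearity holds only almost surely, so even the integral of 0 vanishes only almost
  surely; this starts the induction for finite sums.\<close>

lemma Z_zero: "AE \<omega> in N. Z (\<lambda>_. 0) \<omega> = 0"
proof (rule AE_eq_of_square_zero)
  show "(\<integral>\<^sup>+\<omega>. ennreal ((Z (\<lambda>_. 0) \<omega> - 0)\<^sup>2) \<partial>N) = 0"
    using Z_second_moment[OF adm0_zero] by (simp add: energy_def)
qed (auto intro: Z_measurable adm0_zero)

lemma Z_sum:
  assumes "finite S" "\<And>i. i \<in> S \<Longrightarrow> adm0 (a i)"
  shows "adm0 (\<lambda>\<zeta>. \<Sum>i\<in>S. complex_of_real (r i) * a i \<zeta>) \<and> (AE \<omega> in N. Z (\<lambda>\<zeta>. \<Sum>i\<in>S. complex_of_real (r i) * a i \<zeta>) \<omega>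
    = (\<Sum>i\<in>S. r i * Z (a i) \<omega>))"
  using assms
proof (induction S rule: finite_induct)
  case empty
  then show ?case using adm0_zero Z_zero by simp
next
  case (insert i S)
  let ?s = "\<lambda>\<zeta>. \<Sum>i\<in>S. complex_of_real (r i) * a i \<zeta>"
  have IH: "adm0 ?s" "AE \<omega> in N. Z ?s \<omega> = (\<Sum>i\<in>S. r i * Z (a i) \<omega>)" using insert by auto
  have ai: "adm0 (a i)" using insert by auto
  have eq: "(\<lambda>\<zeta>. \<Sum>i\<in>insert i S. complex_of_real (r i) * a i \<zeta>)
    = (\<lambda>\<zeta>. complex_of_real (r i) * a i \<zeta> + complex_of_real 1 * ?s \<zeta>)"
    using insert.hyps by simp
  have "AE \<omega> in N. Z (\<lambda>\<zeta>. \<Sum>i\<in>insert i S. complex_of_real (r i) * a i \<zeta>) \<omega> = (\<Sum>i\<in>insert i S. r i * Z (a i) \<omega>)"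
    using Z_lincomb[OF ai IH(1), of "r i" 1] IH(2) unfolding eq by eventually_elim (use insert.hyps in simp)
  moreover have "adm0 (\<lambda>\<zeta>. \<Sum>i\<in>insert i S. complex_of_real (r i) * a i \<zeta>)"
    unfolding eq by (rule adm0_lincomb[OF ai IH(1)])
  ultimately show ?case by blast
qed

text \<open>Multiplied by k ^ (n + 1), this dominates the homogeneous layer of degree n + 1 on the
  ball of radius k.\<close>

definition mass :: "nat \<Rightarrow> 'c \<Rightarrow> real" where
  "mass n \<omega> = (\<Sum>vs\<in>basis_lists (Suc n). \<bar>Z (taylor_coeff vs) \<omega>\<bar>)"

definition layer :: "nat \<Rightarrow> 'c \<Rightarrow> 'a \<Rightarrow> real" where
  "layer n \<omega> y = (\<Sum>vs\<in>basis_lists (Suc n). monom_at vs y * Z (taylor_coeff vs) \<omega>)"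

text \<open>Absolute convergence of the majorants on every ball, tested on integer radii so that the
  event is a countable intersection and measurable.\<close>

definition tame :: "'c \<Rightarrow> bool" where
  "tame \<omega> \<longleftrightarrow> (\<forall>k::nat. (\<Sum>n. ennreal (real k ^ Suc n * mass n \<omega>)) \<noteq> \<infinity>)"

text \<open>A path outside the tame event is set to 0 because \<open>random_function\<close> demands
  continuity of every path, not of almost every path.\<close>

definition version :: "'c \<Rightarrow> 'a \<Rightarrow> real" where
  "version \<omega> y = (if tame \<omega> then (\<Sum>n. layer n \<omega> y) else 0)"

lemma basis_lists_adm0: "vs \<in> basis_lists (Suc n) \<Longrightarrow> adm0 (taylor_coeff vs)"
  by (rule taylor_coeff_adm0) (auto simp: basis_lists_def)

lemma mass_measurable[measurable]: "mass n \<in> borel_measurable N"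
  unfolding mass_def by (intro borel_measurable_sum borel_measurable_abs Z_measurable basis_lists_adm0)

lemma layer_measurable[measurable]: "(\<lambda>\<omega>. layer n \<omega> y) \<in> borel_measurable N"
  unfolding layer_def by (intro borel_measurable_sum borel_measurable_times borel_measurable_const Z_measurable
    basis_lists_adm0)

lemma mass_nonneg: "mass n \<omega> \<ge> 0" by (simp add: mass_def sum_nonneg)

lemma layer_bound:
  assumes "norm y \<le> k" shows "\<bar>layer n \<omega> y\<bar> \<le> k ^ Suc n * mass n \<omega>"
proof -
  have "\<bar>layer n \<omega> y\<bar> \<le> (\<Sum>vs\<in>basis_lists (Suc n). \<bar>monom_at vs y * Z (taylor_coeff vs) \<omega>\<bar>)"
    unfolding layer_def by (rule sum_abs)
  also have "\<dots> \<le> (\<Sum>vs\<in>basis_lists (Suc n). k ^ Suc n * \<bar>Z (taylor_coeff vs) \<omega>\<bar>)"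
    unfolding abs_mult
  proof (intro sum_mono mult_right_mono)
    fix vs :: "'a list" assume vs: "vs \<in> basis_lists (Suc n)"
    then have "\<bar>monom_at vs y\<bar> \<le> norm y ^ Suc n" using monom_at_bound[of vs y] by (auto simp: basis_lists_def)
    also have "\<dots> \<le> k ^ Suc n" by (intro power_mono assms) auto
    finally show "\<bar>monom_at vs y\<bar> \<le> k ^ Suc n" .
  qed auto
  finally show ?thesis by (simp add: mass_def sum_distrib_left)
qed

text \<open>Summability in mean suffices. Layer n has d^(n+1) words, and the growth k^(n+1) on the
  ball must be beaten as well; both factors are put into the free radius of
  \<open>energy_taylor_bound\<close>, which still leaves (1 / 2)^(n+1).\<close>

lemma AE_tame: "AE \<omega> in N. tame \<omega>"
proof -
  have "AE \<omega> in N. (\<Sum>n. ennreal (real k ^ Suc n * mass n \<omega>)) \<noteq> \<infinity>" for k :: nat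
  proof (cases "k = 0")
    case True then show ?thesis by simp
  next
    case False
    \<comment> \<open>Chosen so that K^(n+1) cancels both the growth on the ball and the number of
      words.\<close>
    define K where "K = real k * real DIM('a)"
    have K: "K > 0" using False by (simp add: K_def)
    have "2 * pi * K \<ge> 0" using K by simp
    then obtain B where B: "B \<ge> 0" "\<And>I n (a :: 'a \<Rightarrow> complex). I \<subseteq> {T0..} \<Longrightarrow> n \<ge> 1
      \<Longrightarrow> (\<And>\<zeta>. norm (a \<zeta>) \<le> (2 * pi * K * norm \<zeta>) ^ n / fact n) \<Longrightarrow> energy I a \<le> ennreal (B * (1 / 4) ^ n)"
      using energy_taylor_bound[OF dim T0, of "2 * pi * K"] by metis
    have single: "(\<integral>\<^sup>+\<omega>. ennreal \<bar>Z (taylor_coeff vs) \<omega>\<bar> \<partial>N) \<le> ennreal (sqrt B * (1 / 2) ^ Suc n / K ^ Suc n)"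
      if vs: "vs \<in> basis_lists (Suc n)" for vs n
    proof (rule nn_integral_abs_le_sqrt)
      show "Z (taylor_coeff vs) \<in> borel_measurable N" by (intro Z_measurable basis_lists_adm0[OF vs])
      show "sqrt B * (1 / 2) ^ Suc n / K ^ Suc n \<ge> 0" using B K by simp
      \<comment> \<open>Inflating the coefficient by K^(n+1) makes it a symbol of the size allowed
        at radius 2 pi K; undoing this gains the factor K^(-(n+1)) in root mean square.\<close>
      let ?b = "\<lambda>\<zeta>. complex_of_real (K ^ Suc n) * taylor_coeff vs \<zeta>"
      have [measurable]: "taylor_coeff vs \<in> borel_measurable borel"
        by (rule adm_measurable[OF adm0_adm[OF basis_lists_adm0[OF vs]]])
      have "(\<integral>\<^sup>+\<omega>. ennreal ((Z (taylor_coeff vs) \<omega>)\<^sup>2) \<partial>N) = energy I (taylor_coeff vs)"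
        by (rule Z_second_moment[OF basis_lists_adm0[OF vs]])
      also have "\<dots> \<le> ennreal ((1 / K ^ Suc n)\<^sup>2) * energy I ?b"
      proof (rule energy_mono[OF subset_refl])
        fix \<zeta> :: 'a
        show "(norm (taylor_coeff vs \<zeta>))\<^sup>2 \<le> (1 / K ^ Suc n)\<^sup>2 * (norm (?b \<zeta>))\<^sup>2"
          using K by (simp add: norm_mult norm_power power_mult_distrib power_divide)
      qed (use I in auto)
      also have "\<dots> \<le> ennreal ((1 / K ^ Suc n)\<^sup>2) * ennreal (B * (1 / 4) ^ Suc n)"
      proof (intro mult_left_mono B(2) I(2))
        fix \<zeta> :: 'a
        have "norm (?b \<zeta>) \<le> K ^ Suc n * ((2 * pi * norm \<zeta>) ^ Suc n / fact (Suc n))"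
        proof -
          have "norm (taylor_coeff vs \<zeta>) \<le> (2 * pi * norm \<zeta>) ^ Suc n / fact (Suc n)"
            using taylor_coeff_bound[of vs \<zeta>] vs by (auto simp: basis_lists_def)
          then have "K ^ Suc n * norm (taylor_coeff vs \<zeta>) \<le> K ^ Suc n * ((2 * pi * norm \<zeta>) ^ Suc n / fact (Suc n))"
            using K by (intro mult_left_mono) auto
          then show ?thesis using K by (simp add: norm_mult norm_power del: power_Suc fact_Suc)
        qed
        then show "norm (?b \<zeta>) \<le> (2 * pi * K * norm \<zeta>) ^ Suc n / fact (Suc n)"
          by (simp add: power_mult_distrib mult_ac del: power_Suc fact_Suc)
      qed auto
      also have "\<dots> = ennreal ((sqrt B * (1 / 2) ^ Suc n / K ^ Suc n)\<^sup>2)"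
      proof -
        have "(1 / 4 :: real) ^ Suc n = ((1 / 2) ^ Suc n)\<^sup>2"
          by (simp add: power2_eq_square power_mult_distrib[symmetric])
        then have "(1 / K ^ Suc n)\<^sup>2 * (B * (1 / 4) ^ Suc n) = (sqrt B * (1 / 2) ^ Suc n / K ^ Suc n)\<^sup>2"
          using B(1) by (simp add: power_mult_distrib power_divide del: power_Suc)
        then show ?thesis using B(1) by (subst ennreal_mult[symmetric]) auto
      qed
      finally show "(\<integral>\<^sup>+\<omega>. ennreal ((Z (taylor_coeff vs) \<omega>)\<^sup>2) \<partial>N) \<le> ennreal ((sqrt B * (1 / 2) ^ Suc n / K ^ Suc n)\<^sup>2)"
        .
    qed
    have mb: "(\<integral>\<^sup>+\<omega>. ennreal (real k ^ Suc n * mass n \<omega>) \<partial>N) \<le> ennreal (sqrt B * (1 / 2) ^ Suc n)" for n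
    proof -
      have "(\<integral>\<^sup>+\<omega>. ennreal (real k ^ Suc n * mass n \<omega>) \<partial>N)
        = (\<integral>\<^sup>+\<omega>. ennreal (real k ^ Suc n) * (\<Sum>vs\<in>(basis_lists (Suc n) :: 'a list set). ennreal \<bar>Z (taylor_coeff vs) \<omega>\<bar>)
        \<partial>N)"
        unfolding mass_def by (intro nn_integral_cong) (simp add: ennreal_mult' sum_nonneg sum_ennreal del: power_Suc)
      also have "\<dots> = ennreal (real k ^ Suc n)
        * (\<integral>\<^sup>+\<omega>. (\<Sum>vs\<in>(basis_lists (Suc n) :: 'a list set). ennreal \<bar>Z (taylor_coeff vs) \<omega>\<bar>) \<partial>N)"
        by (rule nn_integral_cmult) (intro borel_measurable_sum measurable_compose[OF _ measurable_ennreal]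
          borel_measurable_abs Z_measurable basis_lists_adm0)
      also have "(\<integral>\<^sup>+\<omega>. (\<Sum>vs\<in>(basis_lists (Suc n) :: 'a list set). ennreal \<bar>Z (taylor_coeff vs) \<omega>\<bar>) \<partial>N)
        = (\<Sum>vs\<in>(basis_lists (Suc n) :: 'a list set). \<integral>\<^sup>+\<omega>. ennreal \<bar>Z (taylor_coeff vs) \<omega>\<bar> \<partial>N)"
        by (rule nn_integral_sum) (intro measurable_compose[OF _ measurable_ennreal] borel_measurable_abs Z_measurable
          basis_lists_adm0)
      also have "\<dots> \<le> (\<Sum>vs\<in>(basis_lists (Suc n) :: 'a list set). ennreal (sqrt B * (1 / 2) ^ Suc n / K ^ Suc n))"
        by (intro sum_mono single)
      also have "\<dots> = ennreal (real DIM('a) ^ Suc n * (sqrt B * (1 / 2) ^ Suc n / K ^ Suc n))"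
        using B K by (simp add: card_basis_lists ennreal_of_nat_eq_real_of_nat ennreal_mult[symmetric] del: power_Suc)
      also have "ennreal (real k ^ Suc n) * \<dots>
        = ennreal (real k ^ Suc n * (real DIM('a) ^ Suc n * (sqrt B * (1 / 2) ^ Suc n / K ^ Suc n)))"
        using B K by (subst ennreal_mult[symmetric]) auto
      also have "real k ^ Suc n * (real DIM('a) ^ Suc n * (sqrt B * (1 / 2) ^ Suc n / K ^ Suc n))
        = sqrt B * (1 / 2) ^ Suc n"
        using K False by (simp add: K_def power_mult_distrib del: power_Suc)
      finally show ?thesis by (simp add: mult_left_mono)
    qed
    have "(\<integral>\<^sup>+\<omega>. (\<Sum>n. ennreal (real k ^ Suc n * mass n \<omega>)) \<partial>N) = (\<Sum>n. \<integral>\<^sup>+\<omega>. ennreal (real k ^ Suc n * mass n \<omega>) \<partial>N)"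
      by (rule nn_integral_suminf) measurable
    also have "\<dots> \<le> (\<Sum>n. ennreal (sqrt B * (1 / 2) ^ Suc n))" by (intro suminf_le mb) auto
    also have "\<dots> = ennreal (\<Sum>n. sqrt B * (1 / 2) ^ Suc n)"
      using B by (intro suminf_ennreal2 summable_mult) (auto simp: summable_Suc_iff intro: summable_geometric)
    finally have "(\<integral>\<^sup>+\<omega>. (\<Sum>n. ennreal (real k ^ Suc n * mass n \<omega>)) \<partial>N) \<noteq> \<infinity>" by (auto simp: top_unique)
    then show ?thesis by (intro nn_integral_PInf_AE) auto
  qed
  then have "AE \<omega> in N. \<forall>k::nat. (\<Sum>n. ennreal (real k ^ Suc n * mass n \<omega>)) \<noteq> \<infinity>" by (simp add: AE_all_countable)
  then show ?thesis unfolding tame_def .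
qed

lemma tame_measurable[measurable]: "Measurable.pred N tame"
  unfolding tame_def by measurable

lemma tame_summable:
  assumes "tame \<omega>" shows "summable (\<lambda>n. real k ^ Suc n * mass n \<omega>)"
proof (rule summable_suminf_not_top)
  show "real k ^ Suc n * mass n \<omega> \<ge> 0" for n using mass_nonneg by simp
  show "(\<Sum>n. ennreal (real k ^ Suc n * mass n \<omega>)) \<noteq> \<top>" using assms by (auto simp: tame_def)
qed

lemma tame_uniform:
  assumes "tame \<omega>"
  shows "uniform_limit (cball 0 (real k)) (\<lambda>n y. \<Sum>i<n. layer i \<omega> y) (\<lambda>y. \<Sum>i. layer i \<omega> y) sequentially"
  by (rule Weierstrass_m_test[OF _ tame_summable[OF assms, of k]]) (use layer_bound in auto)

lemma continuous_layer: "continuous_on S (layer n \<omega>)"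
  unfolding layer_def by (intro continuous_intros)

lemma version_continuous: "continuous_on UNIV (version \<omega>)"
proof (cases "tame \<omega>")
  case True
  have c: "continuous_on (cball 0 (real k)) (\<lambda>y. \<Sum>i. layer i \<omega> y)" for k
    by (rule uniform_limit_theorem[OF _ tame_uniform[OF True]])
      (auto intro!: always_eventually continuous_on_sum continuous_layer)
  have "continuous_on (ball 0 (real k)) (\<lambda>y. \<Sum>i. layer i \<omega> y)" for k
    by (rule continuous_on_subset[OF c[of k]]) auto
  then have "continuous_on (\<Union>k. ball 0 (real k)) (\<lambda>y. \<Sum>i. layer i \<omega> y)"
    by (intro continuous_on_open_UN) auto
  moreover have "(\<Union>k. ball (0::'a) (real k)) = UNIV"
    using reals_Archimedean2 by (auto simp: dist_norm)
  ultimately show ?thesis using True by (simp add: version_def[abs_def])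
qed (simp add: version_def[abs_def])

lemma version_random_function: "random_function N version"
  unfolding random_function_def using version_continuous unfolding version_def by auto

lemma partial_sum_Z:
  "adm0 (\<lambda>\<zeta>. \<Sum>vs\<in>taylor_lists n. complex_of_real (c vs) * taylor_coeff vs \<zeta>) \<and>
   (AE \<omega> in N. Z (\<lambda>\<zeta>. \<Sum>vs\<in>taylor_lists n. complex_of_real (c vs) * taylor_coeff vs \<zeta>) \<omega> =
     (\<Sum>vs\<in>taylor_lists n. c vs * Z (taylor_coeff vs) \<omega>))"
proof (rule Z_sum)
  show "adm0 (taylor_coeff vs)" if "vs \<in> taylor_lists n" for vs :: "'a list"
    by (rule taylor_coeff_adm0[OF taylor_listsD[OF that]])
qed simp

text \<open>Both the values and the pairings of the series are identified by passing to the limit in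
  a partial sum of the Taylor expansion of the symbol.\<close>

lemma series_limit:
  assumes a: "adm0 a" and R: "R \<ge> 0" and C: "C \<ge> 0"
    and rem: "\<And>n \<zeta>. norm (a \<zeta> - (\<Sum>vs\<in>taylor_lists n. complex_of_real (c n vs) * taylor_coeff vs \<zeta>))
      \<le> C * ((R * norm \<zeta>) ^ Suc n / fact (Suc n))"
    and Y[measurable]: "Y \<in> borel_measurable N"
      and lim: "AE \<omega> in N. (\<lambda>n. \<Sum>vs\<in>taylor_lists n. c n vs * Z (taylor_coeff vs) \<omega>) \<longlonglongrightarrow> Y \<omega>"
  shows "AE \<omega> in N. Y \<omega> = Z a \<omega>"
proof -
  let ?e = "\<lambda>n \<zeta>. \<Sum>vs\<in>taylor_lists n. complex_of_real (c n vs) * taylor_coeff vs \<zeta>"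
  have e: "adm0 (?e n)" "AE \<omega> in N. Z (?e n) \<omega> = (\<Sum>vs\<in>taylor_lists n. c n vs * Z (taylor_coeff vs) \<omega>)" for n
    using partial_sum_Z by auto
  obtain B where B: "B \<ge> 0" "\<And>I n (a :: 'a \<Rightarrow> complex). I \<subseteq> {T0..} \<Longrightarrow> n \<ge> 1
    \<Longrightarrow> (\<And>\<zeta>. norm (a \<zeta>) \<le> (R * norm \<zeta>) ^ n / fact n) \<Longrightarrow> energy I a \<le> ennreal (B * (1 / 4) ^ n)"
    using energy_taylor_bound[OF dim T0 R] by metis
  have bound: "(\<integral>\<^sup>+\<omega>. ennreal ((Z (?e n) \<omega> - Z a \<omega>)\<^sup>2) \<partial>N) \<le> ennreal (C\<^sup>2 * (B * (1 / 4) ^ Suc n))" for n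
  proof -
    let ?g = "\<lambda>\<zeta>::'a. complex_of_real ((R * norm \<zeta>) ^ Suc n / fact (Suc n))"
    have "(\<integral>\<^sup>+\<omega>. ennreal ((Z (?e n) \<omega> - Z a \<omega>)\<^sup>2) \<partial>N) = energy I (\<lambda>\<zeta>. ?e n \<zeta> - a \<zeta>)" by (rule Z_distance[OF e(1) a])
    also have "\<dots> \<le> ennreal (C\<^sup>2) * energy I ?g"
    proof (rule energy_mono[OF subset_refl])
      fix \<zeta> :: 'a
      have "norm (?e n \<zeta> - a \<zeta>) \<le> C * norm (?g \<zeta>)"
        using rem[of \<zeta> n] R by (subst norm_minus_commute) (simp add: norm_mult norm_power norm_divide del: power_Suc
          fact_Suc of_real_power of_real_divide)
      then have "(norm (?e n \<zeta> - a \<zeta>))\<^sup>2 \<le> (C * norm (?g \<zeta>))\<^sup>2" by (intro power_mono) auto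
      then show "(norm (?e n \<zeta> - a \<zeta>))\<^sup>2 \<le> C\<^sup>2 * (norm (?g \<zeta>))\<^sup>2" by (simp only: power_mult_distrib)
    qed (use I in auto)
    also have "\<dots> \<le> ennreal (C\<^sup>2) * ennreal (B * (1 / 4) ^ Suc n)"
    proof (intro mult_left_mono B(2) I(2))
      fix \<zeta> :: 'a
      show "norm (?g \<zeta>) \<le> (R * norm \<zeta>) ^ Suc n / fact (Suc n)"
        unfolding norm_of_real using R by (simp del: power_Suc fact_Suc)
    qed auto
    finally show ?thesis using B(1) by (subst ennreal_mult) auto
  qed
  have "(\<lambda>n. ennreal (C\<^sup>2 * (B * (1 / 4) ^ Suc n))) \<longlonglongrightarrow> ennreal (C\<^sup>2 * (B * 0))"
    by (intro tendsto_ennrealI tendsto_mult tendsto_const LIMSEQ_Suc LIMSEQ_realpow_zero) auto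
  then have bl: "(\<lambda>n. ennreal (C\<^sup>2 * (B * (1 / 4) ^ Suc n))) \<longlonglongrightarrow> 0" by simp
  show ?thesis
  proof (rule AE_limit_eq_L2_limit[where X="\<lambda>n. Z (?e n)"])
    show "Z (?e n) \<in> borel_measurable N" for n by (rule Z_measurable[OF e(1)])
    show "Z a \<in> borel_measurable N" by (rule Z_measurable[OF a])
    have "AE \<omega> in N. \<forall>n. Z (?e n) \<omega> = (\<Sum>vs\<in>taylor_lists n. c n vs * Z (taylor_coeff vs) \<omega>)" using e(2)
      by (simp add: AE_all_countable)
    then show "AE \<omega> in N. (\<lambda>n. Z (?e n) \<omega>) \<longlonglongrightarrow> Y \<omega>" using lim by eventually_elim simp
    show "(\<lambda>n. \<integral>\<^sup>+\<omega>. ennreal ((Z (?e n) \<omega> - Z a \<omega>)\<^sup>2) \<partial>N) \<longlonglongrightarrow> 0"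
      by (rule tendsto_0_le_ennreal[OF bl]) (intro always_eventually allI bound)
  qed (rule Y)
qed

lemma sum_layer: "(\<Sum>k<n. layer k \<omega> y) = (\<Sum>vs\<in>taylor_lists n. monom_at vs y * Z (taylor_coeff vs) \<omega>)"
  by (simp add: sum_taylor_lists layer_def)

lemma version_value: "AE \<omega> in N. version \<omega> y = Z (incr y) \<omega>"
proof (rule series_limit[where c="\<lambda>_ vs. monom_at vs y" and R="2 * pi * norm y" and C=1])
  show "(\<lambda>\<omega>. version \<omega> y) \<in> borel_measurable N" using version_random_function by (simp add: random_function_def)
  show "AE \<omega> in N. (\<lambda>n. \<Sum>vs\<in>taylor_lists n. monom_at vs y * Z (taylor_coeff vs) \<omega>) \<longlonglongrightarrow> version \<omega> y"
    using AE_tame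
  proof eventually_elim
    case (elim \<omega>)
    obtain k :: nat where "norm y \<le> real k" using real_arch_simple by blast
    then have "(\<lambda>n. \<Sum>i<n. layer i \<omega> y) \<longlonglongrightarrow> (\<Sum>i. layer i \<omega> y)"
      using tendsto_uniform_limitI[OF tame_uniform[OF elim, of k], of y] by simp
    then show ?case using elim by (simp add: sum_layer version_def)
  qed
qed (use taylor_remainder[of y] in \<open>auto intro: incr_adm0 simp del: power_Suc fact_Suc\<close>)

text \<open>In effect a stochastic Fubini theorem. Pairing a partial sum with \<open>f\<close> gives
  a finite combination of stochastic integrals, uniform convergence on the support passes to the
  pairing, and the Taylor remainder, integrated against |f|, controls the symbol.\<close>

lemma version_pairing:
  assumes f0: "f \<in> test_functions0"
  shows "(\<lambda>\<omega>. pairing version \<omega> f) \<in> borel_measurable N" "AE \<omega> in N. pairing version \<omega> f = Z (rfourier f) \<omega>"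
proof -
  have f: "f \<in> test_functions" and fz: "(LINT x|lborel. f x) = 0" using f0 by (auto simp: test_functions0_iff)
  obtain r where r: "r > 0" "\<And>x. norm x > r \<Longrightarrow> f x = 0" using test_support[OF f] by metis
  obtain k :: nat where k: "r \<le> real k" using real_arch_simple by blast
  have [measurable]: "f \<in> borel_measurable borel" using f by measurable
  have int: "integrable lborel (\<lambda>y. f y * g y)" if "continuous_on UNIV g" for g :: "'a \<Rightarrow> real"
    by (rule integrable_compact_support[where r=r])
      (use r that in \<open>auto intro!: continuous_intros test_continuous[OF f]\<close>)
  define c where "c vs = (LINT y|lborel. f y * monom_at vs y)" for vs
  have part: "(LINT y|lborel. f y * (\<Sum>i<n. layer i \<omega> y)) = (\<Sum>vs\<in>taylor_lists n. c vs * Z (taylor_coeff vs) \<omega>)" for n \<omega>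
  proof -
    have "(LINT y|lborel. f y * (\<Sum>i<n. layer i \<omega> y))
      = (LINT y|lborel. (\<Sum>vs\<in>taylor_lists n. (f y * monom_at vs y) * Z (taylor_coeff vs) \<omega>))"
      by (simp add: sum_layer sum_distrib_left mult.assoc)
    also have "\<dots> = (\<Sum>vs\<in>taylor_lists n. LINT y|lborel. (f y * monom_at vs y) * Z (taylor_coeff vs) \<omega>)"
      by (rule Bochner_Integration.integral_sum) (intro integrable_mult_left int continuous_monom_at)
    finally show ?thesis by (simp add: c_def)
  qed
  have lim: "(\<lambda>n. \<Sum>vs\<in>taylor_lists n. c vs * Z (taylor_coeff vs) \<omega>) \<longlonglongrightarrow> pairing version \<omega> f" if t: "tame \<omega>" for \<omega>
    unfolding part[symmetric] pairing_def
  proof (rule integral_dominated_convergence[where w="\<lambda>y. \<bar>f y\<bar> * (\<Sum>n. real k ^ Suc n * mass n \<omega>)"])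
    show "integrable lborel (\<lambda>y. \<bar>f y\<bar> * (\<Sum>n. real k ^ Suc n * mass n \<omega>))" using test_integrable[OF f]
      by (intro integrable_mult_left integrable_abs)
    show "(\<lambda>y. f y * version \<omega> y) \<in> borel_measurable lborel" using int[OF version_continuous] by auto
    show "(\<lambda>y. f y * (\<Sum>i<n. layer i \<omega> y)) \<in> borel_measurable lborel" for n
    proof -
      have "continuous_on UNIV (\<lambda>y. \<Sum>i<n. layer i \<omega> y)" by (intro continuous_on_sum continuous_layer)
      from int[OF this] show ?thesis by auto
    qed
    show "AE y in lborel. (\<lambda>n. f y * (\<Sum>i<n. layer i \<omega> y)) \<longlonglongrightarrow> f y * version \<omega> y"
    proof (intro AE_I2 tendsto_mult tendsto_const)
      fix y :: 'a
      obtain j :: nat where "norm y \<le> real j" using real_arch_simple by blast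
      then show "(\<lambda>n. \<Sum>i<n. layer i \<omega> y) \<longlonglongrightarrow> version \<omega> y"
        using tendsto_uniform_limitI[OF tame_uniform[OF t, of j], of y] t by (simp add: version_def)
    qed
    show "AE y in lborel. norm (f y * (\<Sum>i<n. layer i \<omega> y)) \<le> \<bar>f y\<bar> * (\<Sum>n. real k ^ Suc n * mass n \<omega>)" for n
    proof (rule AE_I2)
      fix y :: 'a
      show "norm (f y * (\<Sum>i<n. layer i \<omega> y)) \<le> \<bar>f y\<bar> * (\<Sum>n. real k ^ Suc n * mass n \<omega>)"
      proof (cases "norm y > r")
        case False
        then have "norm y \<le> real k" using k by simp
        then have "\<bar>\<Sum>i<n. layer i \<omega> y\<bar> \<le> (\<Sum>i<n. real k ^ Suc i * mass i \<omega>)"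
          by (intro order.trans[OF sum_abs] sum_mono layer_bound)
        also have "\<dots> \<le> (\<Sum>n. real k ^ Suc n * mass n \<omega>)"
          by (rule sum_le_suminf[OF tame_summable[OF t]]) (use mass_nonneg in auto)
        finally show ?thesis by (simp add: abs_mult mult_left_mono)
      qed (simp add: r)
    qed
  qed
  \<comment> \<open>Measurability in \<omega> is obtained by writing the pairing as a limit of
    measurable variables on the tame event; off that event the pairing is 0.\<close>
  have "(\<lambda>\<omega>. if tame \<omega> then lim (\<lambda>n. \<Sum>vs\<in>taylor_lists n. c vs * Z (taylor_coeff vs) \<omega>) else 0) \<in> borel_measurable N"
  proof -
    have [measurable]: "(\<lambda>\<omega>. \<Sum>vs\<in>taylor_lists n. c vs * Z (taylor_coeff vs) \<omega>) \<in> borel_measurable N" for n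
      by (intro borel_measurable_sum borel_measurable_times borel_measurable_const Z_measurable taylor_coeff_adm0
        taylor_listsD)
    show ?thesis by measurable
  qed
  also have "(\<lambda>\<omega>. if tame \<omega> then lim (\<lambda>n. \<Sum>vs\<in>taylor_lists n. c vs * Z (taylor_coeff vs) \<omega>) else 0)
    = (\<lambda>\<omega>. pairing version \<omega> f)"
  proof
    fix \<omega>
    show "(if tame \<omega> then lim (\<lambda>n. \<Sum>vs\<in>taylor_lists n. c vs * Z (taylor_coeff vs) \<omega>) else 0) = pairing version \<omega> f"
      using limI[OF lim] by (auto simp: pairing_def version_def)
  qed
  finally show m: "(\<lambda>\<omega>. pairing version \<omega> f) \<in> borel_measurable N" .
  show "AE \<omega> in N. pairing version \<omega> f = Z (rfourier f) \<omega>"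
  proof (rule series_limit[where c="\<lambda>_. c" and R="2 * pi * r"
    and C="LINT y|lborel. \<bar>f y\<bar>", OF rfourier_adm0[OF f0] _ _ _ m])
    show "AE \<omega> in N. (\<lambda>n. \<Sum>vs\<in>taylor_lists n. c vs * Z (taylor_coeff vs) \<omega>) \<longlonglongrightarrow> pairing version \<omega> f"
      using AE_tame by eventually_elim (rule lim)
    fix n and \<zeta> :: 'a
    let ?s = "\<lambda>y. \<Sum>vs\<in>taylor_lists n. complex_of_real (monom_at vs y) * taylor_coeff vs \<zeta>"
    have i1: "integrable lborel (\<lambda>y. complex_of_real (f y) * incr y \<zeta>)"
      by (rule integrable_compact_support[where r=r]) (use r in \<open>auto simp: incr_def intro!: continuous_intros
        test_continuous[OF f]\<close>)
    have i2: "integrable lborel (\<lambda>y. complex_of_real (f y * monom_at vs y) * taylor_coeff vs \<zeta>)" for vs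
      using int[OF continuous_monom_at, of vs]
        by (intro integrable_mult_left) (simp only: complex_of_real_integrable_eq)
    have s1: "rfourier f \<zeta> = (LINT y|lborel. complex_of_real (f y) * incr y \<zeta>)"
    proof -
      have z: "(LINT x|lborel. complex_of_real (f x)) = 0" using fz by (simp only: integral_complex_of_real) simp
      have "(LINT y|lborel. complex_of_real (f y) * incr y \<zeta>)
        = (LINT y|lborel. complex_of_real (f y) * cis (2 * pi * (\<zeta> \<bullet> y)) - complex_of_real (f y))"
        by (intro Bochner_Integration.integral_cong refl) (simp add: incr_def algebra_simps inner_commute)
      also have "\<dots> = rfourier f \<zeta> - (LINT x|lborel. complex_of_real (f x))"
        unfolding fourier_def by (rule Bochner_Integration.integral_diff[OF integrable_fourier_kernel
          test_integrable_complex[OF f]]) (rule test_integrable_complex[OF f])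
      finally show ?thesis using z by simp
    qed
    have s2: "(\<Sum>vs\<in>taylor_lists n. complex_of_real (c vs) * taylor_coeff vs \<zeta>)
      = (LINT y|lborel. complex_of_real (f y) * ?s y)"
    proof -
      have "(LINT y|lborel. complex_of_real (f y) * ?s y)
        = (LINT y|lborel. (\<Sum>vs\<in>taylor_lists n. complex_of_real (f y * monom_at vs y) * taylor_coeff vs \<zeta>))"
        by (simp add: sum_distrib_left mult.assoc)
      also have "\<dots> = (\<Sum>vs\<in>taylor_lists n. LINT y|lborel. complex_of_real (f y * monom_at vs y) * taylor_coeff vs \<zeta>)"
        by (rule Bochner_Integration.integral_sum) (rule i2)
      also have "\<dots> = (\<Sum>vs\<in>taylor_lists n. complex_of_real (c vs) * taylor_coeff vs \<zeta>)"
        unfolding c_def integral_mult_left_zero integral_complex_of_real ..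
      finally show ?thesis by simp
    qed
    have i3: "integrable lborel (\<lambda>y. complex_of_real (f y) * ?s y)"
    proof -
      have "(\<lambda>y. complex_of_real (f y) * ?s y)
        = (\<lambda>y. \<Sum>vs\<in>taylor_lists n. complex_of_real (f y * monom_at vs y) * taylor_coeff vs \<zeta>)"
        by (simp add: sum_distrib_left mult.assoc)
      then show ?thesis using i2 by auto
    qed
    have "norm (rfourier f \<zeta> - (\<Sum>vs\<in>taylor_lists n. complex_of_real (c vs) * taylor_coeff vs \<zeta>))
      = norm (LINT y|lborel. complex_of_real (f y) * incr y \<zeta> - complex_of_real (f y) * ?s y)"
      unfolding s1 s2 by (subst Bochner_Integration.integral_diff[OF i1 i3]) simp
    also have "\<dots> \<le> (LINT y|lborel. norm (complex_of_real (f y) * incr y \<zeta> - complex_of_real (f y) * ?s y))"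
      by (rule integral_norm_bound)
    also have "\<dots> \<le> (LINT y|lborel. \<bar>f y\<bar> * ((2 * pi * r * norm \<zeta>) ^ Suc n / fact (Suc n)))"
    proof (rule integral_mono)
      show "integrable lborel (\<lambda>y. norm (complex_of_real (f y) * incr y \<zeta> - complex_of_real (f y) * ?s y))"
        by (intro integrable_norm Bochner_Integration.integrable_diff i1 i3)
      show "integrable lborel (\<lambda>y. \<bar>f y\<bar> * ((2 * pi * r * norm \<zeta>) ^ Suc n / fact (Suc n)))"
        using test_integrable[OF f] by (intro integrable_mult_left integrable_abs)
      fix y :: 'a
      have "norm (complex_of_real (f y) * incr y \<zeta> - complex_of_real (f y) * ?s y) = \<bar>f y\<bar> * norm (incr y \<zeta> - ?s y)"
        unfolding right_diff_distrib[symmetric] norm_mult by simp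
      also have "\<dots> \<le> \<bar>f y\<bar> * ((2 * pi * r * norm \<zeta>) ^ Suc n / fact (Suc n))"
      proof (cases "norm y > r")
        case False
        have "norm (incr y \<zeta> - ?s y) \<le> (2 * pi * norm y * norm \<zeta>) ^ Suc n / fact (Suc n)" by (rule taylor_remainder)
        also have "\<dots> \<le> (2 * pi * r * norm \<zeta>) ^ Suc n / fact (Suc n)"
          using False by (intro divide_right_mono power_mono mult_right_mono mult_left_mono) auto
        finally show ?thesis by (intro mult_left_mono) auto
      qed (simp add: r)
      finally show "norm (complex_of_real (f y) * incr y \<zeta> - complex_of_real (f y) * ?s y)
        \<le> \<bar>f y\<bar> * ((2 * pi * r * norm \<zeta>) ^ Suc n / fact (Suc n))" .
    qed
    also have "\<dots> = (LINT y|lborel. \<bar>f y\<bar>) * ((2 * pi * r * norm \<zeta>) ^ Suc n / fact (Suc n))"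
      by (rule integral_mult_left_zero)
    finally show "norm (rfourier f \<zeta> - (\<Sum>vs\<in>taylor_lists n. complex_of_real (c vs) * taylor_coeff vs \<zeta>))
      \<le> (LINT y|lborel. \<bar>f y\<bar>) * ((2 * pi * r * norm \<zeta>) ^ Suc n / fact (Suc n))" .
  qed (use r in auto)
qed

text \<open>A continuous process with the right increments coincides, off one null set, with
  \<open>version\<close> plus the random constant \<open>H \<omega> 0\<close>; the integral zero of
  \<open>f\<close> removes the constant.\<close>

lemma pairing_eq_Z:
  assumes H: "random_function N H" and inc: "\<And>y. AE \<omega> in N. H \<omega> y - H \<omega> 0 = Z (incr y) \<omega>"
    and f0: "f \<in> test_functions0"
  shows "AE \<omega> in N. pairing H \<omega> f = Z (rfourier f) \<omega>"
proof -
  have f: "f \<in> test_functions" and fz: "(LINT x|lborel. f x) = 0" using f0 by (auto simp: test_functions0_iff)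
  obtain r where r: "r > 0" "\<And>x. norm x > r \<Longrightarrow> f x = 0" using test_support[OF f] by metis
  have "AE \<omega> in N. \<forall>y. H \<omega> y - H \<omega> 0 = version \<omega> y"
  proof (rule AE_all_continuous)
    show "continuous_on UNIV (\<lambda>y. H \<omega> y - H \<omega> 0)" if "\<omega> \<in> space N" for \<omega>
      using H that by (auto simp: random_function_def intro!: continuous_intros)
    show "AE \<omega> in N. H \<omega> y - H \<omega> 0 = version \<omega> y" for y
      using inc[of y] version_value[of y] by eventually_elim simp
  qed (rule version_continuous)
  then show ?thesis
    using version_pairing(2)[OF f0]
  proof eventually_elim
    case (elim \<omega>)
    have i: "integrable lborel (\<lambda>y. f y * version \<omega> y)"
      by (rule integrable_compact_support[where r=r]) (use r in \<open>auto intro!: continuous_intros test_continuous[OF f]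
        version_continuous\<close>)
    have "pairing H \<omega> f = (LINT y|lborel. f y * version \<omega> y + f y * H \<omega> 0)"
      unfolding pairing_def
    proof (intro Bochner_Integration.integral_cong refl)
      fix y
      have "H \<omega> y = version \<omega> y + H \<omega> 0" using elim(1) by (metis diff_add_cancel)
      then show "f y * H \<omega> y = f y * version \<omega> y + f y * H \<omega> 0" by (simp add: distrib_left)
    qed
    also have "\<dots> = pairing version \<omega> f + 0"
      using i test_integrable[OF f] fz by (simp add: pairing_def)
    finally show ?case using elim(2) by simp
  qed
qed

end

section \<open>The white noise field over an infinite time interval\<close>

lemma L2_limit_cong_limit:
  assumes "L2_limit N X Y" "Y' \<in> borel_measurable N" "AE \<omega> in N. Y' \<omega> = Y \<omega>"
  shows "L2_limit N X Y'"
proof -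
  have "(\<integral>\<^sup>+\<omega>. ennreal ((X R \<omega> - Y' \<omega>)\<^sup>2) \<partial>N) = (\<integral>\<^sup>+\<omega>. ennreal ((X R \<omega> - Y \<omega>)\<^sup>2) \<partial>N)" for R
    by (rule nn_integral_cong_AE) (use assms(3) in \<open>eventually_elim, simp\<close>)
  then show ?thesis using assms by (simp add: L2_limit_def)
qed

lemma bump_integral:
  fixes y :: "'a::euclidean_space"
  assumes n: "n > 0"
  shows "(LINT x|lborel. bump n y x) = (1 / n) ^ DIM('a) * (LINT u|lborel. bump 1 0 (u::'a))"
    and "continuous_on UNIV g \<Longrightarrow> (LINT x|lborel. bump n y x * g x)
      = (1 / n) ^ DIM('a) * (LINT u|lborel. bump 1 0 u * g (y + (1 / n) *\<^sub>R u))"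
proof -
  have [measurable]: "bump n y \<in> borel_measurable borel" by (rule test_measurable[OF bump_test[OF n]])
  show "(LINT x|lborel. bump n y x) = (1 / n) ^ DIM('a) * (LINT u|lborel. bump 1 0 (u::'a))"
    using n by (subst integral_lborel_scale_shift[where c="1 / n" and t=y]) (auto simp: bump_scale)
  assume "continuous_on UNIV g"
  then have [measurable]: "g \<in> borel_measurable borel" by (rule borel_measurable_continuous_onI)
  show "(LINT x|lborel. bump n y x * g x) = (1 / n) ^ DIM('a) * (LINT u|lborel. bump 1 0 u * g (y + (1 / n) *\<^sub>R u))"
    using n by (subst integral_lborel_scale_shift[where c="1 / n" and t=y]) (auto simp: bump_scale)
qed

lemma bump_integral_pos: "(LINT u|lborel. bump 1 0 (u::'a::euclidean_space)) > 0"
proof -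
  have "(LINT u|lborel. indicator (cball 0 1) (u::'a)) \<le> (LINT u|lborel. bump 1 0 (u::'a))"
  proof (rule integral_mono)
    show "integrable lborel (indicator (cball 0 1) :: 'a \<Rightarrow> real)"
      using emeasure_bounded_finite[OF bounded_cball, of "0::'a" 1] by (intro integrable_real_indicator) auto
    show "integrable lborel (bump 1 (0::'a))" by (rule test_integrable[OF bump_test]) simp
    show "indicator (cball 0 1) u \<le> bump 1 0 u" for u :: 'a
      using bump_nonneg[of 1 0 u] bump_eq_1[of 1 u 0] by (auto simp: indicator_def)
  qed
  moreover have "(LINT u|lborel. indicator (cball 0 1) (u::'a)) = unit_ball_vol (real DIM('a))"
    by (simp add: content_cball)
  ultimately show ?thesis using unit_ball_vol_pos[of "real DIM('a)"] by linarith
qed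

text \<open>Rescaled bumps form an approximate identity; in \<open>infinity_unique\<close> they
  recover the values of a continuous path from its pairings.\<close>

lemma bump_average_tendsto:
  fixes g :: "'a::euclidean_space \<Rightarrow> real"
  assumes g: "continuous_on UNIV g"
  shows "(\<lambda>n. LINT u|lborel. bump 1 0 u * g (y + (1 / real (Suc n)) *\<^sub>R u)) \<longlonglongrightarrow> (LINT u|lborel. bump 1 0 (u::'a)) * g y"
proof -
  have bt: "bump 1 (0::'a) \<in> test_functions" by (rule bump_test) simp
  obtain r where r: "r > 0" "\<And>x::'a. norm x > r \<Longrightarrow> bump 1 0 x = 0" using test_support[OF bt] by metis
  have "bounded (g ` cball y r)"
    by (intro compact_imp_bounded compact_continuous_image continuous_on_subset[OF g]) auto
  then obtain B where B: "\<forall>x\<in>cball y r. \<bar>g x\<bar> \<le> B" by (auto simp: bounded_iff)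
  have [measurable]: "g \<in> borel_measurable borel" using g by (rule borel_measurable_continuous_onI)
  have [measurable]: "bump 1 (0::'a) \<in> borel_measurable borel" by (rule test_measurable[OF bt])
  have "(\<lambda>n. LINT u|lborel. bump 1 0 u * g (y + (1 / real (Suc n)) *\<^sub>R u)) \<longlonglongrightarrow> (LINT u|lborel. bump 1 0 (u::'a) * g y)"
  proof (rule integral_dominated_convergence[where w="\<lambda>u. bump 1 0 u * B"])
    show "integrable lborel (\<lambda>u::'a. bump 1 0 u * B)" by (intro integrable_mult_left test_integrable bt)
    show "AE u in lborel. (\<lambda>n. bump 1 0 u * g (y + (1 / real (Suc n)) *\<^sub>R u)) \<longlonglongrightarrow> bump 1 0 u * g y"
    proof (intro AE_I2 tendsto_mult tendsto_const)
      fix u :: 'a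
      have "(\<lambda>n. y + (1 / real (Suc n)) *\<^sub>R u) \<longlonglongrightarrow> y + 0 *\<^sub>R u"
        by (intro tendsto_add tendsto_scaleR tendsto_const LIMSEQ_Suc[OF lim_1_over_n])
      then show "(\<lambda>n. g (y + (1 / real (Suc n)) *\<^sub>R u)) \<longlonglongrightarrow> g y"
        using g by (intro isCont_tendsto_compose[where g=g]) (auto simp: continuous_on_eq_continuous_at)
    qed
    show "AE u in lborel. norm (bump 1 0 u * g (y + (1 / real (Suc n)) *\<^sub>R u)) \<le> bump 1 0 u * B" for n
    proof (rule AE_I2)
      fix u :: 'a
      show "norm (bump 1 0 u * g (y + (1 / real (Suc n)) *\<^sub>R u)) \<le> bump 1 0 u * B"
      proof (cases "norm u > r")
        case False
        have "norm u * 1 \<le> r * real (Suc n)" using False r(1) by (intro mult_mono) auto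
        then have "norm u / real (Suc n) \<le> r" by (simp add: field_simps)
        then have "y + (1 / real (Suc n)) *\<^sub>R u \<in> cball y r" by (simp add: dist_norm)
        then have "\<bar>g (y + (1 / real (Suc n)) *\<^sub>R u)\<bar> \<le> B" by (rule bspec[OF B])
        then show ?thesis using bump_nonneg[of 1 0 u] by (simp add: abs_mult mult_left_mono del: of_nat_Suc)
      qed (simp add: r)
    qed
  qed measurable
  then show ?thesis by simp
qed

context noise begin

lemma intervalI: "T0 > 0 \<Longrightarrow> I \<in> sets borel \<Longrightarrow> I \<subseteq> {T0..} \<Longrightarrow> noise_interval N W I T0"
  by unfold_locales auto

text \<open>States the result outside the locale of a single interval, so that the fields for all R
  and for the infinite interval can be compared over the same noise.\<close>

lemma exists_version:
  assumes "T0 > 0" "I \<in> sets borel" "I \<subseteq> {T0..}"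
  shows "\<exists>X. random_function N X \<and> (\<forall>y. AE \<omega> in N. X \<omega> y = W (Phi I (incr y)) \<omega>) \<and>
     (\<forall>f\<in>test_functions0. (\<lambda>\<omega>. pairing X \<omega> f) \<in> borel_measurable N \<and>
       (AE \<omega> in N. pairing X \<omega> f = W (Phi I (rfourier f)) \<omega>))"
proof -
  interpret noise_interval N W I T0 by (rule intervalI[OF assms])
  show ?thesis using version_random_function version_value version_pairing by blast
qed

lemma cis_L2:
  fixes y :: 'a
  assumes \<beta>: "\<beta> > 0"
  shows "Phi {\<beta>\<^sup>2<..<R\<^sup>2} (\<lambda>\<zeta>. cis (2 * pi * (y \<bullet> \<zeta>))) \<in> L2_spacetime"
proof (rule Phi_L2(1)[OF dim cis_adm])
  have "\<beta>\<^sup>2 > 0" using \<beta> by simp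
  show "{\<beta>\<^sup>2<..<R\<^sup>2} \<subseteq> {0<..}" by (auto intro: le_less_trans[OF zero_le_power2])
  show "energy {\<beta>\<^sup>2<..<R\<^sup>2} (\<lambda>\<zeta>. cis (2 * pi * (y \<bullet> \<zeta>))) < \<infinity>"
    by (rule energy_finite_bounded[OF dim cis_adm \<open>\<beta>\<^sup>2 > 0\<close>, of _ "R\<^sup>2"]) auto
qed simp

text \<open>Over a bounded interval both values have finite energy separately, but only the symbol
  of their difference lies in \<open>adm0\<close>, where \<open>pairing_eq_Z\<close> can use
  it.\<close>

lemma field_increment:
  assumes \<beta>: "\<beta> > 0" and H: "white_noise_field N W \<beta> R H"
  shows "AE \<omega> in N. H \<omega> y - H \<omega> 0 = W (Phi {\<beta>\<^sup>2<..<R\<^sup>2} (incr y)) \<omega>"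
proof -
  let ?I = "{\<beta>\<^sup>2<..<R\<^sup>2}" and ?c = "\<lambda>y \<zeta>. cis (2 * pi * (y \<bullet> \<zeta>))"
  have "\<beta>\<^sup>2 > 0" using \<beta> by simp
  have I0: "?I \<subseteq> {0<..}" by (auto intro: le_less_trans[OF zero_le_power2])
  have val: "AE \<omega> in N. H \<omega> y = W (Phi ?I (?c y)) \<omega>" for y
    using H unfolding white_noise_field_def Phi_heat_kernel by blast
  have "incr y = (\<lambda>\<zeta>. complex_of_real 1 * ?c y \<zeta> + complex_of_real (-1) * ?c 0 \<zeta>)" by (simp add: incr_def fun_eq_iff)
  then have eq: "Phi ?I (incr y) = (\<lambda>z. 1 * Phi ?I (?c y) z + (-1) * Phi ?I (?c 0) z)"
    using Phi_lincomb[OF dim cis_adm cis_adm I0, of 1 y "-1" 0] by simp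
  show ?thesis
    using val[of y] val[of 0] W_linear[OF cis_L2[OF \<beta>, of R y] cis_L2[OF \<beta>, of R 0], of 1 "-1"] unfolding eq
    by eventually_elim simp
qed

text \<open>The difference of the two integrals is white noise over the times from R^2 on, and
  \<open>energy_tail\<close> bounds its variance by a multiple of R^(-4/d).\<close>

lemma truncated_pairing_limit:
  assumes \<beta>: "\<beta> > 0" and f0: "f \<in> test_functions0"
  shows "L2_limit N (\<lambda>R. W (Phi {\<beta>\<^sup>2<..<R\<^sup>2} (rfourier f))) (W (Phi {\<beta>\<^sup>2<..} (rfourier f)))"
proof -
  have b2: "\<beta>\<^sup>2 > 0" using \<beta> by simp
  let ?a = "rfourier f"
  have a: "adm0 ?a" by (rule rfourier_adm0[OF f0])
  interpret Inf: noise_interval N W "{\<beta>\<^sup>2<..}" "\<beta>\<^sup>2" by (rule intervalI[OF b2]) auto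
  have m: "W (Phi {\<beta>\<^sup>2<..<R\<^sup>2} ?a) \<in> borel_measurable N" and L: "Phi {\<beta>\<^sup>2<..<R\<^sup>2} ?a \<in> L2_spacetime" for R :: real
  proof -
    interpret R: noise_interval N W "{\<beta>\<^sup>2<..<R\<^sup>2}" "\<beta>\<^sup>2" by (rule intervalI[OF b2]) auto
    show "W (Phi {\<beta>\<^sup>2<..<R\<^sup>2} ?a) \<in> borel_measurable N" "Phi {\<beta>\<^sup>2<..<R\<^sup>2} ?a \<in> L2_spacetime"
      by (rule R.Z_measurable[OF a], rule R.Z_L2[OF a])
  qed
  obtain D where D: "\<And>T. T \<ge> \<beta>\<^sup>2 \<Longrightarrow> energy {T..} ?a \<le> ennreal (D * T powr (- 2 / DIM('a)))"
    using energy_tail[OF dim a b2] by blast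
  have bd: "(\<integral>\<^sup>+\<omega>. ennreal ((W (Phi {\<beta>\<^sup>2<..<R\<^sup>2} ?a) \<omega> - W (Phi {\<beta>\<^sup>2<..} ?a) \<omega>)\<^sup>2) \<partial>N)
    \<le> ennreal (D * (R\<^sup>2) powr (- 2 / DIM('a)))" if R: "R > \<beta>" for R
  proof -
    have R2: "\<beta>\<^sup>2 < R\<^sup>2" using R \<beta> by (intro power_strict_mono) auto
    interpret T: noise_interval N W "{R\<^sup>2..}" "\<beta>\<^sup>2" by (rule intervalI[OF b2]) (use R2 in auto)
    have eq: "(\<lambda>z. 1 * Phi {\<beta>\<^sup>2<..} ?a z + (-1) * Phi {\<beta>\<^sup>2<..<R\<^sup>2} ?a z) = Phi {R\<^sup>2..} ?a"
      using R2 by (auto simp: Phi_def fun_eq_iff indicator_def)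
    have e: "AE \<omega> in N. W (Phi {R\<^sup>2..} ?a) \<omega> = 1 * W (Phi {\<beta>\<^sup>2<..} ?a) \<omega> + (-1) * W (Phi {\<beta>\<^sup>2<..<R\<^sup>2} ?a) \<omega>"
      using W_linear[OF Inf.Z_L2[OF a] L[of R], of 1 "-1"] unfolding eq .
    have "(\<integral>\<^sup>+\<omega>. ennreal ((W (Phi {\<beta>\<^sup>2<..<R\<^sup>2} ?a) \<omega> - W (Phi {\<beta>\<^sup>2<..} ?a) \<omega>)\<^sup>2) \<partial>N)
      = (\<integral>\<^sup>+\<omega>. ennreal ((W (Phi {R\<^sup>2..} ?a) \<omega>)\<^sup>2) \<partial>N)"
      by (rule nn_integral_cong_AE) (use e in \<open>eventually_elim, simp add: power2_commute\<close>)
    also have "\<dots> = energy {R\<^sup>2..} ?a" by (rule T.Z_second_moment[OF a])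
    also have "\<dots> \<le> ennreal (D * (R\<^sup>2) powr (- 2 / DIM('a)))" by (rule D) (use R2 in simp)
    finally show ?thesis .
  qed
  have "filterlim (\<lambda>R::real. R\<^sup>2) at_top at_top" by (rule filterlim_pow_at_top) (auto simp: filterlim_ident)
  then have "((\<lambda>R::real. (R\<^sup>2) powr (- 2 / DIM('a))) \<longlongrightarrow> 0) at_top" by (intro tendsto_neg_powr) auto
  then have "((\<lambda>R. ennreal (D * (R\<^sup>2) powr (- 2 / DIM('a)))) \<longlongrightarrow> ennreal (D * 0)) at_top"
    by (intro tendsto_ennrealI tendsto_mult tendsto_const)
  then have lim: "((\<lambda>R. ennreal (D * (R\<^sup>2) powr (- 2 / DIM('a)))) \<longlongrightarrow> 0) at_top" by simp
  have "\<forall>\<^sub>F R in at_top. (\<integral>\<^sup>+\<omega>. ennreal ((W (Phi {\<beta>\<^sup>2<..<R\<^sup>2} ?a) \<omega> - W (Phi {\<beta>\<^sup>2<..} ?a) \<omega>)\<^sup>2) \<partial>N)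
    \<le> ennreal (D * (R\<^sup>2) powr (- 2 / DIM('a)))"
    using eventually_gt_at_top[of \<beta>] by eventually_elim (rule bd)
  from tendsto_0_le_ennreal[OF lim this] show ?thesis
    unfolding L2_limit_def using m Inf.Z_measurable[OF a] by (auto intro: always_eventually)
qed

text \<open>The definition leaves the approximating fields \<open>hR\<close> free. Their pairings
  are forced by their increments, hence so is the limit, whichever versions were chosen.\<close>

lemma infinity_pairing:
  assumes \<beta>: "\<beta> > 0" and H: "white_noise_field_infinity N W \<beta> H" and f0: "f \<in> test_functions0"
  shows "AE \<omega> in N. pairing H \<omega> f = W (Phi {\<beta>\<^sup>2<..} (rfourier f)) \<omega>"
proof -
  have b2: "\<beta>\<^sup>2 > 0" using \<beta> by simp
  obtain hR where hR: "\<And>R. R > \<beta> \<Longrightarrow> white_noise_field N W \<beta> R (hR R)"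
    and lim: "L2_limit N (\<lambda>R \<omega>. pairing (hR R) \<omega> f) (\<lambda>\<omega>. pairing H \<omega> f)"
    using H f0 unfolding white_noise_field_infinity_def by blast
  have "L2_limit N (\<lambda>R. W (Phi {\<beta>\<^sup>2<..<R\<^sup>2} (rfourier f))) (\<lambda>\<omega>. pairing H \<omega> f)"
  proof (rule L2_limit_cong_AE[OF lim])
    show "\<forall>\<^sub>F R in at_top. W (Phi {\<beta>\<^sup>2<..<R\<^sup>2} (rfourier f))
      \<in> borel_measurable N \<and> (AE \<omega> in N. W (Phi {\<beta>\<^sup>2<..<R\<^sup>2} (rfourier f)) \<omega> = pairing (hR R) \<omega> f)"
      using eventually_gt_at_top[of \<beta>]
    proof eventually_elim
      case (elim R)
      interpret R: noise_interval N W "{\<beta>\<^sup>2<..<R\<^sup>2}" "\<beta>\<^sup>2" by (rule intervalI[OF b2]) auto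
      have "random_function N (hR R)" using hR[OF elim] by (simp add: white_noise_field_def)
      from R.pairing_eq_Z[OF this field_increment[OF \<beta> hR[OF elim]] f0]
      have "AE \<omega> in N. W (Phi {\<beta>\<^sup>2<..<R\<^sup>2} (rfourier f)) \<omega> = pairing (hR R) \<omega> f" by eventually_elim simp
      then show ?case using R.Z_measurable[OF rfourier_adm0[OF f0]] by simp
    qed
  qed
  from L2_limit_unique[OF this truncated_pairing_limit[OF \<beta> f0]] show ?thesis .
qed

lemma infinity_exists:
  assumes \<beta>: "\<beta> > 0"
  shows "\<exists>H. white_noise_field_infinity N W \<beta> H"
proof -
  have b2: "\<beta>\<^sup>2 > 0" using \<beta> by simp
  \<comment> \<open>The constant symbol 1, written as the character at y = 0 so that
    \<open>cis_L2\<close> and \<open>cis_adm\<close> apply.\<close>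
  let ?one = "\<lambda>\<zeta>::'a. cis (2 * pi * (0 \<bullet> \<zeta>))"
  obtain H where H: "random_function N H"
    "\<And>f. f \<in> test_functions0 \<Longrightarrow> (\<lambda>\<omega>. pairing H \<omega> f)
      \<in> borel_measurable N \<and> (AE \<omega> in N. pairing H \<omega> f = W (Phi {\<beta>\<^sup>2<..} (rfourier f)) \<omega>)"
  proof -
    have "{\<beta>\<^sup>2<..} \<subseteq> {\<beta>\<^sup>2..}" by auto
    then show ?thesis using exists_version[OF b2, of "{\<beta>\<^sup>2<..}"] that by (simp, blast)
  qed
  have "\<exists>X. random_function N X \<and> (\<forall>y. AE \<omega> in N. X \<omega> y = W (Phi {\<beta>\<^sup>2<..<R\<^sup>2} (incr y)) \<omega>) \<and>
     (\<forall>f\<in>test_functions0. (\<lambda>\<omega>. pairing X \<omega> f) \<in> borel_measurable N \<and>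
       (AE \<omega> in N. pairing X \<omega> f = W (Phi {\<beta>\<^sup>2<..<R\<^sup>2} (rfourier f)) \<omega>))" for R :: real
    by (rule exists_version[OF b2]) auto
  then have "\<forall>R. \<exists>X. random_function N X \<and> (\<forall>y. AE \<omega> in N. X \<omega> y = W (Phi {\<beta>\<^sup>2<..<R\<^sup>2} (incr y)) \<omega>) \<and>
     (\<forall>f\<in>test_functions0. (\<lambda>\<omega>. pairing X \<omega> f) \<in> borel_measurable N \<and>
       (AE \<omega> in N. pairing X \<omega> f = W (Phi {\<beta>\<^sup>2<..<R\<^sup>2} (rfourier f)) \<omega>))"
    by (rule allI)
  from choice[OF this] obtain X where "\<forall>R. random_function N (X R) \<and> (\<forall>y. AE \<omega> in N. X R \<omega> y
    = W (Phi {\<beta>\<^sup>2<..<R\<^sup>2} (incr y)) \<omega>) \<and>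
     (\<forall>f\<in>test_functions0. (\<lambda>\<omega>. pairing (X R) \<omega> f) \<in> borel_measurable N \<and>
       (AE \<omega> in N. pairing (X R) \<omega> f = W (Phi {\<beta>\<^sup>2<..<R\<^sup>2} (rfourier f)) \<omega>))" ..
  then have X: "\<And>R. random_function N (X R)" "\<And>R y. AE \<omega> in N. X R \<omega> y = W (Phi {\<beta>\<^sup>2<..<R\<^sup>2} (incr y)) \<omega>"
    "\<And>R f. f \<in> test_functions0 \<Longrightarrow> (\<lambda>\<omega>. pairing (X R) \<omega> f) \<in> borel_measurable N \<and> (AE \<omega> in N. pairing (X R) \<omega> f
      = W (Phi {\<beta>\<^sup>2<..<R\<^sup>2} (rfourier f)) \<omega>)"
    by blast+
  \<comment> \<open>A truncated field has actual values, not only increments. Its value at 0 is the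
    integral of the constant symbol, which has finite energy over a bounded interval; it drops out
    of the pairings.\<close>
  define hR where "hR R \<omega> y = X R \<omega> y + W (Phi {\<beta>\<^sup>2<..<R\<^sup>2} ?one) \<omega>" for R \<omega> y
  have field: "white_noise_field N W \<beta> R (hR R)" for R
    unfolding white_noise_field_def
  proof (intro conjI allI)
    show "random_function N (hR R)"
      using X(1)[of R] W_measurable[OF cis_L2[OF \<beta>, of R 0]] unfolding random_function_def hR_def
      by (auto intro!: continuous_intros borel_measurable_add)
    fix y :: 'a
    let ?I = "{\<beta>\<^sup>2<..<R\<^sup>2}" and ?c = "\<lambda>\<zeta>. cis (2 * pi * (y \<bullet> \<zeta>))"
    have I0: "?I \<subseteq> {0<..}" by (auto intro: le_less_trans[OF zero_le_power2])
    interpret R: noise_interval N W ?I "\<beta>\<^sup>2" by (rule intervalI[OF b2]) auto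
    have "?c = (\<lambda>\<zeta>. complex_of_real 1 * incr y \<zeta> + complex_of_real 1 * ?one \<zeta>)" by (simp add: incr_def fun_eq_iff)
    then have eq: "Phi ?I ?c = (\<lambda>z. 1 * Phi ?I (incr y) z + 1 * Phi ?I ?one z)"
      using Phi_lincomb[OF dim adm0_adm[OF incr_adm0] cis_adm I0, of 1 y 1 0] by simp
    have "AE \<omega> in N. hR R \<omega> y = W (Phi ?I ?c) \<omega>"
      using X(2)[of R y] W_linear[OF R.Z_L2[OF incr_adm0[of y]] cis_L2[OF \<beta>, of R 0], of 1 1] unfolding eq
      by eventually_elim (simp add: hR_def)
    then show "AE \<omega> in N. hR R \<omega> y = W (\<lambda>(x, t). indicator ?I t * frac_heat_kernel (t / 2) (x - y)) \<omega>"
      unfolding Phi_heat_kernel .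
  qed
  have pair: "pairing (hR R) \<omega> f = pairing (X R) \<omega> f" if f0: "f \<in> test_functions0" and \<omega>: "\<omega> \<in> space N" for R \<omega> f
  proof -
    have f: "f \<in> test_functions" and fz: "(LINT x|lborel. f x) = 0" using f0 by (auto simp: test_functions0_iff)
    obtain r where r: "r > 0" "\<And>x. norm x > r \<Longrightarrow> f x = 0" using test_support[OF f] by metis
    have "continuous_on UNIV (X R \<omega>)" using X(1)[of R] \<omega> by (simp add: random_function_def)
    then have i: "integrable lborel (\<lambda>y. f y * X R \<omega> y)"
      by (intro integrable_compact_support[where r=r])
        (use r in \<open>auto intro!: continuous_intros test_continuous[OF f]\<close>)
    then show ?thesis
      using test_integrable[OF f] fz by (simp add: pairing_def hR_def distrib_left)
  qed
  have "L2_limit N (\<lambda>R \<omega>. pairing (hR R) \<omega> f) (\<lambda>\<omega>. pairing H \<omega> f)" if f0: "f \<in> test_functions0" for f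
  proof (rule L2_limit_cong_AE[OF L2_limit_cong_limit[OF truncated_pairing_limit[OF \<beta> f0]]])
    show "(\<lambda>\<omega>. pairing H \<omega> f) \<in> borel_measurable N" "AE \<omega> in N. pairing H \<omega> f = W (Phi {\<beta>\<^sup>2<..} (rfourier f)) \<omega>"
      using H(2)[OF f0] by auto
    show "\<forall>\<^sub>F R in at_top. (\<lambda>\<omega>. pairing (hR R) \<omega> f) \<in> borel_measurable N \<and> (AE \<omega> in N. pairing (hR R) \<omega> f
      = W (Phi {\<beta>\<^sup>2<..<R\<^sup>2} (rfourier f)) \<omega>)"
    proof (rule always_eventually, rule allI, rule conjI)
      fix R
      show "(\<lambda>\<omega>. pairing (hR R) \<omega> f) \<in> borel_measurable N"
        using X(3)[OF f0, of R] pair[OF f0] measurable_cong[of N "\<lambda>\<omega>. pairing (hR R) \<omega> f" "\<lambda>\<omega>.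
          pairing (X R) \<omega> f" borel] by simp
      show "AE \<omega> in N. pairing (hR R) \<omega> f = W (Phi {\<beta>\<^sup>2<..<R\<^sup>2} (rfourier f)) \<omega>"
        using conjunct2[OF X(3)[OF f0, of R]] AE_space by eventually_elim (simp add: pair[OF f0])
    qed
  qed
  then have "white_noise_field_infinity N W \<beta> H"
    unfolding white_noise_field_infinity_def using H(1) field by blast
  then show ?thesis by blast
qed

text \<open>Differences of shrinking bumps at y and at 0 have integral zero, so the noise determines
  their pairings; suitably normalized, these converge to a multiple of the increment from 0 to y.
  Countably many bumps and a dense set of points leave a single null set.\<close>

lemma infinity_unique:
  assumes \<beta>: "\<beta> > 0" and H: "white_noise_field_infinity N W \<beta> H" and H': "white_noise_field_infinity N W \<beta> H'"
  shows "AE \<omega> in N. \<exists>c. \<forall>y. H \<omega> y = H' \<omega> y + c"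
proof -
  have cont: "continuous_on UNIV (H \<omega>)" "continuous_on UNIV (H' \<omega>)" if "\<omega> \<in> space N" for \<omega>
    using H H' that by (auto simp: white_noise_field_infinity_def random_function_def)
  \<comment> \<open>Written with the coefficients 1 and -1, this is an instance of
    \<open>test_lincomb\<close>.\<close>
  define f where "f n y x = 1 * bump (real (Suc n)) y x + (-1) * bump (real (Suc n)) 0 x" for n and y x :: 'a
  have ft: "f n y \<in> test_functions0" for n y
  proof -
    have "f n y \<in> test_functions" unfolding f_def by (intro test_lincomb bump_test) auto
    moreover have "(LINT x|lborel. f n y x) = 0"
    proof -
      have "(LINT x|lborel. f n y x) = (LINT x|lborel. bump (real (Suc n)) y x)
        - (LINT x|lborel. bump (real (Suc n)) 0 (x::'a))"
        unfolding f_def by (simp add: test_integrable[OF bump_test] del: of_nat_Suc)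
      then show ?thesis by (simp add: bump_integral(1)[of "real (Suc n)"] del: of_nat_Suc)
    qed
    ultimately show ?thesis by (simp add: test_functions0_iff)
  qed
  have inc: "AE \<omega> in N. H \<omega> y - H \<omega> 0 = H' \<omega> y - H' \<omega> 0" for y
  proof -
    have "AE \<omega> in N. pairing H \<omega> (f n y) = pairing H' \<omega> (f n y)" for n
      using infinity_pairing[OF \<beta> H ft, of n y] infinity_pairing[OF \<beta> H' ft, of n y] by eventually_elim simp
    then have "AE \<omega> in N. \<forall>n. pairing H \<omega> (f n y) = pairing H' \<omega> (f n y)" by (simp add: AE_all_countable)
    then show ?thesis
      using AE_space
    proof eventually_elim
      case (elim \<omega>)
      let ?c = "LINT u|lborel. bump 1 0 (u::'a)"
      have avg: "(\<lambda>n. real (Suc n) ^ DIM('a) * (LINT x|lborel. f n y x * g x)) \<longlonglongrightarrow> ?c * g y - ?c * g 0"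
        if g: "continuous_on UNIV g" for g
      proof -
        have ib: "integrable lborel (\<lambda>x. bump (real (Suc n)) z x * g x)" for n z
        proof -
          have bt: "bump (real (Suc n)) z \<in> test_functions" by (rule bump_test) simp
          obtain r where r: "\<And>x. norm x > r \<Longrightarrow> bump (real (Suc n)) z x = 0" using test_support[OF bt] by metis
          have "continuous_on UNIV (\<lambda>x. bump (real (Suc n)) z x * g x)"
            by (intro continuous_on_mult test_continuous[OF bt] g)
          then show ?thesis by (rule integrable_compact_support[where r=r]) (simp add: r del: of_nat_Suc)
        qed
        have "real (Suc n) ^ DIM('a) * (LINT x|lborel. f n y x * g x)
          = (LINT u|lborel. bump 1 0 u * g (y + (1 / real (Suc n)) *\<^sub>R u)) -
          (LINT u|lborel. bump 1 0 u * g (0 + (1 / real (Suc n)) *\<^sub>R u))" for n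
        proof -
          have "(LINT x|lborel. f n y x * g x)
            = (LINT x|lborel. bump (real (Suc n)) y x * g x - bump (real (Suc n)) 0 x * g x)"
            by (simp add: f_def left_diff_distrib)
          also have "\<dots> = (LINT x|lborel. bump (real (Suc n)) y x * g x)
            - (LINT x|lborel. bump (real (Suc n)) 0 x * g x)"
            by (rule Bochner_Integration.integral_diff[OF ib ib])
          also have "\<dots> = (1 / real (Suc n)) ^ DIM('a) * ((LINT u|lborel. bump 1 0 u * g (y + (1 / real (Suc n)) *\<^sub>R u))
            - (LINT u|lborel. bump 1 0 u * g (0 + (1 / real (Suc n)) *\<^sub>R u)))"
            by (subst (1 2) bump_integral(2)[OF _ g]) (simp_all only: right_diff_distrib of_nat_0_less_iff
              zero_less_Suc)
          finally show ?thesis by (simp add: power_divide del: of_nat_Suc)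
        qed
        then show ?thesis
          using tendsto_diff[OF bump_average_tendsto[OF g, of y] bump_average_tendsto[OF g, of 0]] by simp
      qed
      have "?c * H \<omega> y - ?c * H \<omega> 0 = ?c * H' \<omega> y - ?c * H' \<omega> 0"
      proof (rule LIMSEQ_unique)
        show "(\<lambda>n. real (Suc n) ^ DIM('a) * (LINT x|lborel. f n y x * H \<omega> x)) \<longlonglongrightarrow> ?c * H \<omega> y - ?c * H \<omega> 0"
          by (rule avg[OF cont(1)[OF elim(2)]])
        show "(\<lambda>n. real (Suc n) ^ DIM('a) * (LINT x|lborel. f n y x * H \<omega> x)) \<longlonglongrightarrow> ?c * H' \<omega> y - ?c * H' \<omega> 0"
          using avg[OF cont(2)[OF elim(2)]] elim(1) by (simp add: pairing_def)
      qed
      then have "?c * (H \<omega> y - H \<omega> 0) = ?c * (H' \<omega> y - H' \<omega> 0)" by (simp add: right_diff_distrib)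
      then show ?case using bump_integral_pos[where 'a='a] by simp
    qed
  qed
  have "AE \<omega> in N. \<forall>y. H \<omega> y - H \<omega> 0 = H' \<omega> y - H' \<omega> 0"
    by (rule AE_all_continuous) (use cont inc in \<open>auto intro!: continuous_intros\<close>)
  then show ?thesis
  proof eventually_elim
    case (elim \<omega>)
    have "H \<omega> y = H' \<omega> y + (H \<omega> 0 - H' \<omega> 0)" for y using elim[rule_format, of y] by (simp add: algebra_simps)
    then show ?case by blast
  qed
qed

lemma infinity_char:
  assumes \<beta>: "\<beta> > 0" and H: "white_noise_field_infinity N W \<beta> H" and f0: "f \<in> test_functions0"
  shows "(LINT \<omega>|N. cis (s * pairing H \<omega> f)) = complex_of_real
    (exp (- (s\<^sup>2 * enn2real (energy {\<beta>\<^sup>2<..} (rfourier f)) / 2)))"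
proof -
  have b2: "\<beta>\<^sup>2 > 0" using \<beta> by simp
  interpret Inf: noise_interval N W "{\<beta>\<^sup>2<..}" "\<beta>\<^sup>2" by (rule intervalI[OF b2]) auto
  have Zm[measurable]: "W (Phi {\<beta>\<^sup>2<..} (rfourier f)) \<in> borel_measurable N"
    by (rule Inf.Z_measurable[OF rfourier_adm0[OF f0]])
  have Hm[measurable]: "(\<lambda>\<omega>. pairing H \<omega> f) \<in> borel_measurable N"
    using H f0 by (auto simp: white_noise_field_infinity_def L2_limit_def)
  have "(LINT \<omega>|N. cis (s * pairing H \<omega> f)) = (LINT \<omega>|N. cis (s * W (Phi {\<beta>\<^sup>2<..} (rfourier f)) \<omega>))"
  proof (rule integral_cong_AE)
    show "AE \<omega> in N. cis (s * pairing H \<omega> f) = cis (s * W (Phi {\<beta>\<^sup>2<..} (rfourier f)) \<omega>)"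
      using infinity_pairing[OF \<beta> H f0] by eventually_elim simp
  qed measurable
  also have "\<dots> = complex_of_real (exp (- (s\<^sup>2 * enn2real (energy {\<beta>\<^sup>2<..} (rfourier f)) / 2)))"
    by (rule centered_gaussian_char[OF Inf.Z_gaussian[OF rfourier_adm0[OF f0]]])
  finally show ?thesis .
qed

end

section \<open>Truncated convolutions with the heat kernel\<close>

text \<open>A correlation, unlike a convolution, sees the transform of \<psi> at the reflected
  frequency.\<close>

lemma rfourier_convolution:
  fixes f \<psi> :: "'a::euclidean_space \<Rightarrow> real"
  assumes f: "f \<in> test_functions" and \<psi>: "continuous_on UNIV \<psi>" and r: "\<And>x. norm x > r \<Longrightarrow> \<psi> x = 0"
  shows "rfourier (\<lambda>w. LINT u|lborel. f (w + u) * \<psi> u) \<zeta> = rfourier f \<zeta> * rfourier \<psi> (- \<zeta>)"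
proof -
  obtain s where s: "s > 0" "\<And>x. norm x > s \<Longrightarrow> f x = 0" using test_support[OF f] by metis
  obtain B where B: "\<And>x. \<bar>f x\<bar> \<le> B" using test_bounded[OF f] by metis
  have [measurable]: "f \<in> borel_measurable borel" by (rule test_measurable[OF f])
  have \<psi>i: "integrable lborel (\<lambda>u. complex_of_real (\<psi> u))"
    using integrable_compact_support[OF \<psi> r] by simp
  \<comment> \<open>\<open>kernel_fubini\<close> needs an integrable factor in w. The indicator of a
    ball that contains the support of the correlation provides it, with f (w + u) as the bounded
    kernel.\<close>
  let ?I = "\<lambda>w::'a. complex_of_real (indicator (cball 0 (s + r)) w)"
  let ?c = "\<lambda>w. cis (2 * pi * (\<zeta> \<bullet> w))"
  have Ii: "integrable lborel (\<lambda>w. ?I w * ?c w)"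
    by (rule integrable_mult_bounded[where B=1])
      (auto simp: emeasure_lborel_cball_finite intro!: integrable_of_real integrable_real_indicator
        emeasure_lborel_cball_finite)
  have vanish: "\<psi> u * f (w + u) = 0" if "w \<notin> cball 0 (s + r)" for u w
  proof (cases "norm u > r")
    case False
    have "norm w \<le> norm (w + u) + norm u" using norm_triangle_ineq4[of "w + u" u] by simp
    then show ?thesis using that False s(2)[of "w + u"] by simp
  qed (simp add: r)
  have z: "(LINT u|lborel. \<psi> u * f (w + u)) = 0" if "w \<notin> cball 0 (s + r)" for w
    by (simp only: vanish[OF that] Bochner_Integration.integral_zero)
  have "rfourier (\<lambda>w. LINT u|lborel. f (w + u) * \<psi> u) \<zeta>
    = (LINT w|lborel. ?I w * ?c w * (LINT u|lborel. complex_of_real (\<psi> u) * complex_of_real (f (w + u))))"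
    unfolding fourier_def
  proof (rule Bochner_Integration.integral_cong[OF refl])
    fix w :: 'a
    have "complex_of_real (LINT u|lborel. f (w + u) * \<psi> u)
      = (LINT u|lborel. complex_of_real (\<psi> u) * complex_of_real (f (w + u)))"
      by (simp add: mult.commute flip: of_real_mult)
    then show "complex_of_real (LINT u|lborel. f (w + u) * \<psi> u) * ?c w
      = ?I w * ?c w * (LINT u|lborel. complex_of_real (\<psi> u) * complex_of_real (f (w + u)))"
      using vanish[of w] z[of w] by (cases "w \<in> cball 0 (s + r)") (simp_all flip: of_real_mult del: mem_cball_0)
  qed
  also have "\<dots> = (LINT u|lborel. complex_of_real (\<psi> u) * (LINT w|lborel. ?I w * ?c w * complex_of_real (f (w + u))))"
    by (rule lborel_pair.kernel_fubini[OF Ii \<psi>i, where B=B]) (use B in auto)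
  also have "\<dots> = (LINT u|lborel. complex_of_real (\<psi> u) * (rfourier f \<zeta> * cis (2 * pi * (- \<zeta> \<bullet> u))))"
  proof (rule Bochner_Integration.integral_cong[OF refl])
    fix u :: 'a
    show "complex_of_real (\<psi> u) * (LINT w|lborel. ?I w * ?c w * complex_of_real (f (w + u)))
      = complex_of_real (\<psi> u) * (rfourier f \<zeta> * cis (2 * pi * (- \<zeta> \<bullet> u)))"
    proof (cases "\<psi> u = 0")
      case False
      have "?I w * ?c w * complex_of_real (f (w + u)) = complex_of_real (f (w + u)) * ?c (w + u)
        * cis (2 * pi * (- \<zeta> \<bullet> u))" for w
        using vanish[of w u] False by (cases "w
          \<in> cball 0 (s + r)") (auto simp: cis_mult inner_add_right algebra_simps)
      moreover have "rfourier f \<zeta> = (LINT w|lborel. complex_of_real (f (w + u)) * ?c (w + u))"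
        unfolding fourier_def using integral_lborel_scale_shift[of 1 "\<lambda>w. complex_of_real (f w) * ?c w" u]
          by (simp add: add.commute)
      ultimately show ?thesis by (simp only: Bochner_Integration.integral_mult_left_zero)
    qed simp
  qed
  also have "\<dots> = rfourier f \<zeta> * rfourier \<psi> (- \<zeta>)"
    unfolding fourier_def[of _ "- \<zeta>"] by (simp add: mult.left_commute flip:
      Bochner_Integration.integral_mult_right_zero)
  finally show ?thesis .
qed

text \<open>At frequency 0 the product formula says that the integral of the correlation is a
  multiple of the integral of \<open>f\<close>.\<close>

lemma convolution_test0:
  fixes f \<psi> :: "'a::euclidean_space \<Rightarrow> real"
  assumes f: "f \<in> test_functions0" and \<psi>: "continuous_on UNIV \<psi>" and r: "\<And>x. norm x > r \<Longrightarrow> \<psi> x = 0"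
  shows "(\<lambda>w. LINT u|lborel. f (w + u) * \<psi> u) \<in> test_functions0"
proof -
  have 0: "rfourier g 0 = complex_of_real (LINT x|lborel. g x)" for g :: "'a \<Rightarrow> real" by (simp add: fourier_def)
  have ft: "f \<in> test_functions" "(LINT x|lborel. f x) = 0" using f by (auto simp: test_functions0_iff)
  show ?thesis
    using trans[OF 0[symmetric] rfourier_convolution[OF ft(1) \<psi>, of r 0]] convolution_test[OF ft(1) \<psi>, of r] ft(2) r
    unfolding 0 by (simp add: test_functions0_iff)
qed

text \<open>The transform of the kernel cut off at scale R: an average of the symbol over frequency
  shifts of order 1 / R, weighted by the transform of the cutoff. The weight need not be positive,
  but it is integrable with total mass \<eta> 0.\<close>

definition mollified_symbol :: "real \<Rightarrow> ('a::euclidean_space \<Rightarrow> real) \<Rightarrow> real \<Rightarrow> 'a \<Rightarrow> complex" where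
  "mollified_symbol t \<eta> R \<zeta> = (LINT v|lborel. rfourier \<eta> v * complex_of_real (heat_symbol t (\<zeta> + (1 / R) *\<^sub>R v)))"

lemma mollified_symbol_measurable:
  assumes "\<eta> \<in> test_functions"
  shows "mollified_symbol t \<eta> R \<in> borel_measurable borel"
proof -
  have [measurable]: "rfourier \<eta> \<in> borel_measurable borel" by (intro measurable_fourier test_integrable_complex assms)
  show ?thesis unfolding mollified_symbol_def by measurable
qed

lemma norm_mollified_symbol:
  assumes t: "t \<ge> 0" and \<eta>: "\<eta> \<in> test_functions"
  shows "norm (mollified_symbol t \<eta> R \<zeta>) \<le> (LINT v|lborel. norm (rfourier \<eta> v))"
proof -
  have i: "integrable lborel (rfourier \<eta>)" by (rule rfourier_test_integrable[OF \<eta>])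
  have "norm (rfourier \<eta> v * complex_of_real (heat_symbol t x)) \<le> norm (rfourier \<eta> v)" for v x
    using heat_symbol_le_1[OF t, of x] heat_symbol_pos[of t x] by (simp add: norm_mult mult_left_le)
  then show ?thesis
    unfolding mollified_symbol_def
    by (intro Bochner_Integration.integral_norm_bound_integral integrable_norm i integrable_mult_bounded[OF i,
      where B=1])
      (auto simp: heat_symbol_le_1[OF t] less_imp_le[OF heat_symbol_pos])
qed

text \<open>Inversion at the origin gives the weight total mass \<eta> 0 = 1, so averaging over
  shrinking shifts reproduces the symbol.\<close>

lemma mollified_symbol_tendsto:
  fixes \<zeta> :: "'a::euclidean_space"
  assumes t: "t \<ge> 0" and \<eta>: "\<eta> \<in> cutoffs"
  shows "((\<lambda>R. mollified_symbol t \<eta> R \<zeta>) \<longlongrightarrow> complex_of_real (heat_symbol t \<zeta>)) at_top"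
proof -
  have \<eta>t: "\<eta> \<in> test_functions" and \<eta>0: "\<eta> 0 = 1" using \<eta> by (auto simp: cutoffs_def)
  have i: "integrable lborel (rfourier \<eta>)" by (rule rfourier_test_integrable[OF \<eta>t])
  have [measurable]: "rfourier \<eta> \<in> borel_measurable borel" by (intro measurable_fourier test_integrable_complex \<eta>t)
  obtain B where B: "\<And>x. \<bar>\<eta> x\<bar> \<le> B" using test_bounded[OF \<eta>t] by metis
  have "(LINT v|lborel. rfourier \<eta> v) = 1"
    using fourier_inversion_at_0[OF test_integrable_complex[OF \<eta>t] _ _ i, of B] B test_continuous[OF \<eta>t, of UNIV] \<eta>0
    by (simp add: continuous_on_of_real)
  moreover have "((\<lambda>R. mollified_symbol t \<eta> R \<zeta>) \<longlongrightarrow> (LINT v|lborel. rfourier \<eta> v * complex_of_real (heat_symbol t \<zeta>)))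
    at_top"
    unfolding mollified_symbol_def
  proof (rule integral_dominated_convergence_at_top[where w="\<lambda>v. norm (rfourier \<eta> v)"])
    show "AE v in lborel. ((\<lambda>R. rfourier \<eta> v * complex_of_real (heat_symbol t (\<zeta> + (1 / R) *\<^sub>R v)))
      \<longlongrightarrow> rfourier \<eta> v * complex_of_real (heat_symbol t \<zeta>)) at_top"
    proof (intro AE_I2 tendsto_mult tendsto_const tendsto_of_real)
      fix v :: 'a
      have "((\<lambda>R::real. 1 / R) \<longlongrightarrow> 0) at_top" by real_asymp
      then have "((\<lambda>R. \<zeta> + (1 / R) *\<^sub>R v) \<longlongrightarrow> \<zeta> + 0 *\<^sub>R v) at_top"
        by (intro tendsto_add tendsto_scaleR tendsto_const)
      then show "((\<lambda>R. heat_symbol t (\<zeta> + (1 / R) *\<^sub>R v)) \<longlongrightarrow> heat_symbol t \<zeta>) at_top"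
        using continuous_heat_symbol[of UNIV t]
          by (intro isCont_tendsto_compose[where g="heat_symbol t"]) (auto simp: continuous_on_eq_continuous_at)
    qed
    show "\<forall>\<^sub>F R in at_top. AE v in lborel. norm (rfourier \<eta> v * complex_of_real (heat_symbol t (\<zeta> + (1 / R) *\<^sub>R v)))
      \<le> norm (rfourier \<eta> v)"
      by (intro always_eventually allI AE_I2) (simp add: norm_mult mult_left_le heat_symbol_le_1[OF t]
        abs_of_pos[OF heat_symbol_pos])
  qed (use i in auto)
  ultimately show ?thesis by simp
qed

lemma frac_heat_kernel_fourier_of_real:
  "complex_of_real (frac_heat_kernel t x) = fourier (\<lambda>\<zeta>. complex_of_real (heat_symbol t \<zeta>)) x"
  using fourier_hermitian_real[of "\<lambda>\<zeta>. complex_of_real (heat_symbol t \<zeta>)" x]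
  by (simp add: heat_kernel_fourier complex_eq_iff heat_symbol_even)

lemma heat_symbol_integrable:
  assumes "DIM('a::euclidean_space) \<ge> 2" "t > 0"
  shows "integrable lborel (\<lambda>\<zeta>::'a. complex_of_real (heat_symbol t \<zeta>))"
  using adm_heat_symbol_integrable[OF assms(1) cis_adm[of 0] assms(2)] by simp

lemma continuous_frac_heat_kernel:
  assumes "DIM('a::euclidean_space) \<ge> 2" "t > 0"
  shows "continuous_on UNIV (frac_heat_kernel t :: 'a \<Rightarrow> real)"
  unfolding heat_kernel_fourier[abs_def] by (intro continuous_intros continuous_fourier heat_symbol_integrable assms)

text \<open>Rescaling space by R and exchanging the integrals moves the cutoff to the frequency
  side; the Jacobians of the two rescalings cancel.\<close>

lemma rfourier_truncated_kernel:
  fixes \<eta> :: "'a::euclidean_space \<Rightarrow> real"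
  assumes d: "DIM('a) \<ge> 2" and t: "t > 0" and \<eta>: "\<eta> \<in> test_functions" and R: "R > 0"
  shows "rfourier (\<lambda>u. frac_heat_kernel t u * \<eta> (u /\<^sub>R R)) (- \<zeta>) = mollified_symbol t \<eta> R \<zeta>"
proof -
  let ?m = "\<lambda>\<xi>::'a. complex_of_real (heat_symbol t \<xi>)" and ?\<eta> = "\<lambda>x. complex_of_real (\<eta> x)"
  have [measurable]: "\<eta> \<in> borel_measurable borel" by (rule test_measurable[OF \<eta>])
  have [measurable]: "(frac_heat_kernel t :: 'a \<Rightarrow> real) \<in> borel_measurable borel"
    by (rule borel_measurable_continuous_onI[OF continuous_frac_heat_kernel[OF d t]])
  have [measurable]: "rfourier \<eta> \<in> borel_measurable borel" by (intro measurable_fourier test_integrable_complex \<eta>)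
  let ?F = "\<lambda>u. complex_of_real (frac_heat_kernel t u * \<eta> (u /\<^sub>R R)) * cis (2 * pi * (- \<zeta> \<bullet> u))"
  have "rfourier (\<lambda>u. frac_heat_kernel t u * \<eta> (u /\<^sub>R R)) (- \<zeta>) = R ^ DIM('a) *\<^sub>R (LINT x|lborel. ?F (0 + R *\<^sub>R x))"
    unfolding fourier_def using R by (subst integral_lborel_scale_shift[of R ?F 0]) auto
  also have "(LINT x|lborel. ?F (0 + R *\<^sub>R x))
    = (LINT x|lborel. ?\<eta> x * (LINT \<xi>|lborel. ?m \<xi> * cis (2 * pi * (R * (x \<bullet> (\<xi> - \<zeta>))))))"
  proof (rule Bochner_Integration.integral_cong[OF refl])
    fix x :: 'a
    have "?F (0 + R *\<^sub>R x) = ?\<eta> x * ((LINT \<xi>|lborel. ?m \<xi> * cis (2 * pi * (R *\<^sub>R x \<bullet> \<xi>)))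
      * cis (2 * pi * (- \<zeta> \<bullet> R *\<^sub>R x)))"
      using R by (simp add: frac_heat_kernel_fourier_of_real fourier_def)
    also have "(LINT \<xi>|lborel. ?m \<xi> * cis (2 * pi * (R *\<^sub>R x \<bullet> \<xi>))) * cis (2 * pi * (- \<zeta> \<bullet> R *\<^sub>R x))
      = (LINT \<xi>|lborel. ?m \<xi> * cis (2 * pi * (R * (x \<bullet> (\<xi> - \<zeta>)))))"
      unfolding Bochner_Integration.integral_mult_left_zero[symmetric]
      by (intro Bochner_Integration.integral_cong refl) (simp add: mult.assoc cis_mult inner_diff_right inner_commute
        algebra_simps)
    finally show "?F (0 + R *\<^sub>R x) = ?\<eta> x * (LINT \<xi>|lborel. ?m \<xi> * cis (2 * pi * (R * (x \<bullet> (\<xi> - \<zeta>)))))" .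
  qed
  also have "\<dots> = (LINT \<xi>|lborel. ?m \<xi> * (LINT x|lborel. ?\<eta> x * cis (2 * pi * (R * (x \<bullet> (\<xi> - \<zeta>))))))"
    by (rule lborel_pair.kernel_fubini[OF test_integrable_complex[OF \<eta>] heat_symbol_integrable[OF d t],
      where B=1]) auto
  also have "\<dots> = (LINT \<xi>|lborel. ?m \<xi> * rfourier \<eta> (R *\<^sub>R (\<xi> - \<zeta>)))"
    by (simp add: fourier_def inner_commute)
  also have "\<dots> = (1 / R) ^ DIM('a) *\<^sub>R mollified_symbol t \<eta> R \<zeta>"
    using R unfolding mollified_symbol_def
    by (subst integral_lborel_scale_shift[of "1 / R" _ \<zeta>]) (simp_all add: mult.commute)
  finally show ?thesis using R by (simp add: power_divide)
qed

abbreviation truncated_convolution :: "real \<Rightarrow> ('a::euclidean_space \<Rightarrow> real) \<Rightarrow> ('a \<Rightarrow> real) \<Rightarrow> real \<Rightarrow> 'a \<Rightarrow> real" where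
  "truncated_convolution t f \<eta> R \<equiv> \<lambda>w. LINT y|lborel. f y * (frac_heat_kernel t (y - w) * \<eta> ((y - w) /\<^sub>R R))"

lemma truncated_convolution:
  fixes f \<eta> :: "'a::euclidean_space \<Rightarrow> real"
  assumes d: "DIM('a) \<ge> 2" and t: "t > 0" and f: "f \<in> test_functions0" and \<eta>: "\<eta> \<in> test_functions" and R: "R > 0"
  shows "truncated_convolution t f \<eta> R \<in> test_functions0"
    and "rfourier (truncated_convolution t f \<eta> R) \<zeta> = rfourier f \<zeta> * mollified_symbol t \<eta> R \<zeta>"
proof -
  let ?\<psi> = "\<lambda>u::'a. frac_heat_kernel t u * \<eta> (u /\<^sub>R R)"
  have ft: "f \<in> test_functions" using f by (simp add: test_functions0_iff)
  have [measurable]: "f \<in> borel_measurable borel" by (rule test_measurable[OF ft])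
  have c: "continuous_on UNIV ?\<psi>"
    by (intro continuous_intros continuous_frac_heat_kernel d t
      continuous_on_compose2[OF test_continuous[OF \<eta>, of UNIV]]) auto
  have [measurable]: "?\<psi> \<in> borel_measurable borel" by (rule borel_measurable_continuous_onI[OF c])
  obtain s where s: "s > 0" "\<And>x. norm x > s \<Longrightarrow> \<eta> x = 0" using test_support[OF \<eta>] by metis
  have v: "?\<psi> u = 0" if "norm u > s * R" for u
    using s(2)[of "u /\<^sub>R R"] that R by (simp add: field_simps)
  have eq: "truncated_convolution t f \<eta> R w = (LINT u|lborel. f (w + u) * ?\<psi> u)" for w
    using integral_lborel_scale_shift[of 1 "\<lambda>y. f y * ?\<psi> (y - w)" w] by simp
  show "truncated_convolution t f \<eta> R \<in> test_functions0" unfolding eq by (rule convolution_test0[OF f c]) (rule v)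
  show "rfourier (truncated_convolution t f \<eta> R) \<zeta> = rfourier f \<zeta> * mollified_symbol t \<eta> R \<zeta>"
    unfolding eq rfourier_truncated_kernel[OF d t \<eta> R, symmetric] by (rule rfourier_convolution[OF ft c]) (rule v)
qed

lemma L2_limit_lincomb:
  assumes X: "L2_limit N X Y" and X': "L2_limit N X' Y'"
  shows "L2_limit N (\<lambda>R \<omega>. a * X R \<omega> + b * X' R \<omega>) (\<lambda>\<omega>. a * Y \<omega> + b * Y' \<omega>)"
  unfolding L2_limit_def
proof (intro conjI)
  have [measurable]: "Y \<in> borel_measurable N" "Y' \<in> borel_measurable N" using X X' by (auto simp: L2_limit_def)
  have m: "\<forall>\<^sub>F R in at_top. X R \<in> borel_measurable N" "\<forall>\<^sub>F R in at_top. X' R \<in> borel_measurable N"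
    using X X' by (auto simp: L2_limit_def)
  show "\<forall>\<^sub>F R in at_top. (\<lambda>\<omega>. a * X R \<omega> + b * X' R \<omega>) \<in> borel_measurable N"
    using m by eventually_elim (intro borel_measurable_add borel_measurable_times borel_measurable_const)
  show "(\<lambda>\<omega>. a * Y \<omega> + b * Y' \<omega>) \<in> borel_measurable N" by measurable
  let ?n = "\<lambda>X Y R. \<integral>\<^sup>+\<omega>. ennreal ((X R \<omega> - Y \<omega>)\<^sup>2) \<partial>N"
  show "((\<lambda>R. \<integral>\<^sup>+\<omega>. ennreal ((a * X R \<omega> + b * X' R \<omega> - (a * Y \<omega> + b * Y' \<omega>))\<^sup>2) \<partial>N) \<longlongrightarrow> 0) at_top"
  proof (rule tendsto_0_le_ennreal)
    have "((\<lambda>R. ennreal (a\<^sup>2) * ?n X Y R) \<longlongrightarrow> ennreal (a\<^sup>2) * 0) at_top"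
      "((\<lambda>R. ennreal (b\<^sup>2) * ?n X' Y' R) \<longlongrightarrow> ennreal (b\<^sup>2) * 0) at_top"
      by (intro ennreal_tendsto_cmult; use X X' in \<open>simp add: L2_limit_def\<close>)+
    then show "((\<lambda>R. 2 * (ennreal (a\<^sup>2) * ?n X Y R) + 2 * (ennreal (b\<^sup>2) * ?n X' Y' R)) \<longlongrightarrow> 0) at_top"
      by (intro ennreal_tendsto_0_lincomb) simp_all
    show "\<forall>\<^sub>F R in at_top. (\<integral>\<^sup>+\<omega>. ennreal ((a * X R \<omega> + b * X' R \<omega> - (a * Y \<omega> + b * Y' \<omega>))\<^sup>2) \<partial>N)
      \<le> 2 * (ennreal (a\<^sup>2) * ?n X Y R) + 2 * (ennreal (b\<^sup>2) * ?n X' Y' R)"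
      using m
    proof eventually_elim
      case (elim R)
      note [measurable] = elim
      have "(\<integral>\<^sup>+\<omega>. ennreal ((a * (X R \<omega> - Y \<omega>) + b * (X' R \<omega> - Y' \<omega>))\<^sup>2) \<partial>N) \<le>
        2 * (\<integral>\<^sup>+\<omega>. ennreal ((a * (X R \<omega> - Y \<omega>))\<^sup>2) \<partial>N) + 2 * (\<integral>\<^sup>+\<omega>. ennreal ((b * (X' R \<omega> - Y' \<omega>))\<^sup>2) \<partial>N)"
        by (rule nn_integral_square_add) measurable
      moreover have "a * (X R \<omega> - Y \<omega>) + b * (X' R \<omega> - Y' \<omega>) = a * X R \<omega> + b * X' R \<omega> - (a * Y \<omega> + b * Y' \<omega>)" for \<omega>
        by (simp add: algebra_simps)
      ultimately show ?case by (simp add: power_mult_distrib ennreal_mult nn_integral_cmult)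
    qed
  qed
qed

lemma test0_lincomb:
  assumes "f \<in> test_functions0" "g \<in> test_functions0"
  shows "(\<lambda>x. a * f x + b * g x) \<in> test_functions0"
  using assms test_lincomb[of f g a b] by (simp add: test_functions0_iff test_integrable)

lemma test0_zero: "(\<lambda>x. 0) \<in> test_functions0"
proof -
  have "(\<lambda>x. 1 * bump 1 0 x + (-1) * bump 1 0 x) \<in> test_functions"
    by (intro test_lincomb bump_test) auto
  then show ?thesis by (simp add: test_functions0_iff)
qed

lemma test0_sum_AE:
  fixes n :: nat
  assumes add: "\<And>f g a b. f \<in> test_functions0 \<Longrightarrow> g \<in> test_functions0 \<Longrightarrow> AE \<omega> in M. X \<omega> (\<lambda>x. a * f x + b * g x)
    = a * X \<omega> f + b * X \<omega> g"
    and F: "\<And>i. i < n \<Longrightarrow> F i \<in> test_functions0"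
  shows "(\<lambda>x. \<Sum>i<n. a i * F i x) \<in> test_functions0 \<and> (AE \<omega> in M. X \<omega> (\<lambda>x. \<Sum>i<n. a i * F i x)
    = (\<Sum>i<n. a i * X \<omega> (F i)))"
  using F
proof (induction n)
  case 0
  \<comment> \<open>With both coefficients 0 the hypothesis says that X vanishes almost surely on
    the zero function.\<close>
  show ?case using add[OF test0_zero test0_zero, of 0 0] test0_zero by simp
next
  case (Suc n)
  then have IH: "(\<lambda>x. \<Sum>i<n. a i * F i x) \<in> test_functions0" "AE \<omega> in M. X \<omega> (\<lambda>x. \<Sum>i<n. a i * F i x)
    = (\<Sum>i<n. a i * X \<omega> (F i))"
    by simp_all
  have Fn: "F n \<in> test_functions0" using Suc.prems by simp
  have "AE \<omega> in M. X \<omega> (\<lambda>x. \<Sum>i<Suc n. a i * F i x) = (\<Sum>i<Suc n. a i * X \<omega> (F i))"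
    using IH(2) add[OF IH(1) Fn, of 1 "a n"] by eventually_elim simp
  then show ?case using test0_lincomb[OF IH(1) Fn, of 1 "a n"] by simp
qed

text \<open>Its integral is the variance of the field tested against \<open>f\<close>; the constant
  divisor is the area of the unit sphere that appears in \<open>log_energy\<close>.\<close>

definition spectral_density :: "('a::euclidean_space \<Rightarrow> real) \<Rightarrow> 'a \<Rightarrow> real" where
  "spectral_density f \<zeta> = (norm (rfourier f \<zeta>))\<^sup>2 / norm \<zeta> ^ DIM('a) / (real DIM('a) * unit_ball_vol (real DIM('a)))"

lemma spectral_density_nonneg: "spectral_density f \<zeta> \<ge> 0"
  by (simp add: spectral_density_def)

lemma spectral_density_measurable:
  assumes "f \<in> test_functions" shows "spectral_density f \<in> borel_measurable borel"
proof -
  have [measurable]: "rfourier f \<in> borel_measurable borel" by (intro measurable_fourier test_integrable_complex assms)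
  show ?thesis unfolding spectral_density_def by measurable
qed

lemma log_variance:
  fixes f :: "'a::euclidean_space \<Rightarrow> real"
  assumes f0: "f \<in> test_functions0"
  shows "integrable lborel (spectral_density f)"
    and "(LINT z|lborel. LINT w|lborel. f z * f w * ln (1 / norm (z - w))) = (LINT \<zeta>|lborel. spectral_density f \<zeta>)"
proof -
  let ?V = "LINT z|lborel. LINT w|lborel. f z * f w * ln (1 / norm (z - w))"
  let ?\<sigma> = "real DIM('a) * unit_ball_vol (real DIM('a))"
  let ?g = "\<lambda>\<zeta>. (norm (rfourier f \<zeta>))\<^sup>2 / norm \<zeta> ^ DIM('a)"
  have \<sigma>: "?\<sigma> > 0" by (simp add: unit_ball_vol_pos)
  have [measurable]: "rfourier f \<in> borel_measurable borel"
    using f0 by (intro measurable_fourier test_integrable_complex) (simp add: test_functions0_iff)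
  have "integrable lborel ?g \<and> (LINT \<zeta>|lborel. ?g \<zeta>) = ?\<sigma> * ?V"
    using log_energy[OF f0] \<sigma> by (subst nn_integral_eq_integrable[symmetric]) auto
  then show "integrable lborel (spectral_density f)" "?V = (LINT \<zeta>|lborel. spectral_density f \<zeta>)"
    using \<sigma> unfolding spectral_density_def
    by (auto simp only: integral_divide_zero integrable_divide_zero nonzero_mult_div_cancel_left)
qed

section \<open>The log-correlated field convolved with the heat kernel\<close>

locale log_field = prob_space M for M :: "'b measure" and h :: "'b \<Rightarrow> ('a::euclidean_space \<Rightarrow> real) \<Rightarrow> real" +
  assumes field: "log_correlated_field M h" and dim: "DIM('a) \<ge> 2"
begin

lemma field_linear:
  assumes "\<omega> \<in> space M" "f \<in> test_functions" "g \<in> test_functions"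
  shows "h \<omega> (\<lambda>x. a * f x + b * g x) = a * h \<omega> f + b * h \<omega> g"
  using field assms by (auto simp: log_correlated_field_def is_distribution_def)

lemma field_gaussian:
  assumes "f \<in> test_functions0"
  shows "centered_gaussian M (\<lambda>\<omega>. h \<omega> f) (LINT \<zeta>|lborel. spectral_density f \<zeta>)"
  using field assms by (simp add: log_correlated_field_def log_variance(2))

lemma field_measurable: "f \<in> test_functions0 \<Longrightarrow> (\<lambda>\<omega>. h \<omega> f) \<in> borel_measurable M"
  using field_gaussian by (auto simp: centered_gaussian_def)

lemma field_distance:
  assumes f: "f \<in> test_functions0" and g: "g \<in> test_functions0"
  shows "(\<integral>\<^sup>+\<omega>. ennreal ((h \<omega> f - h \<omega> g)\<^sup>2) \<partial>M)
    = ennreal (LINT \<zeta>|lborel. spectral_density (\<lambda>x. 1 * f x + (-1) * g x) \<zeta>)"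
proof -
  have "(\<integral>\<^sup>+\<omega>. ennreal ((h \<omega> f - h \<omega> g)\<^sup>2) \<partial>M) = (\<integral>\<^sup>+\<omega>. ennreal ((h \<omega> (\<lambda>x. 1 * f x + (-1) * g x))\<^sup>2) \<partial>M)"
    using f g field_linear[of _ f g 1 "-1"] by (intro nn_integral_cong) (simp add: test_functions0_iff)
  then show ?thesis using centered_gaussian_second_moment[OF field_gaussian[OF test0_lincomb[OF f g, of 1 "-1"]]]
    by simp
qed

end

text \<open>Twice the spectral mean-square error left by the cutoff at scale R. The factor 2, from
  |x - y|^2 \<le> 2 |x|^2 + 2 |y|^2, lets the errors of two truncations simply add in
  \<open>truncation_distance\<close>.\<close>

definition truncation_error :: "real \<Rightarrow> ('a::euclidean_space \<Rightarrow> real) \<Rightarrow> ('a \<Rightarrow> real) \<Rightarrow> real \<Rightarrow> real" where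
  "truncation_error t f \<eta> R = 2 * (LINT \<zeta>|lborel. spectral_density f \<zeta>
    * (norm (mollified_symbol t \<eta> R \<zeta> - complex_of_real (heat_symbol t \<zeta>)))\<^sup>2)"

lemma truncation_error_nonneg: "truncation_error t f \<eta> R \<ge> 0"
  unfolding truncation_error_def by (intro mult_nonneg_nonneg Bochner_Integration.integral_nonneg)
    (auto simp: spectral_density_nonneg)

lemma mollified_symbol_bound:
  assumes t: "t \<ge> 0" and \<eta>: "\<eta> \<in> test_functions"
  shows "(norm (mollified_symbol t \<eta> R \<zeta> - complex_of_real (heat_symbol t \<zeta>)))\<^sup>2
    \<le> ((LINT v|lborel. norm (rfourier \<eta> v)) + 1)\<^sup>2"
proof (rule power_mono)
  have "norm (mollified_symbol t \<eta> R \<zeta> - complex_of_real (heat_symbol t \<zeta>))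
    \<le> norm (mollified_symbol t \<eta> R \<zeta>) + norm (complex_of_real (heat_symbol t \<zeta>))"
    by (rule norm_triangle_ineq4)
  also have "norm (complex_of_real (heat_symbol t \<zeta>)) \<le> 1"
    by (simp add: heat_symbol_le_1[OF t] abs_of_pos[OF heat_symbol_pos])
  finally show "norm (mollified_symbol t \<eta> R \<zeta> - complex_of_real (heat_symbol t \<zeta>))
    \<le> (LINT v|lborel. norm (rfourier \<eta> v)) + 1"
    using norm_mollified_symbol[OF t \<eta>, of R \<zeta>] by linarith
qed simp

lemma truncation_error_integrable:
  assumes t: "t \<ge> 0" and f: "f \<in> test_functions0" and \<eta>: "\<eta> \<in> test_functions"
  shows "integrable lborel (\<lambda>\<zeta>. spectral_density f \<zeta>
    * (norm (mollified_symbol t \<eta> R \<zeta> - complex_of_real (heat_symbol t \<zeta>)))\<^sup>2)"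
proof (rule Bochner_Integration.integrable_bound)
  have [measurable]: "spectral_density f \<in> borel_measurable borel" "mollified_symbol t \<eta> R \<in> borel_measurable borel"
    using f \<eta> by (auto simp: test_functions0_iff intro: spectral_density_measurable mollified_symbol_measurable)
  show "integrable lborel (\<lambda>\<zeta>. spectral_density f \<zeta> * ((LINT v|lborel. norm (rfourier \<eta> v)) + 1)\<^sup>2)"
    by (intro integrable_mult_left log_variance(1)[OF f])
  show "(\<lambda>\<zeta>. spectral_density f \<zeta> * (norm (mollified_symbol t \<eta> R \<zeta> - complex_of_real (heat_symbol t \<zeta>)))\<^sup>2)
    \<in> borel_measurable lborel" by measurable
  show "AE \<zeta> in lborel. norm (spectral_density f \<zeta>
    * (norm (mollified_symbol t \<eta> R \<zeta> - complex_of_real (heat_symbol t \<zeta>)))\<^sup>2) \<le> norm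
    (spectral_density f \<zeta> * ((LINT v|lborel. norm (rfourier \<eta> v)) + 1)\<^sup>2)"
    using mollified_symbol_bound[OF t \<eta>] by (intro AE_I2) (auto simp: abs_mult spectral_density_nonneg intro!:
      mult_left_mono)
qed

lemma truncation_error_tendsto:
  assumes t: "t \<ge> 0" and f: "f \<in> test_functions0" and \<eta>: "\<eta> \<in> cutoffs"
  shows "((\<lambda>R. truncation_error t f \<eta> R) \<longlongrightarrow> 0) at_top"
proof -
  have \<eta>t: "\<eta> \<in> test_functions" using \<eta> by (simp add: cutoffs_def)
  have [measurable]: "spectral_density f \<in> borel_measurable borel" "mollified_symbol t \<eta> R \<in> borel_measurable borel"
    for R
    using f \<eta>t by (auto simp: test_functions0_iff intro: spectral_density_measurable mollified_symbol_measurable)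
  have "((\<lambda>R. LINT \<zeta>|lborel. spectral_density f \<zeta>
    * (norm (mollified_symbol t \<eta> R \<zeta> - complex_of_real (heat_symbol t \<zeta>)))\<^sup>2) \<longlongrightarrow> (LINT \<zeta>|(lborel :: 'a measure). 0))
    at_top"
  proof (rule integral_dominated_convergence_at_top[where w="\<lambda>\<zeta>. spectral_density f \<zeta>
    * ((LINT v|lborel. norm (rfourier \<eta> v)) + 1)\<^sup>2"])
    show "integrable lborel (\<lambda>\<zeta>. spectral_density f \<zeta> * ((LINT v|lborel. norm (rfourier \<eta> v)) + 1)\<^sup>2)"
      by (intro integrable_mult_left log_variance(1)[OF f])
    show "AE \<zeta> in lborel. ((\<lambda>R. spectral_density f \<zeta>
      * (norm (mollified_symbol t \<eta> R \<zeta> - complex_of_real (heat_symbol t \<zeta>)))\<^sup>2) \<longlongrightarrow> 0) at_top"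
    proof (rule AE_I2)
      fix \<zeta> :: 'a
      have "((\<lambda>R. spectral_density f \<zeta> * (norm (mollified_symbol t \<eta> R \<zeta> - complex_of_real (heat_symbol t \<zeta>)))\<^sup>2)
        \<longlongrightarrow> spectral_density f \<zeta> * (norm (complex_of_real (heat_symbol t \<zeta>) - complex_of_real (heat_symbol t \<zeta>)))\<^sup>2)
        at_top"
        by (intro tendsto_intros mollified_symbol_tendsto t \<eta>)
      then show "((\<lambda>R. spectral_density f \<zeta> * (norm (mollified_symbol t \<eta> R \<zeta> - complex_of_real (heat_symbol t \<zeta>)))\<^sup>2)
        \<longlongrightarrow> 0) at_top" by simp
    qed
    show "\<forall>\<^sub>F R in at_top. AE \<zeta> in lborel. norm (spectral_density f \<zeta>
      * (norm (mollified_symbol t \<eta> R \<zeta> - complex_of_real (heat_symbol t \<zeta>)))\<^sup>2) \<le> spectral_density f \<zeta> *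
      ((LINT v|lborel. norm (rfourier \<eta> v)) + 1)\<^sup>2"
      using mollified_symbol_bound[OF t \<eta>t] by (intro always_eventually allI AE_I2)
        (auto simp: abs_mult spectral_density_nonneg intro!: mult_left_mono)
  qed measurable
  then show ?thesis unfolding truncation_error_def using tendsto_mult_right_zero by fastforce
qed

context log_field
begin

text \<open>Two cutoffs as well as two radii are allowed, so that one estimate yields both the
  Cauchy property and independence of the cutoff.\<close>

lemma truncation_distance:
  assumes t: "t > 0" and f: "f \<in> test_functions0" and \<eta>: "\<eta> \<in> test_functions" and \<theta>: "\<theta> \<in> test_functions"
    and R: "R > 0" and S: "S > 0"
  shows "(\<integral>\<^sup>+\<omega>. ennreal ((h \<omega> (truncated_convolution t f \<eta> R) - h \<omega> (truncated_convolution t f \<theta> S))\<^sup>2) \<partial>M)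
    \<le> ennreal (truncation_error t f \<eta> R + truncation_error t f \<theta> S)"
proof -
  note c = truncated_convolution(1)[OF dim t f \<eta> R] truncated_convolution(1)[OF dim t f \<theta> S]
  let ?g = "\<lambda>x. 1 * truncated_convolution t f \<eta> R x + (-1) * truncated_convolution t f \<theta> S x"
  let ?e = "\<lambda>\<eta> R \<zeta>. (norm (mollified_symbol t \<eta> R \<zeta> - complex_of_real (heat_symbol t \<zeta>)))\<^sup>2"
  have i: "integrable lborel (truncated_convolution t f \<eta> R)" "integrable lborel (truncated_convolution t f \<theta> S)"
    using c by (auto simp: test_functions0_iff intro: test_integrable)
  have "spectral_density ?g \<zeta> \<le> 2 * (spectral_density f \<zeta> * ?e \<eta> R \<zeta>) + 2 * (spectral_density f \<zeta> * ?e \<theta> S \<zeta>)" for \<zeta>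
  proof -
    have "rfourier ?g \<zeta> = rfourier f \<zeta> * (mollified_symbol t \<eta> R \<zeta> - mollified_symbol t \<theta> S \<zeta>)"
      by (simp only: rfourier_lincomb[OF i] truncated_convolution(2)[OF dim t f \<eta> R]
        truncated_convolution(2)[OF dim t f \<theta> S])
        (simp add: algebra_simps)
    then have 1: "spectral_density ?g \<zeta> = spectral_density f \<zeta>
      * (norm (mollified_symbol t \<eta> R \<zeta> - mollified_symbol t \<theta> S \<zeta>))\<^sup>2"
      by (simp add: spectral_density_def norm_mult power_mult_distrib)
    let ?x = "mollified_symbol t \<eta> R \<zeta> - complex_of_real (heat_symbol t \<zeta>)"
      and ?y = "mollified_symbol t \<theta> S \<zeta> - complex_of_real (heat_symbol t \<zeta>)"
    have "(norm (?x - ?y))\<^sup>2 \<le> (norm ?x + norm ?y)\<^sup>2" by (intro power_mono norm_triangle_ineq4) simp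
    also have "\<dots> \<le> 2 * (norm ?x)\<^sup>2 + 2 * (norm ?y)\<^sup>2"
      using zero_le_power2[of "norm ?x - norm ?y"] by (simp add: power2_sum power2_diff)
    finally have "spectral_density f \<zeta> * (norm (?x - ?y))\<^sup>2 \<le> spectral_density f \<zeta> * (2 * (norm ?x)\<^sup>2 + 2 * (norm ?y)\<^sup>2)"
      by (intro mult_left_mono spectral_density_nonneg)
    then show ?thesis unfolding 1 by (simp add: algebra_simps)
  qed
  then have "(LINT \<zeta>|lborel. spectral_density ?g \<zeta>)
    \<le> (LINT \<zeta>|lborel. 2 * (spectral_density f \<zeta> * ?e \<eta> R \<zeta>) + 2 * (spectral_density f \<zeta> * ?e \<theta> S \<zeta>))"
    by (intro integral_mono log_variance(1) test0_lincomb c Bochner_Integration.integrable_add integrable_mult_right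
      truncation_error_integrable f \<eta> \<theta> less_imp_le[OF t])
  also have "\<dots> = truncation_error t f \<eta> R + truncation_error t f \<theta> S"
    unfolding truncation_error_def
    by (subst Bochner_Integration.integral_add) (auto intro!: truncation_error_integrable f \<eta> \<theta> less_imp_le[OF t])
  finally show ?thesis unfolding field_distance[OF c] by (rule ennreal_leI)
qed

text \<open>The limit is built from one bump cutoff. Any other cutoff is compared with it at the
  same R, where both truncation errors tend to 0.\<close>

lemma convolution_exists:
  assumes t: "t > 0"
  shows "\<exists>Y. convolution_mod_const M h (frac_heat_kernel t) Y"
proof -
  let ?X = "\<lambda>f \<eta> R \<omega>. h \<omega> (truncated_convolution t f \<eta> R)"
  have m: "?X f \<eta> R \<in> borel_measurable M" if "f \<in> test_functions0" "\<eta> \<in> cutoffs" "R > 0" for f \<eta> R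
    using that by (intro field_measurable truncated_convolution(1) dim t) (auto simp: cutoffs_def)
  have bt: "bump 1 (0::'a) \<in> test_functions" by (rule bump_test) simp
  have "\<exists>Y. L2_limit M (?X f (bump 1 0)) Y" if f: "f \<in> test_functions0" for f
    by (rule L2_limit_complete[of _ "truncation_error t f (bump 1 0)"])
      (use f t in \<open>auto intro!: m bump_cutoff truncation_distance bt truncation_error_tendsto
        truncation_error_nonneg\<close>)
  then have "\<forall>f. \<exists>Y. f \<in> test_functions0 \<longrightarrow> L2_limit M (?X f (bump 1 0)) Y" by blast
  from choice[OF this] obtain Y where Y: "\<And>f. f \<in> test_functions0 \<Longrightarrow> L2_limit M (?X f (bump 1 0)) (Y f)" by blast
  have "L2_limit M (?X f \<eta>) (Y f)" if f: "f \<in> test_functions0" and \<eta>: "\<eta> \<in> cutoffs" for f \<eta>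
    unfolding L2_limit_def
  proof (intro conjI)
    have \<eta>t: "\<eta> \<in> test_functions" using \<eta> by (simp add: cutoffs_def)
    show "\<forall>\<^sub>F R in at_top. ?X f \<eta> R \<in> borel_measurable M"
      using eventually_gt_at_top[of 0] by eventually_elim (rule m[OF f \<eta>])
    show Ym: "Y f \<in> borel_measurable M" using Y[OF f] by (simp add: L2_limit_def)
    show "((\<lambda>R. \<integral>\<^sup>+\<omega>. ennreal ((?X f \<eta> R \<omega> - Y f \<omega>)\<^sup>2) \<partial>M) \<longlongrightarrow> 0) at_top"
    proof (rule tendsto_0_le_ennreal)
      have "((\<lambda>R. ennreal (truncation_error t f \<eta> R + truncation_error t f (bump 1 0) R)) \<longlongrightarrow> ennreal (0 + 0)) at_top"
        by (intro tendsto_ennrealI tendsto_add truncation_error_tendsto f \<eta> bump_cutoff less_imp_le[OF t])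
      then show "((\<lambda>R. 2 * ennreal (truncation_error t f \<eta> R + truncation_error t f (bump 1 0) R) + 2
        * (\<integral>\<^sup>+\<omega>. ennreal ((?X f (bump 1 0) R \<omega> - Y f \<omega>)\<^sup>2) \<partial>M)) \<longlongrightarrow> 0) at_top"
        using Y[OF f] by (intro ennreal_tendsto_0_lincomb) (simp_all add: L2_limit_def)
      show "\<forall>\<^sub>F R in at_top. (\<integral>\<^sup>+\<omega>. ennreal ((?X f \<eta> R \<omega> - Y f \<omega>)\<^sup>2) \<partial>M) \<le>
        2 * ennreal (truncation_error t f \<eta> R + truncation_error t f (bump 1 0) R) + 2 *
          (\<integral>\<^sup>+\<omega>. ennreal ((?X f (bump 1 0) R \<omega> - Y f \<omega>)\<^sup>2) \<partial>M)"
        using eventually_gt_at_top[of 0]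
      proof eventually_elim
        case (elim R)
        show ?case
          by (rule order_trans[OF nn_integral_square_diff_triangle[OF m[OF f \<eta> elim] m[OF f bump_cutoff elim] Ym]])
            (intro add_mono mult_left_mono truncation_distance t f \<eta>t bt elim order_refl; simp)
      qed
    qed
  qed
  then show ?thesis by (intro exI[of _ "\<lambda>\<omega> f. Y f \<omega>"]) (simp add: convolution_mod_const_def)
qed

text \<open>The pairings \<open>Y\<close> are fixed only up to null sets, so linearity is inherited
  almost surely, through uniqueness of mean-square limits.\<close>

lemma convolution_linear:
  assumes t: "t > 0" and Y: "convolution_mod_const M h (frac_heat_kernel t) Y"
    and f: "f \<in> test_functions0" and g: "g \<in> test_functions0"
  shows "AE \<omega> in M. Y \<omega> (\<lambda>x. a * f x + b * g x) = a * Y \<omega> f + b * Y \<omega> g"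
proof -
  let ?X = "\<lambda>f R \<omega>. h \<omega> (truncated_convolution t f (bump 1 0) R)"
  have bt: "bump 1 (0::'a) \<in> test_functions" by (rule bump_test) simp
  have L: "L2_limit M (?X f) (\<lambda>\<omega>. Y \<omega> f)" if "f \<in> test_functions0" for f
    using Y that bump_cutoff unfolding convolution_mod_const_def by blast
  have "L2_limit M (?X (\<lambda>x. a * f x + b * g x)) (\<lambda>\<omega>. a * Y \<omega> f + b * Y \<omega> g)"
  proof (rule L2_limit_cong_AE[OF L2_limit_lincomb[OF L[OF f] L[OF g]]])
    show "\<forall>\<^sub>F R in at_top. ?X (\<lambda>x. a * f x + b * g x) R \<in> borel_measurable M \<and>
      (AE \<omega> in M. ?X (\<lambda>x. a * f x + b * g x) R \<omega> = a * ?X f R \<omega> + b * ?X g R \<omega>)"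
      using eventually_gt_at_top[of 0]
    proof eventually_elim
      case (elim R)
      let ?k = "\<lambda>u::'a. frac_heat_kernel t u * bump 1 0 (u /\<^sub>R R)"
      have kc: "continuous_on UNIV ?k"
        by (intro continuous_intros continuous_frac_heat_kernel dim t
          continuous_on_compose2[OF test_continuous[OF bt, of UNIV]]) auto
      have ki: "integrable lborel (\<lambda>y. f y * ?k (y - w))" if "f \<in> test_functions0" for f :: "'a \<Rightarrow> real" and w
      proof -
        have ft: "f \<in> test_functions" using that by (simp add: test_functions0_iff)
        obtain r where r: "\<And>x. norm x > r \<Longrightarrow> f x = 0" using test_support[OF ft] by metis
        have "continuous_on UNIV (\<lambda>y. f y * ?k (y - w))"
          by (intro continuous_on_mult test_continuous[OF ft] continuous_on_compose2[OF kc] continuous_intros) auto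
        then show ?thesis by (rule integrable_compact_support[where r=r]) (simp add: r)
      qed
      have "truncated_convolution t (\<lambda>x. a * f x + b * g x) (bump 1 0) R =
        (\<lambda>w. a * truncated_convolution t f (bump 1 0) R w + b * truncated_convolution t g (bump 1 0) R w)"
      proof
        fix w :: 'a
        show "truncated_convolution t (\<lambda>x. a * f x + b * g x) (bump 1 0) R w
          = a * truncated_convolution t f (bump 1 0) R w + b * truncated_convolution t g (bump 1 0) R w"
          using ki[OF f, of w] ki[OF g, of w] by (simp add: distrib_right mult.assoc)
      qed
      then have "?X (\<lambda>x. a * f x + b * g x) R \<omega> = a * ?X f R \<omega> + b * ?X g R \<omega>" if "\<omega> \<in> space M" for \<omega>
        using field_linear[OF that, of "truncated_convolution t f (bump 1 0) R" "truncated_convolution t g (bump 1 0)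
          R" a b]
          truncated_convolution(1)[OF dim t f bt elim] truncated_convolution(1)[OF dim t g bt elim]
            by (simp add: test_functions0_iff)
      then show ?case
        using field_measurable[OF truncated_convolution(1)[OF dim t test0_lincomb[OF f g, of a b] bt elim]]
          by (auto intro: AE_I2)
    qed
  qed
  from L2_limit_unique[OF L[OF test0_lincomb[OF f g]] this] show ?thesis .
qed

text \<open>The variance contains the square of the symbol at time t, hence the time 2 t; for t =
  \<beta>^2 / 2 this is the initial time of the white noise field.\<close>

lemma convolution_char:
  assumes t: "t > 0" and Y: "convolution_mod_const M h (frac_heat_kernel t) Y" and f: "f \<in> test_functions0"
  shows "(LINT \<omega>|M. cis (Y \<omega> f)) = complex_of_real
    (exp (- ((LINT \<zeta>|lborel. spectral_density f \<zeta> * heat_symbol (2 * t) \<zeta>) / 2)))"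
proof (rule L2_limit_char)
  let ?X = "\<lambda>R \<omega>. h \<omega> (truncated_convolution t f (bump 1 0) R)"
  have bt: "bump 1 (0::'a) \<in> test_functions" by (rule bump_test) simp
  show "L2_limit M ?X (\<lambda>\<omega>. Y \<omega> f)" using Y f bump_cutoff unfolding convolution_mod_const_def by blast
  let ?S = "mollified_symbol t (bump 1 (0::'a))"
  have [measurable]: "spectral_density f \<in> borel_measurable borel" "?S R \<in> borel_measurable borel" for R
    using f bt by (auto simp: test_functions0_iff intro: spectral_density_measurable mollified_symbol_measurable)
  have "((\<lambda>R. LINT \<zeta>|lborel. spectral_density f \<zeta> * (norm (?S R \<zeta>))\<^sup>2)
    \<longlongrightarrow> (LINT \<zeta>|lborel. spectral_density f \<zeta> * heat_symbol (2 * t) \<zeta>)) at_top"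
  proof (rule integral_dominated_convergence_at_top[where w="\<lambda>\<zeta>. spectral_density f \<zeta>
    * (LINT v|lborel. norm (rfourier (bump 1 0) (v::'a)))\<^sup>2"])
    show "integrable lborel (\<lambda>\<zeta>. spectral_density f \<zeta> * (LINT v|lborel. norm (rfourier (bump 1 0) (v::'a)))\<^sup>2)"
      by (intro integrable_mult_left log_variance(1)[OF f])
    show "AE \<zeta> in lborel. ((\<lambda>R. spectral_density f \<zeta> * (norm (?S R \<zeta>))\<^sup>2)
      \<longlongrightarrow> spectral_density f \<zeta> * heat_symbol (2 * t) \<zeta>) at_top"
    proof (rule AE_I2)
      fix \<zeta> :: 'a
      have "((\<lambda>R. spectral_density f \<zeta> * (norm (?S R \<zeta>))\<^sup>2)
        \<longlongrightarrow> spectral_density f \<zeta> * (norm (complex_of_real (heat_symbol t \<zeta>)))\<^sup>2) at_top"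
        by (intro tendsto_intros mollified_symbol_tendsto less_imp_le[OF t] bump_cutoff)
      then show "((\<lambda>R. spectral_density f \<zeta> * (norm (?S R \<zeta>))\<^sup>2)
        \<longlongrightarrow> spectral_density f \<zeta> * heat_symbol (2 * t) \<zeta>) at_top"
        using heat_symbol_add[of t t \<zeta>] by (simp add: power2_eq_square)
    qed
    show "\<forall>\<^sub>F R in at_top. AE \<zeta> in lborel. norm (spectral_density f \<zeta> * (norm (?S R \<zeta>))\<^sup>2)
      \<le> spectral_density f \<zeta> * (LINT v|lborel. norm (rfourier (bump 1 0) (v::'a)))\<^sup>2"
      using norm_mollified_symbol[OF less_imp_le[OF t] bt]
      by (intro always_eventually allI AE_I2) (auto simp: abs_mult spectral_density_nonneg intro!: mult_left_mono
        power_mono)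
  qed measurable
  then have "((\<lambda>R. complex_of_real (exp (- ((LINT \<zeta>|lborel. spectral_density f \<zeta> * (norm (?S R \<zeta>))\<^sup>2) / 2)))) \<longlongrightarrow>
      complex_of_real (exp (- ((LINT \<zeta>|lborel. spectral_density f \<zeta> * heat_symbol (2 * t) \<zeta>) / 2)))) at_top"
    by (intro tendsto_intros) auto
  moreover have "\<forall>\<^sub>F R in at_top. complex_of_real
    (exp (- ((LINT \<zeta>|lborel. spectral_density f \<zeta> * (norm (?S R \<zeta>))\<^sup>2) / 2))) = (LINT \<omega>|M. cis (?X R \<omega>))"
    using eventually_gt_at_top[of 0]
  proof eventually_elim
    case (elim R)
    have "spectral_density (truncated_convolution t f (bump 1 0) R) \<zeta> = spectral_density f \<zeta> * (norm (?S R \<zeta>))\<^sup>2" for \<zeta>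
      by (simp add: spectral_density_def truncated_convolution(2)[OF dim t f bt elim] norm_mult power_mult_distrib)
    then show ?case
      using centered_gaussian_char[OF field_gaussian[OF truncated_convolution(1)[OF dim t f bt elim]], of 1] by simp
  qed
  ultimately show "((\<lambda>R. LINT \<omega>|M. cis (?X R \<omega>))
    \<longlongrightarrow> complex_of_real (exp (- ((LINT \<zeta>|lborel. spectral_density f \<zeta> * heat_symbol (2 * t) \<zeta>) / 2)))) at_top"
    by (rule Lim_transform_eventually)
qed

end

section \<open>Equality of the two laws\<close>

lemma pairing_linear:
  assumes H: "continuous_on UNIV (H \<omega>)" and f: "f \<in> test_functions0" and g: "g \<in> test_functions0"
  shows "pairing H \<omega> (\<lambda>x. a * f x + b * g x) = a * pairing H \<omega> f + b * pairing H \<omega> g"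
proof -
  have i: "integrable lborel (\<lambda>y. f y * H \<omega> y)" if "f \<in> test_functions0" for f
  proof -
    have ft: "f \<in> test_functions" using that by (simp add: test_functions0_iff)
    obtain r where r: "\<And>x. norm x > r \<Longrightarrow> f x = 0" using test_support[OF ft] by metis
    show ?thesis
      by (rule integrable_compact_support[where r=r]) (auto simp: r intro!: continuous_on_mult test_continuous[OF ft]
        H)
  qed
  show ?thesis using i[OF f] i[OF g] by (simp add: pairing_def distrib_right mult.assoc)
qed

text \<open>The time integral leaves the divisor (2 pi norm \<zeta>)^d, the logarithm leaves norm
  \<zeta>^d times the area of the sphere; \<open>white_noise_normalization\<close> is their
  quotient.\<close>

lemma energy_spectral_density:
  fixes f :: "'a::euclidean_space \<Rightarrow> real"
  assumes f: "f \<in> test_functions0" and T: "T \<ge> 0"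
  shows "white_noise_normalization DIM('a) * enn2real (energy {T<..} (rfourier f))
    = (LINT \<zeta>|lborel. spectral_density f \<zeta> * heat_symbol T \<zeta>)"
proof -
  let ?c = "white_noise_normalization DIM('a)"
  have c: "?c > 0" by (simp add: white_noise_normalization_def unit_ball_vol_pos)
  have v: "unit_ball_vol (real DIM('a)) \<noteq> 0" using unit_ball_vol_pos[of "real DIM('a)"]
    by (metis of_nat_0_le_iff less_irrefl)
  have ft: "f \<in> test_functions" using f by (simp add: test_functions0_iff)
  have [measurable]: "rfourier f \<in> borel_measurable borel" by (intro measurable_fourier test_integrable_complex ft)
  have [measurable]: "spectral_density f \<in> borel_measurable borel" by (rule spectral_density_measurable[OF ft])
  have "(norm (rfourier f \<zeta>))\<^sup>2 * heat_symbol T \<zeta> / ((2 * pi) ^ DIM('a) * norm \<zeta> ^ DIM('a))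
    = spectral_density f \<zeta> * heat_symbol T \<zeta> / ?c" for \<zeta>
    using v by (simp add: spectral_density_def white_noise_normalization_def)
  then have "energy {T<..} (rfourier f) = (\<integral>\<^sup>+\<zeta>. ennreal (spectral_density f \<zeta> * heat_symbol T \<zeta> / ?c) \<partial>lborel)"
    by (simp add: energy_Ioi)
  then have "enn2real (energy {T<..} (rfourier f)) = (LINT \<zeta>|lborel. spectral_density f \<zeta> * heat_symbol T \<zeta> / ?c)"
    using c by (subst integral_eq_nn_integral) (auto simp: spectral_density_nonneg less_imp_le[OF heat_symbol_pos])
  then show ?thesis using c by simp
qed

theorem lemma2p4:
  fixes M :: "'b measure" and N :: "'c measure"
    and h :: "'b \<Rightarrow> ('a::euclidean_space \<Rightarrow> real) \<Rightarrow> real"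
    and W :: "('a \<times> real \<Rightarrow> real) \<Rightarrow> 'c \<Rightarrow> real"
    and \<beta> :: real
  assumes "DIM('a) \<ge> 2"
    and "prob_space M" and "log_correlated_field M h"
    and "prob_space N" and "white_noise N W"
    and "\<beta> > 0"
  shows "(\<exists>H. white_noise_field_infinity N W \<beta> H) \<and>
    (\<forall>H H'. white_noise_field_infinity N W \<beta> H \<longrightarrow> white_noise_field_infinity N W \<beta> H' \<longrightarrow>
       (AE \<omega> in N. \<exists>c. \<forall>y. H \<omega> y = H' \<omega> y + c)) \<and>
    (\<exists>Y. convolution_mod_const M h (frac_heat_kernel (\<beta>\<^sup>2 / 2)) Y) \<and>
    (\<forall>H Y. white_noise_field_infinity N W \<beta> H \<longrightarrow>
       convolution_mod_const M h (frac_heat_kernel (\<beta>\<^sup>2 / 2)) Y \<longrightarrow>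
       same_law_mod_const N
         (\<lambda>\<omega> f. sqrt (white_noise_normalization DIM('a)) * pairing H \<omega> f) M Y)"
proof -
  interpret M: log_field M h using assms by (simp add: log_field_def log_field_axioms_def)
  interpret N: noise N W using assms by (simp add: noise_def noise_axioms_def)
  let ?c = "white_noise_normalization DIM('a)"
  have t: "\<beta>\<^sup>2 / 2 > 0" using \<open>\<beta> > 0\<close> by simp
  have c: "?c > 0" by (simp add: white_noise_normalization_def unit_ball_vol_pos)
  have law: "same_law_mod_const N (\<lambda>\<omega> f. sqrt ?c * pairing H \<omega> f) M Y"
    if H: "white_noise_field_infinity N W \<beta> H" and Y: "convolution_mod_const M h (frac_heat_kernel (\<beta>\<^sup>2 / 2)) Y"
      for H Y
    unfolding same_law_mod_const_def
  proof (intro allI impI joint_law_eqI \<open>prob_space N\<close> \<open>prob_space M\<close>)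
    fix n :: nat and F :: "nat \<Rightarrow> 'a \<Rightarrow> real" and a :: "nat \<Rightarrow> real"
    assume "\<forall>i<n. F i \<in> test_functions0"
    then have F: "\<And>i. i < n \<Longrightarrow> F i \<in> test_functions0" by blast
    have Hm: "(\<lambda>\<omega>. sqrt ?c * pairing H \<omega> f) \<in> borel_measurable N" if "f \<in> test_functions0" for f
      using H that by (auto simp: white_noise_field_infinity_def L2_limit_def intro!: borel_measurable_times)
    have Ym: "(\<lambda>\<omega>. Y \<omega> f) \<in> borel_measurable M" if "f \<in> test_functions0" for f
      using Y that bump_cutoff unfolding convolution_mod_const_def L2_limit_def by blast
    show "(\<lambda>\<omega>. sqrt ?c * pairing H \<omega> (F i)) \<in> borel_measurable N" "(\<lambda>\<omega>. Y \<omega> (F i)) \<in> borel_measurable M" if "i < n"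
      for i
      using Hm[OF F[OF that]] Ym[OF F[OF that]] by auto
    \<comment> \<open>Linearity turns a linear combination of pairings into one pairing, so
      agreement of the one-dimensional characteristic functions is enough for the joint law.\<close>
    let ?f = "\<lambda>x. \<Sum>i<n. a i * F i x"
    have "AE \<omega> in N. sqrt ?c * pairing H \<omega> (\<lambda>x. r * f x + s * g x)
      = r * (sqrt ?c * pairing H \<omega> f) + s * (sqrt ?c * pairing H \<omega> g)"
      if "f \<in> test_functions0" "g \<in> test_functions0" for f g :: "'a \<Rightarrow> real" and r s
      using H pairing_linear[OF _ that, of H _ r s]
      by (intro AE_I2) (simp add: white_noise_field_infinity_def random_function_def algebra_simps)
    then have HA: "\<And>f g r s. f \<in> test_functions0 \<Longrightarrow> g \<in> test_functions0 \<Longrightarrow>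
        AE \<omega> in N. sqrt ?c * pairing H \<omega> (\<lambda>x. r * f x + s * g x) = r * (sqrt ?c * pairing H \<omega> f) + s *
          (sqrt ?c * pairing H \<omega> g)" .
    note NS = test0_sum_AE[where M=N and X="\<lambda>\<omega> f. sqrt ?c * pairing H \<omega> f" and n=n and F=F and a=a, OF HA F]
    note MS = test0_sum_AE[where M=M and X=Y and n=n and F=F and a=a, OF M.convolution_linear[OF t Y] F]
    have f: "?f \<in> test_functions0" using NS by (rule conjunct1)
    have HS: "AE \<omega> in N. sqrt ?c * pairing H \<omega> ?f = (\<Sum>i<n. a i * (sqrt ?c * pairing H \<omega> (F i)))"
      using NS by (rule conjunct2)
    have YS: "AE \<omega> in M. Y \<omega> ?f = (\<Sum>i<n. a i * Y \<omega> (F i))"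
      using MS by (rule conjunct2)
    have "(LINT \<omega>|N. cis (\<Sum>i<n. a i * (sqrt ?c * pairing H \<omega> (F i)))) = (LINT \<omega>|N. cis (sqrt ?c * pairing H \<omega> ?f))"
    proof (rule integral_cong_AE)
      show "AE \<omega> in N. cis (\<Sum>i<n. a i * (sqrt ?c * pairing H \<omega> (F i))) = cis (sqrt ?c * pairing H \<omega> ?f)"
        using HS by eventually_elim simp
    qed (use Hm f F in \<open>auto intro!: measurable_cis borel_measurable_sum borel_measurable_times\<close>)
    also have "\<dots> = complex_of_real (exp (- ((LINT \<zeta>|lborel. spectral_density ?f \<zeta> * heat_symbol (\<beta>\<^sup>2) \<zeta>) / 2)))"
      using N.infinity_char[OF \<open>\<beta> > 0\<close> H f, of "sqrt ?c"] c by (simp add: energy_spectral_density[OF f, symmetric])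
    also have "\<dots> = (LINT \<omega>|M. cis (Y \<omega> ?f))"
      using M.convolution_char[OF t Y f] by simp
    also have "\<dots> = (LINT \<omega>|M. cis (\<Sum>i<n. a i * Y \<omega> (F i)))"
    proof (rule integral_cong_AE)
      show "AE \<omega> in M. cis (Y \<omega> ?f) = cis (\<Sum>i<n. a i * Y \<omega> (F i))"
        using YS by eventually_elim simp
    qed (use Ym f F in \<open>auto intro!: measurable_cis borel_measurable_sum borel_measurable_times\<close>)
    finally show "(LINT \<omega>|N. cis (\<Sum>i<n. a i * (sqrt ?c * pairing H \<omega> (F i))))
      = (LINT \<omega>|M. cis (\<Sum>i<n. a i * Y \<omega> (F i)))" .
  qed
  show ?thesis
    using N.infinity_exists[OF \<open>\<beta> > 0\<close>] N.infinity_unique[OF \<open>\<beta> > 0\<close>] M.convolution_exists[OF t] law by blast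
qed

end
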